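(* Let $X=\{X_{\underline n}\}_{\underline n\in\mathbb Z_+^N}$ be a product system of finite rank over a C*-algebra $A$. Then there exists an affine weak*-homeomorphism $\Psi$ between the states $\tau\in\mathcal S(A)$ and the ground states of $\mathcal{NT}(X)$ such that $$\Psi_\tau(\pi(a))=\tau(a)\ \text{ for all } a\in A\quad\text{and}\quad\Psi_\tau(t(\xi_{\underline n})t(\eta_{\underline m})^* )=0\ \text{ when }\underline n+\underline m\neq\underline 0.$$ The restriction of $\Psi$ to the tracial states $\mathrm T(A)$ induces a weak*-homeomorphism onto the $\mathrm{KMS}_\infty$-states of $\mathcal{NT}(X)$. If $\{I_F\mid\emptyset\neq F\subseteq\{1,\dots,N\}\}$ is a lattice of $\perp$-invariant ideals of $A$ then the corresponding weak*-homeomorphisms for $\mathcal{NO}(I,X)$ (onto its ground states, resp. its $\mathrm{KMS}_\infty$-states) arise by restricting to the states (resp. tracial states) of $A$ that annihilate the ideal $I_{\{1,\dots,N\}}$.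
   Context: Notation. $N\geq 1$ is a finite integer and $\mathbf{1},\dots,\mathbf{N}$ are the free generators of $\mathbb Z_+^N$; $\mathbf{i}$ is the $i$-th one. For $\underline n=(n_1,\dots,n_N)$ put $|\underline n|=\sum_i n_i$ (a signed sum for $\underline n\in\mathbb Z^N$) and $\operatorname{supp}\underline n=\{i\mid n_i\neq 0\}$. For $F\subseteq\{1,\dots,N\}$, $\underline n\perp F$ means $\operatorname{supp}\underline n\cap F=\emptyset$. Product systems. A C*-correspondence over $A$ is a right Hilbert $A$-module $Y$ with a $*$-homomorphism $\phi_Y\colon A\to\mathcal L(Y)$, $a\xi:=\phi_Y(a)\xi$. A product system $X=\{X_{\underline n}\}_{\underline n\in\mathbb Z_+^N}$ over $A$ is a family of C*-correspondences over $A$ (left actions $\phi_{\underline n}$) with $X_{\underline 0}=A$ and associative products $X_{\underline n}\otimes_A X_{\underline m}\to X_{\underline n+\underline m}$, $\xi_{\underline n}\otimes\xi_{\underline m}\mapsto\xi_{\underline n}\xi_{\underline m}$, which are unitary equivalences for $\underline n\neq\underline 0$ and are given by the left action for $\underline n=\underline 0$. It has finite rank if for each $i$ there are $x_{i,1},\dots,x_{i,d_i}$ in the unit ball of $X_{\mathbf i}$, $d_i<\infty$, with $\xi=\sum_{j=1}^{d_i}x_{i,j}\langle x_{i,j},\xi\rangle$ for all $\xi\in X_{\mathbf i}$. Algebras. On the full Fock space $\mathcal F X=\bigoplus_{\underline m}X_{\underline m}$ let $\pi(a)\eta_{\underline m}=\phi_{\underline m}(a)\eta_{\underline m}$ and $t(\xi_{\underline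 n})\eta_{\underline m}=\xi_{\underline n}\eta_{\underline m}$. The Toeplitz-Nica-Pimsner algebra $\mathcal{NT}(X)$ is the C*-algebra generated by all $\pi(a)$, $t(\xi_{\underline n})$; it is the closed span of the $t(\xi_{\underline n})t(\eta_{\underline m})^*$. The gauge action $\gamma$ of $\mathbb T^N$ satisfies $\gamma_{\underline z}(\pi(a))=\pi(a)$, $\gamma_{\underline z}(t(\xi_{\underline n}))=\underline z^{\underline n}t(\xi_{\underline n})$. Put $P_{\mathbf i}=\sum_{j=1}^{d_i}t(x_{i,j})t(x_{i,j})^*$ and $Q_F=\prod_{i\in F}(1-P_{\mathbf i})$, where $1$ is the identity operator on $\mathcal FX$ (so that $\pi(a)Q_F\in\mathcal{NT}(X)$ for all $a\in A$). $\langle S\rangle$ denotes the closed two-sided ideal of $\mathcal{NT}(X)$ generated by $S$. A family $\{I_F\mid\emptyset\neq F\subseteq\{1,\dots,N\}\}$ of ideals of $A$ is a lattice of $\perp$-invariant ideals if $I_F\subseteq I_{F'}$ when $F\subseteq F'$, and $\langle X_{\underline n},I_FX_{\underline n}\rangle\subseteq I_F$ when $\underline n\perp F$. Put $\mathcal K_I=\langle\pi(a)Q_F\mid a\in I_F,\emptyset\ne F\subseteq\{1,\dots,N\}\rangle$ and $\mathcal{NO}(I,X)=\mathcal{NT}(X)/\mathcal K_I$. States. $\mathcal S(A)$ and $\mathrm T(A)$ are the states and tracial states of $A$. Let $\sigma_r=\gamma_{(e^{ir},\dots,e^{ir})}$, $r\in\mathbb R$, on $\mathcal{NT}(X)$,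 and the induced action on $\mathcal{NO}(I,X)$; it extends analytically on monomials by $\sigma_z(t(\xi_{\underline n})t(\eta_{\underline m})^* )=e^{i|\underline n-\underline m|z}t(\xi_{\underline n})t(\eta_{\underline m})^*$, $z\in\mathbb C$. For $\beta>0$ a $(\sigma,\beta)$-KMS state is a state with $\varphi(fg)=\varphi(g\sigma_{i\beta}(f))$ for all $f,g$ in a norm-dense $\sigma$-invariant $*$-subalgebra of analytic elements. A $\mathrm{KMS}_\infty$-state is a weak*-limit of $(\sigma,\beta)$-KMS states as $\beta\uparrow\infty$. A ground state is a state $\varphi$ such that $z\mapsto\varphi(f\sigma_z(g))$ is bounded on $\{z\in\mathbb C\mid\mathrm{Im}\,z>0\}$ for all $f,g$ in a dense analytic subset. *)

theory Defs
  imports "HOL-Analysis.Analysis"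
begin

class scaleC = scaleR +
  fixes scaleC :: "complex \<Rightarrow> 'a \<Rightarrow> 'a" (infixr "*\<^sub>C" 75)
  assumes scaleR_scaleC: "scaleR r x = complex_of_real r *\<^sub>C x"

class complex_vector = scaleC + ab_group_add +
  assumes scaleC_add_right: "c *\<^sub>C (x + y) = c *\<^sub>C x + c *\<^sub>C y"
    and scaleC_add_left: "(c + d) *\<^sub>C x = c *\<^sub>C x + d *\<^sub>C x"
    and scaleC_scaleC: "c *\<^sub>C d *\<^sub>C x = (c * d) *\<^sub>C x"
    and scaleC_one: "1 *\<^sub>C x = x"

text \<open>No unit is required; the zero algebra is allowed.\<close>

class cstar_algebra = complex_vector + banach + real_normed_algebra +
  fixes star :: "'a \<Rightarrow> 'a"
  assumes norm_scaleC: "norm (c *\<^sub>C x) = cmod c * norm x"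
    and scaleC_mult_left: "(c *\<^sub>C x) * y = c *\<^sub>C (x * y)"
    and scaleC_mult_right: "x * (c *\<^sub>C y) = c *\<^sub>C (x * y)"
    and star_add: "star (x + y) = star x + star y"
    and star_scaleC: "star (c *\<^sub>C x) = cnj c *\<^sub>C star x"
    and star_mult: "star (x * y) = star y * star x"
    and star_star: "star (star x) = x"
    and cstar_identity: "norm (star x * x) = (norm x)\<^sup>2"

text \<open>
  Algebras that depend on the data (the adjointable operators on a Hilbert module, the algebra
  generated by some of them, quotients by ideals) are given by their carrier and operations.
  The functions below are used only when such a structure is a C*-algebra.
\<close>

record 'b star_alg =
  carr :: "'b set"
  plus_of :: "'b \<Rightarrow> 'b \<Rightarrow> 'b"
  scale_of :: "complex \<Rightarrow> 'b \<Rightarrow> 'b"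
  times_of :: "'b \<Rightarrow> 'b \<Rightarrow> 'b"
  star_of :: "'b \<Rightarrow> 'b"
  norm_of :: "'b \<Rightarrow> real"

definition type_alg :: "'a::cstar_algebra star_alg" where
  "type_alg = \<lparr>carr = UNIV, plus_of = (+), scale_of = (*\<^sub>C), times_of = (*),
     star_of = star, norm_of = norm\<rparr>"

definition dist_of :: "('b, 'z) star_alg_scheme \<Rightarrow> 'b \<Rightarrow> 'b \<Rightarrow> real" where
  "dist_of B x y = norm_of B (plus_of B x (scale_of B (-1) y))"

definition closed_in :: "('b, 'z) star_alg_scheme \<Rightarrow> 'b set \<Rightarrow> bool" where
  "closed_in B S \<longleftrightarrow>
     (\<forall>s x. (\<forall>k::nat. s k \<in> S) \<and> x \<in> carr B \<and> (\<lambda>k. dist_of B (s k) x) \<longlonglongrightarrow> 0 \<longrightarrow> x \<in> S)"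

definition dense_in :: "('b, 'z) star_alg_scheme \<Rightarrow> 'b set \<Rightarrow> bool" where
  "dense_in B S \<longleftrightarrow> S \<subseteq> carr B \<and> (\<forall>x\<in>carr B. \<forall>e>0. \<exists>s\<in>S. dist_of B s x < e)"

definition star_subalgebra :: "('b, 'z) star_alg_scheme \<Rightarrow> 'b set \<Rightarrow> bool" where
  "star_subalgebra B S \<longleftrightarrow> S \<subseteq> carr B \<and> S \<noteq> {} \<and>
     (\<forall>x\<in>S. \<forall>y\<in>S. plus_of B x y \<in> S \<and> times_of B x y \<in> S) \<and>
     (\<forall>x\<in>S. star_of B x \<in> S \<and> (\<forall>c. scale_of B c x \<in> S))"

definition closed_ideal :: "('b, 'z) star_alg_scheme \<Rightarrow> 'b set \<Rightarrow> bool" where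
  "closed_ideal B J \<longleftrightarrow> J \<subseteq> carr B \<and> J \<noteq> {} \<and> closed_in B J \<and>
     (\<forall>x\<in>J. \<forall>y\<in>J. plus_of B x y \<in> J) \<and> (\<forall>x\<in>J. \<forall>c. scale_of B c x \<in> J) \<and>
     (\<forall>x\<in>J. \<forall>b\<in>carr B. times_of B b x \<in> J \<and> times_of B x b \<in> J)"

definition generated_cstar_algebra :: "'b star_alg \<Rightarrow> 'b set \<Rightarrow> 'b star_alg" where
  "generated_cstar_algebra B G =
     B\<lparr>carr := \<Inter>{S. star_subalgebra B S \<and> closed_in B S \<and> G \<subseteq> S}\<rparr>"

definition generated_ideal :: "('b, 'z) star_alg_scheme \<Rightarrow> 'b set \<Rightarrow> 'b set" where
  "generated_ideal B G = \<Inter>{J. closed_ideal B J \<and> G \<subseteq> J}"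

definition coset :: "('b, 'z) star_alg_scheme \<Rightarrow> 'b set \<Rightarrow> 'b \<Rightarrow> 'b set" where
  "coset B J b = plus_of B b ` J"

text \<open>
  Each union below is over representatives of cosets and, J being an ideal, its members are all
  equal to the coset that results from any one choice of representatives.
\<close>

definition quotient_alg :: "('b, 'z) star_alg_scheme \<Rightarrow> 'b set \<Rightarrow> 'b set star_alg" where
  "quotient_alg B J = \<lparr>
     carr = coset B J ` carr B,
     plus_of = (\<lambda>C D. \<Union>b\<in>C. \<Union>d\<in>D. coset B J (plus_of B b d)),
     scale_of = (\<lambda>c C. \<Union>b\<in>C. coset B J (scale_of B c b)),
     times_of = (\<lambda>C D. \<Union>b\<in>C. \<Union>d\<in>D. coset B J (times_of B b d)),
     star_of = (\<lambda>C. \<Union>b\<in>C. coset B J (star_of B b)),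
     norm_of = (\<lambda>C. INF b\<in>C. norm_of B b)\<rparr>"

definition quotient_action ::
    "('b, 'z) star_alg_scheme \<Rightarrow> 'b set \<Rightarrow> (real \<Rightarrow> 'b \<Rightarrow> 'b) \<Rightarrow> real \<Rightarrow> 'b set \<Rightarrow> 'b set" where
  "quotient_action B J \<sigma> r C = (\<Union>b\<in>C. coset B J (\<sigma> r b))"

text \<open>Functionals are functions on the carrier, extended by \<open>undefined\<close> outside of it.\<close>

definition states :: "('b, 'z) star_alg_scheme \<Rightarrow> ('b \<Rightarrow> complex) set" where
  "states B = {\<phi> \<in> extensional (carr B).
     (\<forall>x\<in>carr B. \<forall>y\<in>carr B. \<phi> (plus_of B x y) = \<phi> x + \<phi> y) \<and>
     (\<forall>c. \<forall>x\<in>carr B. \<phi> (scale_of B c x) = c * \<phi> x) \<and>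
     (\<forall>x\<in>carr B. \<phi> (times_of B (star_of B x) x) \<in> \<real>\<^sub>\<ge>\<^sub>0) \<and>
     (SUP x\<in>{x\<in>carr B. norm_of B x \<le> 1}. ereal (cmod (\<phi> x))) = 1}"

definition tracial_states :: "('b, 'z) star_alg_scheme \<Rightarrow> ('b \<Rightarrow> complex) set" where
  "tracial_states B =
     {\<phi> \<in> states B. \<forall>x\<in>carr B. \<forall>y\<in>carr B. \<phi> (times_of B x y) = \<phi> (times_of B y x)}"

text \<open>Pointwise convergence on the carrier; on functionals this is the weak*-topology.\<close>

definition weak_star :: "('b, 'z) star_alg_scheme \<Rightarrow> ('b \<Rightarrow> complex) topology" where
  "weak_star B = product_topology (\<lambda>_. euclidean) (carr B)"

definition weak_star_homeomorphism ::
    "('b, 'y) star_alg_scheme \<Rightarrow> ('b \<Rightarrow> complex) set \<Rightarrow>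
     ('c, 'z) star_alg_scheme \<Rightarrow> ('c \<Rightarrow> complex) set \<Rightarrow>
     (('b \<Rightarrow> complex) \<Rightarrow> ('c \<Rightarrow> complex)) \<Rightarrow> bool" where
  "weak_star_homeomorphism B S C T \<Psi> \<longleftrightarrow>
     homeomorphic_map (subtopology (weak_star B) S) (subtopology (weak_star C) T) \<Psi>"

definition convex_comb ::
    "('b, 'z) star_alg_scheme \<Rightarrow> real \<Rightarrow> ('b \<Rightarrow> complex) \<Rightarrow> ('b \<Rightarrow> complex) \<Rightarrow> 'b \<Rightarrow> complex" where
  "convex_comb B s \<phi> \<psi> =
     restrict (\<lambda>x. complex_of_real s * \<phi> x + complex_of_real (1 - s) * \<psi> x) (carr B)"

definition affine_map_on ::
    "('b, 'y) star_alg_scheme \<Rightarrow> ('b \<Rightarrow> complex) set \<Rightarrow> ('c, 'z) star_alg_scheme \<Rightarrow>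
     (('b \<Rightarrow> complex) \<Rightarrow> ('c \<Rightarrow> complex)) \<Rightarrow> bool" where
  "affine_map_on B S C \<Psi> \<longleftrightarrow>
     (\<forall>\<phi>\<in>S. \<forall>\<psi>\<in>S. \<forall>s\<in>{0..1}.
        \<Psi> (convex_comb B s \<phi> \<psi>) = convex_comb C s (\<Psi> \<phi>) (\<Psi> \<psi>))"

text \<open>
  \<open>F\<close> is an entire (norm differentiable) extension of the orbit map of \<open>f\<close> from the real line;
  it is unique if it exists, and \<open>F z\<close> is what is usually written with \<open>z\<close> in place of
  the real parameter of the action.
\<close>

definition analytic_extension ::
    "('b, 'z) star_alg_scheme \<Rightarrow> (real \<Rightarrow> 'b \<Rightarrow> 'b) \<Rightarrow> 'b \<Rightarrow> (complex \<Rightarrow> 'b) \<Rightarrow> bool" where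
  "analytic_extension B \<sigma> f F \<longleftrightarrow>
     (\<forall>z. F z \<in> carr B) \<and> (\<forall>r. F (complex_of_real r) = \<sigma> r f) \<and>
     (\<forall>z. \<exists>D\<in>carr B.
        ((\<lambda>h. dist_of B
           (scale_of B (1 / h) (plus_of B (F (z + h)) (scale_of B (-1) (F z)))) D) \<longlongrightarrow> 0) (at 0))"

definition kms_states ::
    "('b, 'z) star_alg_scheme \<Rightarrow> (real \<Rightarrow> 'b \<Rightarrow> 'b) \<Rightarrow> real \<Rightarrow> ('b \<Rightarrow> complex) set" where
  "kms_states B \<sigma> \<beta> = {\<phi> \<in> states B. \<beta> > 0 \<and>
     (\<exists>D. star_subalgebra B D \<and> dense_in B D \<and> (\<forall>r. \<forall>f\<in>D. \<sigma> r f \<in> D) \<and>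
        (\<forall>f\<in>D. \<exists>F. analytic_extension B \<sigma> f F \<and>
           (\<forall>g\<in>D. \<phi> (times_of B f g) = \<phi> (times_of B g (F (\<i> * complex_of_real \<beta>))))))}"

text \<open>
  Weak*-limits of nets; a net is represented by a proper filter on the pairs of an inverse
  temperature and a functional.
\<close>

definition kms_infinity_states ::
    "('b, 'z) star_alg_scheme \<Rightarrow> (real \<Rightarrow> 'b \<Rightarrow> 'b) \<Rightarrow> ('b \<Rightarrow> complex) set" where
  "kms_infinity_states B \<sigma> = {\<phi> \<in> states B.
     \<exists>\<F> :: (real \<times> ('b \<Rightarrow> complex)) filter. \<F> \<noteq> bot \<and>
        (\<forall>\<^sub>F p in \<F>. snd p \<in> kms_states B \<sigma> (fst p)) \<and>
        filterlim fst at_top \<F> \<and>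
        limitin (weak_star B) snd \<phi> \<F>}"

definition ground_states ::
    "('b, 'z) star_alg_scheme \<Rightarrow> (real \<Rightarrow> 'b \<Rightarrow> 'b) \<Rightarrow> ('b \<Rightarrow> complex) set" where
  "ground_states B \<sigma> = {\<phi> \<in> states B.
     \<exists>D. dense_in B D \<and>
        (\<forall>g\<in>D. \<exists>G. analytic_extension B \<sigma> g G \<and>
           (\<forall>f\<in>D. bounded ((\<lambda>z. \<phi> (times_of B f (G z))) ` {z. Im z > 0})))}"

text \<open>
  A correspondence over the C*-algebra \<open>'a\<close> lives on a linear subspace \<open>mcarr\<close> of an ambient
  vector space; the inner product is linear in its second argument.
\<close>

record ('a, 'x) correspondence =
  mcarr :: "'x set"
  ip :: "'x \<Rightarrow> 'x \<Rightarrow> 'a"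
  rmul :: "'x \<Rightarrow> 'a \<Rightarrow> 'x"
  lmul :: "'a \<Rightarrow> 'x \<Rightarrow> 'x"

definition mnorm :: "('a::cstar_algebra, 'x) correspondence \<Rightarrow> 'x \<Rightarrow> real" where
  "mnorm Y \<xi> = sqrt (norm (ip Y \<xi> \<xi>))"

definition right_module :: "('a::cstar_algebra, 'x::complex_vector) correspondence \<Rightarrow> bool" where
  "right_module Y \<longleftrightarrow>
     0 \<in> mcarr Y \<and>
     (\<forall>\<xi>\<in>mcarr Y. \<forall>\<eta>\<in>mcarr Y. \<xi> + \<eta> \<in> mcarr Y) \<and>
     (\<forall>\<xi>\<in>mcarr Y. \<forall>c. c *\<^sub>C \<xi> \<in> mcarr Y) \<and>
     (\<forall>\<xi>\<in>mcarr Y. \<forall>a. rmul Y \<xi> a \<in> mcarr Y) \<and>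
     (\<forall>\<xi>\<in>mcarr Y. \<forall>\<eta>\<in>mcarr Y. \<forall>a. rmul Y (\<xi> + \<eta>) a = rmul Y \<xi> a + rmul Y \<eta> a) \<and>
     (\<forall>\<xi>\<in>mcarr Y. \<forall>a b. rmul Y \<xi> (a + b) = rmul Y \<xi> a + rmul Y \<xi> b) \<and>
     (\<forall>\<xi>\<in>mcarr Y. \<forall>a b. rmul Y \<xi> (a * b) = rmul Y (rmul Y \<xi> a) b) \<and>
     (\<forall>\<xi>\<in>mcarr Y. \<forall>a c. rmul Y (c *\<^sub>C \<xi>) a = c *\<^sub>C rmul Y \<xi> a \<and>
        rmul Y \<xi> (c *\<^sub>C a) = c *\<^sub>C rmul Y \<xi> a)"

definition hilbert_module :: "('a::cstar_algebra, 'x::complex_vector) correspondence \<Rightarrow> bool" where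
  "hilbert_module Y \<longleftrightarrow> right_module Y \<and>
     (\<forall>\<xi>\<in>mcarr Y. \<forall>\<eta>\<in>mcarr Y. \<forall>\<zeta>\<in>mcarr Y. ip Y \<xi> (\<eta> + \<zeta>) = ip Y \<xi> \<eta> + ip Y \<xi> \<zeta>) \<and>
     (\<forall>\<xi>\<in>mcarr Y. \<forall>\<eta>\<in>mcarr Y. \<forall>c. ip Y \<xi> (c *\<^sub>C \<eta>) = c *\<^sub>C ip Y \<xi> \<eta>) \<and>
     (\<forall>\<xi>\<in>mcarr Y. \<forall>\<eta>\<in>mcarr Y. \<forall>a. ip Y \<xi> (rmul Y \<eta> a) = ip Y \<xi> \<eta> * a) \<and>
     (\<forall>\<xi>\<in>mcarr Y. \<forall>\<eta>\<in>mcarr Y. ip Y \<eta> \<xi> = star (ip Y \<xi> \<eta>)) \<and>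
     (\<forall>\<xi>\<in>mcarr Y. \<exists>b. ip Y \<xi> \<xi> = star b * b) \<and>
     (\<forall>\<xi>\<in>mcarr Y. ip Y \<xi> \<xi> = 0 \<longrightarrow> \<xi> = 0) \<and>
     (\<forall>s::nat \<Rightarrow> 'x. (\<forall>k. s k \<in> mcarr Y) \<and>
        (\<forall>e>0. \<exists>K. \<forall>k\<ge>K. \<forall>l\<ge>K. mnorm Y (s k - s l) < e) \<longrightarrow>
        (\<exists>\<xi>\<in>mcarr Y. (\<lambda>k. mnorm Y (s k - \<xi>)) \<longlonglongrightarrow> 0))"

text \<open>
  The left action sends \<open>a\<close> to an adjointable operator with adjoint the action of \<open>star a\<close>;
  linearity in the vector is a consequence.
\<close>

definition cstar_correspondence ::
    "('a::cstar_algebra, 'x::complex_vector) correspondence \<Rightarrow> bool" where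
  "cstar_correspondence Y \<longleftrightarrow> hilbert_module Y \<and>
     (\<forall>a. \<forall>\<xi>\<in>mcarr Y. lmul Y a \<xi> \<in> mcarr Y) \<and>
     (\<forall>a. \<forall>\<xi>\<in>mcarr Y. \<forall>\<eta>\<in>mcarr Y. ip Y (lmul Y a \<xi>) \<eta> = ip Y \<xi> (lmul Y (star a) \<eta>)) \<and>
     (\<forall>a b. \<forall>\<xi>\<in>mcarr Y. lmul Y (a + b) \<xi> = lmul Y a \<xi> + lmul Y b \<xi>) \<and>
     (\<forall>a c. \<forall>\<xi>\<in>mcarr Y. lmul Y (c *\<^sub>C a) \<xi> = c *\<^sub>C lmul Y a \<xi>) \<and>
     (\<forall>a b. \<forall>\<xi>\<in>mcarr Y. lmul Y (a * b) \<xi> = lmul Y a (lmul Y b \<xi>))"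

text \<open>
  \<open>\<mu>\<close> induces a unitary equivalence from the interior tensor product of \<open>Y\<close> and \<open>Z\<close> onto \<open>W\<close>:
  it is bilinear and balanced, carries the inner product that defines the interior tensor product
  to that of \<open>W\<close>, has dense range (hence is onto on the completion), and intertwines both actions.
\<close>

definition tensor_unitary ::
    "('a::cstar_algebra, 'x::complex_vector) correspondence \<Rightarrow> ('a, 'x) correspondence \<Rightarrow>
     ('a, 'x) correspondence \<Rightarrow> ('x \<Rightarrow> 'x \<Rightarrow> 'x) \<Rightarrow> bool" where
  "tensor_unitary Y Z W \<mu> \<longleftrightarrow>
     (\<forall>\<xi>\<in>mcarr Y. \<forall>\<eta>\<in>mcarr Z. \<mu> \<xi> \<eta> \<in> mcarr W) \<and>
     (\<forall>\<xi>\<in>mcarr Y. \<forall>\<xi>'\<in>mcarr Y. \<forall>\<eta>\<in>mcarr Z. \<mu> (\<xi> + \<xi>') \<eta> = \<mu> \<xi> \<eta> + \<mu> \<xi>' \<eta>) \<and>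
     (\<forall>\<xi>\<in>mcarr Y. \<forall>\<eta>\<in>mcarr Z. \<forall>\<eta>'\<in>mcarr Z. \<mu> \<xi> (\<eta> + \<eta>') = \<mu> \<xi> \<eta> + \<mu> \<xi> \<eta>') \<and>
     (\<forall>\<xi>\<in>mcarr Y. \<forall>\<eta>\<in>mcarr Z. \<forall>c. \<mu> (c *\<^sub>C \<xi>) \<eta> = c *\<^sub>C \<mu> \<xi> \<eta> \<and> \<mu> \<xi> (c *\<^sub>C \<eta>) = c *\<^sub>C \<mu> \<xi> \<eta>) \<and>
     (\<forall>\<xi>\<in>mcarr Y. \<forall>\<eta>\<in>mcarr Z. \<forall>a. \<mu> (rmul Y \<xi> a) \<eta> = \<mu> \<xi> (lmul Z a \<eta>)) \<and>
     (\<forall>\<xi>\<in>mcarr Y. \<forall>\<xi>'\<in>mcarr Y. \<forall>\<eta>\<in>mcarr Z. \<forall>\<eta>'\<in>mcarr Z.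
        ip W (\<mu> \<xi> \<eta>) (\<mu> \<xi>' \<eta>') = ip Z \<eta> (lmul Z (ip Y \<xi> \<xi>') \<eta>')) \<and>
     (\<forall>\<zeta>\<in>mcarr W. \<forall>e>0. \<exists>(k::nat) \<xi> \<eta>. (\<forall>i<k. \<xi> i \<in> mcarr Y \<and> \<eta> i \<in> mcarr Z) \<and>
        mnorm W (\<zeta> - (\<Sum>i<k. \<mu> (\<xi> i) (\<eta> i))) < e) \<and>
     (\<forall>\<xi>\<in>mcarr Y. \<forall>\<eta>\<in>mcarr Z. \<forall>a. lmul W a (\<mu> \<xi> \<eta>) = \<mu> (lmul Y a \<xi>) \<eta> \<and>
        rmul W (\<mu> \<xi> \<eta>) a = \<mu> \<xi> (rmul Z \<eta> a))"

text \<open>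
  The index set is \<open>'n\<close> (finite, nonempty) in place of 1, ..., N. The fibres are subspaces of one
  ambient vector space, and \<open>emb\<close> is the identification of the coefficient algebra with the fibre
  at 0.
\<close>

record ('n::finite, 'a, 'x) product_system =
  fib :: "nat ^ 'n \<Rightarrow> ('a, 'x) correspondence"
  prd :: "nat ^ 'n \<Rightarrow> nat ^ 'n \<Rightarrow> 'x \<Rightarrow> 'x \<Rightarrow> 'x"
  emb :: "'a \<Rightarrow> 'x"

definition identity_correspondence ::
    "('a::cstar_algebra, 'x::complex_vector) correspondence \<Rightarrow> ('a \<Rightarrow> 'x) \<Rightarrow> bool" where
  "identity_correspondence Y \<iota> \<longleftrightarrow> bij_betw \<iota> UNIV (mcarr Y) \<and>
     (\<forall>a b. \<iota> (a + b) = \<iota> a + \<iota> b) \<and> (\<forall>c a. \<iota> (c *\<^sub>C a) = c *\<^sub>C \<iota> a) \<and>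
     (\<forall>a b. ip Y (\<iota> a) (\<iota> b) = star a * b \<and> rmul Y (\<iota> a) b = \<iota> (a * b) \<and>
        lmul Y a (\<iota> b) = \<iota> (a * b))"

definition is_product_system ::
    "('n::finite, 'a::cstar_algebra, 'x::complex_vector) product_system \<Rightarrow> bool" where
  "is_product_system X \<longleftrightarrow>
     (\<forall>n. cstar_correspondence (fib X n)) \<and>
     identity_correspondence (fib X 0) (emb X) \<and>
     (\<forall>n m. n \<noteq> 0 \<longrightarrow> tensor_unitary (fib X n) (fib X m) (fib X (n + m)) (prd X n m)) \<and>
     (\<forall>m a. \<forall>\<eta>\<in>mcarr (fib X m). prd X 0 m (emb X a) \<eta> = lmul (fib X m) a \<eta>) \<and>
     (\<forall>n m k. \<forall>\<xi>\<in>mcarr (fib X n). \<forall>\<eta>\<in>mcarr (fib X m). \<forall>\<zeta>\<in>mcarr (fib X k).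
        prd X (n + m) k (prd X n m \<xi> \<eta>) \<zeta> = prd X n (m + k) \<xi> (prd X m k \<eta> \<zeta>))"

definition is_frame ::
    "('n::finite, 'a::cstar_algebra, 'x::complex_vector) product_system \<Rightarrow>
     ('n \<Rightarrow> nat) \<Rightarrow> ('n \<Rightarrow> nat \<Rightarrow> 'x) \<Rightarrow> bool" where
  "is_frame X d x \<longleftrightarrow> (\<forall>i. let Y = fib X (axis i 1) in
     (\<forall>j<d i. x i j \<in> mcarr Y \<and> mnorm Y (x i j) \<le> 1) \<and>
     (\<forall>\<xi>\<in>mcarr Y. \<xi> = (\<Sum>j<d i. rmul Y (x i j) (ip Y (x i j) \<xi>))))"

definition finite_rank ::
    "('n::finite, 'a::cstar_algebra, 'x::complex_vector) product_system \<Rightarrow> bool" where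
  "finite_rank X \<longleftrightarrow> (\<exists>d x. is_frame X d x)"

type_synonym ('n, 'x) fvec = "nat ^ 'n \<Rightarrow> 'x"
type_synonym ('n, 'x) fop = "('n, 'x) fvec \<Rightarrow> ('n, 'x) fvec"

definition fock ::
    "('n::finite, 'a::cstar_algebra, 'x::complex_vector) product_system \<Rightarrow> ('n, 'x) fvec set" where
  "fock X = {\<eta>. (\<forall>m. \<eta> m \<in> mcarr (fib X m)) \<and> (\<lambda>m. ip (fib X m) (\<eta> m) (\<eta> m)) summable_on UNIV}"

definition fock_ip ::
    "('n::finite, 'a::cstar_algebra, 'x::complex_vector) product_system \<Rightarrow>
     ('n, 'x) fvec \<Rightarrow> ('n, 'x) fvec \<Rightarrow> 'a" where
  "fock_ip X \<eta> \<zeta> = infsum (\<lambda>m. ip (fib X m) (\<eta> m) (\<zeta> m)) UNIV"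

definition fock_norm ::
    "('n::finite, 'a::cstar_algebra, 'x::complex_vector) product_system \<Rightarrow> ('n, 'x) fvec \<Rightarrow> real" where
  "fock_norm X \<eta> = sqrt (norm (fock_ip X \<eta> \<eta>))"

text \<open>
  Operators on the Fock space are set to zero outside of it, so that products are compositions and
  equality of operators is equality of functions.
\<close>

definition on_fock ::
    "('n::finite, 'a::cstar_algebra, 'x::complex_vector) product_system \<Rightarrow>
     ('n, 'x) fop \<Rightarrow> ('n, 'x) fop" where
  "on_fock X T = (\<lambda>\<eta>. if \<eta> \<in> fock X then T \<eta> else (\<lambda>_. 0))"

definition fock_operator ::
    "('n::finite, 'a::cstar_algebra, 'x::complex_vector) product_system \<Rightarrow> ('n, 'x) fop \<Rightarrow> bool" where
  "fock_operator X T \<longleftrightarrow> (\<forall>\<eta>\<in>fock X. T \<eta> \<in> fock X) \<and> (\<forall>\<eta>. \<eta> \<notin> fock X \<longrightarrow> T \<eta> = (\<lambda>_. 0))"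

definition is_adjoint ::
    "('n::finite, 'a::cstar_algebra, 'x::complex_vector) product_system \<Rightarrow>
     ('n, 'x) fop \<Rightarrow> ('n, 'x) fop \<Rightarrow> bool" where
  "is_adjoint X T S \<longleftrightarrow> fock_operator X S \<and>
     (\<forall>\<eta>\<in>fock X. \<forall>\<zeta>\<in>fock X. fock_ip X (T \<eta>) \<zeta> = fock_ip X \<eta> (S \<zeta>))"

text \<open>Boundedness is automatic for adjointable operators; it is included for convenience.\<close>

definition adjointable_ops ::
    "('n::finite, 'a::cstar_algebra, 'x::complex_vector) product_system \<Rightarrow> ('n, 'x) fop star_alg" where
  "adjointable_ops X = \<lparr>
     carr = {T. fock_operator X T \<and> (\<exists>S. is_adjoint X T S) \<and>
       (\<exists>K. \<forall>\<eta>\<in>fock X. fock_norm X (T \<eta>) \<le> K * fock_norm X \<eta>)},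
     plus_of = (\<lambda>S T \<eta> m. S \<eta> m + T \<eta> m),
     scale_of = (\<lambda>c T \<eta> m. c *\<^sub>C T \<eta> m),
     times_of = (\<lambda>S T. S \<circ> T),
     star_of = (\<lambda>T. THE S. is_adjoint X T S),
     norm_of = (\<lambda>T. SUP \<eta>\<in>{\<eta>\<in>fock X. fock_norm X \<eta> \<le> 1}. fock_norm X (T \<eta>))\<rparr>"

definition fpi ::
    "('n::finite, 'a::cstar_algebra, 'x::complex_vector) product_system \<Rightarrow> 'a \<Rightarrow> ('n, 'x) fop" where
  "fpi X a = on_fock X (\<lambda>\<eta> m. lmul (fib X m) a (\<eta> m))"

definition creation ::
    "('n::finite, 'a::cstar_algebra, 'x::complex_vector) product_system \<Rightarrow>
     nat ^ 'n \<Rightarrow> 'x \<Rightarrow> ('n, 'x) fop" where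
  "creation X n \<xi> = on_fock X (\<lambda>\<eta> m.
     if \<forall>i. n $ i \<le> m $ i then prd X n (m - n) \<xi> (\<eta> (m - n)) else 0)"

definition NT ::
    "('n::finite, 'a::cstar_algebra, 'x::complex_vector) product_system \<Rightarrow> ('n, 'x) fop star_alg" where
  "NT X = generated_cstar_algebra (adjointable_ops X)
     (range (fpi X) \<union> {creation X n \<xi> | n \<xi>. \<xi> \<in> mcarr (fib X n)})"

definition monomial ::
    "('n::finite, 'a::cstar_algebra, 'x::complex_vector) product_system \<Rightarrow>
     nat ^ 'n \<Rightarrow> 'x \<Rightarrow> nat ^ 'n \<Rightarrow> 'x \<Rightarrow> ('n, 'x) fop" where
  "monomial X n \<xi> m \<eta> =
     times_of (NT X) (creation X n \<xi>) (star_of (NT X) (creation X m \<eta>))"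

text \<open>
  The gauge action is conjugation by the unitaries that multiply the fibre at \<open>m\<close> by the monomial
  with exponent \<open>m\<close> in the parameters \<open>z i\<close>, all of modulus one.
\<close>

definition gauge_unitary :: "('n::finite \<Rightarrow> complex) \<Rightarrow> ('n, 'x::complex_vector) fop" where
  "gauge_unitary z = (\<lambda>\<eta> m. (\<Prod>i\<in>UNIV. z i ^ (m $ i)) *\<^sub>C \<eta> m)"

definition gauge_action ::
    "('n::finite \<Rightarrow> complex) \<Rightarrow> ('n, 'x::complex_vector) fop \<Rightarrow> ('n, 'x) fop" where
  "gauge_action z T = gauge_unitary z \<circ> T \<circ> gauge_unitary (\<lambda>i. cnj (z i))"

definition rotation :: "real \<Rightarrow> ('n::finite, 'x::complex_vector) fop \<Rightarrow> ('n, 'x) fop" where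
  "rotation r = gauge_action (\<lambda>_. exp (\<i> * complex_of_real r))"

definition range_proj ::
    "('n::finite, 'a::cstar_algebra, 'x::complex_vector) product_system \<Rightarrow>
     ('n \<Rightarrow> nat) \<Rightarrow> ('n \<Rightarrow> nat \<Rightarrow> 'x) \<Rightarrow> 'n \<Rightarrow> ('n, 'x) fop" where
  "range_proj X d x i =
     (\<lambda>\<eta> m. \<Sum>j<d i. monomial X (axis i 1) (x i j) (axis i 1) (x i j) \<eta> m)"

text \<open>
  For a frame \<open>x\<close> the operator \<open>range_proj X d x i\<close> is the projection onto the sum of the fibres
  at all \<open>m\<close> with \<open>m $ i \<noteq> 0\<close>. The factors of the product therefore commute, and the fold does not
  depend on an enumeration of \<open>F\<close>.
\<close>

definition defect_proj ::
    "('n::finite, 'a::cstar_algebra, 'x::complex_vector) product_system \<Rightarrow>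
     ('n \<Rightarrow> nat) \<Rightarrow> ('n \<Rightarrow> nat \<Rightarrow> 'x) \<Rightarrow> 'n set \<Rightarrow> ('n, 'x) fop" where
  "defect_proj X d x F =
     Finite_Set.fold (\<lambda>i T. on_fock X (\<lambda>\<eta> m. \<eta> m - range_proj X d x i \<eta> m) \<circ> T)
       (on_fock X (\<lambda>\<eta>. \<eta>)) F"

definition supp :: "nat ^ 'n \<Rightarrow> 'n set" where
  "supp n = {i. n $ i \<noteq> 0}"

definition perp_invariant_lattice ::
    "('n::finite, 'a::cstar_algebra, 'x::complex_vector) product_system \<Rightarrow>
     ('n set \<Rightarrow> 'a set) \<Rightarrow> bool" where
  "perp_invariant_lattice X I \<longleftrightarrow>
     (\<forall>F. F \<noteq> {} \<longrightarrow> closed_ideal type_alg (I F)) \<and>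
     (\<forall>F F'. F \<noteq> {} \<and> F \<subseteq> F' \<longrightarrow> I F \<subseteq> I F') \<and>
     (\<forall>F n. F \<noteq> {} \<and> supp n \<inter> F = {} \<longrightarrow>
        (\<forall>\<xi>\<in>mcarr (fib X n). \<forall>\<eta>\<in>mcarr (fib X n). \<forall>a\<in>I F.
           ip (fib X n) \<xi> (lmul (fib X n) a \<eta>) \<in> I F))"

definition kernel_ideal ::
    "('n::finite, 'a::cstar_algebra, 'x::complex_vector) product_system \<Rightarrow>
     ('n \<Rightarrow> nat) \<Rightarrow> ('n \<Rightarrow> nat \<Rightarrow> 'x) \<Rightarrow> ('n set \<Rightarrow> 'a set) \<Rightarrow> ('n, 'x) fop set" where
  "kernel_ideal X d x I = generated_ideal (NT X)
     {fpi X a \<circ> defect_proj X d x F | a F. F \<noteq> {} \<and> a \<in> I F}"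

definition NO ::
    "('n::finite, 'a::cstar_algebra, 'x::complex_vector) product_system \<Rightarrow>
     ('n \<Rightarrow> nat) \<Rightarrow> ('n \<Rightarrow> nat \<Rightarrow> 'x) \<Rightarrow> ('n set \<Rightarrow> 'a set) \<Rightarrow> ('n, 'x) fop set star_alg" where
  "NO X d x I = quotient_alg (NT X) (kernel_ideal X d x I)"

definition NO_quot ::
    "('n::finite, 'a::cstar_algebra, 'x::complex_vector) product_system \<Rightarrow>
     ('n \<Rightarrow> nat) \<Rightarrow> ('n \<Rightarrow> nat \<Rightarrow> 'x) \<Rightarrow> ('n set \<Rightarrow> 'a set) \<Rightarrow> ('n, 'x) fop \<Rightarrow> ('n, 'x) fop set" where
  "NO_quot X d x I = coset (NT X) (kernel_ideal X d x I)"

definition NO_sigma ::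
    "('n::finite, 'a::cstar_algebra, 'x::complex_vector) product_system \<Rightarrow>
     ('n \<Rightarrow> nat) \<Rightarrow> ('n \<Rightarrow> nat \<Rightarrow> 'x) \<Rightarrow> ('n set \<Rightarrow> 'a set) \<Rightarrow>
     real \<Rightarrow> ('n, 'x) fop set \<Rightarrow> ('n, 'x) fop set" where
  "NO_sigma X d x I = quotient_action (NT X) (kernel_ideal X d x I) rotation"

definition annihilating :: "'a set \<Rightarrow> ('a \<Rightarrow> complex) set" where
  "annihilating J = {\<tau>. \<forall>a\<in>J. \<tau> a = 0}"

end

theory Submission
  imports Defs "HOL-Complex_Analysis.Complex_Analysis"
begin

text \<open>
  Write \<open>E f\<close> for the compression of \<open>f\<close> to the fibre at 0 (\<open>e0\<close> below), so that
  \<open>\<Psi> \<tau> = \<tau> \<circ> E\<close>, and \<open>Q\<close> for the product of all \<open>1 - P i\<close>, the projection onto that fibre.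

  If \<open>b\<close> has negative degree \<open>k\<close>, the orbit of \<open>g b\<close> under a ground state is \<open>exp (i k z)\<close> times
  its value, and boundedness in the upper half plane makes that value zero; for a general element of
  the dense set this is applied to the \<open>k\<close>-th Fourier coefficient of its orbit. So a ground state
  vanishes on all \<open>g t(\<xi>)\<^sup>*\<close> and, by Cauchy-Schwarz, on all \<open>t(\<xi>) g\<close> with \<open>\<xi>\<close> of positive degree.
  It is then unchanged by multiplication with \<open>Q\<close> on either side, and \<open>Q f Q = \<pi>(E f) Q\<close> shows that
  it factors through \<open>E\<close>. The same Fourier argument turns the KMS condition into
  \<open>\<phi>(b g) = exp (- k \<beta>) \<phi>(g b)\<close>, whose limits at infinite \<open>\<beta>\<close> are of the form \<open>\<tau> \<circ> E\<close> with \<open>\<tau>\<close>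
  tracial.

  Conversely, for a trace \<open>\<tau>\<close> the weighted sums of \<open>\<tau>(E(t(y)\<^sup>* f t(y)))\<close> over frames \<open>y\<close> of
  the fibres at \<open>m\<close>, with weights \<open>exp (- \<beta> \<bar>m\<bar>)\<close>, converge for large \<open>\<beta>\<close> because the ranks grow at
  most exponentially. They satisfy the KMS condition and, once normalised, tend to \<open>\<tau> \<circ> E\<close>.

  For the quotients, invariance of the lattice puts all \<open>E (u f v)\<close> with \<open>f\<close> in the kernel into the
  largest ideal, so that the functionals above vanish on the kernel if \<open>\<tau>\<close> annihilates that ideal;
  the converse is \<open>E (\<pi>(a) Q) = a\<close>.
\<close>

text \<open>Two obstacles shape the proof. First, \<open>'a\<close> may lack a unit, so the
  projections of the argument need not lie in the Toeplitz algebra. They act only as multipliers,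
  functionals are normalised by their norm, and the vacuum vector is replaced by the column of
  \<open>f\<close> over the fibre at 0. That this column is given by a Fock vector, hence that
  \<open>E f\<close> lies in \<open>'a\<close> and not merely among its multipliers, is special to
  the generated algebra. Second, inner products in the Fock module converge in norm, in general not
  absolutely. Convergence is therefore controlled by order: if \<open>0 \<le> a \<le> b\<close> then
  the norm of \<open>a\<close> is at most that of \<open>b\<close>. This makes the positive cone,
  including positivity of \<open>star v * v\<close>, the base of everything else. Moreover a KMS or
  ground state comes with its own dense set of analytic elements, of which little is known; Fourier
  coefficients exchange it for homogeneous elements that can be chosen freely. In the same way,
  states of a quotient are lifted to the Toeplitz algebra although their dense sets are not.\<close>

lemma scaleC_zero_left [simp]: "0 *\<^sub>C (x::'a::complex_vector) = 0"
  using scaleC_add_left[of 0 0 x] by simp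

lemma scaleC_zero_right [simp]: "c *\<^sub>C (0::'a::complex_vector) = 0"
  using scaleC_add_right[of c 0 "0::'a"] by simp

lemma scaleC_minus_left: "(- c) *\<^sub>C (x::'a::complex_vector) = - (c *\<^sub>C x)"
  using scaleC_add_left[of c "-c" x] by (simp add: eq_neg_iff_add_eq_0 add.commute)

lemma scaleC_minus_right: "c *\<^sub>C (- x::'a::complex_vector) = - (c *\<^sub>C x)"
  using scaleC_add_right[of c x "-x"] by (simp add: eq_neg_iff_add_eq_0 add.commute)

lemma scaleC_diff_right: "c *\<^sub>C (x - y::'a::complex_vector) = c *\<^sub>C x - c *\<^sub>C y"
  using scaleC_add_right[of c x "-y"] by (simp add: scaleC_minus_right)

lemma scaleC_sum_right: "c *\<^sub>C (\<Sum>i\<in>I. f i) = (\<Sum>i\<in>I. c *\<^sub>C (f i::'a::complex_vector))"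
  by (induction I rule: infinite_finite_induct) (auto simp: scaleC_add_right)

lemmas scaleC_simps = scaleC_zero_left scaleC_zero_right scaleC_minus_left scaleC_minus_right
  scaleC_one scaleC_add_right scaleC_diff_right scaleC_scaleC

lemma scaleC_minus_one [simp]: "(-1) *\<^sub>C (x::'a::complex_vector) = - x"
  by (simp add: scaleC_minus_left scaleC_one)

section \<open>Positivity in C*-algebras\<close>

context cstar_algebra
begin

lemma star_zero [simp]: "star 0 = 0"
  using star_add[of 0 0] by simp

lemma star_minus: "star (- x) = - star x"
  using star_add[of x "-x"] by (simp add: eq_neg_iff_add_eq_0 add.commute)

lemma star_diff: "star (x - y) = star x - star y"
  using star_add[of x "-y"] by (simp add: star_minus)

lemma star_sum: "star (\<Sum>i\<in>I. f i) = (\<Sum>i\<in>I. star (f i))"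
  by (induction I rule: infinite_finite_induct) (auto simp: star_add)

lemma star_scaleR: "star (r *\<^sub>R x) = r *\<^sub>R star x"
  by (simp add: scaleR_scaleC star_scaleC)

lemma norm_star [simp]: "norm (star x) = norm x"
proof -
  have le: "norm y \<le> norm (star y)" for y
  proof (cases "norm y = 0")
    case False
    have "norm y * norm y \<le> norm (star y) * norm y"
      using norm_mult_ineq[of "star y" y] cstar_identity[of y] by (simp add: power2_eq_square)
    then show ?thesis
      using False by simp
  qed simp
  show ?thesis
    using le[of x] le[of "star x"] by (simp add: star_star)
qed

lemma norm_self_adjoint_square: "star x = x \<Longrightarrow> norm (x * x) = (norm x)\<^sup>2"
  using cstar_identity[of x] by simp

lemma star_mult_self_eq_zero: "star x * x = 0 \<Longrightarrow> x = 0"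
  using cstar_identity[of x] by simp

end

lemmas star_simps = star_add star_diff star_minus star_mult star_star star_scaleR star_scaleC

lemma bounded_linear_star: "bounded_linear (star :: 'a \<Rightarrow> 'a::cstar_algebra)"
  by (rule bounded_linear_intro[where K=1]) (auto simp: star_simps)

lemmas tendsto_star = bounded_linear.tendsto[OF bounded_linear_star]

lemma bounded_linear_scaleC: "bounded_linear (\<lambda>x::'a::cstar_algebra. c *\<^sub>C x)"
  by (rule bounded_linear_intro[where K="cmod c"])
    (auto simp: scaleC_add_right scaleR_scaleC scaleC_scaleC norm_scaleC mult.commute)

text \<open>The fourth power has norm \<open>norm x ^ 4\<close> by the C*-identity used twice, and
  it splits into the cube times \<open>x\<close>. Cubes appear later where a unit is missing:
  testing a positive element on itself yields its cube.\<close>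

lemma norm_self_adjoint_cube:
  fixes x :: "'a::cstar_algebra"
  assumes "star x = x"
  shows "norm (x * x * x) = (norm x) ^ 3"
proof (cases "norm x = 0")
  case False
  have "norm ((x * x) * (x * x)) = norm x ^ 4"
    using norm_self_adjoint_square[of "x * x"] norm_self_adjoint_square[of x] assms
    by (simp add: star_mult)
  also have "(x * x) * (x * x) = (x * x * x) * x"
    by (simp add: mult.assoc)
  finally have "norm x ^ 4 \<le> norm (x * x * x) * norm x"
    using norm_mult_ineq[of "x * x * x" x] by simp
  then have "norm x ^ 3 * norm x \<le> norm (x * x * x) * norm x"
    by (simp add: power3_eq_cube power4_eq_xxxx)
  then have "norm x ^ 3 \<le> norm (x * x * x)"
    using False by (metis mult_right_le_imp_le norm_ge_zero order_le_less)
  moreover have "norm (x * x * x) \<le> norm x ^ 3"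
    by (intro order_trans[OF norm_mult_ineq])
      (simp add: power3_eq_cube mult_right_mono norm_mult_ineq)
  ultimately show ?thesis
    by simp
qed simp

text \<open>
  The element \<open>1 - z\<close> is the square root of \<open>1 - x\<close>, stated without a unit. It is the limit of
  the iteration \<open>z \<mapsto> (x + z\<^sup>2) / 2\<close>, whose steps are dominated by those of the scalar iteration
  \<open>s \<mapsto> (1 + s\<^sup>2) / 2\<close>.
\<close>

lemma sqrt_one_minus:
  fixes x :: "'a::cstar_algebra"
  assumes x: "star x = x" "norm x \<le> 1"
  shows "\<exists>z. star z = z \<and> norm z \<le> 1 \<and> 2 *\<^sub>R z - z * z = x \<and> (\<forall>y. x * y = y * x \<longrightarrow> z * y = y * z)"
proof -
  \<comment> \<open>The scalar iteration increases and stays below 1; only its Cauchy property is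
    used, to control the increments of \<open>z\<close>.\<close>
  define s :: "nat \<Rightarrow> real" where "s = rec_nat 0 (\<lambda>_ t. (1 + t * t) / 2)"
  define z where "z = rec_nat 0 (\<lambda>_ t. (1/2) *\<^sub>R (x + t * t))"
  have s0: "s 0 = 0" and sS: "\<And>n. s (Suc n) = (1 + s n * s n) / 2"
    by (simp_all add: s_def)
  have z0: "z 0 = 0" and zS: "\<And>n. z (Suc n) = (1/2) *\<^sub>R (x + z n * z n)"
    by (simp_all add: z_def)
  have s_bd: "0 \<le> s n \<and> s n \<le> 1" for n
    by (induction n) (auto simp: s0 sS mult_le_one)
  have s_mono: "s n \<le> s (Suc n)" for n
    using zero_le_power2[of "s n - 1"] by (simp add: sS power2_eq_square algebra_simps)
  have "Bseq s"
    by (rule BseqI[of 1]) (use s_bd in auto)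
  then have "convergent s"
    using s_mono by (intro Bseq_monoseq_convergent) (auto simp: monoseq_Suc)
  then have Cs: "Cauchy s"
    by (rule convergent_Cauchy)
  have comm: "z n * y = y * z n" if "x * y = y * x" for n y
  proof (induction n)
    case (Suc n)
    have "z n * z n * y = y * (z n * z n)"
      by (metis Suc mult.assoc)
    then show ?case
      by (simp add: zS that algebra_simps)
  qed (simp add: z0)
  have cz: "z n * z m = z m * z n" for n m
    by (rule comm) (rule comm[OF refl, symmetric])
  have z_bd: "norm (z n) \<le> s n" for n
  proof (induction n)
    case (Suc n)
    have "norm (z n * z n) \<le> s n * s n"
      by (meson Suc mult_mono norm_ge_zero norm_mult_ineq order_trans s_bd)
    then show ?case
      using x norm_triangle_ineq[of x "z n * z n"] by (simp add: zS sS)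
  qed (simp add: z0 s0)
  have step: "norm (z (Suc n) - z n) \<le> s (Suc n) - s n" for n
  proof (induction n)
    case (Suc n)
    \<comment> \<open>The iterates commute, so a difference of squares factors, and each factor is
      dominated by its scalar counterpart.\<close>
    have "z (Suc (Suc n)) - z (Suc n) = (1/2) *\<^sub>R ((z (Suc n) - z n) * (z (Suc n) + z n))"
      using cz[of n "Suc n"] by (simp add: zS[of "Suc n"] zS[of n] algebra_simps flip: zS)
    moreover have "norm ((z (Suc n) - z n) * (z (Suc n) + z n)) \<le> (s (Suc n) - s n) * (s (Suc n) + s n)"
      using norm_triangle_ineq[of "z (Suc n)" "z n"] z_bd[of n] z_bd[of "Suc n"] s_mono[of n]
      by (intro order_trans[OF norm_mult_ineq] mult_mono Suc) auto
    moreover have "s (Suc (Suc n)) - s (Suc n) = (1/2) * ((s (Suc n) - s n) * (s (Suc n) + s n))"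
    proof -
      have "(1/2) * ((s (Suc n) - s n) * (s (Suc n) + s n)) = (s (Suc n) * s (Suc n) - s n * s n) / 2"
        by (simp add: algebra_simps)
      then show ?thesis
        unfolding sS[of "Suc n"] using sS[of n] by (simp add: field_simps)
    qed
    ultimately show ?case
      by simp
  qed (use x in \<open>simp add: z0 s0 zS sS\<close>)
  have diff: "norm (z (n + k) - z n) \<le> s (n + k) - s n" for n k
  proof (induction k)
    case (Suc k)
    then show ?case
      using step[of "n + k"] norm_triangle_ineq[of "z (Suc (n + k)) - z (n + k)" "z (n + k) - z n"]
      by simp
  qed simp
  have diff': "dist (z m) (z n) \<le> dist (s m) (s n)" for m n
  proof (cases "n \<le> m")
    case True
    then show ?thesis
      using diff[of n "m - n"] by (simp add: dist_norm)
  next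
    case False
    then show ?thesis
      using diff[of m "n - m"] by (simp add: dist_norm norm_minus_commute)
  qed
  have "Cauchy z"
    unfolding Cauchy_def
  proof (intro allI impI)
    fix e :: real assume "e > 0"
    then obtain M where "\<And>m n. m \<ge> M \<Longrightarrow> n \<ge> M \<Longrightarrow> dist (s m) (s n) < e"
      using Cs unfolding Cauchy_def by blast
    then show "\<exists>M. \<forall>m\<ge>M. \<forall>n\<ge>M. dist (z m) (z n) < e"
      using diff' by (meson le_less_trans)
  qed
  then obtain l where l: "z \<longlonglongrightarrow> l"
    using Cauchy_convergent convergent_def by blast
  have "star (z n) = z n" for n
    by (induction n) (auto simp: z0 zS star_simps x)
  then have "star l = l"
    using tendsto_star[OF l] l LIMSEQ_unique by auto
  moreover have "norm l \<le> 1"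
    by (rule Lim_bounded[OF tendsto_norm[OF l], of 0]) (use z_bd s_bd order_trans in blast)
  moreover have "l = (1/2) *\<^sub>R (x + l * l)"
  proof (rule LIMSEQ_unique)
    show "(\<lambda>n. z (Suc n)) \<longlonglongrightarrow> l"
      using l by (rule LIMSEQ_Suc)
    show "(\<lambda>n. z (Suc n)) \<longlonglongrightarrow> (1/2) *\<^sub>R (x + l * l)"
      unfolding zS by (intro tendsto_intros l)
  qed
  then have "2 *\<^sub>R l = x + l * l"
    by (drule_tac arg_cong[where f="\<lambda>v. 2 *\<^sub>R v"]) (simp only: scaleR_scaleR, simp)
  moreover have "l * y = y * l" if "x * y = y * x" for y
  proof (rule LIMSEQ_unique)
    show "(\<lambda>n. z n * y) \<longlonglongrightarrow> l * y"
      by (intro tendsto_intros l)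
    show "(\<lambda>n. z n * y) \<longlonglongrightarrow> y * l"
      unfolding comm[OF that] by (intro tendsto_intros l)
  qed
  ultimately show ?thesis
    by (metis add_diff_cancel_right')
qed

section \<open>The positive cone of a unital algebra without spectral theory\<close>

class unital_cstar_algebra = cstar_algebra + real_normed_algebra_1

lemma star_one [simp]: "star (1::'a::unital_cstar_algebra) = 1"
  by (metis mult.right_neutral star_mult star_star)

lemma star_of_real [simp]: "star (of_real t) = (of_real t :: 'a::unital_cstar_algebra)"
  by (simp add: of_real_def star_scaleR)

text \<open>
  Self-adjoint with spectrum in \<open>[0, 2t]\<close>, in a form that makes closure under addition obvious.
\<close>

definition Pos :: "'a::unital_cstar_algebra \<Rightarrow> bool" where
  "Pos a \<longleftrightarrow> star a = a \<and> (\<exists>t\<ge>0. norm (of_real t - a) \<le> t)"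

lemma Pos_add:
  assumes "Pos a" "Pos b"
  shows "Pos (a + b)"
proof -
  from assms obtain s t where "s \<ge> 0" "norm (of_real s - a) \<le> s" "t \<ge> 0" "norm (of_real t - b) \<le> t"
    unfolding Pos_def by blast
  then have "norm (of_real (s + t) - (a + b)) \<le> s + t"
    using norm_triangle_ineq[of "of_real s - a" "of_real t - b"] by (simp add: algebra_simps)
  then show ?thesis
    using assms \<open>s \<ge> 0\<close> \<open>t \<ge> 0\<close> unfolding Pos_def
    by (intro conjI exI[of _ "s + t"]) (auto simp: star_add)
qed

lemma Pos_scaleR:
  assumes "Pos a" "r \<ge> 0"
  shows "Pos (r *\<^sub>R a)"
proof -
  from assms obtain t where t: "t \<ge> 0" "norm (of_real t - a) \<le> t"
    unfolding Pos_def by blast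
  have "of_real (r * t) - r *\<^sub>R a = r *\<^sub>R (of_real t - a)"
    by (simp add: algebra_simps of_real_def)
  then have "norm (of_real (r * t) - r *\<^sub>R a) \<le> r * t"
    using t assms(2) by (simp add: mult_left_mono)
  then show ?thesis
    using assms t unfolding Pos_def by (intro conjI exI[of _ "r * t"]) (auto simp: star_scaleR)
qed

lemma Pos_0 [simp]: "Pos 0"
  unfolding Pos_def by (auto intro: exI[of _ 0])

lemma Pos_of_real_minus: "star a = a \<Longrightarrow> norm a \<le> t \<Longrightarrow> Pos (of_real t - a)"
  unfolding Pos_def by (auto simp: star_diff intro!: exI[of _ t]) (use norm_ge_zero order_trans in blast)

text \<open>The element \<open>u = p + \<i> *\<^sub>C q\<close> satisfies
  \<open>star u * u = p * p + q * q\<close> because \<open>p\<close> and \<open>q\<close> commute,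
  and \<open>q\<close> is its imaginary part, so \<open>norm q \<le> norm u\<close>. This stands in
  for functional calculus below.\<close>

lemma commuting_square_mono:
  fixes p q :: "'a::cstar_algebra"
  assumes "star p = p" "star q = q" "p * q = q * p"
  shows "norm (q * q) \<le> norm (p * p + q * q)"
proof -
  define u where "u = p + \<i> *\<^sub>C q"
  have u: "star u = p - \<i> *\<^sub>C q"
    by (simp add: u_def star_simps assms scaleC_minus_left)
  have "star u * u = p * p + q * q"
    unfolding u unfolding u_def using assms(3)
    by (simp add: algebra_simps scaleC_mult_left scaleC_mult_right scaleC_simps)
  then have nu: "(norm u)\<^sup>2 = norm (p * p + q * q)"
    using cstar_identity[of u] by simp
  have "u - star u = (2 * \<i>) *\<^sub>C q"
    unfolding u unfolding u_def by (simp add: scaleC_add_left[symmetric])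
  then have "2 * norm q \<le> norm u + norm (star u)"
    using norm_triangle_ineq4[of u "star u"] norm_scaleC[of "2 * \<i>" q] by (simp add: norm_mult)
  then have "norm q \<le> norm u"
    by simp
  then have "(norm q)\<^sup>2 \<le> (norm u)\<^sup>2"
    by (simp add: power_mono)
  then show ?thesis
    using nu norm_self_adjoint_square[OF assms(2)] by simp
qed

text \<open>With \<open>z\<close> from \<open>sqrt_one_minus\<close> for \<open>x / t\<close>, the
  root is \<open>sqrt t\<close> times \<open>1 - z\<close>. The commutation clause is what allows
  several roots to be multiplied later.\<close>

lemma Pos_sqrt_shift:
  fixes x :: "'a::unital_cstar_algebra"
  assumes "star x = x" "norm x \<le> t" "0 \<le> t"
  shows "\<exists>k. Pos k \<and> k * k = of_real t - x \<and> (\<forall>y. x * y = y * x \<longrightarrow> k * y = y * k)"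
proof (cases "t = 0")
  case True
  then show ?thesis
    using assms by (intro exI[of _ 0]) simp
next
  case False
  then have t: "t > 0"
    using assms(3) by simp
  have "norm ((1/t) *\<^sub>R x) \<le> 1"
    using t assms(2) by (simp add: field_simps)
  moreover have "star ((1/t) *\<^sub>R x) = (1/t) *\<^sub>R x"
    using assms(1) by (simp add: star_scaleR)
  ultimately obtain z where z: "star z = z" "norm z \<le> 1" "2 *\<^sub>R z - z * z = (1/t) *\<^sub>R x"
    and cz: "\<And>y. ((1/t) *\<^sub>R x) * y = y * ((1/t) *\<^sub>R x) \<Longrightarrow> z * y = y * z"
    using sqrt_one_minus[of "(1/t) *\<^sub>R x"] by metis
  define k where "k = sqrt t *\<^sub>R (1 - z)"
  have "k * k = t *\<^sub>R ((1 - z) * (1 - z))"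
    using t by (simp add: k_def)
  also have "(1 - z) * (1 - z) = 1 - (2 *\<^sub>R z - z * z)"
    by (simp add: algebra_simps scaleR_2)
  also have "t *\<^sub>R (1 - (2 *\<^sub>R z - z * z)) = of_real t - x"
    unfolding z using t by (simp add: algebra_simps of_real_def)
  finally have "k * k = of_real t - x" .
  moreover have "k * y = y * k" if "x * y = y * x" for y
    using cz[of y] that by (simp add: k_def algebra_simps)
  moreover have "Pos (1 - z)"
    unfolding Pos_def using z by (auto simp: star_diff intro!: exI[of _ 1])
  then have "Pos k"
    using t by (simp add: k_def Pos_scaleR)
  ultimately show ?thesis
    by blast
qed

lemma Pos_self_adjoint: "Pos a \<Longrightarrow> star a = a"
  by (simp add: Pos_def)

lemma Pos_sqrt:
  assumes "Pos a"
  shows "\<exists>k. Pos k \<and> k * k = a \<and> (\<forall>y. a * y = y * a \<longrightarrow> k * y = y * k)"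
proof -
  obtain t where t: "t \<ge> 0" "norm (of_real t - a) \<le> t"
    using assms unfolding Pos_def by blast
  have "star (of_real t - a) = of_real t - a"
    using assms by (simp add: Pos_def star_diff)
  then obtain k where k: "Pos k" "k * k = of_real t - (of_real t - a)"
    "\<And>y. (of_real t - a) * y = y * (of_real t - a) \<Longrightarrow> k * y = y * k"
    using Pos_sqrt_shift[OF _ t(2) t(1)] by metis
  have "k * k = a"
    using k(2) by simp
  moreover have "(of_real t - a) * y = y * (of_real t - a)" if "a * y = y * a" for y
    using that by (simp add: algebra_simps of_real_def)
  ultimately show ?thesis
    using k(1,3) by blast
qed

text \<open>Put \<open>t = norm (h * h)\<close> and \<open>k * k = t - h * h\<close>. The two
  commuting squares add up to the scalar \<open>t\<close>, so
  \<open>norm (t - h * h) \<le> t\<close>, which is the defining condition.\<close>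

lemma Pos_square:
  fixes h :: "'a::unital_cstar_algebra"
  assumes "star h = h"
  shows "Pos (h * h)"
proof -
  define t where "t = norm (h * h)"
  have "star (h * h) = h * h" "norm (h * h) \<le> t" "0 \<le> t"
    using assms by (simp_all add: t_def star_mult)
  then obtain k where k: "Pos k" "k * k = of_real t - h * h"
    "\<And>y. (h * h) * y = y * (h * h) \<Longrightarrow> k * y = y * k"
    using Pos_sqrt_shift by metis
  have "norm (k * k) \<le> norm (h * h + k * k)"
    using k(3)[of h] k(1) assms
    by (intro commuting_square_mono) (auto simp: mult.assoc Pos_self_adjoint)
  also have "\<dots> = t"
    by (simp add: k t_def)
  finally show ?thesis
    unfolding Pos_def using assms k(2)
    by (auto simp: star_mult t_def intro!: exI[of _ t])
qed

text \<open>Both \<open>a\<close> and \<open>t - a\<close> are squares, their roots commute, and the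
  squares add up to the scalar \<open>t\<close>.\<close>

lemma Pos_norm_le:
  assumes "Pos a" "Pos (of_real t - a)" "t \<ge> 0"
  shows "norm a \<le> t"
proof -
  obtain f where f: "Pos f" "f * f = a" "\<And>y. a * y = y * a \<Longrightarrow> f * y = y * f"
    using Pos_sqrt[OF assms(1)] by metis
  obtain g where g: "Pos g" "g * g = of_real t - a"
    "\<And>y. (of_real t - a) * y = y * (of_real t - a) \<Longrightarrow> g * y = y * g"
    using Pos_sqrt[OF assms(2)] by metis
  have "g * f = f * g"
    using f(3)[of a] by (intro g(3)) (simp add: algebra_simps of_real_def)
  then have "norm (f * f) \<le> norm (g * g + f * f)"
    by (rule commuting_square_mono[OF Pos_self_adjoint[OF g(1)] Pos_self_adjoint[OF f(1)]])
  also have "g * g + f * f = of_real t"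
    by (simp add: f g)
  finally show ?thesis
    unfolding f(2) using assms(3) by simp
qed

lemma Pos_norm_mono:
  assumes "Pos a" "Pos b"
  shows "norm a \<le> norm (a + b)"
proof (rule Pos_norm_le[OF assms(1)])
  have "Pos (of_real (norm (a + b)) - (a + b) + b)"
    using assms Pos_add[OF assms] by (intro Pos_add Pos_of_real_minus) (auto simp: Pos_self_adjoint)
  then show "Pos (of_real (norm (a + b)) - a)"
    by simp
qed simp

text \<open>The quantifier over \<open>t\<close> disappears because \<open>t = norm a\<close> always
  works. What remains is a closed condition, so positivity survives limits.\<close>

lemma Pos_iff: "Pos a \<longleftrightarrow> star a = a \<and> norm (of_real (norm a) - a) \<le> norm a"
proof
  assume a: "Pos a"
  then have "Pos (of_real (norm a) - a)"
    by (intro Pos_of_real_minus) (auto simp: Pos_self_adjoint)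
  then show "star a = a \<and> norm (of_real (norm a) - a) \<le> norm a"
    using a by (auto intro!: Pos_norm_le simp: Pos_self_adjoint)
qed (auto simp: Pos_def intro!: exI[of _ "norm a"])

text \<open>
  Put \<open>h = v\<^sup>* v\<close>, \<open>k = \<bar>h\<bar>\<close> and \<open>w = v (k - h)\<close>. Then \<open>w\<^sup>* w = - f\<^sup>2\<close> with \<open>f\<close> self-adjoint, hence
  \<open>c = w w\<^sup>*\<close> is positive. With \<open>M = \<parallel>c\<parallel>\<close> the identity \<open>(M/2 - c) w = w (M/2 + f\<^sup>2)\<close> gives
  \<open>M\<^sup>3 \<le> M (M/2)\<^sup>2\<close>, so that \<open>w = 0\<close> and \<open>h = k\<close>.
\<close>

theorem Pos_star_mult:
  fixes v :: "'a::unital_cstar_algebra"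
  shows "Pos (star v * v)"
proof -
  define h where "h = star v * v"
  have h: "star h = h"
    by (simp add: h_def star_simps)
  obtain k where k: "Pos k" "k * k = h * h" and ck: "\<And>y. (h * h) * y = y * (h * h) \<Longrightarrow> k * y = y * k"
    using Pos_sqrt[OF Pos_square[OF h]] by metis
  have kh: "k * h = h * k"
    by (rule ck) (simp add: mult.assoc)
  obtain r where r: "Pos r" "r * r = k" and cr: "\<And>y. k * y = y * k \<Longrightarrow> r * y = y * r"
    using Pos_sqrt[OF k(1)] by metis
  have rk: "r * k = k * r" and rh: "r * h = h * r"
    using cr kh by auto
  have sk: "star k = k" and sr: "star r = r"
    using k r by (auto simp: Pos_self_adjoint)
  define w where "w = v * (k - h)"
  define f where "f = (k - h) * r"
  have f: "star f = f"
    by (simp add: f_def star_simps sk sr h algebra_simps rk rh)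
  have "star w * w = (k - h) * h * (k - h)"
    by (simp add: w_def star_simps sk h) (simp add: h_def mult.assoc)
  also have "h * (k - h) = - (k * (k - h))"
    by (simp add: algebra_simps kh k)
  then have "(k - h) * h * (k - h) = - ((k - h) * k * (k - h))"
    by (simp add: mult.assoc)
  also have "(k - h) * k * (k - h) = f * f"
  proof -
    have "f = r * (k - h)"
      by (simp add: f_def algebra_simps rk rh)
    then have "f * f = (k - h) * r * (r * (k - h))"
      by (metis f_def)
    also have "\<dots> = (k - h) * (r * r) * (k - h)"
      by (simp add: mult.assoc)
    finally show ?thesis
      by (simp add: r)
  qed
  finally have ww: "star w * w = - (f * f)" .
  \<comment> \<open>Cartesian parts of \<open>w\<close>. Since
    \<open>w * star w + star w * w\<close> is twice \<open>p * p + q * q\<close>, the product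
    \<open>w * star w\<close> becomes a sum of squares once \<open>star w * w = - (f * f)\<close> is
    inserted.\<close>
  define p where "p = (1/2) *\<^sub>C (w + star w)"
  define q where "q = (\<i>/2) *\<^sub>C (star w - w)"
  have pq: "star p = p" "star q = q"
    by (simp_all add: p_def q_def star_simps scaleC_simps algebra_simps)
  have w: "w = p + \<i> *\<^sub>C q" "star w = p - \<i> *\<^sub>C q"
    by (simp_all add: p_def q_def scaleC_simps algebra_simps)
      (simp_all add: scaleC_add_left[symmetric] scaleC_one)
  have "w * star w + star w * w = 2 *\<^sub>R (p * p + q * q)"
    unfolding w(2) unfolding w(1)
    by (simp add: algebra_simps scaleC_mult_left scaleC_mult_right scaleC_simps scaleR_2)
  then have c_eq: "w * star w = 2 *\<^sub>R (p * p + q * q) + f * f"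
    using ww by (simp add: algebra_simps)
  define c where "c = w * star w"
  have c: "Pos c"
    unfolding c_def c_eq using pq f by (intro Pos_add Pos_scaleR Pos_square) auto
  define M where "M = norm c"
  have M: "M = (norm w)\<^sup>2"
    using cstar_identity[of "star w"] by (simp add: M_def c_def star_star)
  have fM: "norm (f * f) = M"
    using ww cstar_identity[of w] by (simp add: M)
  define d where "d = of_real (M/2) - c"
  \<comment> \<open>In terms of spectra, \<open>c\<close> lives on \<open>[0, M]\<close>, so its
    distance to \<open>M / 2\<close> is at most \<open>M / 2\<close>. Algebraically: with commuting
    roots \<open>e\<close> of \<open>c\<close> and \<open>g\<close> of \<open>M - c\<close>, the
    squares of \<open>e * g\<close> and of \<open>d\<close> add up to the scalar
    \<open>(M/2)\<^sup>2\<close>.\<close>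
  have d: "norm d \<le> M / 2"
  proof -
    have "Pos (of_real M - c)"
      using c by (intro Pos_of_real_minus) (auto simp: M_def Pos_self_adjoint)
    then obtain g where g: "Pos g" "g * g = of_real M - c"
      "\<And>y. (of_real M - c) * y = y * (of_real M - c) \<Longrightarrow> g * y = y * g"
      using Pos_sqrt by metis
    obtain e where e: "Pos e" "e * e = c" "\<And>y. c * y = y * c \<Longrightarrow> e * y = y * e"
      using Pos_sqrt[OF c] by metis
    have ge: "g * e = e * g"
      using e(3)[of c] by (intro g(3)) (simp add: algebra_simps of_real_def)
    have sd: "star d = d"
      using c by (simp add: d_def star_diff Pos_self_adjoint)
    have dg: "d * (e * g) = (e * g) * d"
    proof -
      have "c * e = e * c" and "g * c = c * g"
        using e(3)[of c] g(3)[of c] by (simp_all add: algebra_simps of_real_def)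
      then have "c * (e * g) = (e * g) * c"
        by (metis mult.assoc)
      then show ?thesis
        by (simp add: d_def algebra_simps of_real_def)
    qed
    have "norm (d * d) \<le> norm ((e * g) * (e * g) + d * d)"
      using e(1) g(1) sd dg by (intro commuting_square_mono) (auto simp: star_mult Pos_self_adjoint ge)
    also have "(e * g) * (e * g) = c * (of_real M - c)"
      using ge by (metis e(2) g(2) mult.assoc)
    also have "c * (of_real M - c) + d * d = of_real ((M/2)\<^sup>2)"
      by (simp add: d_def of_real_def algebra_simps power2_eq_square)
        (simp add: scaleR_add_left[symmetric])
    finally have "(norm d)\<^sup>2 \<le> (M/2)\<^sup>2"
      unfolding norm_of_real norm_self_adjoint_square[OF sd] by simp
    then show ?thesis
      by (rule power2_le_imp_le) (simp add: M_def)
  qed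
  define F where "F = f * f"
  have F: "star F = F" "Pos F"
    using Pos_square[OF f] by (auto simp: F_def Pos_self_adjoint)
  \<comment> \<open>Written with \<open>F\<close> on the right, \<open>x\<close> allows
    \<open>star x * x\<close> to be computed exactly; written as \<open>d * w\<close> it can be
    bounded.\<close>
  define x where "x = w * (of_real (M/2) + F)"
  have "x = d * w"
    by (simp add: x_def d_def c_def F_def algebra_simps of_real_def mult.assoc ww)
  then have "norm x \<le> M/2 * norm w"
    using norm_mult_ineq[of d w] mult_right_mono[OF d, of "norm w"] by simp
  then have "(norm x)\<^sup>2 \<le> (M/2 * norm w)\<^sup>2"
    by (intro power_mono) auto
  then have "norm (star x * x) \<le> (M/2)\<^sup>2 * M"
    by (simp only: cstar_identity M power_mult_distrib)
  moreover have "star x * x = - (F * F * F + (M *\<^sub>R (F * F) + (M/2)\<^sup>2 *\<^sub>R F))"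
  proof -
    have "star x * x = (of_real (M/2) + F) * (star w * w) * (of_real (M/2) + F)"
      by (simp add: x_def star_simps F mult.assoc)
    also have "star w * w = - F"
      by (simp add: ww F_def)
    finally have "star x * x = - ((of_real (M/2) + F) * F * (of_real (M/2) + F))"
      by simp
    moreover have "M *\<^sub>R (F * F) = (M/2) *\<^sub>R (F * F) + (M/2) *\<^sub>R (F * F)"
      by (simp add: scaleR_add_left[symmetric])
    ultimately show ?thesis
      by (simp add: of_real_def algebra_simps power2_eq_square)
  qed
  \<comment> \<open>The cube is one of three positive summands. Its norm is \<open>M ^ 3\<close>,
    while the bound coming from \<open>d\<close> is a quarter of that.\<close>
  moreover have "norm (F * F * F) \<le> norm (F * F * F + (M *\<^sub>R (F * F) + (M/2)\<^sup>2 *\<^sub>R F))"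
  proof (intro Pos_norm_mono Pos_add Pos_scaleR)
    have "F * F * F = (f * F) * (f * F)"
      by (simp add: F_def mult.assoc)
    moreover have "star (f * F) = f * F"
      by (simp add: F_def star_simps f mult.assoc)
    ultimately show "Pos (F * F * F)"
      by (simp add: Pos_square)
  qed (use F Pos_square in \<open>auto simp: M_def\<close>)
  ultimately have "norm (F * F * F) \<le> (M/2)\<^sup>2 * M"
    by (metis norm_minus_cancel order_trans)
  then have "M ^ 3 \<le> (M/2)\<^sup>2 * M"
    using norm_self_adjoint_cube[OF F(1)] fM by (simp add: F_def)
  then have "M ^ 3 \<le> 0"
    by (simp add: power2_eq_square power3_eq_cube)
  then have "M = 0"
    unfolding M by simp
  then have "v * (k - h) = 0"
    using M by (simp add: w_def)
  then have "h * (k - h) = 0"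
    by (simp add: h_def mult.assoc)
  then have "star (k - h) * (k - h) = 0"
    by (simp add: star_diff sk h algebra_simps kh k)
  then have "k - h = 0"
    by (rule star_mult_self_eq_zero)
  then show ?thesis
    using k(1) by (simp add: h_def)
qed

section \<open>Unitization and the order of a C*-algebra\<close>

text \<open>
  The second argument of \<open>max\<close> alone is degenerate on the copy of \<open>\<complex>\<close> if \<open>'a\<close> has a unit.
\<close>

datatype 'a unitization = Unitization (scalar_part: complex) (alg_part: 'a)

text \<open>The left regular representation on the ideal \<open>'a\<close>; its operator norm is the
  part of the norm that sees \<open>'a\<close>.\<close>

abbreviation unitization_op :: "'a::cstar_algebra unitization \<Rightarrow> 'a \<Rightarrow> 'a" where
  "unitization_op u \<equiv> (\<lambda>x. scalar_part u *\<^sub>C x + alg_part u * x)"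

lemma bounded_linear_unitization_op: "bounded_linear (unitization_op u)"
  by (intro bounded_linear_add bounded_linear_scaleC bounded_linear_mult_right)

instantiation unitization :: (cstar_algebra) "{zero, one, plus, uminus, minus, times, scaleR}"
begin

definition "0 = Unitization 0 0"
definition "1 = Unitization 1 0"
definition "u + v = Unitization (scalar_part u + scalar_part v) (alg_part u + alg_part v)"
definition "- u = Unitization (- scalar_part u) (- alg_part u)"
definition "u - v = Unitization (scalar_part u - scalar_part v) (alg_part u - alg_part v)"
definition "u * v = Unitization (scalar_part u * scalar_part v)
  (scalar_part u *\<^sub>C alg_part v + scalar_part v *\<^sub>C alg_part u + alg_part u * alg_part v)"
definition "r *\<^sub>R u = Unitization (complex_of_real r * scalar_part u) (r *\<^sub>R alg_part u)"

instance ..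

end

instantiation unitization :: (cstar_algebra) complex_vector
begin

definition "c *\<^sub>C u = Unitization (c * scalar_part u) (c *\<^sub>C alg_part u)"

instance
proof
  fix u v w :: "'a unitization" and c d :: complex and r :: real
  show "r *\<^sub>R u = complex_of_real r *\<^sub>C u" "c *\<^sub>C (u + v) = c *\<^sub>C u + c *\<^sub>C v"
    "(c + d) *\<^sub>C u = c *\<^sub>C u + d *\<^sub>C u" "c *\<^sub>C d *\<^sub>C u = (c * d) *\<^sub>C u" "1 *\<^sub>C u = u"
    "u + v + w = u + (v + w)" "u + v = v + u" "0 + u = u" "- u + u = 0" "u - v = u + - v"
    by (simp_all add: zero_unitization_def plus_unitization_def uminus_unitization_def
      minus_unitization_def scaleC_unitization_def scaleR_unitization_def scaleR_scaleC scaleC_simps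
      scaleC_add_left algebra_simps)
qed

end

lemmas unitization_defs = zero_unitization_def one_unitization_def plus_unitization_def
  uminus_unitization_def minus_unitization_def scaleC_unitization_def scaleR_unitization_def
  times_unitization_def

instantiation unitization :: (cstar_algebra) real_normed_algebra_1
begin

definition "norm u = max (cmod (scalar_part u)) (onorm (unitization_op u))"
definition "sgn (u::'a unitization) = u /\<^sub>R norm u"
definition "dist u (v::'a unitization) = norm (u - v)"
definition [code del]: "(uniformity :: ('a unitization \<times> 'a unitization) filter) =
  (INF e\<in>{0<..}. principal {(x, y). dist x y < e})"
definition [code del]: "open (U :: 'a unitization set) \<longleftrightarrow>
  (\<forall>x\<in>U. eventually (\<lambda>(x', y). x' = x \<longrightarrow> y \<in> U) uniformity)"

lemma unitization_op_norm: "norm (scalar_part u *\<^sub>C x + alg_part u * x) \<le> onorm (unitization_op u) * norm x"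
  using onorm[OF bounded_linear_unitization_op] .

text \<open>Testing the operator on \<open>star a\<close> gives the square of \<open>norm a\<close>
  by the C*-identity, so no norm is lost on \<open>'a\<close>.\<close>

lemma norm_alg_part_le: "norm a \<le> onorm (unitization_op (Unitization 0 a))"
proof (cases "norm a = 0")
  case False
  have "norm (a * star a) \<le> onorm (unitization_op (Unitization 0 a)) * norm a"
    using unitization_op_norm[of "Unitization 0 a" "star a"] by simp
  moreover have "norm (a * star a) = norm a * norm a"
    using cstar_identity[of "star a"] by (simp add: star_star power2_eq_square)
  ultimately show ?thesis
    using False by simp
next
  case True
  then show ?thesis
    using onorm_pos_le[OF bounded_linear_unitization_op[of "Unitization 0 a"]] by simp
qed

lemma norm_unitization_mult: "norm (u * v) \<le> norm u * norm (v :: 'a unitization)"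
proof -
  have eq: "unitization_op (u * v) = unitization_op u \<circ> unitization_op v"
    by (rule ext) (simp add: times_unitization_def scaleC_simps scaleC_add_left algebra_simps
      scaleC_mult_left scaleC_mult_right)
  have pos: "onorm (unitization_op u) \<ge> 0" "onorm (unitization_op v) \<ge> 0"
    using onorm_pos_le bounded_linear_unitization_op by blast+
  have "onorm (unitization_op (u * v)) \<le> onorm (unitization_op u) * onorm (unitization_op v)"
    unfolding eq by (intro onorm_compose bounded_linear_unitization_op)
  moreover have "onorm (unitization_op u) * onorm (unitization_op v) \<le> norm u * norm v"
    using pos by (intro mult_mono) (auto simp: norm_unitization_def)
  moreover have "cmod (scalar_part (u * v)) \<le> norm u * norm v"
    using pos by (auto simp: times_unitization_def norm_mult norm_unitization_def intro!: mult_mono)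
  ultimately show ?thesis
    unfolding norm_unitization_def[of "u * v"] by simp
qed

lemma norm_unitization_scaleC: "norm (c *\<^sub>C u) = cmod c * norm (u :: 'a unitization)"
proof -
    have le: "norm (c *\<^sub>C u) \<le> cmod c * norm u" for c and u :: "'a unitization"
    proof -
      have "norm (unitization_op (c *\<^sub>C u) x) \<le> (cmod c * onorm (unitization_op u)) * norm x" for x
      proof -
        have "unitization_op (c *\<^sub>C u) x = c *\<^sub>C unitization_op u x"
          by (simp add: unitization_defs scaleC_simps scaleC_mult_left)
        then show ?thesis
          using mult_left_mono[OF unitization_op_norm[of u x], of "cmod c"]
          by (simp add: norm_scaleC mult.assoc)
      qed
      then have "onorm (unitization_op (c *\<^sub>C u)) \<le> cmod c * onorm (unitization_op u)"
        using onorm_pos_le[OF bounded_linear_unitization_op[of u]] by (intro onorm_bound) simp_all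
      also have "\<dots> \<le> cmod c * norm u"
        by (intro mult_left_mono) (auto simp: norm_unitization_def)
      finally show ?thesis
        unfolding norm_unitization_def[of "c *\<^sub>C u"]
        by (auto simp: scaleC_unitization_def norm_mult norm_unitization_def intro!: mult_left_mono)
    qed
    show ?thesis
    proof (cases "c = 0")
      case True
      then show ?thesis
        by (simp add: scaleC_unitization_def norm_unitization_def onorm_zero)
    next
      case False
      have "inverse c *\<^sub>C (c *\<^sub>C u) = u"
        using False by (cases u) (simp add: scaleC_unitization_def scaleC_simps)
      then have "norm u \<le> inverse (cmod c) * norm (c *\<^sub>C u)"
        using le[of "inverse c" "c *\<^sub>C u"] by (simp add: norm_inverse)
      then show ?thesis
        using le[of c u] False by (simp add: field_simps)
    qed
qed

instance
proof
  fix u v w :: "'a unitization" and r s :: real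
  show "r *\<^sub>R (u + v) = r *\<^sub>R u + r *\<^sub>R v" "(r + s) *\<^sub>R u = r *\<^sub>R u + s *\<^sub>R u"
    "r *\<^sub>R s *\<^sub>R u = (r * s) *\<^sub>R u" "1 *\<^sub>R u = u"
    "u * v * w = u * (v * w)" "(u + v) * w = u * w + v * w" "u * (v + w) = u * v + u * w"
    "(r *\<^sub>R u) * v = r *\<^sub>R (u * v)" "u * (r *\<^sub>R v) = r *\<^sub>R (u * v)"
    "1 * u = u" "u * 1 = u" "(0::'a unitization) \<noteq> 1"
    by (simp_all add: unitization_defs scaleR_scaleC scaleC_simps scaleC_add_left
      algebra_simps scaleC_mult_left scaleC_mult_right)
  show "sgn u = inverse (norm u) *\<^sub>R u"
    by (rule sgn_unitization_def)
  show "dist u v = norm (u - v)"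
    by (rule dist_unitization_def)
  show "(uniformity :: ('a unitization \<times> 'a unitization) filter) =
      (INF e\<in>{0<..}. principal {(x, y). dist x y < e})"
    by (rule uniformity_unitization_def)
  show "open U \<longleftrightarrow> (\<forall>x\<in>U. eventually (\<lambda>(x', y). x' = x \<longrightarrow> y \<in> U) uniformity)"
    for U :: "'a unitization set"
    by (rule open_unitization_def)
  show "norm u = 0 \<longleftrightarrow> u = 0"
  proof
    assume "norm u = 0"
    moreover have "onorm (unitization_op u) \<ge> 0"
      using onorm_pos_le bounded_linear_unitization_op by blast
    ultimately have "scalar_part u = 0" "onorm (unitization_op u) = 0"
      unfolding norm_unitization_def by (auto simp: max_def split: if_splits)
    then show "u = 0"
      using norm_alg_part_le[of "alg_part u"] by (cases u) (simp add: zero_unitization_def)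
  qed (simp add: zero_unitization_def norm_unitization_def onorm_zero)
  have "onorm (unitization_op (u + v)) \<le> onorm (unitization_op u) + onorm (unitization_op v)"
    using onorm_triangle[OF bounded_linear_unitization_op[of u] bounded_linear_unitization_op[of v]]
    by (simp add: plus_unitization_def scaleC_add_left algebra_simps)
  then show "norm (u + v) \<le> norm u + norm v"
    using norm_triangle_ineq[of "scalar_part u" "scalar_part v"]
    unfolding norm_unitization_def by (auto simp: plus_unitization_def max_def)
  show "norm (r *\<^sub>R u) = \<bar>r\<bar> * norm u"
    using norm_unitization_scaleC[of "complex_of_real r" u] by (simp add: scaleR_scaleC)
  show "norm (u * v) \<le> norm u * norm v"
    by (rule norm_unitization_mult)
  have "onorm (unitization_op (1::'a unitization)) \<le> 1"
    by (rule onorm_bound) (simp_all add: one_unitization_def scaleC_one)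
  then show "norm (1::'a unitization) = 1"
    unfolding norm_unitization_def by (simp add: one_unitization_def)
qed

end

lemma norm_scalar_part_le: "cmod (scalar_part u) \<le> norm (u :: 'a::cstar_algebra unitization)"
  by (simp add: norm_unitization_def)

lemma norm_Unitization_le: "norm (Unitization c x) \<le> cmod c + norm (x :: 'a::cstar_algebra)"
proof -
  have "norm (unitization_op (Unitization c x) y) \<le> (cmod c + norm x) * norm y" for y
    using norm_triangle_ineq[of "c *\<^sub>C y" "x * y"] norm_mult_ineq[of x y]
    by (simp add: norm_scaleC distrib_right)
  then have "onorm (unitization_op (Unitization c x)) \<le> cmod c + norm x"
    by (intro onorm_bound) simp_all
  then show ?thesis
    by (simp add: norm_unitization_def)
qed

lemma norm_Unitization_0 [simp]: "norm (Unitization 0 x) = norm (x :: 'a::cstar_algebra)"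
proof (rule antisym)
  show "norm x \<le> norm (Unitization 0 x)"
    using norm_alg_part_le[of x] unfolding norm_unitization_def by simp
qed (use norm_Unitization_le[of 0 x] in simp)

instance unitization :: (cstar_algebra) banach
proof
  fix f :: "nat \<Rightarrow> 'a unitization" assume f: "Cauchy f"
  \<comment> \<open>Both parts are controlled by the norm, so a Cauchy sequence is Cauchy in each
    part; the factor 2 pays for subtracting the scalar part.\<close>
  have alg: "norm (alg_part u) \<le> 2 * norm u" for u :: "'a unitization"
  proof -
    have "Unitization 0 (alg_part u) = u - Unitization (scalar_part u) 0"
      by (simp add: minus_unitization_def)
    then have "norm (alg_part u) \<le> norm u + norm (Unitization (scalar_part u) (0::'a))"
      by (metis norm_Unitization_0 norm_triangle_ineq4)
    then show ?thesis
      using norm_Unitization_le[of "scalar_part u" "0::'a"] norm_scalar_part_le[of u] by simp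
  qed
  have "Cauchy (\<lambda>n. scalar_part (f n))"
    unfolding Cauchy_def
  proof (intro allI impI)
    fix e :: real assume "e > 0"
    then obtain M where M: "\<And>m n. m \<ge> M \<Longrightarrow> n \<ge> M \<Longrightarrow> norm (f m - f n) < e"
      using f unfolding Cauchy_def dist_norm by metis
    have "dist (scalar_part (f m)) (scalar_part (f n)) \<le> norm (f m - f n)" for m n
      using norm_scalar_part_le[of "f m - f n"] by (simp add: dist_norm minus_unitization_def)
    then show "\<exists>M. \<forall>m\<ge>M. \<forall>n\<ge>M. dist (scalar_part (f m)) (scalar_part (f n)) < e"
      using M order_le_less_trans by blast
  qed
  then obtain l where l: "(\<lambda>n. scalar_part (f n)) \<longlonglongrightarrow> l"
    using Cauchy_convergent convergent_def by blast
  have "Cauchy (\<lambda>n. alg_part (f n))"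
    unfolding Cauchy_def
  proof (intro allI impI)
    fix e :: real assume "e > 0"
    then obtain M where M: "\<And>m n. m \<ge> M \<Longrightarrow> n \<ge> M \<Longrightarrow> norm (f m - f n) < e / 2"
      using f half_gt_zero unfolding Cauchy_def dist_norm by metis
    have d: "dist (alg_part (f m)) (alg_part (f n)) \<le> 2 * norm (f m - f n)" for m n
      using alg[of "f m - f n"] by (simp add: dist_norm minus_unitization_def)
    have "dist (alg_part (f m)) (alg_part (f n)) < e" if "m \<ge> M" "n \<ge> M" for m n
      using M[OF that] d[of m n] by simp
    then show "\<exists>M. \<forall>m\<ge>M. \<forall>n\<ge>M. dist (alg_part (f m)) (alg_part (f n)) < e"
      by blast
  qed
  then obtain a where a: "(\<lambda>n. alg_part (f n)) \<longlonglongrightarrow> a"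
    using Cauchy_convergent convergent_def by blast
  have "(\<lambda>n. cmod (scalar_part (f n) - l) + norm (alg_part (f n) - a)) \<longlonglongrightarrow> 0"
    by (intro tendsto_add_zero tendsto_norm_zero LIM_zero l a)
  then have "(\<lambda>n. f n - Unitization l a) \<longlonglongrightarrow> 0"
    by (rule Lim_null_comparison[rotated])
      (simp add: minus_unitization_def norm_Unitization_le)
  then show "convergent f"
    using LIM_zero_cancel convergent_def by blast
qed

instantiation unitization :: (cstar_algebra) unital_cstar_algebra
begin

definition "star u = Unitization (cnj (scalar_part u)) (star (alg_part u))"

text \<open>For \<open>x\<close> in \<open>'a\<close>, the C*-identity of \<open>'a\<close> turns
  the squared norm of \<open>u x\<close> into the norm of \<open>star x\<close> times
  \<open>(star u * u) x\<close>. Together with submultiplicativity this yields the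
  C*-identity.\<close>

lemma norm_unitization_star_mult: "(norm u)\<^sup>2 \<le> norm (star u * (u :: 'a unitization))"
proof -
  let ?c = "onorm (unitization_op (star u * u))"
  have c: "?c \<ge> 0"
    using onorm_pos_le bounded_linear_unitization_op by blast
  have "norm (unitization_op u x) \<le> sqrt ?c * norm x" for x
  proof -
    have "(norm (unitization_op u x))\<^sup>2 = norm (star x * unitization_op (star u * u) x)"
      unfolding cstar_identity[symmetric]
      by (simp add: unitization_defs star_unitization_def star_simps scaleC_simps scaleC_add_left algebra_simps
        scaleC_mult_left scaleC_mult_right)
    also have "\<dots> \<le> norm x * (?c * norm x)"
      using unitization_op_norm[of "star u * u" x]
      by (intro order_trans[OF norm_mult_ineq]) (simp add: mult_left_mono)
    also have "\<dots> = (sqrt ?c * norm x)\<^sup>2"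
      using c by (simp add: power_mult_distrib power2_eq_square)
    finally show ?thesis
      by (rule power2_le_imp_le) (simp add: c)
  qed
  then have "onorm (unitization_op u) \<le> sqrt ?c"
    using c by (intro onorm_bound) auto
  then have "(onorm (unitization_op u))\<^sup>2 \<le> ?c"
    using c onorm_pos_le[OF bounded_linear_unitization_op[of u]] by (metis real_sqrt_pow2 power_mono)
  moreover have "(cmod (scalar_part u))\<^sup>2 = cmod (scalar_part (star u * u))"
    by (simp add: unitization_defs star_unitization_def norm_mult power2_eq_square)
  ultimately show ?thesis
    unfolding norm_unitization_def by (auto simp: max_def)
qed

instance
proof
  fix u v :: "'a unitization" and c :: complex
  show "(c *\<^sub>C u) * v = c *\<^sub>C (u * v)" "u * (c *\<^sub>C v) = c *\<^sub>C (u * v)"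
    "star (u + v) = star u + star v" "star (c *\<^sub>C u) = cnj c *\<^sub>C star u"
    "star (u * v) = star v * star u" "star (star u) = u"
    by (simp_all add: unitization_defs star_unitization_def star_simps scaleC_simps scaleC_add_left
      algebra_simps scaleC_mult_left scaleC_mult_right)
  show "norm (c *\<^sub>C u) = cmod c * norm u"
    by (rule norm_unitization_scaleC)
  have star_le: "norm w \<le> norm (star w)" for w :: "'a unitization"
  proof (cases "norm w = 0")
    case False
    have "norm w * norm w \<le> norm (star w) * norm w"
      using order_trans[OF norm_unitization_star_mult[of w] norm_unitization_mult[of "star w" w]]
      by (simp only: power2_eq_square)
    then show ?thesis
      using False by (metis mult_right_le_imp_le norm_ge_zero order_le_less)
  qed simp
  have "star (star u) = u"
    by (simp add: star_unitization_def star_star)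
  then have "norm (star u) = norm u"
    using star_le[of u] star_le[of "star u"] by simp
  then show "norm (star u * u) = (norm u)\<^sup>2"
    using norm_unitization_star_mult[of u] norm_unitization_mult[of "star u" u]
    by (simp add: power2_eq_square)
qed

end

section \<open>The order of an algebra without unit\<close>

definition pos :: "'a::cstar_algebra \<Rightarrow> bool" where
  "pos a \<longleftrightarrow> (\<exists>b. a = star b * b)"

text \<open>A root in the unitization of an element of \<open>'a\<close> has a scalar part with
  square 0, so the root lies in \<open>'a\<close> itself.\<close>

lemma pos_iff_Pos: "pos a \<longleftrightarrow> Pos (Unitization 0 a)"
proof
  assume "pos a"
  then obtain b where "a = star b * b"
    unfolding pos_def by blast
  then have "Unitization 0 a = star (Unitization 0 b) * Unitization 0 b"
    by (simp add: star_unitization_def times_unitization_def)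
  then show "Pos (Unitization 0 a)"
    using Pos_star_mult by simp
next
  assume "Pos (Unitization 0 a)"
  then obtain k where k: "Pos k" "k * k = Unitization 0 a"
    using Pos_sqrt by blast
  then have "scalar_part k = 0"
    by (simp add: times_unitization_def)
  moreover have "star k = k"
    using k by (simp add: Pos_self_adjoint)
  ultimately have "a = star (alg_part k) * alg_part k"
    using k(2) by (cases k) (simp add: times_unitization_def star_unitization_def)
  then show "pos a"
    unfolding pos_def by blast
qed

lemma pos_star_mult [simp]: "pos (star b * b)"
  unfolding pos_def by blast

lemma pos_zero [simp]: "pos 0"
  using pos_star_mult[of 0] by simp

lemma pos_self_adjoint: "pos a \<Longrightarrow> star a = a"
  by (auto simp: pos_def star_simps)

lemma pos_add: "pos a \<Longrightarrow> pos b \<Longrightarrow> pos (a + b)"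
  using Pos_add[of "Unitization 0 a" "Unitization 0 b"]
  by (simp add: pos_iff_Pos plus_unitization_def)

lemma pos_scaleR: "pos a \<Longrightarrow> r \<ge> 0 \<Longrightarrow> pos (r *\<^sub>R a)"
  using Pos_scaleR[of "Unitization 0 a" r]
  by (simp add: pos_iff_Pos scaleR_unitization_def)

lemma pos_sum: "(\<And>i. i \<in> I \<Longrightarrow> pos (f i)) \<Longrightarrow> pos (\<Sum>i\<in>I. f i)"
  by (induction I rule: infinite_finite_induct) (auto simp: pos_add)

lemma pos_conj: "pos a \<Longrightarrow> pos (star x * a * x)"
  by (auto simp: pos_def star_mult[symmetric] mult.assoc intro: exI[of _ "_ * x"])
    (metis mult.assoc star_mult)

lemma pos_norm_mono:
  assumes "pos a" "pos (c - a)"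
  shows "norm a \<le> norm c"
  using Pos_norm_mono[of "Unitization 0 a" "Unitization 0 (c - a)"] assms
  by (simp add: pos_iff_Pos plus_unitization_def)

text \<open>Embedded in the unitization, positivity is the closed inequality of
  \<open>Pos_iff\<close>.\<close>

lemma pos_limit:
  fixes f :: "'b \<Rightarrow> 'a::cstar_algebra"
  assumes lim: "(f \<longlongrightarrow> a) F" and F: "F \<noteq> bot" and ev: "\<forall>\<^sub>F x in F. pos (f x)"
  shows "pos a"
proof -
  let ?U = "\<lambda>x. Unitization 0 x :: 'a unitization"
  have U: "((\<lambda>x. ?U (f x)) \<longlongrightarrow> ?U a) F"
  proof -
    have "?U (f x) - ?U a = ?U (f x - a)" for x
      by (simp add: minus_unitization_def)
    then have "((\<lambda>x. ?U (f x) - ?U a) \<longlongrightarrow> 0) F"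
      using LIM_zero[OF lim] by (subst tendsto_norm_zero_iff[symmetric]) (simp add: tendsto_norm_zero)
    then show ?thesis
      by (rule LIM_zero_cancel)
  qed
  have "star (?U a) = ?U a"
  proof (rule tendsto_unique[OF F])
    show "((\<lambda>x. star (?U (f x))) \<longlongrightarrow> star (?U a)) F"
      by (rule tendsto_star[OF U])
    show "((\<lambda>x. star (?U (f x))) \<longlongrightarrow> ?U a) F"
      by (rule Lim_transform_eventually[OF U])
        (use ev in eventually_elim, simp add: pos_iff_Pos Pos_self_adjoint)
  qed
  moreover have "norm (of_real (norm (?U a)) - ?U a) \<le> norm (?U a)"
    by (rule tendsto_le[OF F tendsto_norm[OF U]
        tendsto_norm[OF tendsto_diff[OF tendsto_of_real[OF tendsto_norm[OF U]] U]]])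
      (use ev in eventually_elim, simp add: pos_iff_Pos Pos_iff[of "?U _"])
  ultimately show ?thesis
    by (simp add: pos_iff_Pos Pos_iff)
qed

text \<open>The element \<open>z\<close> is \<open>1 - sqrt (1 - c / t)\<close>, computed in the unitization.\<close>

lemma norm_minus_pos:
  fixes c :: "'a::cstar_algebra"
  assumes "star c = c" "norm c \<le> t"
  shows "\<exists>z. star z = z \<and> (\<forall>y. pos (t *\<^sub>R (star y * y) - star y * c * y)) \<and>
    t *\<^sub>R (2 *\<^sub>R z - z * z) = c"
proof (cases "t = 0")
  case True
  then show ?thesis
    using assms by (intro exI[of _ 0]) auto
next
  case False
  then have t: "t > 0"
    using assms(2) norm_ge_zero[of c] by linarith
  have "star ((1/t) *\<^sub>R c) = (1/t) *\<^sub>R c" "norm ((1/t) *\<^sub>R c) \<le> 1"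
    using assms t by (simp_all add: star_scaleR)
  then obtain z where z: "star z = z" "2 *\<^sub>R z - z * z = (1/t) *\<^sub>R c"
    using sqrt_one_minus by blast
  have "pos (t *\<^sub>R (star y * y) - star y * c * y)" for y
  proof -
    have c: "c = t *\<^sub>R (2 *\<^sub>R z - z * z)"
      using z(2) t by simp
    have "t *\<^sub>R (star y * y) - star y * c * y = t *\<^sub>R (star (y - z * y) * (y - z * y))"
      unfolding c by (simp add: star_simps z algebra_simps scaleR_2)
    then show ?thesis
      using t by (simp add: pos_scaleR)
  qed
  then show ?thesis
    using z t by (intro exI[of _ z]) auto
qed

section \<open>Infinite sums and pre-Hilbert modules\<close>

text \<open>The Cauchy criterion lets summability be transferred between series in different Banach
  spaces by comparing finite sums only.\<close>

lemma summable_on_Cauchy_iff: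
  fixes f :: "'i \<Rightarrow> 'b::banach"
  shows "f summable_on A \<longleftrightarrow>
    (\<forall>e>0. \<exists>F\<^sub>0. finite F\<^sub>0 \<and> F\<^sub>0 \<subseteq> A \<and> (\<forall>G. finite G \<and> G \<subseteq> A - F\<^sub>0 \<longrightarrow> norm (sum f G) < e))"
    (is "_ \<longleftrightarrow> ?C")
proof
  assume "f summable_on A"
  then obtain L where L: "(sum f \<longlongrightarrow> L) (finite_subsets_at_top A)"
    unfolding summable_on_def has_sum_def by blast
  show ?C
  proof (intro allI impI)
    fix e :: real assume "e > 0"
    then have "eventually (\<lambda>F. dist (sum f F) L < e/2) (finite_subsets_at_top A)"
      using L by (intro tendstoD) auto
    then obtain F0 where F0: "finite F0" "F0 \<subseteq> A"
      "\<And>F. finite F \<Longrightarrow> F0 \<subseteq> F \<Longrightarrow> F \<subseteq> A \<Longrightarrow> dist (sum f F) L < e/2"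
      unfolding eventually_finite_subsets_at_top by metis
    have "norm (sum f G) < e" if G: "finite G" "G \<subseteq> A - F0" for G
    proof -
      have "sum f (F0 \<union> G) = sum f F0 + sum f G"
        using F0 G by (intro sum.union_disjoint) auto
      moreover have "dist (sum f (F0 \<union> G)) L < e/2" "dist (sum f F0) L < e/2"
        using F0(1,2) G by (intro F0(3); auto)+
      ultimately show ?thesis
        using dist_triangle_half_r[of L "sum f (F0 \<union> G)" e "sum f F0"]
        by (simp add: dist_commute dist_norm)
    qed
    then show "\<exists>F\<^sub>0. finite F\<^sub>0 \<and> F\<^sub>0 \<subseteq> A \<and> (\<forall>G. finite G \<and> G \<subseteq> A - F\<^sub>0 \<longrightarrow> norm (sum f G) < e)"
      using F0 by blast
  qed
next
  assume C: ?C
  have "\<exists>P. eventually P (finite_subsets_at_top A) \<and>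
      (\<forall>F F'. P F \<and> P F' \<longrightarrow> dist (sum f F) (sum f F') < e)" if "e > 0" for e
  proof -
    obtain F0 where F0: "finite F0" "F0 \<subseteq> A"
      "\<And>G. finite G \<Longrightarrow> G \<subseteq> A - F0 \<Longrightarrow> norm (sum f G) < e/2"
      using C \<open>e > 0\<close> half_gt_zero by metis
    define P where "P F \<longleftrightarrow> finite F \<and> F0 \<subseteq> F \<and> F \<subseteq> A" for F
    have "eventually P (finite_subsets_at_top A)"
      unfolding eventually_finite_subsets_at_top P_def using F0 by blast
    moreover have "dist (sum f F) (sum f F0) < e/2" if "P F" for F
    proof -
      have "sum f F - sum f F0 = sum f (F - F0)"
        using that F0 unfolding P_def by (subst sum_diff) auto
      then show ?thesis
        using F0(3)[of "F - F0"] that unfolding P_def dist_norm by auto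
    qed
    ultimately show ?thesis
      using dist_triangle_half_l by (intro exI[of _ P]) blast
  qed
  then have "cauchy_filter (filtermap (sum f) (finite_subsets_at_top A))"
    by (simp add: cauchy_filter_metric_filtermap)
  moreover have "complete (UNIV::'b set)"
    by (meson Cauchy_convergent UNIV_I complete_def convergent_def)
  ultimately obtain L where "(sum f \<longlongrightarrow> L) (finite_subsets_at_top A)"
    using complete_uniform[where S=UNIV] by (force simp add: filterlim_def)
  then show "f summable_on A"
    using summable_on_def has_sum_def by blast
qed

text \<open>Norms of finite sums are compared rather than norms of terms, since a series of inner
  products with values in \<open>'a\<close> may converge without converging absolutely.\<close>

lemma summable_on_dominated:
  fixes f :: "'i \<Rightarrow> 'b::banach" and g :: "'i \<Rightarrow> 'c::banach"
  assumes g: "g summable_on A"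
    and le: "\<And>F. finite F \<Longrightarrow> F \<subseteq> A \<Longrightarrow> norm (sum f F) \<le> C * norm (sum g F)"
  shows "f summable_on A"
  unfolding summable_on_Cauchy_iff
proof (intro allI impI)
  fix e :: real assume e: "e > 0"
  define d where "d = e / (\<bar>C\<bar> + 1)"
  have "d > 0"
    using e by (simp add: d_def add_nonneg_pos)
  then obtain F0 where F0: "finite F0" "F0 \<subseteq> A"
      "\<And>G. finite G \<Longrightarrow> G \<subseteq> A - F0 \<Longrightarrow> norm (sum g G) < d"
    using g unfolding summable_on_Cauchy_iff by metis
  have "norm (sum f G) < e" if G: "finite G" "G \<subseteq> A - F0" for G
  proof -
    have "norm (sum f G) \<le> C * norm (sum g G)"
      using G by (intro le) auto
    also have "\<dots> \<le> (\<bar>C\<bar> + 1) * norm (sum g G)"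
      by (intro mult_right_mono) auto
    also have "\<dots> < (\<bar>C\<bar> + 1) * d"
      using F0(3)[OF G] by (intro mult_strict_left_mono) auto
    finally show ?thesis
      by (simp add: d_def)
  qed
  then show "\<exists>F\<^sub>0. finite F\<^sub>0 \<and> F\<^sub>0 \<subseteq> A \<and> (\<forall>G. finite G \<and> G \<subseteq> A - F\<^sub>0 \<longrightarrow> norm (sum f G) < e)"
    using F0 by blast
qed

lemma pos_infsum:
  assumes "f summable_on A" "\<And>x. x \<in> A \<Longrightarrow> pos (f x)"
  shows "pos (infsum f A)"
proof (rule pos_limit)
  show "(sum f \<longlongrightarrow> infsum f A) (finite_subsets_at_top A)"
    using assms(1) by (rule infsum_tendsto)
  show "\<forall>\<^sub>F F in finite_subsets_at_top A. pos (sum f F)"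
    using assms(2) by (intro eventually_finite_subsets_at_top_weakI pos_sum) auto
qed simp

text \<open>Neither definiteness nor completeness is assumed, so that finite sums of fibres are covered.\<close>

locale pre_module =
  fixes V :: "'v set" and add :: "'v \<Rightarrow> 'v \<Rightarrow> 'v" and sc :: "complex \<Rightarrow> 'v \<Rightarrow> 'v"
    and rm :: "'v \<Rightarrow> 'a::cstar_algebra \<Rightarrow> 'v" and inner :: "'v \<Rightarrow> 'v \<Rightarrow> 'a"
  assumes add_mem: "u \<in> V \<Longrightarrow> v \<in> V \<Longrightarrow> add u v \<in> V"
    and sc_mem: "u \<in> V \<Longrightarrow> sc c u \<in> V"
    and rm_mem: "u \<in> V \<Longrightarrow> rm u a \<in> V"
    and inner_add: "u \<in> V \<Longrightarrow> v \<in> V \<Longrightarrow> w \<in> V \<Longrightarrow> inner u (add v w) = inner u v + inner u w"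
    and inner_sc: "u \<in> V \<Longrightarrow> v \<in> V \<Longrightarrow> inner u (sc c v) = c *\<^sub>C inner u v"
    and inner_rm: "u \<in> V \<Longrightarrow> v \<in> V \<Longrightarrow> inner u (rm v a) = inner u v * a"
    and inner_star: "u \<in> V \<Longrightarrow> v \<in> V \<Longrightarrow> inner v u = star (inner u v)"
    and inner_pos: "v \<in> V \<Longrightarrow> pos (inner v v)"
begin

definition sub :: "'v \<Rightarrow> 'v \<Rightarrow> 'v" where "sub u v = add u (sc (-1) v)"

definition nrm :: "'v \<Rightarrow> real" where "nrm v = sqrt (norm (inner v v))"

lemma sub_mem: "u \<in> V \<Longrightarrow> v \<in> V \<Longrightarrow> sub u v \<in> V"
  by (simp add: sub_def add_mem sc_mem)

lemma inner_add_left: "u \<in> V \<Longrightarrow> v \<in> V \<Longrightarrow> w \<in> V \<Longrightarrow> inner (add v w) u = inner v u + inner w u"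
  by (metis add_mem inner_add inner_star star_add)

lemma inner_sc_left: "u \<in> V \<Longrightarrow> v \<in> V \<Longrightarrow> inner (sc c v) u = cnj c *\<^sub>C inner v u"
  by (metis sc_mem inner_sc inner_star star_scaleC)

lemma inner_rm_left: "u \<in> V \<Longrightarrow> v \<in> V \<Longrightarrow> inner (rm v a) u = star a * inner v u"
  by (metis rm_mem inner_rm inner_star star_mult)

lemma inner_sub: "u \<in> V \<Longrightarrow> v \<in> V \<Longrightarrow> w \<in> V \<Longrightarrow> inner u (sub v w) = inner u v - inner u w"
  by (simp add: sub_def inner_add inner_sc sc_mem)

lemma inner_sub_left: "u \<in> V \<Longrightarrow> v \<in> V \<Longrightarrow> w \<in> V \<Longrightarrow> inner (sub v w) u = inner v u - inner w u"
  by (simp add: sub_def inner_add_left inner_sc_left sc_mem)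

lemmas mem = add_mem sc_mem rm_mem sub_mem
lemmas inner_simps = inner_add inner_sc inner_rm inner_sub inner_add_left inner_sc_left
  inner_rm_left inner_sub_left

lemma nrm_nonneg [simp]: "0 \<le> nrm v"
  by (simp add: nrm_def)

lemma nrm_square: "(nrm v)\<^sup>2 = norm (inner v v)"
  by (simp add: nrm_def)

lemma nrm_sc: "v \<in> V \<Longrightarrow> nrm (sc c v) = cmod c * nrm v"
proof -
  assume v: "v \<in> V"
  have "norm (inner (sc c v) (sc c v)) = (cmod c)\<^sup>2 * norm (inner v v)"
    using v by (simp add: inner_simps mem norm_scaleC power2_eq_square)
  then show ?thesis
    by (simp add: nrm_def real_sqrt_mult)
qed

text \<open>Expand the inner square of \<open>s u a - v\<close>, where \<open>a\<close> is the inner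
  product of \<open>u\<close> and \<open>v\<close>; bound \<open>star a * p * a\<close> by
  \<open>norm p\<close> times \<open>star a * a\<close>, and take
  \<open>s = 1 / norm p\<close>.\<close>

lemma Cauchy_Schwarz:
  assumes u: "u \<in> V" and v: "v \<in> V"
  shows "pos (norm (inner u u) *\<^sub>R inner v v - star (inner u v) * inner u v)"
proof -
  define p where "p = inner u u"
  define a where "a = inner u v"
  define q where "q = inner v v"
  have p: "star p = p"
    using inner_pos[OF u] pos_self_adjoint p_def by blast
  have a': "inner v u = star a"
    using inner_star[OF u v] by (simp add: a_def)
  have exp: "inner (sub (rm u (s *\<^sub>R a)) v) (sub (rm u (s *\<^sub>R a)) v) =
      s\<^sup>2 *\<^sub>R (star a * p * a) - (2 * s) *\<^sub>R (star a * a) + q" for s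
    using u v by (simp add: inner_simps mem a' star_simps algebra_simps power2_eq_square
      flip: p_def q_def a_def) (simp add: scaleR_add_left[symmetric])
  have pe: "pos (s\<^sup>2 *\<^sub>R (star a * p * a) - (2 * s) *\<^sub>R (star a * a) + q)" for s
    unfolding exp[symmetric] using u v by (intro inner_pos mem)
  have dom: "pos (norm p *\<^sub>R (star a * a) - star a * p * a)"
    using norm_minus_pos[OF p order.refl] by blast
  have "pos (norm p *\<^sub>R q - star a * a)"
  proof (cases "p = 0")
    case True
    \<comment> \<open>The form may degenerate at \<open>u\<close>; then \<open>s\<close> can grow
      without bound and forces \<open>star a * a\<close> to vanish.\<close>
    have "norm (star a * a) \<le> e" if "e > 0" for e
    proof -
      define s where "s = (norm q + 1) / e"
      have s: "s > 0"
        using that by (simp add: s_def add_nonneg_pos)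
      have "pos ((2 * s) *\<^sub>R (star a * a))" "pos (q - (2 * s) *\<^sub>R (star a * a))"
        using pe[of s] True s by (auto simp: pos_scaleR algebra_simps)
      then have "2 * s * norm (star a * a) \<le> norm q"
        using s pos_norm_mono by fastforce
      also have "\<dots> \<le> s * e"
        using that by (simp add: s_def)
      also have "\<dots> \<le> 2 * s * e"
        using s that by simp
      finally show ?thesis
        using s by simp
    qed
    then have "star a * a = 0"
      by (metis dense_le_bounded field_le_epsilon add_0 norm_le_zero_iff)
    then show ?thesis
      by (simp add: True)
  next
    case False
    define t where "t = norm p"
    have t: "t > 0"
      using False by (simp add: t_def)
    have "pos (((1/t)\<^sup>2 *\<^sub>R (star a * p * a) - (2 * (1/t)) *\<^sub>R (star a * a) + q) +
        (1/t)\<^sup>2 *\<^sub>R (t *\<^sub>R (star a * a) - star a * p * a))"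
      using dom by (intro pos_add pe pos_scaleR) (auto simp: t_def)
    also have "(((1/t)\<^sup>2 *\<^sub>R (star a * p * a) - (2 * (1/t)) *\<^sub>R (star a * a) + q) +
        (1/t)\<^sup>2 *\<^sub>R (t *\<^sub>R (star a * a) - star a * p * a)) = q - (1/t) *\<^sub>R (star a * a)"
    proof -
      have "(1/t)\<^sup>2 * t = 1/t"
        using t by (simp add: power2_eq_square)
      then show ?thesis
        by (simp add: algebra_simps) (simp add: scaleR_add_left[symmetric] algebra_simps)
    qed
    finally have "pos (t *\<^sub>R (q - (1/t) *\<^sub>R (star a * a)))"
      using t by (intro pos_scaleR) auto
    then show ?thesis
      using t by (simp add: algebra_simps t_def)
  qed
  then show ?thesis
    by (simp add: p_def q_def a_def)
qed

lemma norm_inner_le: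
  assumes u: "u \<in> V" and v: "v \<in> V"
  shows "norm (inner u v) \<le> nrm u * nrm v"
proof -
  have "norm (star (inner u v) * inner u v) \<le> norm (norm (inner u u) *\<^sub>R inner v v)"
    using Cauchy_Schwarz[OF assms] by (intro pos_norm_mono) auto
  then have "(norm (inner u v))\<^sup>2 \<le> (nrm u * nrm v)\<^sup>2"
    by (simp add: cstar_identity power_mult_distrib nrm_square)
  then show ?thesis
    by (rule power2_le_imp_le) simp
qed

lemma nrm_add_le:
  assumes u: "u \<in> V" and v: "v \<in> V"
  shows "nrm (add u v) \<le> nrm u + nrm v"
proof -
  have "(nrm (add u v))\<^sup>2 = norm ((inner u u + inner v v) + (inner u v + inner v u))"
    using assms by (simp add: nrm_square inner_simps mem algebra_simps)
  also have "\<dots> \<le> (norm (inner u u) + norm (inner v v)) + (norm (inner u v) + norm (inner v u))"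
    by (intro order_trans[OF norm_triangle_ineq] add_mono norm_triangle_ineq)
  also have "\<dots> \<le> (nrm u + nrm v)\<^sup>2"
    using norm_inner_le[OF u v] norm_inner_le[OF v u]
    unfolding power2_sum nrm_square[symmetric] mult.commute[of "nrm v" "nrm u"] by simp
  finally show ?thesis
    by (rule power2_le_imp_le) (simp add: add_nonneg_nonneg)
qed

lemma nrm_sub_le: "u \<in> V \<Longrightarrow> v \<in> V \<Longrightarrow> nrm (sub u v) \<le> nrm u + nrm v"
  using nrm_add_le[of u "sc (-1) v"] by (simp add: sub_def sc_mem nrm_sc)

lemma nrm_rm_le: "v \<in> V \<Longrightarrow> nrm (rm v a) \<le> nrm v * norm a"
proof -
  assume v: "v \<in> V"
  have "inner (rm v a) (rm v a) = star a * inner v v * a"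
    using v by (simp add: inner_simps mem mult.assoc)
  then have "(nrm (rm v a))\<^sup>2 \<le> norm a * norm (inner v v) * norm a"
    unfolding nrm_square
    by (metis norm_mult_ineq norm_star mult_right_mono norm_ge_zero order_trans)
  also have "\<dots> = (nrm v * norm a)\<^sup>2"
    by (simp add: power_mult_distrib nrm_square power2_eq_square[of "norm a"])
  finally show ?thesis
    by (rule power2_le_imp_le) simp
qed

lemma parallelogram_pos:
  assumes "u \<in> V" "v \<in> V"
  shows "pos (2 *\<^sub>R (inner u u + inner v v) - inner (add u v) (add u v))"
proof -
  have "2 *\<^sub>R (inner u u + inner v v) - inner (add u v) (add u v) = inner (sub u v) (sub u v)"
    using assms by (simp add: inner_simps mem algebra_simps scaleR_2)
  then show ?thesis
    using assms by (simp add: inner_pos mem)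
qed

text \<open>With \<open>z\<close> from \<open>norm_minus_pos\<close> for \<open>star b * b\<close>,
  the scalar \<open>(norm b)\<^sup>2\<close> minus \<open>star b * b\<close> equals
  \<open>(norm b)\<^sup>2\<close> times the square of \<open>1 - z\<close>. Hence the gap is
  \<open>(norm b)\<^sup>2\<close> times the inner square of \<open>u - l z u\<close>, an expression
  without a unit.\<close>

lemma action_bound:
  assumes l_mem: "\<And>a u. u \<in> V \<Longrightarrow> l a u \<in> V"
    and l_adj: "\<And>a u v. u \<in> V \<Longrightarrow> v \<in> V \<Longrightarrow> inner (l a u) v = inner u (l (star a) v)"
    and l_add: "\<And>a b u. u \<in> V \<Longrightarrow> l (a + b) u = add (l a u) (l b u)"
    and l_sc: "\<And>a c u. u \<in> V \<Longrightarrow> l (c *\<^sub>C a) u = sc c (l a u)"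
    and l_mult: "\<And>a b u. u \<in> V \<Longrightarrow> l (a * b) u = l a (l b u)"
    and u: "u \<in> V"
  shows "pos ((norm b)\<^sup>2 *\<^sub>R inner u u - inner (l b u) (l b u))"
proof -
  define t where "t = (norm b)\<^sup>2"
  have "star (star b * b) = star b * b" "norm (star b * b) \<le> t"
    by (simp_all add: star_simps cstar_identity t_def)
  then obtain z where z: "star z = z" "t *\<^sub>R (2 *\<^sub>R z - z * z) = star b * b"
    using norm_minus_pos by blast
  have c: "star b * b = complex_of_real (2 * t) *\<^sub>C z + complex_of_real (- t) *\<^sub>C (z * z)"
    unfolding z(2)[symmetric] by (simp add: scaleR_scaleC scaleC_simps algebra_simps)
  have zz: "inner (l z u) v = inner u (l z v)" if "v \<in> V" for v
    using l_adj[OF u that, of z] by (simp add: z)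
  have "inner (l b u) (l b u) = inner u (l (star b * b) u)"
    using u by (simp add: l_adj l_mult l_mem)
  also have "\<dots> = (2 * t) *\<^sub>R inner u (l z u) - t *\<^sub>R inner u (l z (l z u))"
    unfolding c using u
    by (simp add: l_add l_sc l_mult l_mem inner_simps mem) (simp add: scaleR_scaleC scaleC_minus_left)
  finally have "t *\<^sub>R inner u u - inner (l b u) (l b u) = t *\<^sub>R inner (sub u (l z u)) (sub u (l z u))"
    using u by (simp add: inner_simps mem l_mem zz algebra_simps)
      (simp add: scaleR_add_left[symmetric])
  then show ?thesis
    using u l_mem by (auto simp: t_def intro!: pos_scaleR inner_pos mem)
qed

end

text \<open>Here \<open>v\<close> plays the value of the adjoint at \<open>w\<close>. Positivity of
  the inner square of \<open>Tv - K w\<close> gives the bound. Only these vectors enter, so the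
  adjoint may be known pointwise before it is known as an operator.\<close>

lemma adjoint_bound:
  assumes V: "pre_module V addV scV rmV innerV" and W: "pre_module W addW scW rmW innerW"
    and v: "v \<in> V" "Tv \<in> W" and w: "w \<in> W"
    and adj: "innerW Tv w = innerV v v"
    and le: "pos (K *\<^sub>R innerV v v - innerW Tv Tv)" and K: "K > 0"
  shows "pos (K *\<^sub>R innerW w w - innerV v v)"
proof -
  interpret V: pre_module V addV scV rmV innerV by fact
  interpret W: pre_module W addW scW rmW innerW by fact
  define x where "x = innerV v v"
  have x: "innerW w Tv = x"
    using W.inner_star[of Tv w] v w adj V.inner_pos[OF v(1)] pos_self_adjoint x_def by metis
  let ?d = "W.sub Tv (scW (complex_of_real K) w)"
  have "innerW ?d ?d = innerW Tv Tv - (2 * K) *\<^sub>R x + K\<^sup>2 *\<^sub>R innerW w w"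
    using v w adj x by (simp add: W.inner_simps W.mem scaleR_scaleC[symmetric] algebra_simps
      power2_eq_square flip: x_def) (simp add: scaleR_add_left[symmetric])
  then have "pos (innerW Tv Tv - (2 * K) *\<^sub>R x + K\<^sup>2 *\<^sub>R innerW w w)"
    using v w W.inner_pos[of ?d] by (simp add: W.mem)
  moreover have "(2 * K) *\<^sub>R x = K *\<^sub>R x + K *\<^sub>R x"
    by (simp add: scaleR_add_left[symmetric])
  ultimately have "pos (K\<^sup>2 *\<^sub>R innerW w w - K *\<^sub>R x)"
    using pos_add[OF _ le] by (fastforce simp: x_def)
  then have "pos ((1/K) *\<^sub>R (K\<^sup>2 *\<^sub>R innerW w w - K *\<^sub>R x))"
    using K by (intro pos_scaleR) simp_all
  then show ?thesis
    using K by (simp add: algebra_simps power2_eq_square x_def)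
qed

section \<open>Product systems\<close>

declare One_nat_def [simp del]

text \<open>The choice \<open>c = p\<close> makes the cube of \<open>p\<close> vanish; the unit, the
  obvious choice, may not exist.\<close>

lemma conj_eq_0:
  fixes p :: "'a::cstar_algebra"
  assumes "\<And>c. star c * (p * c) = 0" "star p = p"
  shows "p = 0"
proof -
  have "norm (p * p * p) = 0"
    using assms(1)[of p] assms(2) by (simp add: mult.assoc)
  then show ?thesis
    using norm_self_adjoint_cube[OF assms(2)] by simp
qed

locale product_sys =
  fixes X :: "('n::finite, 'a::cstar_algebra, 'x::complex_vector) product_system"
  assumes product_system: "is_product_system X"
begin

abbreviation "M n \<equiv> mcarr (fib X n)"
abbreviation "ipf n \<equiv> ip (fib X n)"
abbreviation "rmf n \<equiv> rmul (fib X n)"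
abbreviation "lmf n \<equiv> lmul (fib X n)"

lemma cstar_correspondence: "cstar_correspondence (fib X n)"
  using product_system unfolding is_product_system_def by (elim conjE) (rule spec)

lemma hilbert_module: "hilbert_module (fib X n)"
  using cstar_correspondence[of n] unfolding cstar_correspondence_def by (rule conjunct1)

lemma right_module: "right_module (fib X n)"
  using hilbert_module[of n] unfolding hilbert_module_def by (rule conjunct1)

lemmas right_module_laws = right_module[unfolded right_module_def]

lemma zero_mem [simp]: "0 \<in> M n"
  by (rule right_module_laws[THEN conjunct1])

lemma add_mem [simp]: "\<xi> \<in> M n \<Longrightarrow> \<eta> \<in> M n \<Longrightarrow> \<xi> + \<eta> \<in> M n"
  by (rule right_module_laws[THEN conjunct2, THEN conjunct1, rule_format])

lemma scaleC_mem [simp]: "\<xi> \<in> M n \<Longrightarrow> c *\<^sub>C \<xi> \<in> M n"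
  by (rule right_module_laws[THEN conjunct2, THEN conjunct2, THEN conjunct1, rule_format])

lemma rmul_mem [simp]: "\<xi> \<in> M n \<Longrightarrow> rmf n \<xi> a \<in> M n"
  by (rule right_module_laws[THEN conjunct2, THEN conjunct2, THEN conjunct2, THEN conjunct1, rule_format])

lemma rmul_add: "\<xi> \<in> M n \<Longrightarrow> \<eta> \<in> M n \<Longrightarrow> rmf n (\<xi> + \<eta>) a = rmf n \<xi> a + rmf n \<eta> a"
  by (rule right_module_laws[THEN conjunct2, THEN conjunct2, THEN conjunct2, THEN conjunct2, THEN conjunct1, rule_format])

lemma rmul_scaleC: "\<xi> \<in> M n \<Longrightarrow> rmf n (c *\<^sub>C \<xi>) a = c *\<^sub>C rmf n \<xi> a"
  and rmul_scaleC_right: "\<xi> \<in> M n \<Longrightarrow> rmf n \<xi> (c *\<^sub>C a) = c *\<^sub>C rmf n \<xi> a"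
  using right_module_laws[THEN conjunct2, THEN conjunct2, THEN conjunct2, THEN conjunct2, THEN conjunct2, THEN conjunct2, THEN conjunct2] by blast+

lemma minus_mem [simp]: "\<xi> \<in> M n \<Longrightarrow> - \<xi> \<in> M n"
  using scaleC_mem[of \<xi> n "-1"] by simp

lemma diff_mem [simp]: "\<xi> \<in> M n \<Longrightarrow> \<eta> \<in> M n \<Longrightarrow> \<xi> - \<eta> \<in> M n"
  using add_mem[of \<xi> n "-\<eta>"] by simp

lemma sum_mem: "(\<And>i. i \<in> I \<Longrightarrow> f i \<in> M n) \<Longrightarrow> (\<Sum>i\<in>I. f i) \<in> M n"
  by (induction I rule: infinite_finite_induct) auto

lemmas hilbert_module_laws = hilbert_module[unfolded hilbert_module_def, THEN conjunct2]

lemma ip_add: "\<xi> \<in> M n \<Longrightarrow> \<eta> \<in> M n \<Longrightarrow> \<zeta> \<in> M n \<Longrightarrow> ipf n \<xi> (\<eta> + \<zeta>) = ipf n \<xi> \<eta> + ipf n \<xi> \<zeta>"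
  by (rule hilbert_module_laws[THEN conjunct1, rule_format])

lemma ip_scaleC: "\<xi> \<in> M n \<Longrightarrow> \<eta> \<in> M n \<Longrightarrow> ipf n \<xi> (c *\<^sub>C \<eta>) = c *\<^sub>C ipf n \<xi> \<eta>"
  by (rule hilbert_module_laws[THEN conjunct2, THEN conjunct1, rule_format])

lemma ip_rmul: "\<xi> \<in> M n \<Longrightarrow> \<eta> \<in> M n \<Longrightarrow> ipf n \<xi> (rmf n \<eta> a) = ipf n \<xi> \<eta> * a"
  by (rule hilbert_module_laws[THEN conjunct2, THEN conjunct2, THEN conjunct1, rule_format])

lemma ip_star: "\<xi> \<in> M n \<Longrightarrow> \<eta> \<in> M n \<Longrightarrow> ipf n \<eta> \<xi> = star (ipf n \<xi> \<eta>)"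
  by (rule hilbert_module_laws[THEN conjunct2, THEN conjunct2, THEN conjunct2, THEN conjunct1, rule_format])

lemma ip_pos: "\<xi> \<in> M n \<Longrightarrow> pos (ipf n \<xi> \<xi>)"
  unfolding pos_def by (rule hilbert_module_laws[THEN conjunct2, THEN conjunct2, THEN conjunct2, THEN conjunct2, THEN conjunct1, rule_format])

lemma ip_eq_0: "\<xi> \<in> M n \<Longrightarrow> ipf n \<xi> \<xi> = 0 \<Longrightarrow> \<xi> = 0"
  by (rule hilbert_module_laws[THEN conjunct2, THEN conjunct2, THEN conjunct2, THEN conjunct2, THEN conjunct2, THEN conjunct1, rule_format])

lemma ip_zero_right [simp]: "\<xi> \<in> M n \<Longrightarrow> ipf n \<xi> 0 = 0"
  using ip_scaleC[of \<xi> n 0 0] by simp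

lemma ip_zero_left [simp]: "\<xi> \<in> M n \<Longrightarrow> ipf n 0 \<xi> = 0"
  using ip_star[of \<xi> n 0] by simp

lemma fib_complete:
  "(\<And>k. s k \<in> M n) \<Longrightarrow> (\<And>e. e > 0 \<Longrightarrow> \<exists>K. \<forall>k\<ge>K. \<forall>l\<ge>K. mnorm (fib X n) (s k - s l) < e) \<Longrightarrow>
    \<exists>\<xi>\<in>M n. (\<lambda>k. mnorm (fib X n) (s k - \<xi>)) \<longlonglongrightarrow> 0"
  by (rule hilbert_module_laws[THEN conjunct2, THEN conjunct2, THEN conjunct2, THEN conjunct2, THEN conjunct2, THEN conjunct2, rule_format]) auto

lemma pre_module_fib: "pre_module (M n) (+) (*\<^sub>C) (rmf n) (ipf n)"
  by unfold_locales (auto simp: ip_add ip_scaleC ip_rmul ip_pos intro: ip_star)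

text \<open>The rewrites make the abstract module lemmas appear with the subtraction of
  \<open>'x\<close> and with \<open>mnorm\<close>.\<close>

sublocale fib: pre_module "M n" "(+)" "(*\<^sub>C)" "rmf n" "ipf n"
  rewrites "pre_module.sub (+) (*\<^sub>C) = ((-) :: 'x \<Rightarrow> 'x \<Rightarrow> 'x)"
    and "pre_module.nrm (ipf n) = mnorm (fib X n)"
  for n
proof -
  show "pre_module (M n) (+) (*\<^sub>C) (rmf n) (ipf n)"
    by (rule pre_module_fib)
  then interpret I: pre_module "M n" "(+)" "(*\<^sub>C)" "rmf n" "ipf n" .
  show "I.sub = (-)"
    by (intro ext) (simp add: I.sub_def)
  show "I.nrm = mnorm (fib X n)"
    by (intro ext) (simp add: I.nrm_def mnorm_def)
qed

lemma lmul_mem [simp]: "\<xi> \<in> M n \<Longrightarrow> lmf n a \<xi> \<in> M n"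
  and lmul_adj: "\<xi> \<in> M n \<Longrightarrow> \<eta> \<in> M n \<Longrightarrow> ipf n (lmf n a \<xi>) \<eta> = ipf n \<xi> (lmf n (star a) \<eta>)"
  and lmul_add_left: "\<xi> \<in> M n \<Longrightarrow> lmf n (a + b) \<xi> = lmf n a \<xi> + lmf n b \<xi>"
  and lmul_scaleC_left: "\<xi> \<in> M n \<Longrightarrow> lmf n (c *\<^sub>C a) \<xi> = c *\<^sub>C lmf n a \<xi>"
  and lmul_mult: "\<xi> \<in> M n \<Longrightarrow> lmf n (a * b) \<xi> = lmf n a (lmf n b \<xi>)"
  using cstar_correspondence[of n] unfolding cstar_correspondence_def by blast+

lemma lmul_bound: "\<xi> \<in> M n \<Longrightarrow> pos ((norm b)\<^sup>2 *\<^sub>R ipf n \<xi> \<xi> - ipf n (lmf n b \<xi>) (lmf n b \<xi>))"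
  by (rule fib.action_bound) (auto simp: lmul_adj lmul_add_left lmul_scaleC_left lmul_mult)

lemma fib_eqI:
  assumes "\<xi> \<in> M n" "\<eta> \<in> M n" "\<And>\<zeta>. \<zeta> \<in> M n \<Longrightarrow> ipf n \<zeta> \<xi> = ipf n \<zeta> \<eta>"
  shows "\<xi> = \<eta>"
proof -
  have "ipf n (\<xi> - \<eta>) (\<xi> - \<eta>) = 0"
    using assms by (simp add: fib.inner_simps)
  then show ?thesis
    using ip_eq_0[of "\<xi> - \<eta>" n] assms by simp
qed

lemma lmul_adj': "\<xi> \<in> M n \<Longrightarrow> \<eta> \<in> M n \<Longrightarrow> ipf n \<xi> (lmf n a \<eta>) = ipf n (lmf n (star a) \<xi>) \<eta>"
  by (simp add: lmul_adj star_star)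

text \<open>Linearity in the vector comes from the adjoint relation, by testing against all
  vectors.\<close>

lemma lmul_add: "\<xi> \<in> M n \<Longrightarrow> \<eta> \<in> M n \<Longrightarrow> lmf n a (\<xi> + \<eta>) = lmf n a \<xi> + lmf n a \<eta>"
  by (rule fib_eqI[of _ n]) (auto simp: lmul_adj' ip_add)

lemma lmul_scaleC: "\<xi> \<in> M n \<Longrightarrow> lmf n a (c *\<^sub>C \<xi>) = c *\<^sub>C lmf n a \<xi>"
  by (rule fib_eqI[of _ n]) (auto simp: lmul_adj' ip_scaleC)

lemma lmul_rmul: "\<xi> \<in> M n \<Longrightarrow> lmf n a (rmf n \<xi> b) = rmf n (lmf n a \<xi>) b"
  by (rule fib_eqI[of _ n]) (auto simp: lmul_adj' ip_rmul)

lemma mnorm_minus_commute: "\<xi> \<in> M n \<Longrightarrow> \<eta> \<in> M n \<Longrightarrow> mnorm (fib X n) (\<xi> - \<eta>) = mnorm (fib X n) (\<eta> - \<xi>)"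
  using fib.nrm_sc[of "\<eta> - \<xi>" n "-1"] by simp

lemma identity_fib: "identity_correspondence (fib X 0) (emb X)"
  using product_system unfolding is_product_system_def by blast

lemma emb_bij: "bij_betw (emb X) UNIV (M 0)"
  and emb_add: "emb X (a + b) = emb X a + emb X b"
  and emb_scaleC: "emb X (c *\<^sub>C a) = c *\<^sub>C emb X a"
  and emb_ip: "ipf 0 (emb X a) (emb X b) = star a * b"
  and emb_rmul: "rmf 0 (emb X a) b = emb X (a * b)"
  and emb_lmul: "lmf 0 a (emb X b) = emb X (a * b)"
  using identity_fib unfolding identity_correspondence_def by blast+

lemma emb_mem [simp]: "emb X a \<in> M 0"
  using emb_bij unfolding bij_betw_def by auto

lemma emb_inject: "emb X a = emb X b \<longleftrightarrow> a = b"
  using emb_bij unfolding bij_betw_def inj_def by auto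

lemma emb_cases: "\<xi> \<in> M 0 \<Longrightarrow> \<exists>a. \<xi> = emb X a"
  using emb_bij unfolding bij_betw_def by auto

lemma emb_zero [simp]: "emb X 0 = 0"
  using emb_add[of 0 0] by simp

lemma mnorm_emb: "mnorm (fib X 0) (emb X a) = norm a"
  by (simp add: mnorm_def emb_ip cstar_identity)

lemma tensor_unitary: "n \<noteq> 0 \<Longrightarrow> tensor_unitary (fib X n) (fib X m) (fib X (n + m)) (prd X n m)"
  using product_system unfolding is_product_system_def by blast

lemma prd_0: "\<eta> \<in> M m \<Longrightarrow> prd X 0 m (emb X a) \<eta> = lmf m a \<eta>"
  using product_system unfolding is_product_system_def by blast

lemma prd_assoc: "\<xi> \<in> M n \<Longrightarrow> \<eta> \<in> M m \<Longrightarrow> \<zeta> \<in> M k \<Longrightarrow>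
    prd X (n + m) k (prd X n m \<xi> \<eta>) \<zeta> = prd X n (m + k) \<xi> (prd X m k \<eta> \<zeta>)"
  using product_system unfolding is_product_system_def by blast

text \<open>For \<open>n \<noteq> 0\<close> these are clauses of \<open>tensor_unitary\<close>. For
  \<open>n = 0\<close> the product is the left action, and they follow from its laws through
  \<open>emb\<close>. This removes most later case distinctions.\<close>

lemma prd_laws:
  assumes "\<xi> \<in> M n" "\<eta> \<in> M m"
  shows prd_mem [simp]: "prd X n m \<xi> \<eta> \<in> M (n + m)"
    and prd_add: "\<xi>' \<in> M n \<Longrightarrow> prd X n m (\<xi> + \<xi>') \<eta> = prd X n m \<xi> \<eta> + prd X n m \<xi>' \<eta>"
    and prd_add_right: "\<eta>' \<in> M m \<Longrightarrow> prd X n m \<xi> (\<eta> + \<eta>') = prd X n m \<xi> \<eta> + prd X n m \<xi> \<eta>'"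
    and prd_scaleC: "prd X n m (c *\<^sub>C \<xi>) \<eta> = c *\<^sub>C prd X n m \<xi> \<eta>"
    and prd_scaleC_right: "prd X n m \<xi> (c *\<^sub>C \<eta>) = c *\<^sub>C prd X n m \<xi> \<eta>"
    and prd_balanced: "prd X n m (rmf n \<xi> a) \<eta> = prd X n m \<xi> (lmf m a \<eta>)"
    and prd_rmul: "rmf (n + m) (prd X n m \<xi> \<eta>) a = prd X n m \<xi> (rmf m \<eta> a)"
    and prd_ip: "\<xi>' \<in> M n \<Longrightarrow> \<eta>' \<in> M m \<Longrightarrow>
      ipf (n + m) (prd X n m \<xi> \<eta>) (prd X n m \<xi>' \<eta>') = ipf m \<eta> (lmf m (ipf n \<xi> \<xi>') \<eta>')"
proof -
  consider "n \<noteq> 0" | "n = 0" by blast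
  then have "prd X n m \<xi> \<eta> \<in> M (n + m) \<and>
    (\<forall>\<xi>'\<in>M n. prd X n m (\<xi> + \<xi>') \<eta> = prd X n m \<xi> \<eta> + prd X n m \<xi>' \<eta>) \<and>
    (\<forall>\<eta>'\<in>M m. prd X n m \<xi> (\<eta> + \<eta>') = prd X n m \<xi> \<eta> + prd X n m \<xi> \<eta>') \<and>
    (\<forall>c. prd X n m (c *\<^sub>C \<xi>) \<eta> = c *\<^sub>C prd X n m \<xi> \<eta>) \<and>
    (\<forall>c. prd X n m \<xi> (c *\<^sub>C \<eta>) = c *\<^sub>C prd X n m \<xi> \<eta>) \<and>
    (\<forall>a. prd X n m (rmf n \<xi> a) \<eta> = prd X n m \<xi> (lmf m a \<eta>)) \<and>
    (\<forall>a. rmf (n + m) (prd X n m \<xi> \<eta>) a = prd X n m \<xi> (rmf m \<eta> a)) \<and>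
    (\<forall>\<xi>'\<in>M n. \<forall>\<eta>'\<in>M m. ipf (n + m) (prd X n m \<xi> \<eta>) (prd X n m \<xi>' \<eta>') =
        ipf m \<eta> (lmf m (ipf n \<xi> \<xi>') \<eta>'))"
  proof cases
    case 1
    then show ?thesis
      using tensor_unitary[OF 1, of m] assms unfolding tensor_unitary_def by simp
  next
    case 2
    then obtain a where a: "\<xi> = emb X a"
      using assms emb_cases by auto
    have all: "(\<forall>\<xi>'\<in>M 0. P \<xi>') \<longleftrightarrow> (\<forall>b. P (emb X b))" for P
      using emb_cases by auto
    show ?thesis
      unfolding 2 a all using assms(2)
      by (simp add: prd_0 lmul_add lmul_add_left lmul_scaleC lmul_scaleC_left lmul_rmul lmul_mult
        emb_ip lmul_adj emb_rmul flip: emb_add emb_scaleC)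
  qed
  then show "prd X n m \<xi> \<eta> \<in> M (n + m)"
    "\<xi>' \<in> M n \<Longrightarrow> prd X n m (\<xi> + \<xi>') \<eta> = prd X n m \<xi> \<eta> + prd X n m \<xi>' \<eta>"
    "\<eta>' \<in> M m \<Longrightarrow> prd X n m \<xi> (\<eta> + \<eta>') = prd X n m \<xi> \<eta> + prd X n m \<xi> \<eta>'"
    "prd X n m (c *\<^sub>C \<xi>) \<eta> = c *\<^sub>C prd X n m \<xi> \<eta>"
    "prd X n m \<xi> (c *\<^sub>C \<eta>) = c *\<^sub>C prd X n m \<xi> \<eta>"
    "prd X n m (rmf n \<xi> a) \<eta> = prd X n m \<xi> (lmf m a \<eta>)"
    "rmf (n + m) (prd X n m \<xi> \<eta>) a = prd X n m \<xi> (rmf m \<eta> a)"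
    "\<xi>' \<in> M n \<Longrightarrow> \<eta>' \<in> M m \<Longrightarrow>
      ipf (n + m) (prd X n m \<xi> \<eta>) (prd X n m \<xi>' \<eta>') = ipf m \<eta> (lmf m (ipf n \<xi> \<xi>') \<eta>')"
    by blast+
qed

lemma prd_zero_right [simp]: "\<xi> \<in> M n \<Longrightarrow> prd X n m \<xi> 0 = 0"
  using prd_scaleC_right[of \<xi> n 0 m 0] by simp

lemma prd_zero_left [simp]: "\<eta> \<in> M m \<Longrightarrow> prd X n m 0 \<eta> = 0"
  using prd_scaleC[of 0 n \<eta> m 0] by simp

lemma prd_sum_right:
  assumes "\<xi> \<in> M n" "\<And>i. i \<in> I \<Longrightarrow> f i \<in> M m"
  shows "prd X n m \<xi> (\<Sum>i\<in>I. f i) = (\<Sum>i\<in>I. prd X n m \<xi> (f i))"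
  using assms(2) by (induction I rule: infinite_finite_induct) (auto simp: assms(1) prd_add_right sum_mem)

lemma prd_sum_left:
  assumes "\<eta> \<in> M m" "\<And>i. i \<in> I \<Longrightarrow> f i \<in> M n"
  shows "prd X n m (\<Sum>i\<in>I. f i) \<eta> = (\<Sum>i\<in>I. prd X n m (f i) \<eta>)"
  using assms(2) by (induction I rule: infinite_finite_induct) (auto simp: assms(1) prd_add sum_mem)

lemma ip_sum_right:
  assumes "\<xi> \<in> M n" "\<And>i. i \<in> I \<Longrightarrow> f i \<in> M n"
  shows "ipf n \<xi> (\<Sum>i\<in>I. f i) = (\<Sum>i\<in>I. ipf n \<xi> (f i))"
  using assms(2) by (induction I rule: infinite_finite_induct) (auto simp: ip_add assms(1) sum_mem)

text \<open>Write the inner square of \<open>\<xi>\<close> as \<open>star b * b\<close>; then the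
  product has the same inner square as \<open>lmf m b \<eta>\<close>, and \<open>lmul_bound\<close>
  applies.\<close>

lemma prd_bound:
  assumes "\<xi> \<in> M n" "\<eta> \<in> M m"
  shows "pos ((mnorm (fib X n) \<xi>)\<^sup>2 *\<^sub>R ipf m \<eta> \<eta> - ipf (n + m) (prd X n m \<xi> \<eta>) (prd X n m \<xi> \<eta>))"
proof -
  obtain b where b: "ipf n \<xi> \<xi> = star b * b"
    using ip_pos[OF assms(1)] unfolding pos_def by blast
  have "(mnorm (fib X n) \<xi>)\<^sup>2 = (norm b)\<^sup>2"
    by (simp add: mnorm_def b cstar_identity)
  then show ?thesis
    using lmul_bound[OF assms(2), of b] assms by (simp add: prd_ip b lmul_mult lmul_adj)
qed

lemma ip_sum_left:
  assumes "\<xi> \<in> M n" "\<And>i. i \<in> I \<Longrightarrow> f i \<in> M n"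
  shows "ipf n (\<Sum>i\<in>I. f i) \<xi> = (\<Sum>i\<in>I. ipf n (f i) \<xi>)"
  using assms(2) by (induction I rule: infinite_finite_induct) (auto simp: fib.inner_add_left assms(1) sum_mem)

lemma prd_approx:
  assumes "n \<noteq> 0" "\<zeta> \<in> M (n + m)" "e > 0"
  shows "\<exists>(k::nat) \<xi> \<eta>. (\<forall>i<k. \<xi> i \<in> M n \<and> \<eta> i \<in> M m) \<and>
    mnorm (fib X (n + m)) (\<zeta> - (\<Sum>i<k. prd X n m (\<xi> i) (\<eta> i))) < e"
  by (rule tensor_unitary[OF assms(1), of m, unfolded tensor_unitary_def, THEN conjunct2, THEN conjunct2, THEN conjunct2, THEN conjunct2, THEN conjunct2, THEN conjunct2, THEN conjunct1, rule_format])
    (use assms in auto)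

lemma prd_total:
  assumes n: "n \<noteq> 0" and d: "d \<in> M (n + m)"
    and orth: "\<And>\<xi> \<eta>. \<xi> \<in> M n \<Longrightarrow> \<eta> \<in> M m \<Longrightarrow> ipf (n + m) (prd X n m \<xi> \<eta>) d = 0"
  shows "d = 0"
proof -
  let ?N = "mnorm (fib X (n + m))"
  have N1: "?N d + 1 > 0"
    by (intro add_nonneg_pos) auto
  have "norm (ipf (n + m) d d) \<le> e" if e: "e > 0" for e
  proof -
    have "e / (?N d + 1) > 0"
      using e N1 by simp
    then obtain k :: nat and \<xi> \<eta> where k: "\<forall>i<k. \<xi> i \<in> M n \<and> \<eta> i \<in> M m"
      "?N (d - (\<Sum>i<k. prd X n m (\<xi> i) (\<eta> i))) < e / (?N d + 1)"
      using prd_approx[OF n d] by meson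
    define \<zeta> where "\<zeta> = (\<Sum>i<k. prd X n m (\<xi> i) (\<eta> i))"
    have \<zeta>: "\<zeta> \<in> M (n + m)"
      using k by (auto simp: \<zeta>_def intro!: sum_mem)
    have "ipf (n + m) \<zeta> d = 0"
      unfolding \<zeta>_def using k d by (subst ip_sum_left) (auto simp: orth)
    then have "ipf (n + m) d d = ipf (n + m) (d - \<zeta>) d"
      using d \<zeta> by (simp add: fib.inner_sub_left)
    then have "norm (ipf (n + m) d d) \<le> ?N (d - \<zeta>) * ?N d"
      using fib.norm_inner_le[of "d - \<zeta>" "n + m" d] d \<zeta> by simp
    also have "\<dots> \<le> (e / (?N d + 1)) * (?N d + 1)"
      using k(2) e N1 by (intro mult_mono) (auto simp: \<zeta>_def)
    also have "\<dots> = e"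
      using N1 by simp
    finally show ?thesis .
  qed
  then have "ipf (n + m) d d = 0"
    by (metis field_le_epsilon add_0 norm_le_zero_iff)
  then show ?thesis
    using d by (rule ip_eq_0[rotated])
qed

text \<open>
  The product with the fibre at 0 is only assumed to be unitary; by associativity it kills the
  differences \<open>w\<close> below, hence it is the right action.
\<close>

lemma prd_emb_right:
  assumes \<xi>: "\<xi> \<in> M n"
  shows "prd X n 0 \<xi> (emb X a) = rmf n \<xi> a"
proof (cases "n = 0")
  case True
  then obtain b where "\<xi> = emb X b"
    using emb_cases \<xi> by blast
  then show ?thesis
    using True by (simp add: prd_0 emb_lmul emb_rmul)
next
  case False
  define w where "w = prd X n 0 \<xi> (emb X a) - rmf n \<xi> a"
  have mem: "prd X n 0 \<zeta> (emb X b) \<in> M n" if "\<zeta> \<in> M n" for \<zeta> b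
    using prd_mem[OF that emb_mem] by simp
  have w: "w \<in> M n"
    using mem \<xi> by (simp add: w_def)
  have "prd X n 0 w (emb X c) = 0" for c
  proof -
    have "prd X n 0 (prd X n 0 \<xi> (emb X a)) (emb X c) = prd X n 0 (rmf n \<xi> a) (emb X c)"
      using prd_assoc[OF \<xi> emb_mem emb_mem, of a c] \<xi> by (simp add: prd_balanced prd_0)
    moreover have "prd X n 0 (w + rmf n \<xi> a) (emb X c) = prd X n 0 w (emb X c) + prd X n 0 (rmf n \<xi> a) (emb X c)"
      using w \<xi> by (intro prd_add) auto
    ultimately show ?thesis
      by (simp add: w_def)
  qed
  then have "star c * (ipf n w w * c) = 0" for c
    using prd_ip[OF w emb_mem w emb_mem, of c c] by (simp add: emb_lmul emb_ip)
  then have "ipf n w w = 0"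
    by (rule conj_eq_0) (use w ip_pos pos_self_adjoint in blast)
  then show ?thesis
    using ip_eq_0[OF w] by (simp add: w_def)
qed

lemma mnorm_prd_le:
  assumes "\<xi> \<in> M n" "\<eta> \<in> M m"
  shows "mnorm (fib X (n + m)) (prd X n m \<xi> \<eta>) \<le> mnorm (fib X n) \<xi> * mnorm (fib X m) \<eta>"
proof -
  have "norm (ipf (n + m) (prd X n m \<xi> \<eta>) (prd X n m \<xi> \<eta>)) \<le> norm ((mnorm (fib X n) \<xi>)\<^sup>2 *\<^sub>R ipf m \<eta> \<eta>)"
    using prd_bound[OF assms] assms by (intro pos_norm_mono ip_pos) auto
  then have "(mnorm (fib X (n + m)) (prd X n m \<xi> \<eta>))\<^sup>2 \<le> (mnorm (fib X n) \<xi> * mnorm (fib X m) \<eta>)\<^sup>2"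
    by (simp add: fib.nrm_square power_mult_distrib)
  then show ?thesis
    by (rule power2_le_imp_le) simp
qed

section \<open>Adjoints of left multiplications between fibres\<close>

lemma tendsto_ip:
  assumes "\<eta> \<in> M n" "\<And>k. s k \<in> M n" "l \<in> M n" "(\<lambda>k. mnorm (fib X n) (s k - l)) \<longlonglongrightarrow> 0"
  shows "(\<lambda>k. ipf n \<eta> (s k)) \<longlonglongrightarrow> ipf n \<eta> l"
proof (rule LIM_zero_cancel, rule Lim_null_comparison)
  show "\<forall>\<^sub>F k in sequentially. norm (ipf n \<eta> (s k) - ipf n \<eta> l) \<le> mnorm (fib X n) \<eta> * mnorm (fib X n) (s k - l)"
    using fib.norm_inner_le[of \<eta> n "s _ - l"] assms by (simp add: fib.inner_sub)
  show "(\<lambda>k. mnorm (fib X n) \<eta> * mnorm (fib X n) (s k - l)) \<longlonglongrightarrow> 0"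
    using tendsto_mult_right_zero[OF assms(4)] by simp
qed

text \<open>On product vectors the adjoint is explicit: the inner product of \<open>\<xi>\<close>
  with the first factor acts on the second. Approximate \<open>w\<close> by sums of product vectors;
  the bound on left multiplication makes the images Cauchy, and the fibre is complete.\<close>

lemma prd_adjoint_exists:
  assumes \<xi>: "\<xi> \<in> M n" and w: "w \<in> M (n + m)"
  shows "\<exists>v\<in>M m. \<forall>\<eta>\<in>M m. ipf (n + m) (prd X n m \<xi> \<eta>) w = ipf m \<eta> v"
proof (cases "n = 0")
  case True
  then obtain a where "\<xi> = emb X a"
    using emb_cases \<xi> by blast
  then show ?thesis
    using True w by (intro bexI[of _ "lmf m (star a) w"]) (auto simp: prd_0 lmul_adj)
next
  case n: False
  let ?N = "mnorm (fib X (n + m))" and ?C = "mnorm (fib X n) \<xi>"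
  define rep where "rep w v \<longleftrightarrow> v \<in> M m \<and> (\<forall>\<eta>\<in>M m. ipf (n + m) (prd X n m \<xi> \<eta>) w = ipf m \<eta> v)" for w v
  have "\<exists>w' v'. w' \<in> M (n + m) \<and> ?N (w - w') < inverse (Suc k) \<and> rep w' v'" for k
  proof -
    obtain j :: nat and \<xi>' \<eta>' where j: "\<forall>i<j. \<xi>' i \<in> M n \<and> \<eta>' i \<in> M m"
      "?N (w - (\<Sum>i<j. prd X n m (\<xi>' i) (\<eta>' i))) < inverse (Suc k)"
      using prd_approx[OF n w, of "inverse (Suc k)"] by auto
    moreover have "ipf (n + m) (prd X n m \<xi> \<eta>) (\<Sum>i<j. prd X n m (\<xi>' i) (\<eta>' i)) =
        ipf m \<eta> (\<Sum>i<j. lmf m (ipf n \<xi> (\<xi>' i)) (\<eta>' i))" if "\<eta> \<in> M m" for \<eta>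
      using j(1) \<xi> that by (subst (1 2) ip_sum_right) (auto simp: prd_ip)
    then have "rep (\<Sum>i<j. prd X n m (\<xi>' i) (\<eta>' i)) (\<Sum>i<j. lmf m (ipf n \<xi> (\<xi>' i)) (\<eta>' i))"
      unfolding rep_def using j(1) by (auto intro!: sum_mem)
    ultimately show ?thesis
      by (intro exI[of _ "\<Sum>i<j. prd X n m (\<xi>' i) (\<eta>' i)"]
          exI[of _ "\<Sum>i<j. lmf m (ipf n \<xi> (\<xi>' i)) (\<eta>' i)"]) (auto intro!: sum_mem)
  qed
  then obtain W v where Wv: "\<And>k. W k \<in> M (n + m)" "\<And>k. ?N (w - W k) < inverse (Suc k)" "\<And>k. rep (W k) (v k)"
    by metis
  have v: "v k \<in> M m" for k
    using Wv(3) rep_def by blast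
  \<comment> \<open>The representing vectors depend on the approximants with Lipschitz constant
    \<open>?C\<close>: pair the difference with itself and cancel one factor.\<close>
  have est: "mnorm (fib X m) (v k - v l) \<le> ?C * ?N (W k - W l)" for k l
  proof -
    let ?x = "v k - v l"
    have x: "?x \<in> M m"
      using v by simp
    have "ipf m ?x ?x = ipf (n + m) (prd X n m \<xi> ?x) (W k - W l)"
      using Wv(1,3) x v \<xi> unfolding rep_def by (simp add: fib.inner_sub)
    then have "(mnorm (fib X m) ?x)\<^sup>2 \<le> ?N (prd X n m \<xi> ?x) * ?N (W k - W l)"
      using fib.norm_inner_le[of "prd X n m \<xi> ?x" "n + m" "W k - W l"] Wv(1) x \<xi>
      by (simp add: fib.nrm_square)
    also have "\<dots> \<le> (?C * mnorm (fib X m) ?x) * ?N (W k - W l)"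
      by (intro mult_right_mono mnorm_prd_le \<xi> x) simp
    finally have "mnorm (fib X m) ?x * mnorm (fib X m) ?x \<le> (?C * ?N (W k - W l)) * mnorm (fib X m) ?x"
      by (simp add: power2_eq_square mult_ac)
    then show ?thesis
      by (cases "mnorm (fib X m) ?x = 0")
        (auto simp: mult_nonneg_nonneg dest!: mult_right_le_imp_le intro: order.not_eq_order_implies_strict)
  qed
  have WW: "?N (W k - W l) \<le> inverse (Suc k) + inverse (Suc l)" for k l
  proof -
    have "W k - W l = (w - W l) - (w - W k)"
      by simp
    then have "?N (W k - W l) \<le> ?N (w - W l) + ?N (w - W k)"
      using fib.nrm_sub_le[of "w - W l" "n + m" "w - W k"] Wv(1) w by simp
    then show ?thesis
      using Wv(2)[of k] Wv(2)[of l] by simp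
  qed
  have "\<exists>\<zeta>\<in>M m. (\<lambda>k. mnorm (fib X m) (v k - \<zeta>)) \<longlonglongrightarrow> 0"
  proof (rule fib_complete[OF v])
    fix e :: real assume e: "e > 0"
    then have "e / (2 * (?C + 1)) > 0"
      by (intro divide_pos_pos mult_pos_pos add_nonneg_pos) auto
    then obtain K :: nat where K: "inverse (Suc K) < e / (2 * (?C + 1))"
      using reals_Archimedean by blast
    have C1: "?C + 1 > 0"
      by (intro add_nonneg_pos) auto
    have "mnorm (fib X m) (v k - v l) < e" if "k \<ge> K" "l \<ge> K" for k l
    proof -
      have "inverse (real (Suc k)) \<le> inverse (Suc K)" "inverse (real (Suc l)) \<le> inverse (Suc K)"
        using that by (auto intro!: le_imp_inverse_le)
      then have "?N (W k - W l) < 2 * (e / (2 * (?C + 1)))"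
        using WW[of k l] K by linarith
      also have "2 * (e / (2 * (?C + 1))) = e / (?C + 1)"
        by (subst times_divide_eq_right) (rule mult_divide_mult_cancel_left, simp)
      finally have "(?C + 1) * ?N (W k - W l) < (?C + 1) * (e / (?C + 1))"
        using C1 by (rule mult_strict_left_mono)
      moreover have "mnorm (fib X m) (v k - v l) \<le> (?C + 1) * ?N (W k - W l)"
        using est[of k l] by (simp add: distrib_right add_increasing2)
      ultimately show ?thesis
        using C1 by simp
    qed
    then show "\<exists>K. \<forall>k\<ge>K. \<forall>l\<ge>K. mnorm (fib X m) (v k - v l) < e"
      by blast
  qed
  then obtain \<zeta> where \<zeta>: "\<zeta> \<in> M m" "(\<lambda>k. mnorm (fib X m) (v k - \<zeta>)) \<longlonglongrightarrow> 0"
    by blast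
  have "(\<lambda>k. ?N (W k - w)) \<longlonglongrightarrow> 0"
    by (rule Lim_null_comparison[OF _ LIMSEQ_inverse_real_of_nat])
      (use Wv w in \<open>auto simp: mnorm_minus_commute[of _ _ w] less_imp_le\<close>)
  then have "ipf (n + m) (prd X n m \<xi> \<eta>) w = ipf m \<eta> \<zeta>" if \<eta>: "\<eta> \<in> M m" for \<eta>
  proof (intro LIMSEQ_unique[OF tendsto_ip tendsto_ip[OF \<eta> v \<zeta>, THEN Lim_transform_eventually]])
    show "\<forall>\<^sub>F k in sequentially. ipf m \<eta> (v k) = ipf (n + m) (prd X n m \<xi> \<eta>) (W k)"
      using Wv(3) \<eta> by (simp add: rep_def)
  qed (use \<xi> \<eta> w Wv in auto)
  then show ?thesis
    using \<zeta> by blast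
qed

definition ladj :: "nat ^ 'n \<Rightarrow> 'x \<Rightarrow> nat ^ 'n \<Rightarrow> 'x \<Rightarrow> 'x" where
  "ladj n \<xi> m w = (SOME v. v \<in> M m \<and> (\<forall>\<eta>\<in>M m. ipf (n + m) (prd X n m \<xi> \<eta>) w = ipf m \<eta> v))"

lemma ladj:
  assumes "\<xi> \<in> M n" "w \<in> M (n + m)"
  shows ladj_mem [simp]: "ladj n \<xi> m w \<in> M m"
    and ladj_ip: "\<eta> \<in> M m \<Longrightarrow> ipf (n + m) (prd X n m \<xi> \<eta>) w = ipf m \<eta> (ladj n \<xi> m w)"
  using someI_ex[OF prd_adjoint_exists[OF assms, unfolded Bex_def]] unfolding ladj_def by blast+

text \<open>The added 1 makes the constant positive, as \<open>adjoint_bound\<close>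
  demands.\<close>

lemma ladj_bound:
  assumes "\<xi> \<in> M n" "w \<in> M (n + m)"
  shows "pos (((mnorm (fib X n) \<xi>)\<^sup>2 + 1) *\<^sub>R ipf (n + m) w w - ipf m (ladj n \<xi> m w) (ladj n \<xi> m w))"
proof (rule adjoint_bound[OF pre_module_fib pre_module_fib])
  let ?v = "ladj n \<xi> m w"
  show "ipf (n + m) (prd X n m \<xi> ?v) w = ipf m ?v ?v"
    using assms by (intro ladj_ip) auto
  have "pos (((mnorm (fib X n) \<xi>)\<^sup>2 *\<^sub>R ipf m ?v ?v - ipf (n + m) (prd X n m \<xi> ?v) (prd X n m \<xi> ?v)) + ipf m ?v ?v)"
    using assms by (intro pos_add prd_bound ip_pos) auto
  then show "pos (((mnorm (fib X n) \<xi>)\<^sup>2 + 1) *\<^sub>R ipf m ?v ?v - ipf (n + m) (prd X n m \<xi> ?v) (prd X n m \<xi> ?v))"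
    by (simp add: algebra_simps)
  show "(mnorm (fib X n) \<xi>)\<^sup>2 + 1 > 0"
    by (intro add_nonneg_pos) auto
qed (use assms in auto)

end

section \<open>Degrees of multi-indices and frames of all fibres\<close>

definition deg :: "nat ^ 'n::finite \<Rightarrow> nat" where
  "deg m = (\<Sum>i\<in>UNIV. m $ i)"

lemma deg_add: "deg (m + n) = deg m + deg n"
  by (simp add: deg_def sum.distrib)

lemma deg_axis [simp]: "deg (axis i 1) = 1"
  by (simp add: deg_def axis_def if_distrib[of "\<lambda>f. f _"] cong: if_cong)

lemma deg_zero [simp]: "deg 0 = 0"
  by (simp add: deg_def)

lemma deg_eq_0: "deg m = 0 \<longleftrightarrow> m = 0"
  by (simp add: deg_def vec_eq_iff)

lemma vec_split:
  fixes m :: "nat ^ 'n::finite"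
  assumes "m $ i \<noteq> 0"
  shows "axis i 1 + (m - axis i 1) = m"
  using assms by (auto simp: vec_eq_iff axis_def)

locale framed_system = product_sys X
  for X :: "('n::finite, 'a::cstar_algebra, 'x::complex_vector) product_system" +
  fixes d :: "'n \<Rightarrow> nat" and x :: "'n \<Rightarrow> nat \<Rightarrow> 'x"
  assumes frame: "is_frame X d x"
begin

lemma frame_mem [simp]: "j < d i \<Longrightarrow> x i j \<in> M (axis i 1)"
  and frame_norm: "j < d i \<Longrightarrow> mnorm (fib X (axis i 1)) (x i j) \<le> 1"
  and frame_expand: "\<xi> \<in> M (axis i 1) \<Longrightarrow>
    (\<Sum>j<d i. rmf (axis i 1) (x i j) (ipf (axis i 1) (x i j) \<xi>)) = \<xi>"
  using frame unfolding is_frame_def Let_def by (blast, blast, metis)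

lemma axis_nonzero: "axis i (1::nat) \<noteq> 0"
  by (simp add: axis_eq_0_iff)

text \<open>The frame of a generator resolves the identity of every fibre above it. Against a
  product vector, adjoints and balancing move the frame onto the first factor, where
  \<open>frame_expand\<close> applies; product vectors are total.\<close>

lemma frame_prd:
  assumes w: "w \<in> M (axis i 1 + m)"
  shows "(\<Sum>j<d i. prd X (axis i 1) m (x i j) (ladj (axis i 1) (x i j) m w)) = w" (is "?w = w")
proof -
  let ?n = "axis i 1 :: nat ^ 'n"
  have w': "?w \<in> M (?n + m)"
    using w by (auto intro!: sum_mem)
  have "ipf (?n + m) (prd X ?n m \<xi> \<eta>) (?w - w) = 0" if \<xi>: "\<xi> \<in> M ?n" and \<eta>: "\<eta> \<in> M m" for \<xi> \<eta>
  proof -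
    have *: "ipf (?n + m) (prd X ?n m \<xi> \<eta>) (prd X ?n m (x i j) (ladj ?n (x i j) m w)) =
        ipf (?n + m) (prd X ?n m (rmf ?n (x i j) (ipf ?n (x i j) \<xi>)) \<eta>) w" if "j < d i" for j
    proof -
      have "ipf (?n + m) (prd X ?n m \<xi> \<eta>) (prd X ?n m (x i j) (ladj ?n (x i j) m w)) =
          ipf m (lmf m (ipf ?n (x i j) \<xi>) \<eta>) (ladj ?n (x i j) m w)"
        using that w \<xi> \<eta> ip_star[of \<xi> ?n "x i j"] by (simp add: prd_ip lmul_adj star_star)
      also have "\<dots> = ipf (?n + m) (prd X ?n m (x i j) (lmf m (ipf ?n (x i j) \<xi>) \<eta>)) w"
        using that w \<eta> by (simp add: ladj_ip)
      finally show ?thesis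
        using that \<eta> by (simp add: prd_balanced)
    qed
    have "ipf (?n + m) (prd X ?n m \<xi> \<eta>) ?w =
        (\<Sum>j<d i. ipf (?n + m) (prd X ?n m (rmf ?n (x i j) (ipf ?n (x i j) \<xi>)) \<eta>) w)"
      using \<xi> \<eta> w by (subst ip_sum_right) (auto simp: *)
    also have "\<dots> = ipf (?n + m) (prd X ?n m (\<Sum>j<d i. rmf ?n (x i j) (ipf ?n (x i j) \<xi>)) \<eta>) w"
      using \<eta> w by (subst prd_sum_left) (auto intro!: ip_sum_left[symmetric])
    finally show ?thesis
      using \<xi> \<eta> w w' by (simp add: frame_expand fib.inner_sub)
  qed
  then have "?w - w = 0"
    using w w' by (intro prd_total[OF axis_nonzero]) auto
  then show ?thesis
    by simp
qed

definition rank_bound :: nat where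
  "rank_bound = Suc (Max (range d))"

lemma rank_bound: "d i \<le> rank_bound" "1 \<le> rank_bound"
  by (auto simp: rank_bound_def le_SucI)

text \<open>Products of a frame of one generator with a frame of the remaining fibre form a frame,
  and each step multiplies the size by at most \<open>rank_bound\<close>. The fibre at 0 is excluded
  because a finite frame of it would provide a unit of \<open>'a\<close>.\<close>

lemma fib_frame_exists:
  "m \<noteq> 0 \<Longrightarrow> \<exists>(S::nat set) y. finite S \<and> card S \<le> rank_bound ^ deg m \<and>
    (\<forall>j\<in>S. y j \<in> M m \<and> mnorm (fib X m) (y j) \<le> 1) \<and>
    (\<forall>\<xi>\<in>M m. (\<Sum>j\<in>S. rmf m (y j) (ipf m (y j) \<xi>)) = \<xi>)"
proof (induction "deg m" arbitrary: m)
  case 0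
  then show ?case
    by (simp add: deg_eq_0)
next
  case (Suc k)
  obtain i where i: "m $ i \<noteq> 0"
    using Suc.prems by (auto simp: vec_eq_iff)
  define n :: "nat ^ 'n" where "n = axis i 1"
  define m' where "m' = m - n"
  have m: "n + m' = m"
    using vec_split[OF i] by (simp add: n_def m'_def)
  have k: "k = deg m'"
    using Suc.hyps(2) deg_add[of n m'] m by (simp add: n_def)
  show ?case
  proof (cases "m' = 0")
    case True
    then have "m = axis i 1"
      using m by (simp add: n_def)
    then show ?thesis
      using rank_bound(1)[of i] frame_norm frame_expand
      by (intro exI[of _ "{..<d i}"] exI[of _ "x i"]) auto
  next
    case False
    then obtain S :: "nat set" and y where Sy: "finite S \<and> card S \<le> rank_bound ^ deg m' \<and>
      (\<forall>j\<in>S. y j \<in> M m' \<and> mnorm (fib X m') (y j) \<le> 1) \<and>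
      (\<forall>\<xi>\<in>M m'. (\<Sum>j\<in>S. rmf m' (y j) (ipf m' (y j) \<xi>)) = \<xi>)"
      using Suc.hyps(1)[OF k] by (elim exE meta_impE)
    then have S: "finite S" "card S \<le> rank_bound ^ deg m'"
      and y: "\<And>j. j \<in> S \<Longrightarrow> y j \<in> M m'" "\<And>j. j \<in> S \<Longrightarrow> mnorm (fib X m') (y j) \<le> 1"
        "\<And>\<xi>. \<xi> \<in> M m' \<Longrightarrow> (\<Sum>j\<in>S. rmf m' (y j) (ipf m' (y j) \<xi>)) = \<xi>"
      by blast+
    \<comment> \<open>Pairs of indices are coded as natural numbers so that the index set keeps its
      type through the induction.\<close>
    define y' where "y' e = (case prod_decode e of (j, l) \<Rightarrow> prd X n m' (x i j) (y l))" for e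
    define S' where "S' = prod_encode ` ({..<d i} \<times> S)"
    have xm: "j < d i \<Longrightarrow> x i j \<in> M n" for j
      by (simp add: n_def)
    have y': "y' e \<in> M m" "mnorm (fib X m) (y' e) \<le> 1" if "e \<in> S'" for e
    proof -
      obtain j l where jl: "e = prod_encode (j, l)" "j < d i" "l \<in> S"
        using \<open>e \<in> S'\<close> by (auto simp: S'_def)
      show "y' e \<in> M m"
        using prd_mem[OF xm[OF jl(2)] y(1)[OF jl(3)]] by (simp add: y'_def jl(1) m)
      have "mnorm (fib X m) (y' e) \<le> mnorm (fib X n) (x i j) * mnorm (fib X m') (y l)"
        using mnorm_prd_le[OF xm[OF jl(2)] y(1)[OF jl(3)]] by (simp add: y'_def jl(1) m)
      also have "\<dots> \<le> 1 * 1"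
        using frame_norm[OF jl(2)] y(2)[OF jl(3)] by (intro mult_mono) (auto simp: n_def)
      finally show "mnorm (fib X m) (y' e) \<le> 1"
        by simp
    qed
    have inj: "inj_on prod_encode ({..<d i} \<times> S)"
      by (rule inj_prod_encode)
    have card: "card S' \<le> rank_bound ^ deg m"
    proof -
      have "card S' = d i * card S"
        unfolding S'_def card_image[OF inj] by (simp add: card_cartesian_product)
      also have "\<dots> \<le> rank_bound * rank_bound ^ deg m'"
        using S rank_bound(1)[of i] by (intro mult_mono) auto
      also have "\<dots> = rank_bound ^ deg m"
        unfolding Suc.hyps(2)[symmetric] k by simp
      finally show ?thesis .
    qed
    have "(\<Sum>e\<in>S'. rmf m (y' e) (ipf m (y' e) \<xi>)) = \<xi>" if \<xi>: "\<xi> \<in> M m" for \<xi>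
    proof -
      have \<xi>': "\<xi> \<in> M (n + m')"
        using \<xi> m by simp
      have "(\<Sum>e\<in>S'. rmf m (y' e) (ipf m (y' e) \<xi>)) =
          (\<Sum>(j, l)\<in>{..<d i} \<times> S. rmf m (y' (prod_encode (j, l))) (ipf m (y' (prod_encode (j, l))) \<xi>))"
        unfolding S'_def sum.reindex[OF inj] by (rule sum.cong) auto
      also have "\<dots> = (\<Sum>j<d i. \<Sum>l\<in>S. rmf m (prd X n m' (x i j) (y l)) (ipf m (prd X n m' (x i j) (y l)) \<xi>))"
        by (simp add: sum.cartesian_product[symmetric] y'_def)
      also have "\<dots> = (\<Sum>j<d i. prd X n m' (x i j) (ladj n (x i j) m' \<xi>))"
      proof (rule sum.cong[OF refl])
        fix j assume "j \<in> {..<d i}"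
        then have j: "x i j \<in> M n"
          by (simp add: xm)
        let ?v = "ladj n (x i j) m' \<xi>"
        have v: "?v \<in> M m'"
          using j \<xi>' by simp
        have "rmf m (prd X n m' (x i j) (y l)) (ipf m (prd X n m' (x i j) (y l)) \<xi>) =
            prd X n m' (x i j) (rmf m' (y l) (ipf m' (y l) ?v))" if "l \<in> S" for l
          using prd_rmul[OF j y(1)[OF that]] ladj_ip[OF j \<xi>' y(1)[OF that]] by (simp add: m)
        then have "(\<Sum>l\<in>S. rmf m (prd X n m' (x i j) (y l)) (ipf m (prd X n m' (x i j) (y l)) \<xi>)) =
            prd X n m' (x i j) (\<Sum>l\<in>S. rmf m' (y l) (ipf m' (y l) ?v))"
          using j y(1) by (simp add: prd_sum_right)
        then show "(\<Sum>l\<in>S. rmf m (prd X n m' (x i j) (y l)) (ipf m (prd X n m' (x i j) (y l)) \<xi>)) =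
            prd X n m' (x i j) ?v"
          using y(3)[OF v] by simp
      qed
      also have "\<dots> = \<xi>"
        using frame_prd[of \<xi> i m'] \<xi>' by (simp add: n_def)
      finally show ?thesis .
    qed
    then show ?thesis
      using card y' S by (intro exI[of _ S'] exI[of _ y']) (auto simp: S'_def)
  qed
qed

end

section \<open>The Fock module\<close>

lemma norm_infsum_le_finite:
  fixes f :: "'i \<Rightarrow> 'b::banach"
  assumes "f summable_on A" "\<And>F. finite F \<Longrightarrow> F \<subseteq> A \<Longrightarrow> norm (sum f F) \<le> C"
  shows "norm (infsum f A) \<le> C"
proof (rule tendsto_upperbound)
  show "((\<lambda>F. norm (sum f F)) \<longlongrightarrow> norm (infsum f A)) (finite_subsets_at_top A)"
    using assms(1) by (intro tendsto_norm infsum_tendsto)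
  show "\<forall>\<^sub>F F in finite_subsets_at_top A. norm (sum f F) \<le> C"
    using assms(2) by (intro eventually_finite_subsets_at_top_weakI) auto
qed simp

definition vec_add :: "('n::finite, 'x::complex_vector) fvec \<Rightarrow> ('n, 'x) fvec \<Rightarrow> ('n, 'x) fvec" where
  "vec_add \<eta> \<zeta> = (\<lambda>m. \<eta> m + \<zeta> m)"

definition vec_scale :: "complex \<Rightarrow> ('n::finite, 'x::complex_vector) fvec \<Rightarrow> ('n, 'x) fvec" where
  "vec_scale c \<eta> = (\<lambda>m. c *\<^sub>C \<eta> m)"

definition single :: "nat ^ 'n::finite \<Rightarrow> 'x::complex_vector \<Rightarrow> ('n, 'x) fvec" where
  "single n \<xi> = (\<lambda>m. if m = n then \<xi> else 0)"

lemma single_same [simp]: "single n \<xi> n = \<xi>"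
  and single_other [simp]: "m \<noteq> n \<Longrightarrow> single n \<xi> m = 0"
  by (auto simp: single_def)

context product_sys
begin

definition vec_rmul :: "('n, 'x) fvec \<Rightarrow> 'a \<Rightarrow> ('n, 'x) fvec" where
  "vec_rmul \<eta> a = (\<lambda>m. rmf m (\<eta> m) a)"

abbreviation "fibred \<equiv> {\<eta>. \<forall>m. \<eta> m \<in> M m}"

lemma pre_module_finite:
  "pre_module fibred vec_add vec_scale vec_rmul (\<lambda>\<eta> \<zeta>. \<Sum>m\<in>F. ipf m (\<eta> m) (\<zeta> m))"
proof
  fix u v :: "('n, 'x) fvec"
  assume "u \<in> fibred" "v \<in> fibred"
  then show "(\<Sum>m\<in>F. ipf m (v m) (u m)) = star (\<Sum>m\<in>F. ipf m (u m) (v m))"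
    by (auto simp: star_sum intro!: sum.cong ip_star)
qed (auto simp: vec_add_def vec_scale_def vec_rmul_def ip_add ip_scaleC ip_rmul sum.distrib
  scaleC_sum_right sum_distrib_right intro!: pos_sum ip_pos)

sublocale fin: pre_module fibred vec_add vec_scale vec_rmul "\<lambda>\<eta> \<zeta>. \<Sum>m\<in>F. ipf m (\<eta> m) (\<zeta> m)"
  rewrites "pre_module.sub vec_add vec_scale = (\<lambda>\<eta> \<zeta> m. \<eta> m - \<zeta> m :: 'x)"
  for F
proof -
  show "pre_module fibred vec_add vec_scale vec_rmul (\<lambda>\<eta> \<zeta>. \<Sum>m\<in>F. ipf m (\<eta> m) (\<zeta> m))"
    by (rule pre_module_finite)
  then interpret I: pre_module fibred vec_add vec_scale vec_rmul "\<lambda>\<eta> \<zeta>. \<Sum>m\<in>F. ipf m (\<eta> m) (\<zeta> m)" .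
  show "I.sub = (\<lambda>\<eta> \<zeta> m. \<eta> m - \<zeta> m :: 'x)"
    by (intro ext) (simp add: I.sub_def vec_add_def vec_scale_def)
qed

lemma fock_mem: "\<eta> \<in> fock X \<Longrightarrow> \<eta> m \<in> M m"
  and fock_summable_self: "\<eta> \<in> fock X \<Longrightarrow> (\<lambda>m. ipf m (\<eta> m) (\<eta> m)) summable_on UNIV"
  by (auto simp: fock_def)

lemma fockI:
  assumes "\<And>m. \<zeta> m \<in> M m" "\<eta> \<in> fock X"
    "\<And>F. finite F \<Longrightarrow> norm (\<Sum>m\<in>F. ipf m (\<zeta> m) (\<zeta> m)) \<le> C * norm (\<Sum>m\<in>F. ipf m (\<eta> m) (\<eta> m))"
  shows "\<zeta> \<in> fock X"
  using summable_on_dominated[OF fock_summable_self[OF assms(2)], of "\<lambda>m. ipf m (\<zeta> m) (\<zeta> m)" C] assms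
  by (simp add: fock_def)

text \<open>Cauchy-Schwarz over a finite set bounds the sum by the mean of two squares, and each
  square is dominated in the order by the sum of both inner squares.\<close>

lemma fock_summable:
  assumes "\<eta> \<in> fock X" "\<zeta> \<in> fock X"
  shows "(\<lambda>m. ipf m (\<eta> m) (\<zeta> m)) summable_on UNIV"
proof (rule summable_on_dominated[where C=1])
  let ?g = "\<lambda>m. ipf m (\<eta> m) (\<eta> m) + ipf m (\<zeta> m) (\<zeta> m)"
  show "?g summable_on UNIV"
    using assms by (intro summable_on_add fock_summable_self)
  fix F :: "(nat ^ 'n) set"
  have mem: "\<eta> \<in> fibred" "\<zeta> \<in> fibred"
    using assms fock_mem by auto
  have p: "pos (\<Sum>m\<in>F. ipf m (\<eta> m) (\<eta> m))" "pos (\<Sum>m\<in>F. ipf m (\<zeta> m) (\<zeta> m))"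
    using fin.inner_pos mem by blast+
  have "norm (\<Sum>m\<in>F. ipf m (\<eta> m) (\<zeta> m)) \<le> fin.nrm F \<eta> * fin.nrm F \<zeta>"
    using fin.norm_inner_le[OF mem] .
  also have "\<dots> \<le> ((fin.nrm F \<eta>)\<^sup>2 + (fin.nrm F \<zeta>)\<^sup>2) / 2"
    using sum_squares_bound[of "fin.nrm F \<eta>" "fin.nrm F \<zeta>"] by simp
  also have "(fin.nrm F \<eta>)\<^sup>2 \<le> norm (sum ?g F)"
    unfolding fin.nrm_square sum.distrib using p by (intro pos_norm_mono) auto
  also have "(fin.nrm F \<zeta>)\<^sup>2 \<le> norm (sum ?g F)"
    unfolding fin.nrm_square sum.distrib using p by (intro pos_norm_mono) auto
  finally show "norm (\<Sum>m\<in>F. ipf m (\<eta> m) (\<zeta> m)) \<le> 1 * norm (sum ?g F)"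
    by simp
qed

lemma fock_zero [simp]: "(\<lambda>_. 0) \<in> fock X"
  by (simp add: fock_def)

text \<open>The parallelogram law bounds the inner square of a sum by twice the sum of the inner
  squares; hence the constant 2.\<close>

lemma fock_add:
  assumes "\<eta> \<in> fock X" "\<zeta> \<in> fock X"
  shows "vec_add \<eta> \<zeta> \<in> fock X"
proof -
  let ?g = "\<lambda>m. ipf m (\<eta> m) (\<eta> m) + ipf m (\<zeta> m) (\<zeta> m)"
  have mem: "\<eta> \<in> fibred" "\<zeta> \<in> fibred"
    using assms fock_mem by auto
  have "(\<lambda>m. ipf m (vec_add \<eta> \<zeta> m) (vec_add \<eta> \<zeta> m)) summable_on UNIV"
  proof (rule summable_on_dominated[where C=2 and g="?g"])
    show "?g summable_on UNIV"
      using assms by (intro summable_on_add fock_summable_self)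
    fix F :: "(nat ^ 'n) set"
    have "norm (\<Sum>m\<in>F. ipf m (vec_add \<eta> \<zeta> m) (vec_add \<eta> \<zeta> m)) \<le>
        norm (2 *\<^sub>R ((\<Sum>m\<in>F. ipf m (\<eta> m) (\<eta> m)) + (\<Sum>m\<in>F. ipf m (\<zeta> m) (\<zeta> m))))"
      using mem fin.mem by (intro pos_norm_mono fin.parallelogram_pos fin.inner_pos) auto
    then show "norm (\<Sum>m\<in>F. ipf m (vec_add \<eta> \<zeta> m) (vec_add \<eta> \<zeta> m)) \<le> 2 * norm (sum ?g F)"
      by (simp add: sum.distrib)
  qed
  then show ?thesis
    using fin.add_mem[OF mem] by (simp add: fock_def)
qed

lemma fock_scale:
  assumes "\<eta> \<in> fock X"
  shows "vec_scale c \<eta> \<in> fock X"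
proof (rule fockI[OF _ assms, of _ "(cmod c)\<^sup>2"])
  have mem: "\<eta> \<in> fibred"
    using assms fock_mem by auto
  then show "vec_scale c \<eta> m \<in> M m" for m
    using fin.sc_mem[OF mem] by auto
  show "norm (\<Sum>m\<in>F. ipf m (vec_scale c \<eta> m) (vec_scale c \<eta> m)) \<le>
      (cmod c)\<^sup>2 * norm (\<Sum>m\<in>F. ipf m (\<eta> m) (\<eta> m))" for F
    using fin.nrm_sc[OF mem, of F c] by (simp add: fin.nrm_square[symmetric] power_mult_distrib)
qed

lemma fock_rmul:
  assumes "\<eta> \<in> fock X"
  shows "vec_rmul \<eta> a \<in> fock X"
proof (rule fockI[OF _ assms, of _ "(norm a)\<^sup>2"])
  have mem: "\<eta> \<in> fibred"
    using assms fock_mem by auto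
  then show "vec_rmul \<eta> a m \<in> M m" for m
    using fin.rm_mem[OF mem] by auto
  show "norm (\<Sum>m\<in>F. ipf m (vec_rmul \<eta> a m) (vec_rmul \<eta> a m)) \<le>
      (norm a)\<^sup>2 * norm (\<Sum>m\<in>F. ipf m (\<eta> m) (\<eta> m))" for F
    using power_mono[OF fin.nrm_rm_le[OF mem, of F a], of 2]
    by (simp add: fin.nrm_square[symmetric] power_mult_distrib mult.commute)
qed

lemma fock_ip_has_sum:
  "\<eta> \<in> fock X \<Longrightarrow> \<zeta> \<in> fock X \<Longrightarrow> ((\<lambda>m. ipf m (\<eta> m) (\<zeta> m)) has_sum fock_ip X \<eta> \<zeta>) UNIV"
  unfolding fock_ip_def by (intro has_sum_infsum fock_summable)

lemma fock_ip_eqI: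
  assumes "\<eta> \<in> fock X" "\<zeta> \<in> fock X" "((\<lambda>m. ipf m (\<eta> m) (\<zeta> m)) has_sum a) UNIV"
  shows "fock_ip X \<eta> \<zeta> = a"
  using has_sum_unique[OF fock_ip_has_sum[OF assms(1,2)] assms(3)] .

lemma pre_module_fock: "pre_module (fock X) vec_add vec_scale vec_rmul (fock_ip X)"
proof
  fix u v w :: "('n, 'x) fvec" and c a
  assume u: "u \<in> fock X" and v: "v \<in> fock X"
  show "vec_add u v \<in> fock X" "vec_scale c u \<in> fock X" "vec_rmul u a \<in> fock X"
    using u v by (auto intro: fock_add fock_scale fock_rmul)
  have mem: "u m \<in> M m" "v m \<in> M m" for m
    using u v fock_mem by auto
  show "fock_ip X u (vec_scale c v) = c *\<^sub>C fock_ip X u v"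
    using has_sum_bounded_linear[OF bounded_linear_scaleC fock_ip_has_sum[OF u v], of c] u v mem
    by (intro fock_ip_eqI fock_scale) (simp_all add: vec_scale_def ip_scaleC)
  show "fock_ip X u (vec_rmul v a) = fock_ip X u v * a"
    using has_sum_bounded_linear[OF bounded_linear_mult_left fock_ip_has_sum[OF u v], of a] u v mem
    by (intro fock_ip_eqI fock_rmul) (simp_all add: vec_rmul_def ip_rmul)
  have "(\<lambda>m. ipf m (v m) (u m)) = (\<lambda>m. star (ipf m (u m) (v m)))"
    using ip_star[OF mem] by auto
  then show "fock_ip X v u = star (fock_ip X u v)"
    using has_sum_bounded_linear[OF bounded_linear_star fock_ip_has_sum[OF u v]] u v
    by (intro fock_ip_eqI) simp_all
  show "pos (fock_ip X v v)"
    unfolding fock_ip_def using v mem by (intro pos_infsum fock_summable ip_pos)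
  assume w: "w \<in> fock X"
  then have "w m \<in> M m" for m
    using fock_mem by auto
  then show "fock_ip X u (vec_add v w) = fock_ip X u v + fock_ip X u w"
    using has_sum_add[OF fock_ip_has_sum[OF u v] fock_ip_has_sum[OF u w]] u v w mem
    by (intro fock_ip_eqI fock_add) (simp_all add: vec_add_def ip_add)
qed

sublocale fk: pre_module "fock X" vec_add vec_scale vec_rmul "fock_ip X"
  rewrites "pre_module.sub vec_add vec_scale = (\<lambda>\<eta> \<zeta> m. \<eta> m - \<zeta> m :: 'x)"
    and "pre_module.nrm (fock_ip X) = fock_norm X"
proof -
  show "pre_module (fock X) vec_add vec_scale vec_rmul (fock_ip X)"
    by (rule pre_module_fock)
  then interpret I: pre_module "fock X" vec_add vec_scale vec_rmul "fock_ip X" .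
  show "I.sub = (\<lambda>\<eta> \<zeta> m. \<eta> m - \<zeta> m :: 'x)"
    by (intro ext) (simp add: I.sub_def vec_add_def vec_scale_def)
  show "I.nrm = fock_norm X"
    by (intro ext) (simp add: I.nrm_def fock_norm_def)
qed

lemma fock_ip_dominates_finite:
  assumes \<eta>: "\<eta> \<in> fock X"
  shows "pos (fock_ip X \<eta> \<eta> - (\<Sum>m\<in>F. ipf m (\<eta> m) (\<eta> m)))"
proof (cases "finite F")
  case True
  have "fock_ip X \<eta> \<eta> = infsum (\<lambda>m. ipf m (\<eta> m) (\<eta> m)) (F \<union> (UNIV - F))"
    by (simp add: fock_ip_def)
  also have "\<dots> = infsum (\<lambda>m. ipf m (\<eta> m) (\<eta> m)) F + infsum (\<lambda>m. ipf m (\<eta> m) (\<eta> m)) (UNIV - F)"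
    by (rule infsum_Un_disjoint[OF summable_on_subset_banach[OF fock_summable_self[OF \<eta>]]
          summable_on_subset_banach[OF fock_summable_self[OF \<eta>]]]) auto
  finally have "fock_ip X \<eta> \<eta> - (\<Sum>m\<in>F. ipf m (\<eta> m) (\<eta> m)) =
      infsum (\<lambda>m. ipf m (\<eta> m) (\<eta> m)) (UNIV - F)"
    using True by simp
  moreover have "pos (infsum (\<lambda>m. ipf m (\<eta> m) (\<eta> m)) (UNIV - F))"
    by (rule pos_infsum[OF summable_on_subset_banach[OF fock_summable_self[OF \<eta>]]])
      (simp_all add: ip_pos fock_mem \<eta>)
  ultimately show ?thesis
    by simp
next
  case False
  then show ?thesis
    using fk.inner_pos[OF \<eta>] by simp
qed

lemma norm_finite_le_fock:
  "\<eta> \<in> fock X \<Longrightarrow> norm (\<Sum>m\<in>F. ipf m (\<eta> m) (\<eta> m)) \<le> (fock_norm X \<eta>)\<^sup>2"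
  unfolding fk.nrm_square using fock_mem
  by (intro pos_norm_mono fock_ip_dominates_finite pos_sum ip_pos) auto

lemma mnorm_le_fock: "\<eta> \<in> fock X \<Longrightarrow> mnorm (fib X m) (\<eta> m) \<le> fock_norm X \<eta>"
  using norm_finite_le_fock[of \<eta> "{m}"]
  by (intro power2_le_imp_le[of "mnorm (fib X m) (\<eta> m)"]) (auto simp: fib.nrm_square)

lemma fock_ip_self_eq_0: "\<eta> \<in> fock X \<Longrightarrow> fock_ip X \<eta> \<eta> = 0 \<Longrightarrow> \<eta> = (\<lambda>_. 0)"
proof
  fix m assume "\<eta> \<in> fock X" "fock_ip X \<eta> \<eta> = 0"
  then have "(mnorm (fib X m) (\<eta> m))\<^sup>2 \<le> 0"
    using mnorm_le_fock[of \<eta> m] fib.nrm_nonneg[of m "\<eta> m"] by (simp add: fock_norm_def)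
  then show "\<eta> m = 0"
    using ip_eq_0[OF fock_mem, of \<eta> m] \<open>\<eta> \<in> fock X\<close> unfolding fib.nrm_square by simp
qed

lemma fock_eqI:
  assumes "\<eta> \<in> fock X" "\<zeta> \<in> fock X" "\<And>\<theta>. \<theta> \<in> fock X \<Longrightarrow> fock_ip X \<theta> \<eta> = fock_ip X \<theta> \<zeta>"
  shows "\<eta> = \<zeta>"
proof -
  have "fock_ip X (\<lambda>m. \<eta> m - \<zeta> m) (\<lambda>m. \<eta> m - \<zeta> m) = 0"
    using assms fk.sub_mem by (simp add: fk.inner_simps)
  then have "(\<lambda>m. \<eta> m - \<zeta> m) = (\<lambda>_. 0)"
    using assms fk.sub_mem by (intro fock_ip_self_eq_0) auto
  then show ?thesis
    by (intro ext) (metis eq_iff_diff_eq_0)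
qed

lemma fock_ip_finite_support:
  assumes "\<eta> \<in> fock X" "\<zeta> \<in> fock X" "finite F" "\<And>m. m \<notin> F \<Longrightarrow> ipf m (\<eta> m) (\<zeta> m) = 0"
  shows "fock_ip X \<eta> \<zeta> = (\<Sum>m\<in>F. ipf m (\<eta> m) (\<zeta> m))"
  using assms(3,4) by (intro fock_ip_eqI[OF assms(1,2)] has_sum_finite_neutralI[of F]) auto

lemma single_mem [simp]: "\<xi> \<in> M n \<Longrightarrow> single n \<xi> \<in> fock X"
proof -
  assume \<xi>: "\<xi> \<in> M n"
  have "((\<lambda>m. ipf m (single n \<xi> m) (single n \<xi> m)) has_sum ipf n \<xi> \<xi>) UNIV"
    by (rule has_sum_finite_neutralI[of "{n}"]) (auto simp: single_def)
  then show ?thesis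
    using \<xi> by (auto simp: fock_def single_def summable_on_def)
qed

lemma fock_ip_single: "\<xi> \<in> M n \<Longrightarrow> \<eta> \<in> fock X \<Longrightarrow> fock_ip X (single n \<xi>) \<eta> = ipf n \<xi> (\<eta> n)"
  by (subst fock_ip_finite_support[of _ _ "{n}"]) (auto simp: fock_mem)

lemma fock_ip_single_right: "\<xi> \<in> M n \<Longrightarrow> \<eta> \<in> fock X \<Longrightarrow> fock_ip X \<eta> (single n \<xi>) = ipf n (\<eta> n) \<xi>"
  by (subst fock_ip_finite_support[of _ _ "{n}"]) (auto simp: fock_mem)

lemma fock_norm_single: "\<xi> \<in> M n \<Longrightarrow> fock_norm X (single n \<xi>) = mnorm (fib X n) \<xi>"
  by (simp add: fock_norm_def mnorm_def fock_ip_single)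

text \<open>The limit is taken fibre by fibre. The Cauchy condition bounds all finite truncations
  uniformly, which shows both that the limit lies in the Fock module and that convergence holds in
  its norm.\<close>

lemma fock_complete:
  assumes s: "\<And>k::nat. s k \<in> fock X"
    and Cauchy: "\<And>e. e > 0 \<Longrightarrow> \<exists>K. \<forall>k\<ge>K. \<forall>l\<ge>K. fock_norm X (\<lambda>m. s k m - s l m) < e"
  shows "\<exists>\<eta>\<in>fock X. (\<lambda>k. fock_norm X (\<lambda>m. s k m - \<eta> m)) \<longlonglongrightarrow> 0"
proof -
  have smem: "s k m \<in> M m" for k m
    using s fock_mem by blast
  have "\<exists>\<xi>\<in>M m. (\<lambda>k. mnorm (fib X m) (s k m - \<xi>)) \<longlonglongrightarrow> 0" for m
  proof (rule fib_complete[of "\<lambda>k. s k m" m])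
    show "s k m \<in> M m" for k
      by (rule smem)
    fix e :: real assume "e > 0"
    then show "\<exists>K. \<forall>k\<ge>K. \<forall>l\<ge>K. mnorm (fib X m) (s k m - s l m) < e"
      using Cauchy[of e] mnorm_le_fock[OF fk.sub_mem[OF s s]] by (meson le_less_trans)
  qed
  then obtain \<eta> where \<eta>: "\<And>m. \<eta> m \<in> M m" "\<And>m. (\<lambda>k. mnorm (fib X m) (s k m - \<eta> m)) \<longlonglongrightarrow> 0"
    by metis
  have fmem: "s k \<in> fibred" "\<eta> \<in> fibred" for k
    by (simp_all add: smem \<eta>(1))
  \<comment> \<open>On a finite set of fibres, insert \<open>s l\<close> and let \<open>l\<close>
    grow: fibrewise convergence removes the last term and leaves a bound that does not depend on
    \<open>F\<close>.\<close>
  have tail: "\<exists>K. \<forall>k\<ge>K. \<forall>F. finite F \<longrightarrow> fin.nrm F (\<lambda>m. s k m - \<eta> m) \<le> e" if e: "e > 0" for e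
  proof -
    obtain K where K: "\<And>k l. k \<ge> K \<Longrightarrow> l \<ge> K \<Longrightarrow> fock_norm X (\<lambda>m. s k m - s l m) < e"
      using Cauchy[OF e] by blast
    have "fin.nrm F (\<lambda>m. s k m - \<eta> m) \<le> e" if k: "k \<ge> K" and F: "finite F" for k F
    proof (rule tendsto_lowerbound)
      have "(\<lambda>l. \<Sum>m\<in>F. (mnorm (fib X m) (s l m - \<eta> m))\<^sup>2) \<longlonglongrightarrow> (\<Sum>m\<in>F. 0\<^sup>2)"
        by (intro tendsto_sum tendsto_power \<eta>)
      then have "(\<lambda>l. e + sqrt (\<Sum>m\<in>F. (mnorm (fib X m) (s l m - \<eta> m))\<^sup>2)) \<longlonglongrightarrow> e + sqrt 0"
        by (intro tendsto_intros) simp_all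
      then show "(\<lambda>l. e + sqrt (\<Sum>m\<in>F. (mnorm (fib X m) (s l m - \<eta> m))\<^sup>2)) \<longlonglongrightarrow> e"
        by simp
      have "fin.nrm F (\<lambda>m. s k m - \<eta> m) \<le> e + sqrt (\<Sum>m\<in>F. (mnorm (fib X m) (s l m - \<eta> m))\<^sup>2)"
        if l: "l \<ge> K" for l
      proof -
        have eq: "(\<lambda>m. s k m - \<eta> m) = vec_add (\<lambda>m. s k m - s l m) (\<lambda>m. s l m - \<eta> m)"
          by (auto simp: vec_add_def)
        have "fin.nrm F (\<lambda>m. s k m - \<eta> m) \<le> fin.nrm F (\<lambda>m. s k m - s l m) + fin.nrm F (\<lambda>m. s l m - \<eta> m)"
          by (rule ord_eq_le_trans[OF arg_cong[OF eq]]) (rule fin.nrm_add_le[OF fin.sub_mem[OF fmem(1) fmem(1)] fin.sub_mem[OF fmem(1) fmem(2)]])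
        moreover have "fin.nrm F (\<lambda>m. s k m - s l m) \<le> fock_norm X (\<lambda>m. s k m - s l m)"
          by (rule power2_le_imp_le[OF _ fk.nrm_nonneg])
            (unfold fin.nrm_square, rule norm_finite_le_fock[OF fk.sub_mem[OF s s]])
        moreover have "(fin.nrm F (\<lambda>m. s l m - \<eta> m))\<^sup>2 \<le> (\<Sum>m\<in>F. (mnorm (fib X m) (s l m - \<eta> m))\<^sup>2)"
          unfolding fin.nrm_square fib.nrm_square by (rule norm_sum)
        then have "fin.nrm F (\<lambda>m. s l m - \<eta> m) \<le> sqrt (\<Sum>m\<in>F. (mnorm (fib X m) (s l m - \<eta> m))\<^sup>2)"
          by (rule real_le_rsqrt)
        ultimately show ?thesis
          using K[OF k l] by linarith
      qed
      then show "\<forall>\<^sub>F l in sequentially. fin.nrm F (\<lambda>m. s k m - \<eta> m) \<le>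
          e + sqrt (\<Sum>m\<in>F. (mnorm (fib X m) (s l m - \<eta> m))\<^sup>2)"
        unfolding eventually_sequentially by blast
    qed simp
    then show ?thesis
      by blast
  qed
  have \<eta>F: "\<eta> \<in> fock X"
  proof -
    have "(\<lambda>m. ipf m (\<eta> m) (\<eta> m)) summable_on UNIV"
      unfolding summable_on_Cauchy_iff
    proof (intro allI impI)
      fix e :: real assume e: "e > 0"
      define r where "r = sqrt e / 2"
      have r: "r > 0" "(2 * r)\<^sup>2 = e"
        using e by (auto simp: r_def power2_eq_square)
      obtain K where K: "\<And>F. finite F \<Longrightarrow> fin.nrm F (\<lambda>m. s K m - \<eta> m) \<le> r"
        using tail[OF r(1)] by blast
      obtain F0 where F0: "finite F0" "\<And>G. finite G \<Longrightarrow> G \<subseteq> UNIV - F0 \<Longrightarrow>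
          norm (\<Sum>m\<in>G. ipf m (s K m) (s K m)) < r\<^sup>2"
        using fock_summable_self[OF s[of K]] r(1) unfolding summable_on_Cauchy_iff by (metis zero_less_power)
      have "norm (\<Sum>m\<in>G. ipf m (\<eta> m) (\<eta> m)) < e" if G: "finite G" "G \<subseteq> UNIV - F0" for G
      proof -
        have "fin.nrm G \<eta> \<le> fin.nrm G (s K) + fin.nrm G (\<lambda>m. s K m - \<eta> m)"
          using fin.nrm_sub_le[OF fmem(1)[of K] fin.sub_mem[OF fmem(1)[of K] fmem(2)], of G] by simp
        moreover have "fin.nrm G (s K) < r"
          by (rule power2_less_imp_less[OF _ less_imp_le[OF r(1)]])
            (unfold fin.nrm_square, rule F0(2)[OF G])
        ultimately have "fin.nrm G \<eta> < 2 * r"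
          using K[OF G(1)] by linarith
        then have "(fin.nrm G \<eta>)\<^sup>2 < (2 * r)\<^sup>2"
          by (intro power_strict_mono) auto
        then show ?thesis
          unfolding fin.nrm_square r(2) .
      qed
      then show "\<exists>F\<^sub>0. finite F\<^sub>0 \<and> F\<^sub>0 \<subseteq> UNIV \<and>
          (\<forall>G. finite G \<and> G \<subseteq> UNIV - F\<^sub>0 \<longrightarrow> norm (\<Sum>m\<in>G. ipf m (\<eta> m) (\<eta> m)) < e)"
        using F0(1) by blast
    qed
    then show ?thesis
      using \<eta> by (simp add: fock_def)
  qed
  have "(\<lambda>k. fock_norm X (\<lambda>m. s k m - \<eta> m)) \<longlonglongrightarrow> 0"
  proof (rule LIMSEQ_I)
    fix e :: real assume "e > 0"
    then obtain K where K: "\<And>k F. k \<ge> K \<Longrightarrow> finite F \<Longrightarrow> fin.nrm F (\<lambda>m. s k m - \<eta> m) \<le> e / 2"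
      using tail[of "e/2"] by auto
    have "fock_norm X (\<lambda>m. s k m - \<eta> m) < e" if "k \<ge> K" for k
    proof -
      have "norm (fock_ip X (\<lambda>m. s k m - \<eta> m) (\<lambda>m. s k m - \<eta> m)) \<le> (e / 2)\<^sup>2"
        unfolding fock_ip_def
      proof (rule norm_infsum_le_finite)
        show "(\<lambda>m. ipf m (s k m - \<eta> m) (s k m - \<eta> m)) summable_on UNIV"
          by (rule fock_summable_self[OF fk.sub_mem[OF s \<eta>F]])
        show "norm (\<Sum>m\<in>F. ipf m (s k m - \<eta> m) (s k m - \<eta> m)) \<le> (e / 2)\<^sup>2" if "finite F" for F
          using power_mono[OF K[OF \<open>k \<ge> K\<close> that] fin.nrm_nonneg, of 2] unfolding fin.nrm_square .
      qed
      then have "(fock_norm X (\<lambda>m. s k m - \<eta> m))\<^sup>2 \<le> (e / 2)\<^sup>2"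
        by (simp add: fk.nrm_square)
      then have "fock_norm X (\<lambda>m. s k m - \<eta> m) \<le> e / 2"
        using \<open>e > 0\<close> power2_le_imp_le[of "fock_norm X (\<lambda>m. s k m - \<eta> m)" "e / 2"] by simp
      then show ?thesis
        using \<open>e > 0\<close> by simp
    qed
    then show "\<exists>K. \<forall>k\<ge>K. norm (fock_norm X (\<lambda>m. s k m - \<eta> m) - 0) < e"
      by auto
  qed
  then show ?thesis
    using \<eta>F by blast
qed

end

section \<open>Operators on the Fock module\<close>

lemma pos_sum_norm_mono:
  assumes "\<And>i. i \<in> I \<Longrightarrow> pos (f i)" "\<And>i. i \<in> I \<Longrightarrow> pos (g i - f i)"
  shows "norm (\<Sum>i\<in>I. f i) \<le> norm (\<Sum>i\<in>I. g i)"
proof (rule pos_norm_mono)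
  show "pos (\<Sum>i\<in>I. f i)"
    using assms(1) by (rule pos_sum)
  show "pos ((\<Sum>i\<in>I. g i) - (\<Sum>i\<in>I. f i))"
    unfolding sum_subtractf[symmetric] using assms(2) by (rule pos_sum)
qed

definition op_add :: "('n::finite, 'x::complex_vector) fop \<Rightarrow> ('n, 'x) fop \<Rightarrow> ('n, 'x) fop" where
  "op_add S T = (\<lambda>\<eta> m. S \<eta> m + T \<eta> m)"

definition op_scale :: "complex \<Rightarrow> ('n::finite, 'x::complex_vector) fop \<Rightarrow> ('n, 'x) fop" where
  "op_scale c T = (\<lambda>\<eta> m. c *\<^sub>C T \<eta> m)"

lemma op_add_apply: "op_add S T \<eta> = vec_add (S \<eta>) (T \<eta>)"
  by (simp add: op_add_def vec_add_def)

lemma op_scale_apply: "op_scale c T \<eta> = vec_scale c (T \<eta>)"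
  by (simp add: op_scale_def vec_scale_def)

lemma op_scale_minus_one: "op_add S (op_scale (-1) T) = (\<lambda>\<eta> m. S \<eta> m - T \<eta> m)"
  by (simp add: op_add_def op_scale_def)

context product_sys
begin

abbreviation "Op \<equiv> carr (adjointable_ops X)"

definition adj :: "('n, 'x) fop \<Rightarrow> ('n, 'x) fop" where
  "adj = star_of (adjointable_ops X)"

definition opnorm :: "('n, 'x) fop \<Rightarrow> real" where
  "opnorm = norm_of (adjointable_ops X)"

lemma adjointable_ops_simps [simp]:
  "plus_of (adjointable_ops X) = op_add" "scale_of (adjointable_ops X) = op_scale"
  "times_of (adjointable_ops X) = (\<circ>)" "star_of (adjointable_ops X) = adj"
  "norm_of (adjointable_ops X) = opnorm"
  by (auto simp: adjointable_ops_def op_add_def op_scale_def adj_def opnorm_def fun_eq_iff)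

lemma Op_iff: "T \<in> Op \<longleftrightarrow> fock_operator X T \<and> (\<exists>S. is_adjoint X T S) \<and>
    (\<exists>K. \<forall>\<eta>\<in>fock X. fock_norm X (T \<eta>) \<le> K * fock_norm X \<eta>)"
  by (simp add: adjointable_ops_def)

lemma Op_mem: "T \<in> Op \<Longrightarrow> \<eta> \<in> fock X \<Longrightarrow> T \<eta> \<in> fock X"
  by (simp add: Op_iff fock_operator_def)

lemma Op_out: "T \<in> Op \<Longrightarrow> \<eta> \<notin> fock X \<Longrightarrow> T \<eta> = (\<lambda>_. 0)"
  by (simp add: Op_iff fock_operator_def)

lemma Op_eqI: "S \<in> Op \<Longrightarrow> T \<in> Op \<Longrightarrow> (\<And>\<eta>. \<eta> \<in> fock X \<Longrightarrow> S \<eta> = T \<eta>) \<Longrightarrow> S = T"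
  using Op_out by (metis ext)

lemma is_adjoint_unique:
  assumes "is_adjoint X T S" "is_adjoint X T S'" "fock_operator X T"
  shows "S = S'"
proof
  fix \<zeta>
  show "S \<zeta> = S' \<zeta>"
  proof (cases "\<zeta> \<in> fock X")
    case True
    then show ?thesis
      using assms by (intro fock_eqI) (auto simp: is_adjoint_def fock_operator_def)
  qed (use assms in \<open>auto simp: is_adjoint_def fock_operator_def\<close>)
qed

lemma adjI:
  assumes "is_adjoint X T S" "fock_operator X T"
  shows "adj T = S"
proof -
  have "adj T = (THE S. is_adjoint X T S)"
    by (simp add: adj_def adjointable_ops_def)
  also have "\<dots> = S"
    by (rule the_equality, rule assms(1)) (rule is_adjoint_unique[OF _ assms])
  finally show ?thesis .
qed

lemma adj_is_adjoint: "T \<in> Op \<Longrightarrow> is_adjoint X T (adj T)"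
  using adjI Op_iff by metis

lemma adj_mem: "T \<in> Op \<Longrightarrow> \<eta> \<in> fock X \<Longrightarrow> adj T \<eta> \<in> fock X"
  using adj_is_adjoint by (auto simp: is_adjoint_def fock_operator_def)

lemma adj_ip: "T \<in> Op \<Longrightarrow> \<eta> \<in> fock X \<Longrightarrow> \<zeta> \<in> fock X \<Longrightarrow> fock_ip X (T \<eta>) \<zeta> = fock_ip X \<eta> (adj T \<zeta>)"
  using adj_is_adjoint by (auto simp: is_adjoint_def)

lemma adj_ip': "T \<in> Op \<Longrightarrow> \<eta> \<in> fock X \<Longrightarrow> \<zeta> \<in> fock X \<Longrightarrow> fock_ip X (adj T \<eta>) \<zeta> = fock_ip X \<eta> (T \<zeta>)"
  by (metis Op_mem adj_ip adj_mem fk.inner_star)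

lemma Op_bound: "T \<in> Op \<Longrightarrow> \<exists>K\<ge>0. \<forall>\<eta>\<in>fock X. fock_norm X (T \<eta>) \<le> K * fock_norm X \<eta>"
proof -
  assume "T \<in> Op"
  then obtain K where "\<And>\<eta>. \<eta> \<in> fock X \<Longrightarrow> fock_norm X (T \<eta>) \<le> K * fock_norm X \<eta>"
    unfolding Op_iff by blast
  then have "fock_norm X (T \<eta>) \<le> \<bar>K\<bar> * fock_norm X \<eta>" if "\<eta> \<in> fock X" for \<eta>
    using that by (meson abs_ge_self fk.nrm_nonneg mult_right_mono order_trans)
  then show ?thesis
    by (intro exI[of _ "\<bar>K\<bar>"]) auto
qed

text \<open>The inner square of \<open>S \<zeta>\<close> is the inner product of
  \<open>T (S \<zeta>)\<close> with \<open>\<zeta>\<close>; apply Cauchy-Schwarz and cancel one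
  factor.\<close>

lemma adjoint_norm_le:
  assumes "\<And>\<eta>. \<eta> \<in> fock X \<Longrightarrow> fock_norm X (T \<eta>) \<le> K * fock_norm X \<eta>"
    and S: "S \<zeta> \<in> fock X" and T: "T (S \<zeta>) \<in> fock X" and \<zeta>: "\<zeta> \<in> fock X"
    and adj: "fock_ip X (T (S \<zeta>)) \<zeta> = fock_ip X (S \<zeta>) (S \<zeta>)"
  shows "fock_norm X (S \<zeta>) \<le> K * fock_norm X \<zeta>"
proof (cases "fock_norm X (S \<zeta>) = 0")
  case True
  have "0 \<le> K * fock_norm X \<zeta>"
    using assms(1)[OF \<zeta>] fk.nrm_nonneg[of "T \<zeta>"] by linarith
  then show ?thesis
    using True by simp
next
  case False
  then have pos: "fock_norm X (S \<zeta>) > 0"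
    using fk.nrm_nonneg[of "S \<zeta>"] by linarith
  have "fock_norm X (S \<zeta>) * fock_norm X (S \<zeta>) = norm (fock_ip X (T (S \<zeta>)) \<zeta>)"
    unfolding adj fk.nrm_square[symmetric] by (simp add: power2_eq_square)
  also have "\<dots> \<le> fock_norm X (T (S \<zeta>)) * fock_norm X \<zeta>"
    by (rule fk.norm_inner_le[OF T \<zeta>])
  also have "\<dots> \<le> (K * fock_norm X (S \<zeta>)) * fock_norm X \<zeta>"
    by (intro mult_right_mono assms(1) S) simp
  finally have "fock_norm X (S \<zeta>) * fock_norm X (S \<zeta>) \<le> (K * fock_norm X \<zeta>) * fock_norm X (S \<zeta>)"
    by (simp add: mult_ac)
  then show ?thesis
    using pos by (rule mult_right_le_imp_le)
qed

lemma adj_Op [simp]: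
  assumes T: "T \<in> Op"
  shows "adj T \<in> Op"
proof -
  obtain K where K: "\<And>\<eta>. \<eta> \<in> fock X \<Longrightarrow> fock_norm X (T \<eta>) \<le> K * fock_norm X \<eta>"
    using T unfolding Op_iff by blast
  have "fock_norm X (adj T \<zeta>) \<le> K * fock_norm X \<zeta>" if "\<zeta> \<in> fock X" for \<zeta>
    by (rule adjoint_norm_le[OF K]) (simp_all add: that T Op_mem adj_mem adj_ip)
  moreover have "is_adjoint X (adj T) T"
    using T by (auto simp: is_adjoint_def adj_ip' Op_iff)
  moreover have "fock_operator X (adj T)"
    using adj_is_adjoint[OF T] by (simp add: is_adjoint_def)
  ultimately show ?thesis
    unfolding Op_iff by blast
qed

lemma adj_adj [simp]: "T \<in> Op \<Longrightarrow> adj (adj T) = T"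
  by (rule adjI) (use adj_Op[of T] in \<open>auto simp: is_adjoint_def adj_ip' Op_iff\<close>)

lemma OpI:
  assumes "fock_operator X T" "fock_operator X S"
    "\<And>\<eta> \<zeta>. \<eta> \<in> fock X \<Longrightarrow> \<zeta> \<in> fock X \<Longrightarrow> fock_ip X (T \<eta>) \<zeta> = fock_ip X \<eta> (S \<zeta>)"
    "\<And>\<eta>. \<eta> \<in> fock X \<Longrightarrow> fock_norm X (T \<eta>) \<le> K * fock_norm X \<eta>"
  shows "T \<in> Op" "adj T = S"
proof -
  have "is_adjoint X T S"
    using assms by (simp add: is_adjoint_def)
  then show "T \<in> Op" "adj T = S"
    using assms by (auto simp: Op_iff intro!: adjI)
qed

text \<open>Membership in \<open>Op\<close> does not mention linearity; the existence of an adjoint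
  enforces it, as testing against all vectors shows.\<close>

lemma Op_add_vec: "T \<in> Op \<Longrightarrow> \<eta> \<in> fock X \<Longrightarrow> \<zeta> \<in> fock X \<Longrightarrow> T (vec_add \<eta> \<zeta>) = vec_add (T \<eta>) (T \<zeta>)"
  by (rule fock_eqI) (auto simp: Op_mem fk.mem adj_ip'[symmetric] fk.inner_add adj_mem)

lemma Op_scale_vec: "T \<in> Op \<Longrightarrow> \<eta> \<in> fock X \<Longrightarrow> T (vec_scale c \<eta>) = vec_scale c (T \<eta>)"
  by (rule fock_eqI) (auto simp: Op_mem fk.mem adj_ip'[symmetric] fk.inner_sc adj_mem)

lemma Op_rmul_vec: "T \<in> Op \<Longrightarrow> \<eta> \<in> fock X \<Longrightarrow> T (vec_rmul \<eta> a) = vec_rmul (T \<eta>) a"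
  by (rule fock_eqI) (auto simp: Op_mem fk.mem adj_ip'[symmetric] fk.inner_rm adj_mem)

lemma Op_diff_vec: "T \<in> Op \<Longrightarrow> \<eta> \<in> fock X \<Longrightarrow> \<zeta> \<in> fock X \<Longrightarrow> T (\<lambda>m. \<eta> m - \<zeta> m) = (\<lambda>m. T \<eta> m - T \<zeta> m)"
  by (rule fock_eqI) (auto simp: Op_mem fk.mem adj_ip'[symmetric] fk.inner_sub adj_mem)

lemma Op_zero_vec [simp]: "T \<in> Op \<Longrightarrow> T (\<lambda>_. 0) = (\<lambda>_. 0)"
  using Op_diff_vec[of T "\<lambda>_. 0" "\<lambda>_. 0"] by (simp add: fun_eq_iff)

lemma opnorm_bdd:
  assumes "T \<in> Op"
  shows "bdd_above ((\<lambda>\<eta>. fock_norm X (T \<eta>)) ` {\<eta>\<in>fock X. fock_norm X \<eta> \<le> 1})"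
proof -
  obtain K where K: "K \<ge> 0" "\<And>\<eta>. \<eta> \<in> fock X \<Longrightarrow> fock_norm X (T \<eta>) \<le> K * fock_norm X \<eta>"
    using Op_bound[OF assms] by blast
  then have "fock_norm X (T \<eta>) \<le> K" if "\<eta> \<in> fock X" "fock_norm X \<eta> \<le> 1" for \<eta>
    using that by (meson mult_left_le order_trans)
  then show ?thesis
    by (intro bdd_aboveI[of _ K]) auto
qed

lemma opnorm_def': "opnorm T = (SUP \<eta>\<in>{\<eta>\<in>fock X. fock_norm X \<eta> \<le> 1}. fock_norm X (T \<eta>))"
  unfolding opnorm_def by (simp add: adjointable_ops_def)

lemma fock_norm_zero [simp]: "fock_norm X (\<lambda>_. 0) = 0"
  by (simp add: fock_norm_def fock_ip_def)

lemma opnorm_le: "K \<ge> 0 \<Longrightarrow> (\<And>\<eta>. \<eta> \<in> fock X \<Longrightarrow> fock_norm X (T \<eta>) \<le> K * fock_norm X \<eta>) \<Longrightarrow> opnorm T \<le> K"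
  unfolding opnorm_def'
proof (rule cSUP_least)
  show "{\<eta> \<in> fock X. fock_norm X \<eta> \<le> 1} \<noteq> {}"
    using fock_zero fock_norm_zero by (metis (mono_tags, lifting) emptyE mem_Collect_eq zero_le_one)
qed (auto intro: order_trans mult_left_le)

lemma opnorm_nonneg: "T \<in> Op \<Longrightarrow> opnorm T \<ge> 0"
  unfolding opnorm_def' using fock_zero fock_norm_zero
  by (intro cSUP_upper2[OF opnorm_bdd, of _ "\<lambda>_. 0"]) auto

lemma opnorm_bound:
  assumes T: "T \<in> Op" and \<eta>: "\<eta> \<in> fock X"
  shows "fock_norm X (T \<eta>) \<le> opnorm T * fock_norm X \<eta>"
proof (cases "fock_norm X \<eta> = 0")
  case True
  then show ?thesis
    using Op_bound[OF T] \<eta> by fastforce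
next
  case False
  define r where "r = fock_norm X \<eta>"
  have r: "r > 0"
    using False fk.nrm_nonneg[of \<eta>] unfolding r_def by linarith
  have "fock_norm X (vec_scale (complex_of_real (1/r)) \<eta>) \<le> 1"
    using r \<eta> by (simp add: fk.nrm_sc norm_divide flip: r_def)
  then have "fock_norm X (T (vec_scale (complex_of_real (1/r)) \<eta>)) \<le> opnorm T"
    unfolding opnorm_def' using \<eta> by (intro cSUP_upper opnorm_bdd T) (auto intro: fk.mem)
  then have "(1/r) * fock_norm X (T \<eta>) \<le> opnorm T"
    using r T \<eta> by (simp add: Op_scale_vec fk.nrm_sc Op_mem norm_divide)
  then show ?thesis
    using r by (simp add: field_simps flip: r_def)
qed

lemma op_add_Op [simp]: "S \<in> Op \<Longrightarrow> T \<in> Op \<Longrightarrow> op_add S T \<in> Op"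
  and adj_op_add: "S \<in> Op \<Longrightarrow> T \<in> Op \<Longrightarrow> adj (op_add S T) = op_add (adj S) (adj T)"
proof -
  assume S: "S \<in> Op" and T: "T \<in> Op"
  have op: "fock_operator X (op_add S T)" "fock_operator X (op_add (adj S) (adj T))"
    using S T by (auto simp: fock_operator_def op_add_apply Op_mem adj_mem fk.mem Op_out)
      (auto simp: vec_add_def)
  have nb: "fock_norm X (op_add S T \<eta>) \<le> (opnorm S + opnorm T) * fock_norm X \<eta>" if "\<eta> \<in> fock X" for \<eta>
    using fk.nrm_add_le[OF Op_mem Op_mem, OF S that T that] opnorm_bound[OF S that] opnorm_bound[OF T that]
    by (simp add: op_add_apply distrib_right)
  have ip: "fock_ip X (op_add S T \<eta>) \<zeta> = fock_ip X \<eta> (op_add (adj S) (adj T) \<zeta>)"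
    if "\<eta> \<in> fock X" "\<zeta> \<in> fock X" for \<eta> \<zeta>
    using that S T by (simp add: op_add_apply fk.inner_simps Op_mem adj_mem adj_ip)
  show "op_add S T \<in> Op" "adj (op_add S T) = op_add (adj S) (adj T)"
    using OpI[OF op ip nb] by auto
qed

lemma op_scale_Op [simp]: "T \<in> Op \<Longrightarrow> op_scale c T \<in> Op"
  and adj_op_scale: "T \<in> Op \<Longrightarrow> adj (op_scale c T) = op_scale (cnj c) (adj T)"
proof -
  assume T: "T \<in> Op"
  have op: "fock_operator X (op_scale c T)" "fock_operator X (op_scale (cnj c) (adj T))"
    using T by (auto simp: fock_operator_def op_scale_apply Op_mem adj_mem fk.mem Op_out)
      (auto simp: vec_scale_def)
  have nb: "fock_norm X (op_scale c T \<eta>) \<le> (cmod c * opnorm T) * fock_norm X \<eta>" if "\<eta> \<in> fock X" for \<eta>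
    using opnorm_bound[OF T that] T that
    by (simp add: op_scale_apply fk.nrm_sc Op_mem mult.assoc mult_left_mono)
  have ip: "fock_ip X (op_scale c T \<eta>) \<zeta> = fock_ip X \<eta> (op_scale (cnj c) (adj T) \<zeta>)"
    if "\<eta> \<in> fock X" "\<zeta> \<in> fock X" for \<eta> \<zeta>
    using that T by (simp add: op_scale_apply fk.inner_simps Op_mem adj_mem adj_ip)
  show "op_scale c T \<in> Op" "adj (op_scale c T) = op_scale (cnj c) (adj T)"
    using OpI[OF op ip nb] by auto
qed

lemma op_comp_Op [simp]: "S \<in> Op \<Longrightarrow> T \<in> Op \<Longrightarrow> S \<circ> T \<in> Op"
  and adj_op_comp: "S \<in> Op \<Longrightarrow> T \<in> Op \<Longrightarrow> adj (S \<circ> T) = adj T \<circ> adj S"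
proof -
  assume S: "S \<in> Op" and T: "T \<in> Op"
  have op: "fock_operator X (S \<circ> T)" "fock_operator X (adj T \<circ> adj S)"
    using S T by (auto simp: fock_operator_def Op_mem adj_mem Op_out)
  have nb: "fock_norm X ((S \<circ> T) \<eta>) \<le> (opnorm S * opnorm T) * fock_norm X \<eta>" if "\<eta> \<in> fock X" for \<eta>
    using opnorm_bound[OF S Op_mem[OF T that]] mult_left_mono[OF opnorm_bound[OF T that] opnorm_nonneg[OF S]]
    by (simp add: mult.assoc)
  have ip: "fock_ip X ((S \<circ> T) \<eta>) \<zeta> = fock_ip X \<eta> ((adj T \<circ> adj S) \<zeta>)"
    if "\<eta> \<in> fock X" "\<zeta> \<in> fock X" for \<eta> \<zeta>
    using that S T by (simp add: Op_mem adj_mem adj_ip)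
  show "S \<circ> T \<in> Op" "adj (S \<circ> T) = adj T \<circ> adj S"
    using OpI[OF op ip nb] by (auto simp: comp_def)
qed

lemma opnorm_add: "S \<in> Op \<Longrightarrow> T \<in> Op \<Longrightarrow> opnorm (op_add S T) \<le> opnorm S + opnorm T"
proof (rule opnorm_le)
  fix \<eta> assume S: "S \<in> Op" and T: "T \<in> Op" and \<eta>: "\<eta> \<in> fock X"
  show "fock_norm X (op_add S T \<eta>) \<le> (opnorm S + opnorm T) * fock_norm X \<eta>"
    using fk.nrm_add_le[OF Op_mem Op_mem, OF S \<eta> T \<eta>] opnorm_bound[OF S \<eta>] opnorm_bound[OF T \<eta>]
    by (simp add: op_add_apply distrib_right)
qed (simp add: opnorm_nonneg)

lemma opnorm_comp: "S \<in> Op \<Longrightarrow> T \<in> Op \<Longrightarrow> opnorm (S \<circ> T) \<le> opnorm S * opnorm T"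
proof (rule opnorm_le)
  fix \<eta> assume S: "S \<in> Op" and T: "T \<in> Op" and \<eta>: "\<eta> \<in> fock X"
  show "fock_norm X ((S \<circ> T) \<eta>) \<le> opnorm S * opnorm T * fock_norm X \<eta>"
    using opnorm_bound[OF S Op_mem[OF T \<eta>]] mult_left_mono[OF opnorm_bound[OF T \<eta>] opnorm_nonneg[OF S]]
    by (simp add: mult.assoc)
qed (simp add: opnorm_nonneg)

lemma opnorm_adj: "T \<in> Op \<Longrightarrow> opnorm (adj T) = opnorm T"
proof -
  have le: "opnorm (adj T) \<le> opnorm T" if T: "T \<in> Op" for T
  proof (rule opnorm_le[OF opnorm_nonneg[OF T]])
    fix \<eta> assume \<eta>: "\<eta> \<in> fock X"
    show "fock_norm X (adj T \<eta>) \<le> opnorm T * fock_norm X \<eta>"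
      by (rule adjoint_norm_le[OF opnorm_bound[OF T]]) (simp_all add: \<eta> T Op_mem adj_mem adj_ip)
  qed
  assume "T \<in> Op"
  then show ?thesis
    using le[of T] le[of "adj T"] by simp
qed

lemma opnorm_scale_le: "T \<in> Op \<Longrightarrow> opnorm (op_scale c T) \<le> cmod c * opnorm T"
proof (rule opnorm_le)
  fix \<eta> assume T: "T \<in> Op" and \<eta>: "\<eta> \<in> fock X"
  show "fock_norm X (op_scale c T \<eta>) \<le> cmod c * opnorm T * fock_norm X \<eta>"
    using opnorm_bound[OF T \<eta>] T \<eta>
    by (simp add: op_scale_apply fk.nrm_sc Op_mem mult.assoc mult_left_mono)
qed (simp add: opnorm_nonneg)

lemma op_scale_op_scale: "op_scale c (op_scale e T) = op_scale (c * e) T"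
  by (simp add: op_scale_def scaleC_scaleC)

lemma op_scale_one [simp]: "op_scale 1 T = T"
  by (simp add: op_scale_def scaleC_one)

lemma opnorm_scale: "T \<in> Op \<Longrightarrow> opnorm (op_scale c T) = cmod c * opnorm T"
proof (cases "c = 0")
  case True
  then show "T \<in> Op \<Longrightarrow> opnorm (op_scale c T) = cmod c * opnorm T"
    using opnorm_scale_le[of T c] opnorm_nonneg[of "op_scale c T"] by simp
next
  case False
  assume T: "T \<in> Op"
  have "opnorm T = opnorm (op_scale (inverse c) (op_scale c T))"
    using False by (simp add: op_scale_op_scale)
  also have "\<dots> \<le> inverse (cmod c) * opnorm (op_scale c T)"
    using opnorm_scale_le[of "op_scale c T" "inverse c"] T by (simp add: norm_inverse)
  finally show ?thesis
    using opnorm_scale_le[OF T, of c] False by (simp add: field_simps)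
qed

lemma op_comp_add_left: "op_add S T \<circ> R = op_add (S \<circ> R) (T \<circ> R)"
  by (simp add: op_add_def comp_def)

lemma op_comp_scale_left: "op_scale c S \<circ> R = op_scale c (S \<circ> R)"
  by (simp add: op_scale_def comp_def)

lemma op_comp_add_right: "R \<in> Op \<Longrightarrow> S \<in> Op \<Longrightarrow> T \<in> Op \<Longrightarrow> R \<circ> op_add S T = op_add (R \<circ> S) (R \<circ> T)"
  by (rule Op_eqI) (auto simp: op_add_apply Op_add_vec Op_mem)

lemma op_comp_scale_right: "R \<in> Op \<Longrightarrow> S \<in> Op \<Longrightarrow> R \<circ> op_scale c S = op_scale c (R \<circ> S)"
  by (rule Op_eqI) (auto simp: op_scale_apply Op_scale_vec Op_mem)

lemma star_subalgebra_Op: "star_subalgebra (adjointable_ops X) Op"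
proof -
  have "(\<lambda>_ _. 0) \<in> Op"
  proof (rule OpI(1)[of _ "\<lambda>_ _. 0" 0])
    show "fock_ip X (\<lambda>_. 0) \<zeta> = fock_ip X \<eta> (\<lambda>_. 0)" if "\<eta> \<in> fock X" "\<zeta> \<in> fock X" for \<eta> \<zeta>
      using fk.inner_sc[OF that(1,2), of 0] fk.inner_sc_left[OF that(2,1), of 0] by (simp add: vec_scale_def)
  qed (auto simp: fock_operator_def)
  then show ?thesis
    by (auto simp: star_subalgebra_def)
qed

lemma closed_in_Op: "closed_in (adjointable_ops X) Op"
  by (simp add: closed_in_def)

subsection \<open>Creation operators\<close>

lemma vec_le_add: "(\<forall>i. n $ i \<le> m $ i) \<longleftrightarrow> (\<exists>k. m = n + (k :: nat ^ 'n))"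
proof
  assume "\<forall>i. n $ i \<le> m $ i"
  then have "m = n + (m - n)"
    by (simp add: vec_eq_iff)
  then show "\<exists>k. m = n + k"
    by blast
qed auto

lemma creation_add: "\<eta> \<in> fock X \<Longrightarrow> creation X n \<xi> \<eta> (n + k) = prd X n k \<xi> (\<eta> k)"
  by (simp add: creation_def on_fock_def)

lemma creation_other: "\<nexists>k. m = n + k \<Longrightarrow> creation X n \<xi> \<eta> m = 0"
  by (auto simp: creation_def on_fock_def vec_le_add)

definition annihilation :: "nat ^ 'n \<Rightarrow> 'x \<Rightarrow> ('n, 'x) fop" where
  "annihilation n \<xi> = on_fock X (\<lambda>\<zeta> m. ladj n \<xi> m (\<zeta> (n + m)))"

lemma inj_vec_add: "inj ((+) (n :: nat ^ 'n))"
  by (auto simp: inj_def)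

lemma has_sum_shift:
  fixes f :: "nat ^ 'n \<Rightarrow> 'a"
  assumes "\<And>m. \<nexists>k. m = n + k \<Longrightarrow> f m = 0"
  shows "(f has_sum s) UNIV \<longleftrightarrow> ((\<lambda>k. f (n + k)) has_sum s) UNIV"
proof -
  have "(f has_sum s) UNIV \<longleftrightarrow> (f has_sum s) (range ((+) n))"
    by (rule has_sum_cong_neutral) (use assms in auto)
  also have "\<dots> \<longleftrightarrow> ((f \<circ> (+) n) has_sum s) UNIV"
    by (rule has_sum_reindex[OF inj_vec_add])
  finally show ?thesis
    by (simp add: comp_def)
qed

lemma creation_fock:
  assumes \<xi>: "\<xi> \<in> M n" and \<eta>: "\<eta> \<in> fock X"
  shows "creation X n \<xi> \<eta> \<in> fock X"
    and "fock_norm X (creation X n \<xi> \<eta>) \<le> mnorm (fib X n) \<xi> * fock_norm X \<eta>"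
proof -
  let ?C = "mnorm (fib X n) \<xi>" and ?T = "creation X n \<xi> \<eta>"
  let ?g = "\<lambda>k. ipf (n + k) (prd X n k \<xi> (\<eta> k)) (prd X n k \<xi> (\<eta> k))"
  have mem: "?T m \<in> M m" for m
    using \<xi> \<eta> fock_mem creation_add creation_other by (cases "\<exists>k. m = n + k") auto
  have le: "norm (\<Sum>k\<in>F. ?g k) \<le> ?C\<^sup>2 * norm (\<Sum>k\<in>F. ipf k (\<eta> k) (\<eta> k))" for F
  proof -
    have "norm (\<Sum>k\<in>F. ?g k) \<le> norm (\<Sum>k\<in>F. ?C\<^sup>2 *\<^sub>R ipf k (\<eta> k) (\<eta> k))"
      by (rule pos_sum_norm_mono) (simp_all add: ip_pos prd_bound \<xi> fock_mem[OF \<eta>])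
    then have "norm (\<Sum>k\<in>F. ?g k) \<le> norm (?C\<^sup>2 *\<^sub>R (\<Sum>k\<in>F. ipf k (\<eta> k) (\<eta> k)))"
      unfolding scaleR_sum_right .
    then show ?thesis
      by simp
  qed
  have g: "?g summable_on UNIV"
    using le by (intro summable_on_dominated[OF fock_summable_self[OF \<eta>]])
  have shift: "((\<lambda>m. ipf m (?T m) (?T m)) has_sum infsum ?g UNIV) UNIV"
    using g \<eta> by (subst has_sum_shift[of n]) (auto simp: creation_other creation_add)
  then show T: "?T \<in> fock X"
    using mem by (auto simp: fock_def summable_on_def)
  have "fock_ip X ?T ?T = infsum ?g UNIV"
    using shift T by (intro fock_ip_eqI)
  moreover have "norm (infsum ?g UNIV) \<le> ?C\<^sup>2 * (fock_norm X \<eta>)\<^sup>2"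
    using le norm_finite_le_fock[OF \<eta>]
    by (intro norm_infsum_le_finite g) (meson mult_left_mono order_trans zero_le_power2)
  ultimately have "(fock_norm X ?T)\<^sup>2 \<le> (?C * fock_norm X \<eta>)\<^sup>2"
    by (simp add: fk.nrm_square power_mult_distrib)
  then show "fock_norm X ?T \<le> ?C * fock_norm X \<eta>"
    by (rule power2_le_imp_le) simp
qed

text \<open>The adjoint relation makes sense only once the candidate maps the Fock module into
  itself. Summability comes from \<open>ladj_bound\<close>, summed over finite sets of
  fibres.\<close>

lemma annihilation_fock:
  assumes \<xi>: "\<xi> \<in> M n" and \<zeta>: "\<zeta> \<in> fock X"
  shows "annihilation n \<xi> \<zeta> \<in> fock X"
proof -
  note mem = fock_mem[OF \<zeta>]
  let ?S = "annihilation n \<xi> \<zeta>" and ?K = "(mnorm (fib X n) \<xi>)\<^sup>2 + 1"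
  have S: "?S k = ladj n \<xi> k (\<zeta> (n + k))" for k
    using \<zeta> by (simp add: annihilation_def on_fock_def)
  have "(\<lambda>k. ipf k (?S k) (?S k)) summable_on UNIV"
  proof (rule summable_on_dominated)
    have "(\<lambda>m. ipf m (\<zeta> m) (\<zeta> m)) summable_on range ((+) n)"
      using fock_summable_self[OF \<zeta>] summable_on_subset_banach by blast
    then show "(\<lambda>k. ipf (n + k) (\<zeta> (n + k)) (\<zeta> (n + k))) summable_on UNIV"
      by (subst (asm) summable_on_reindex[OF inj_vec_add]) (simp add: comp_def)
    fix F :: "(nat ^ 'n) set"
    have "norm (\<Sum>k\<in>F. ipf k (?S k) (?S k)) \<le> norm (\<Sum>k\<in>F. ?K *\<^sub>R ipf (n + k) (\<zeta> (n + k)) (\<zeta> (n + k)))"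
      unfolding S
      by (rule pos_sum_norm_mono) (simp_all add: ip_pos ladj_bound \<xi> mem)
    then have "norm (\<Sum>k\<in>F. ipf k (?S k) (?S k)) \<le> norm (?K *\<^sub>R (\<Sum>k\<in>F. ipf (n + k) (\<zeta> (n + k)) (\<zeta> (n + k))))"
      unfolding scaleR_sum_right .
    then show "norm (\<Sum>k\<in>F. ipf k (?S k) (?S k)) \<le> \<bar>?K\<bar> * norm (\<Sum>k\<in>F. ipf (n + k) (\<zeta> (n + k)) (\<zeta> (n + k)))"
      by simp
  qed
  then show ?thesis
    by (simp add: fock_def S \<xi> mem)
qed

lemma
  assumes \<xi>: "\<xi> \<in> M n"
  shows creation_Op [simp]: "creation X n \<xi> \<in> Op"
    and adj_creation: "adj (creation X n \<xi>) = annihilation n \<xi>"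
proof -
  have op: "fock_operator X (creation X n \<xi>)" "fock_operator X (annihilation n \<xi>)"
    using \<xi> by (simp_all add: fock_operator_def creation_fock annihilation_fock)
      (simp_all add: creation_def annihilation_def on_fock_def)
  have "fock_ip X (creation X n \<xi> \<eta>) \<zeta> = fock_ip X \<eta> (annihilation n \<xi> \<zeta>)"
    if \<eta>: "\<eta> \<in> fock X" and \<zeta>: "\<zeta> \<in> fock X" for \<eta> \<zeta>
  proof (rule fock_ip_eqI)
    have "((\<lambda>k. ipf k (\<eta> k) (annihilation n \<xi> \<zeta> k)) has_sum fock_ip X \<eta> (annihilation n \<xi> \<zeta>)) UNIV"
      by (intro fock_ip_has_sum annihilation_fock \<xi> \<eta> \<zeta>)
    then show "((\<lambda>m. ipf m (creation X n \<xi> \<eta> m) (\<zeta> m)) has_sum fock_ip X \<eta> (annihilation n \<xi> \<zeta>)) UNIV"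
      using \<eta> \<zeta> \<xi> fock_mem
      by (subst has_sum_shift[of n])
        (simp_all add: creation_other creation_add ladj_ip annihilation_def on_fock_def)
  qed (use \<xi> \<eta> \<zeta> creation_fock in auto)
  then show "creation X n \<xi> \<in> Op" "adj (creation X n \<xi>) = annihilation n \<xi>"
    using OpI[OF op, of "mnorm (fib X n) \<xi>"] creation_fock(2)[OF \<xi>] by blast+
qed

lemma opnorm_creation: "\<xi> \<in> M n \<Longrightarrow> opnorm (creation X n \<xi>) \<le> mnorm (fib X n) \<xi>"
  by (rule opnorm_le) (auto intro: creation_fock)

text \<open>Treating \<open>fpi\<close> as creation of degree 0 leaves a single family of
  generators.\<close>

lemma fpi_eq_creation: "fpi X a = creation X 0 (emb X a)"
proof (intro ext)
  fix \<eta> m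
  have "creation X 0 (emb X a) \<eta> (0 + m) = lmf m a (\<eta> m)" if "\<eta> \<in> fock X"
    using that fock_mem by (subst creation_add) (auto simp: prd_0)
  then show "fpi X a \<eta> m = creation X 0 (emb X a) \<eta> m"
    by (simp add: fpi_def creation_def on_fock_def)
qed

lemma fpi_apply: "\<eta> \<in> fock X \<Longrightarrow> fpi X a \<eta> m = lmf m a (\<eta> m)"
  by (simp add: fpi_def on_fock_def)

lemma fpi_Op [simp]: "fpi X a \<in> Op"
  by (simp add: fpi_eq_creation)

lemma opnorm_fpi: "opnorm (fpi X a) \<le> norm a"
  using opnorm_creation[of "emb X a" 0] by (simp add: fpi_eq_creation mnorm_emb)

lemma creation_single: "\<xi> \<in> M n \<Longrightarrow> creation X n \<xi> (single 0 (emb X a)) = vec_rmul (single n \<xi>) a"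
proof
  fix m assume \<xi>: "\<xi> \<in> M n"
  have z: "rmf m 0 a = 0" for m
    using rmul_scaleC[of 0 m 0 a] by simp
  show "creation X n \<xi> (single 0 (emb X a)) m = vec_rmul (single n \<xi>) a m"
  proof (cases "\<exists>k. m = n + k")
    case True
    then obtain k where k: "m = n + k"
      by blast
    show ?thesis
      using creation_add[of "single 0 (emb X a)" n \<xi> k] \<xi> z unfolding k
      by (cases "k = 0") (auto simp: vec_rmul_def prd_emb_right)
  next
    case False
    then have "m \<noteq> n"
      by (metis add.right_neutral)
    then show ?thesis
      using z False by (simp add: creation_other vec_rmul_def)
  qed
qed

subsection \<open>The Toeplitz algebra\<close>

abbreviation "NTc \<equiv> carr (NT X)"

lemma NT_simps [simp]:
  "plus_of (NT X) = op_add" "scale_of (NT X) = op_scale" "times_of (NT X) = (\<circ>)"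
  "star_of (NT X) = adj" "norm_of (NT X) = opnorm"
  using adjointable_ops_simps by (simp_all add: NT_def generated_cstar_algebra_def)

lemma NT_induct:
  assumes "star_subalgebra (adjointable_ops X) S" "closed_in (adjointable_ops X) S"
    "\<And>n \<xi>. \<xi> \<in> M n \<Longrightarrow> creation X n \<xi> \<in> S"
  shows "NTc \<subseteq> S"
proof -
  have "range (fpi X) \<union> {creation X n \<xi> | n \<xi>. \<xi> \<in> M n} \<subseteq> S"
    using assms(3) by (auto simp: fpi_eq_creation)
  then show ?thesis
    using assms(1,2) by (auto simp: NT_def generated_cstar_algebra_def)
qed

lemma NT_subset_Op: "NTc \<subseteq> Op"
  by (rule NT_induct[OF star_subalgebra_Op closed_in_Op]) simp

lemma NT_Op [simp]: "f \<in> NTc \<Longrightarrow> f \<in> Op"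
  using NT_subset_Op by blast

lemma creation_NT [simp]: "\<xi> \<in> M n \<Longrightarrow> creation X n \<xi> \<in> NTc"
  by (auto simp: NT_def generated_cstar_algebra_def)

lemma fpi_NT [simp]: "fpi X a \<in> NTc"
  by (simp add: fpi_eq_creation)

lemma star_subalgebra_NT: "star_subalgebra (adjointable_ops X) NTc"
  unfolding star_subalgebra_def
proof (intro conjI ballI allI)
  let ?G = "range (fpi X) \<union> {creation X n \<xi> | n \<xi>. \<xi> \<in> M n}"
  let ?A = "adjointable_ops X"
  have mem: "f \<in> NTc \<longleftrightarrow> (\<forall>S. star_subalgebra ?A S \<and> closed_in ?A S \<and> ?G \<subseteq> S \<longrightarrow> f \<in> S)" for f
    by (simp add: NT_def generated_cstar_algebra_def)
  show "NTc \<subseteq> Op"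
    by (rule NT_subset_Op)
  show "NTc \<noteq> {}"
    using fpi_NT[of 0] by blast
  fix f g c
  assume f: "f \<in> NTc" and g: "g \<in> NTc"
  have S: "star_of ?A f \<in> S \<and> plus_of ?A f g \<in> S \<and> times_of ?A f g \<in> S \<and> (\<forall>c. scale_of ?A c f \<in> S)"
    if "star_subalgebra ?A S \<and> closed_in ?A S \<and> ?G \<subseteq> S" for S
  proof -
    have "f \<in> S" "g \<in> S"
      using f g that unfolding mem by blast+
    then show ?thesis
      using that[THEN conjunct1] unfolding star_subalgebra_def by blast
  qed
  show "plus_of ?A f g \<in> NTc" "times_of ?A f g \<in> NTc"
    using S unfolding mem by blast+
next
  fix f c
  assume f: "f \<in> NTc"
  have S: "star_of (adjointable_ops X) f \<in> S \<and> (\<forall>c. scale_of (adjointable_ops X) c f \<in> S)"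
    if "star_subalgebra (adjointable_ops X) S \<and> closed_in (adjointable_ops X) S \<and>
      range (fpi X) \<union> {creation X n \<xi> | n \<xi>. \<xi> \<in> M n} \<subseteq> S" for S
  proof -
    have "f \<in> S"
      using f that by (simp add: NT_def generated_cstar_algebra_def)
    then show ?thesis
      using that[THEN conjunct1] unfolding star_subalgebra_def by blast
  qed
  then show "star_of (adjointable_ops X) f \<in> NTc" "scale_of (adjointable_ops X) c f \<in> NTc"
    by (simp_all add: NT_def generated_cstar_algebra_def)
qed

lemma NT_closed:
  shows NT_add [simp]: "f \<in> NTc \<Longrightarrow> g \<in> NTc \<Longrightarrow> op_add f g \<in> NTc"
    and NT_comp [simp]: "f \<in> NTc \<Longrightarrow> g \<in> NTc \<Longrightarrow> f \<circ> g \<in> NTc"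
    and NT_adj [simp]: "f \<in> NTc \<Longrightarrow> adj f \<in> NTc"
    and NT_scale [simp]: "f \<in> NTc \<Longrightarrow> op_scale c f \<in> NTc"
  using star_subalgebra_NT by (auto simp: star_subalgebra_def)

lemma closed_in_NT: "closed_in (adjointable_ops X) NTc"
  unfolding NT_def generated_cstar_algebra_def closed_in_def by simp blast

lemma NT_sum:
  "finite J \<Longrightarrow> (\<And>j. j \<in> J \<Longrightarrow> f j \<in> NTc) \<Longrightarrow> (\<lambda>\<eta> m. \<Sum>j\<in>J. f j \<eta> m) \<in> NTc"
proof (induction J rule: finite_induct)
  case empty
  have "op_scale 0 (fpi X 0) = (\<lambda>\<eta> m. 0)"
    by (simp add: op_scale_def)
  then show ?case
    using NT_scale[OF fpi_NT[of 0], of 0] by simp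
next
  case (insert j J)
  then have "op_add (f j) (\<lambda>\<eta> m. \<Sum>j\<in>J. f j \<eta> m) \<in> NTc"
    by (intro NT_add) auto
  moreover have "op_add (f j) (\<lambda>\<eta> m. \<Sum>j\<in>J. f j \<eta> m) = (\<lambda>\<eta> m. \<Sum>j\<in>insert j J. f j \<eta> m)"
    using insert by (simp add: op_add_def)
  ultimately show ?case
    by simp
qed

lemma monomial_eq: "monomial X n \<xi> m \<eta> = creation X n \<xi> \<circ> adj (creation X m \<eta>)"
  by (simp add: monomial_def)

text \<open>The closed form of \<open>defect_proj\<close>. In particular \<open>proj {}\<close> is
  the identity and \<open>proj UNIV\<close> is the projection onto the fibre at 0.\<close>

definition proj :: "'n set \<Rightarrow> ('n, 'x) fop" where
  "proj F = on_fock X (\<lambda>\<eta> m. if supp m \<inter> F = {} then \<eta> m else 0)"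

lemma proj_apply: "\<eta> \<in> fock X \<Longrightarrow> proj F \<eta> m = (if supp m \<inter> F = {} then \<eta> m else 0)"
  by (simp add: proj_def on_fock_def)

lemma proj_fock:
  assumes \<eta>: "\<eta> \<in> fock X"
  shows "proj F \<eta> \<in> fock X" and "fock_norm X (proj F \<eta>) \<le> 1 * fock_norm X \<eta>"
proof -
  have sum: "norm (\<Sum>m\<in>G. ipf m (proj F \<eta> m) (proj F \<eta> m)) \<le> norm (\<Sum>m\<in>G. ipf m (\<eta> m) (\<eta> m))" for G
    by (rule pos_sum_norm_mono) (auto simp: proj_apply[OF \<eta>] fock_mem[OF \<eta>] ip_pos)
  show P: "proj F \<eta> \<in> fock X"
    by (rule fockI[OF _ \<eta>, of _ 1]) (use sum in \<open>auto simp: proj_apply[OF \<eta>] fock_mem[OF \<eta>]\<close>)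
  have "norm (fock_ip X (proj F \<eta>) (proj F \<eta>)) \<le> (fock_norm X \<eta>)\<^sup>2"
    unfolding fock_ip_def
    by (rule norm_infsum_le_finite[OF fock_summable_self[OF P]])
      (rule order_trans[OF sum norm_finite_le_fock[OF \<eta>]])
  then have "(fock_norm X (proj F \<eta>))\<^sup>2 \<le> (fock_norm X \<eta>)\<^sup>2"
    by (simp add: fk.nrm_square)
  then show "fock_norm X (proj F \<eta>) \<le> 1 * fock_norm X \<eta>"
    using power2_le_imp_le[OF _ fk.nrm_nonneg] by simp
qed

lemma proj_Op [simp]: "proj F \<in> Op" and adj_proj [simp]: "adj (proj F) = proj F"
proof -
  have op: "fock_operator X (proj F)"
    by (auto simp: fock_operator_def proj_fock) (simp add: proj_def on_fock_def)
  have ip: "fock_ip X (proj F \<eta>) \<zeta> = fock_ip X \<eta> (proj F \<zeta>)" if "\<eta> \<in> fock X" "\<zeta> \<in> fock X" for \<eta> \<zeta>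
    unfolding fock_ip_def
    by (rule infsum_cong) (simp add: proj_apply that fock_mem[OF that(1)] fock_mem[OF that(2)])
  show "proj F \<in> Op" "adj (proj F) = proj F"
    using OpI[OF op op ip proj_fock(2)] by auto
qed

lemma proj_comp: "proj F \<circ> proj G = proj (F \<union> G)"
  by (rule Op_eqI) (auto simp: fun_eq_iff proj_apply proj_fock)

lemma proj_empty: "proj {} = on_fock X (\<lambda>\<eta>. \<eta>)"
  by (simp add: proj_def)

lemma comp_proj_empty [simp]: "f \<in> Op \<Longrightarrow> f \<circ> proj {} = f"
proof -
  assume f: "f \<in> Op"
  then have "f \<circ> proj {} \<in> Op"
    by simp
  then show "f \<circ> proj {} = f"
    by (rule Op_eqI[OF _ f]) (simp add: proj_empty on_fock_def)
qed

lemma proj_empty_comp [simp]: "f \<in> Op \<Longrightarrow> proj {} \<circ> f = f"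
proof -
  assume f: "f \<in> Op"
  then have "proj {} \<circ> f \<in> Op"
    by simp
  then show "proj {} \<circ> f = f"
    by (rule Op_eqI[OF _ f]) (simp add: proj_empty on_fock_def Op_mem[OF f])
qed

lemma proj_UNIV_apply: "\<eta> \<in> fock X \<Longrightarrow> proj UNIV \<eta> = single 0 (\<eta> 0)"
proof -
  have "supp m \<inter> UNIV = {} \<longleftrightarrow> m = 0" for m :: "nat ^ 'n"
    by (auto simp: supp_def vec_eq_iff)
  then show "\<eta> \<in> fock X \<Longrightarrow> proj UNIV \<eta> = single 0 (\<eta> 0)"
    by (simp add: fun_eq_iff proj_apply single_def)
qed

end

section \<open>Defect projections in terms of supports\<close>

context framed_system
begin

lemma range_proj_NT: "range_proj X d x i \<in> NTc"
proof -
  have "range_proj X d x i =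
      (\<lambda>\<eta> m. \<Sum>j<d i. (creation X (axis i 1) (x i j) \<circ> adj (creation X (axis i 1) (x i j))) \<eta> m)"
    by (simp add: range_proj_def monomial_eq)
  also have "\<dots> \<in> NTc"
    by (rule NT_sum[of "{..<d i}" "\<lambda>j. creation X (axis i 1) (x i j) \<circ> adj (creation X (axis i 1) (x i j))"])
      (simp_all only: finite_lessThan lessThan_iff NT_comp NT_adj creation_NT frame_mem)
  finally show ?thesis .
qed

text \<open>Where \<open>m $ i \<noteq> 0\<close> this is the resolution of the identity
  \<open>frame_prd\<close>; elsewhere creation from the fibre at \<open>axis i 1\<close> produces
  nothing.\<close>

lemma range_proj_apply:
  assumes \<eta>: "\<eta> \<in> fock X"
  shows "range_proj X d x i \<eta> m = (if m $ i \<noteq> 0 then \<eta> m else 0)"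
proof -
  have ann: "annihilation (axis i 1) (x i j) \<eta> \<in> fock X" if "j < d i" for j
    using that \<eta> by (intro annihilation_fock) auto
  have eq: "range_proj X d x i \<eta> m =
      (\<Sum>j<d i. creation X (axis i 1) (x i j) (annihilation (axis i 1) (x i j) \<eta>) m)"
    unfolding range_proj_def by (rule sum.cong) (auto simp: monomial_eq adj_creation)
  show ?thesis
  proof (cases "m $ i = 0")
    case True
    then have "\<nexists>k. m = axis i 1 + k"
      by (auto simp: axis_def)
    then show ?thesis
      unfolding eq using True by (simp add: creation_other)
  next
    case False
    define k where "k = m - axis i 1"
    have m: "m = axis i 1 + k"
      using vec_split[OF False] by (simp add: k_def)
    have "range_proj X d x i \<eta> m = (\<Sum>j<d i. prd X (axis i 1) k (x i j) (ladj (axis i 1) (x i j) k (\<eta> (axis i 1 + k))))"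
      unfolding eq
      by (rule sum.cong) (simp_all add: m creation_add[OF ann], simp add: annihilation_def on_fock_def \<eta>)
    also have "\<dots> = \<eta> m"
      using frame_prd[of "\<eta> (axis i 1 + k)" i k] fock_mem[OF \<eta>] m by simp
    finally show ?thesis
      using False by simp
  qed
qed

lemma proj_singleton: "on_fock X (\<lambda>\<eta> m. \<eta> m - range_proj X d x i \<eta> m) = proj {i}"
  by (auto simp: fun_eq_iff on_fock_def proj_def range_proj_apply supp_def)

lemma defect_proj_eq: "defect_proj X d x F = proj F"
proof -
  interpret comp_fun_commute "\<lambda>i T. proj {i} \<circ> T"
    by unfold_locales (auto simp: comp_def proj_comp[unfolded comp_def, THEN fun_cong] insert_commute
      fun_eq_iff intro!: arg_cong2[where f="\<lambda>f x. f x"])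
  have "defect_proj X d x F = Finite_Set.fold (\<lambda>i T. proj {i} \<circ> T) (proj {}) F"
    unfolding defect_proj_def proj_singleton proj_empty ..
  also have "\<dots> = proj F"
  proof -
    have "finite F"
      by simp
    then show ?thesis
    proof (induction F rule: finite_induct)
      case (insert i F)
      show ?case
        unfolding fold_insert[OF insert(1,2)] insert(3) by (simp add: proj_comp)
    qed simp
  qed
  finally show ?thesis .
qed

text \<open>Even if \<open>proj {i}\<close> lies outside the algebra, this formula shows that its
  products with elements of the algebra stay inside.\<close>

lemma proj_diff:
  assumes f: "f \<in> Op"
  shows "proj {i} \<circ> f = op_add f (op_scale (-1) (range_proj X d x i \<circ> f))"
proof (rule Op_eqI)
  have R: "range_proj X d x i \<in> Op"
    using range_proj_NT NT_Op by blast
  then show "op_add f (op_scale (-1) (range_proj X d x i \<circ> f)) \<in> Op"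
    using f by simp
  fix \<eta> assume \<eta>: "\<eta> \<in> fock X"
  show "(proj {i} \<circ> f) \<eta> = op_add f (op_scale (-1) (range_proj X d x i \<circ> f)) \<eta>"
    using Op_mem[OF f \<eta>]
    by (auto simp: op_scale_minus_one proj_apply range_proj_apply supp_def fun_eq_iff)
qed (use f in simp)

lemma proj_diff_right:
  assumes f: "f \<in> Op"
  shows "f \<circ> proj {i} = op_add f (op_scale (-1) (f \<circ> range_proj X d x i))"
proof (rule Op_eqI)
  have R: "range_proj X d x i \<in> Op"
    using range_proj_NT NT_Op by blast
  then show "op_add f (op_scale (-1) (f \<circ> range_proj X d x i)) \<in> Op"
    using f by simp
  fix \<eta> assume \<eta>: "\<eta> \<in> fock X"
  have "proj {i} \<eta> = (\<lambda>m. \<eta> m - range_proj X d x i \<eta> m)"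
    using \<eta> by (auto simp: proj_apply range_proj_apply supp_def)
  then show "(f \<circ> proj {i}) \<eta> = op_add f (op_scale (-1) (f \<circ> range_proj X d x i)) \<eta>"
    using \<eta> f Op_mem[OF R \<eta>] by (simp add: op_scale_minus_one Op_diff_vec)
qed (use f in simp)

text \<open>\<open>proj F\<close> is built up one index at a time, so a property only has to survive
  multiplication by a single \<open>proj {i}\<close>.\<close>

lemma proj_NT_induct:
  fixes F :: "'n set"
  assumes "P f" "\<And>i g. g \<in> NTc \<Longrightarrow> P g \<Longrightarrow> P (proj {i} \<circ> g)" "f \<in> NTc"
  shows "proj F \<circ> f \<in> NTc \<and> P (proj F \<circ> f)"
proof -
  have "finite F"
    by simp
  then show ?thesis
  proof (induction F rule: finite_induct)
    case empty
    have "proj {} \<circ> f = f"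
      using assms(3) by (intro Op_eqI) (simp_all add: fun_eq_iff proj_apply Op_mem)
    then show ?case
      using assms by simp
  next
    case (insert i F)
    have IH: "proj F \<circ> f \<in> NTc" "P (proj F \<circ> f)"
      using insert.IH by blast+
    have eq: "proj (insert i F) \<circ> f = proj {i} \<circ> (proj F \<circ> f)"
      unfolding comp_assoc[symmetric] proj_comp by simp
    have "proj {i} \<circ> (proj F \<circ> f) \<in> NTc"
      unfolding proj_diff[OF NT_Op[OF IH(1)]] by (intro NT_add NT_scale NT_comp range_proj_NT IH)
    then show ?case
      unfolding eq using assms(2)[OF IH] by blast
  qed
qed

lemma proj_left_NT [simp]: "f \<in> NTc \<Longrightarrow> proj F \<circ> f \<in> NTc"
  using proj_NT_induct[of "\<lambda>_. True"] by blast

lemma proj_right_NT [simp]: "f \<in> NTc \<Longrightarrow> f \<circ> proj F \<in> NTc"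
  using NT_adj[OF proj_left_NT[OF NT_adj], of f F] by (simp add: adj_op_comp)

end

section \<open>The rotation and the vacuum expectation\<close>

definition phase :: "real \<Rightarrow> int \<Rightarrow> complex" where
  "phase r k = exp (\<i> * of_real (r * of_int k))"

lemma phase_add_left: "phase (r + s) k = phase r k * phase s k"
  by (simp add: phase_def exp_add[symmetric] algebra_simps)

lemma phase_add_right: "phase r (k + l) = phase r k * phase r l"
  by (simp add: phase_def exp_add[symmetric] algebra_simps)

lemma phase_zero [simp]: "phase 0 k = 1" "phase r 0 = 1"
  by (simp_all add: phase_def)

lemma cmod_phase [simp]: "cmod (phase r k) = 1"
  by (simp add: phase_def)

lemma cnj_phase: "cnj (phase r k) = phase (- r) k" "cnj (phase r k) = phase r (- k)"
  by (simp_all add: phase_def exp_cnj)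

lemma phase_2pi: "phase (r + 2 * pi) k = phase r k"
proof -
  have "\<i> * of_real ((r + 2 * pi) * of_int k) = \<i> * of_real (r * of_int k) + of_real (2 * of_int k * pi) * \<i>"
    by (simp add: algebra_simps)
  then show ?thesis
    unfolding phase_def by (simp only: exp_add exp_integer_2pi[OF Ints_of_int] mult_1_right)
qed

lemma phase_eq_1_imp: "(\<And>r. phase r k = 1) \<Longrightarrow> k = 0"
proof (rule ccontr)
  assume k: "k \<noteq> 0" and "\<And>r. phase r k = 1"
  then have "phase (pi / of_int k) k = 1"
    by blast
  then show False
    using k by (simp add: phase_def)
qed

definition vec_rot :: "real \<Rightarrow> ('n::finite, 'x::complex_vector) fvec \<Rightarrow> ('n, 'x) fvec" where
  "vec_rot r \<eta> = (\<lambda>m. phase r (int (deg m)) *\<^sub>C \<eta> m)"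

lemma vec_rot_add: "vec_rot r (vec_rot s \<eta>) = vec_rot (r + s) \<eta>"
  by (simp add: vec_rot_def scaleC_scaleC phase_add_left)

lemma vec_rot_zero [simp]: "vec_rot 0 \<eta> = \<eta>"
  by (simp add: vec_rot_def scaleC_one)

lemma rotation_eq: "rotation r T = (\<lambda>\<eta>. vec_rot r (T (vec_rot (- r) \<eta>)))"
proof -
  have "(\<Prod>i\<in>UNIV. exp (\<i> * complex_of_real r) ^ (m $ i)) = phase r (int (deg m))" for r and m :: "nat ^ 'a"
  proof -
    have "phase r (int (deg m)) = exp (\<i> * complex_of_real r) ^ deg m"
      by (simp add: phase_def exp_of_nat_mult[symmetric] mult_ac)
    then show ?thesis
      by (simp add: deg_def power_sum)
  qed
  then have g: "gauge_unitary (\<lambda>_. exp (\<i> * complex_of_real r)) = (vec_rot r :: ('a, 'b) fop)" for r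
    by (simp add: gauge_unitary_def vec_rot_def fun_eq_iff)
  have "cnj (exp (\<i> * complex_of_real r)) = exp (\<i> * complex_of_real (- r))"
    by (simp add: exp_cnj)
  then show ?thesis
    unfolding rotation_def gauge_action_def by (simp only: g) (simp add: comp_def)
qed

lemma rotation_op_add: "rotation r (op_add S T) = op_add (rotation r S) (rotation r T)"
  by (simp add: rotation_eq op_add_def vec_rot_def scaleC_add_right)

lemma rotation_op_scale: "rotation r (op_scale c T) = op_scale c (rotation r T)"
  by (simp add: rotation_eq op_scale_def vec_rot_def scaleC_scaleC mult.commute)

lemma rotation_comp: "rotation r (S \<circ> T) = rotation r S \<circ> rotation r T"
  by (simp add: rotation_eq comp_def vec_rot_add)

lemma rotation_rotation: "rotation r (rotation s T) = rotation (r + s) T"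
  by (simp add: rotation_eq vec_rot_add algebra_simps)

lemma rotation_zero [simp]: "rotation 0 T = T"
  by (simp add: rotation_eq)

lemma vec_rot_2pi: "vec_rot (r + 2 * pi) \<eta> = vec_rot r \<eta>"
  by (simp add: vec_rot_def phase_2pi)

lemma rotation_2pi: "rotation (r + 2 * pi) T = rotation r T"
proof -
  have "vec_rot (- (r + 2 * pi)) \<eta> = vec_rot (- r) \<eta>" for \<eta> :: "('a, 'b) fvec"
    using vec_rot_2pi[of "- (r + 2 * pi)" \<eta>] by simp
  then show ?thesis
    unfolding rotation_eq vec_rot_2pi by simp
qed

text \<open>For \<open>a = p\<close> and \<open>b = star p * p\<close> the square of
  \<open>star p * p\<close> vanishes. It follows later that matrix coefficients over the fibre at 0
  determine an element of \<open>'a\<close>.\<close>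

lemma two_sided_zero:
  fixes p :: "'a::cstar_algebra"
  assumes "\<And>a b. star a * (p * b) = 0"
  shows "p = 0"
proof -
  have "star p * p * (star p * p) = 0"
    using assms[of p "star p * p"] by (simp add: mult.assoc)
  then have "star p * p = 0"
    using star_mult_self_eq_zero[of "star p * p"] by (simp add: star_mult star_star)
  then show ?thesis
    by (rule star_mult_self_eq_zero)
qed

context product_sys
begin

lemma vec_rot_fock:
  assumes \<eta>: "\<eta> \<in> fock X"
  shows vec_rot_mem [simp]: "vec_rot r \<eta> \<in> fock X" and vec_rot_norm: "fock_norm X (vec_rot r \<eta>) = fock_norm X \<eta>"
proof -
  have "ipf m (vec_rot r \<eta> m) (vec_rot r \<eta> m) = ipf m (\<eta> m) (\<eta> m)" for m
    using fock_mem[OF \<eta>]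
    by (simp add: vec_rot_def fib.inner_sc fib.inner_sc_left scaleC_scaleC cnj_phase(1)
      phase_add_left[symmetric] scaleC_one)
  then have eq: "(\<lambda>m. ipf m (vec_rot r \<eta> m) (vec_rot r \<eta> m)) = (\<lambda>m. ipf m (\<eta> m) (\<eta> m))"
    by blast
  then show "vec_rot r \<eta> \<in> fock X"
    using fock_summable_self[OF \<eta>] fock_mem[OF \<eta>] by (simp add: fock_def vec_rot_def)
  show "fock_norm X (vec_rot r \<eta>) = fock_norm X \<eta>"
    by (simp add: fock_norm_def fock_ip_def eq)
qed

lemma vec_rot_ip: "\<eta> \<in> fock X \<Longrightarrow> \<zeta> \<in> fock X \<Longrightarrow> fock_ip X (vec_rot r \<eta>) \<zeta> = fock_ip X \<eta> (vec_rot (- r) \<zeta>)"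
  unfolding fock_ip_def
  by (rule infsum_cong) (simp add: vec_rot_def fib.inner_sc fib.inner_sc_left fock_mem[of \<eta>] fock_mem[of \<zeta>] cnj_phase(1))

lemma vec_rot_fock_iff: "vec_rot r \<eta> \<in> fock X \<longleftrightarrow> \<eta> \<in> fock X"
  using vec_rot_mem[of "vec_rot r \<eta>" "- r"] by (auto simp: vec_rot_add)

lemma
  assumes T: "T \<in> Op"
  shows rotation_Op [simp]: "rotation r T \<in> Op" and adj_rotation: "adj (rotation r T) = rotation r (adj T)"
proof -
  have op: "fock_operator X (rotation r T)" if T: "T \<in> Op" for T
    using T by (auto simp: fock_operator_def rotation_eq vec_rot_fock_iff Op_mem Op_out)
      (simp add: vec_rot_def)
  have nb: "fock_norm X (rotation r T \<eta>) \<le> opnorm T * fock_norm X \<eta>" if "\<eta> \<in> fock X" for \<eta>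
    using opnorm_bound[OF T vec_rot_mem[OF that, of "- r"]] T that
    by (simp add: rotation_eq vec_rot_norm Op_mem)
  have ip: "fock_ip X (rotation r T \<eta>) \<zeta> = fock_ip X \<eta> (rotation r (adj T) \<zeta>)"
    if "\<eta> \<in> fock X" "\<zeta> \<in> fock X" for \<eta> \<zeta>
    using that T by (simp add: rotation_eq vec_rot_ip Op_mem adj_ip adj_mem)
  show "rotation r T \<in> Op" "adj (rotation r T) = rotation r (adj T)"
    using OpI[OF op[OF T] op[OF adj_Op[OF T]] ip nb] by auto
qed

lemma opnorm_rotation:
  assumes T: "T \<in> Op"
  shows "opnorm (rotation r T) = opnorm T"
proof -
  have le: "opnorm (rotation r T) \<le> opnorm T" if T: "T \<in> Op" for r T
  proof (rule opnorm_le[OF opnorm_nonneg[OF T]])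
    show "fock_norm X (rotation r T \<eta>) \<le> opnorm T * fock_norm X \<eta>" if "\<eta> \<in> fock X" for \<eta>
      using opnorm_bound[OF T vec_rot_mem[OF that, of "- r"]] T that
      by (simp add: rotation_eq vec_rot_norm Op_mem)
  qed
  show ?thesis
    using le[OF T, of r] le[OF rotation_Op[OF T], of "- r" r] by (simp add: rotation_rotation)
qed

lemma rotation_creation:
  assumes \<xi>: "\<xi> \<in> M n"
  shows "rotation r (creation X n \<xi>) = op_scale (phase r (int (deg n))) (creation X n \<xi>)"
proof (rule Op_eqI)
  fix \<eta> assume \<eta>: "\<eta> \<in> fock X"
  show "rotation r (creation X n \<xi>) \<eta> = op_scale (phase r (int (deg n))) (creation X n \<xi>) \<eta>"
  proof
    fix m
    show "rotation r (creation X n \<xi>) \<eta> m = op_scale (phase r (int (deg n))) (creation X n \<xi>) \<eta> m"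
    proof (cases "\<exists>k. m = n + k")
      case True
      then obtain k where m: "m = n + k"
        by blast
      have "rotation r (creation X n \<xi>) \<eta> m =
          phase r (int (deg m)) *\<^sub>C prd X n k \<xi> (phase (- r) (int (deg k)) *\<^sub>C \<eta> k)"
        unfolding m using \<eta> by (simp add: rotation_eq vec_rot_def[of r] creation_add) (simp add: vec_rot_def)
      also have "\<dots> = (phase r (int (deg m)) * phase (- r) (int (deg k))) *\<^sub>C prd X n k \<xi> (\<eta> k)"
        using prd_scaleC_right[OF \<xi> fock_mem[OF \<eta>]] by (simp add: scaleC_scaleC)
      also have "phase r (int (deg m)) * phase (- r) (int (deg k)) = phase r (int (deg n))"
        unfolding m by (simp add: deg_add phase_add_right mult.assoc phase_add_left[symmetric])
      finally show ?thesis
        using \<eta> by (simp add: m op_scale_def creation_add)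
    qed (simp add: rotation_eq vec_rot_def[of r] op_scale_def creation_other)
  qed
qed (use \<xi> in simp_all)

lemma rotation_NT [simp]: "f \<in> NTc \<Longrightarrow> rotation r f \<in> NTc"
proof -
  let ?S = "{f \<in> NTc. rotation r f \<in> NTc}"
  have rot0: "\<exists>f. f \<in> NTc \<and> rotation r f \<in> NTc"
    by (rule exI[of _ "fpi X 0"]) (simp add: fpi_eq_creation rotation_creation)
  have "NTc \<subseteq> ?S"
  proof (rule NT_induct)
    show "star_subalgebra (adjointable_ops X) ?S"
      using star_subalgebra_NT rot0
      by (auto simp: star_subalgebra_def rotation_op_add rotation_op_scale rotation_comp adj_rotation[symmetric])
    show "closed_in (adjointable_ops X) ?S"
      unfolding closed_in_def
    proof (intro allI impI)
      fix s f assume A: "(\<forall>k::nat. s k \<in> ?S) \<and> f \<in> Op \<and> (\<lambda>k. dist_of (adjointable_ops X) (s k) f) \<longlonglongrightarrow> 0"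
      then have f: "f \<in> NTc"
        using closed_in_NT unfolding closed_in_def by blast
      have "dist_of (adjointable_ops X) (rotation r (s k)) (rotation r f) = dist_of (adjointable_ops X) (s k) f" for k
      proof -
        have "s k \<in> Op"
          using A NT_Op by blast
        then show ?thesis
          using A opnorm_rotation[of "op_add (s k) (op_scale (-1) f)" r]
          by (simp add: dist_of_def rotation_op_add rotation_op_scale)
      qed
      then have "(\<lambda>k. dist_of (adjointable_ops X) (rotation r (s k)) (rotation r f)) \<longlonglongrightarrow> 0"
        using A by simp
      then have "rotation r f \<in> NTc"
        using A f NT_Op closed_in_NT[unfolded closed_in_def, rule_format, of "\<lambda>k. rotation r (s k)" "rotation r f"] by simp
      then show "f \<in> ?S"
        using f by simp
    qed
  qed (simp add: rotation_creation)
  then show "f \<in> NTc \<Longrightarrow> rotation r f \<in> NTc"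
    by blast
qed

section \<open>Spectral subspaces of the rotation and columns at 0\<close>

definition homogeneous :: "int \<Rightarrow> ('n, 'x) fop \<Rightarrow> bool" where
  "homogeneous k f \<longleftrightarrow> f \<in> NTc \<and> (\<forall>r. rotation r f = op_scale (phase r k) f)"

lemma homogeneous_creation: "\<xi> \<in> M n \<Longrightarrow> homogeneous (int (deg n)) (creation X n \<xi>)"
  by (simp add: homogeneous_def rotation_creation)

lemma homogeneous_comp: "homogeneous k f \<Longrightarrow> homogeneous l g \<Longrightarrow> homogeneous (k + l) (f \<circ> g)"
  by (simp add: homogeneous_def rotation_comp op_comp_scale_left op_comp_scale_right op_scale_op_scale phase_add_right)

lemma homogeneous_adj: "homogeneous k f \<Longrightarrow> homogeneous (- k) (adj f)"
  by (simp add: homogeneous_def adj_rotation[symmetric] adj_op_scale cnj_phase(2))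

lemma homogeneous_scale: "homogeneous k f \<Longrightarrow> homogeneous k (op_scale c f)"
  by (simp add: homogeneous_def rotation_op_scale op_scale_op_scale mult.commute)

text \<open>
  The column at 0 of an element of the Toeplitz algebra is the multiple \<open>a \<mapsto> \<xi> a\<close> of a vector, that
  is, of the image of a formal unit vector of the fibre at 0.
\<close>

definition has_vac :: "('n, 'x) fop \<Rightarrow> ('n, 'x) fvec \<Rightarrow> bool" where
  "has_vac f \<xi> \<longleftrightarrow> \<xi> \<in> fock X \<and> (\<forall>a. f (single 0 (emb X a)) = vec_rmul \<xi> a)"

lemma emb_single_mem [simp]: "single 0 (emb X a) \<in> fock X"
  by simp

text \<open>The column is tested at \<open>a = c\<close>, the inner square of \<open>\<xi>\<close>
  itself: the image has squared norm \<open>norm c ^ 3\<close>, the argument has squared norm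
  \<open>(norm c)\<^sup>2\<close>.\<close>

lemma has_vac_norm:
  assumes f: "f \<in> Op" and \<xi>: "has_vac f \<xi>"
  shows "fock_norm X \<xi> \<le> opnorm f"
proof -
  define c where "c = fock_ip X \<xi> \<xi>"
  have \<xi>m: "\<xi> \<in> fock X" and \<xi>a: "\<And>a. f (single 0 (emb X a)) = vec_rmul \<xi> a"
    using \<xi> by (auto simp: has_vac_def)
  have c: "star c = c"
    using fk.inner_pos[OF \<xi>m] pos_self_adjoint c_def by blast
  have "(fock_norm X (vec_rmul \<xi> c))\<^sup>2 = norm (c * c * c)"
    using \<xi>m c by (simp add: fk.nrm_square fk.inner_simps fk.mem mult.assoc flip: c_def)
  then have "norm c ^ 3 = (fock_norm X (f (single 0 (emb X c))))\<^sup>2"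
    using norm_self_adjoint_cube[OF c] \<xi>a by simp
  also have "\<dots> \<le> (opnorm f * norm c)\<^sup>2"
    using opnorm_bound[OF f emb_single_mem, of c] by (intro power_mono) (simp_all add: fock_norm_single mnorm_emb)
  finally have le: "norm c * (norm c)\<^sup>2 \<le> (opnorm f)\<^sup>2 * (norm c)\<^sup>2"
    by (simp add: power_mult_distrib power3_eq_cube power2_eq_square mult_ac)
  have "norm c \<le> (opnorm f)\<^sup>2"
  proof (cases "norm c = 0")
    case False
    then have "(norm c)\<^sup>2 > 0"
      by simp
    then show ?thesis
      using le by (rule mult_right_le_imp_le[rotated])
  qed simp
  then have "(fock_norm X \<xi>)\<^sup>2 \<le> (opnorm f)\<^sup>2"
    by (simp add: fk.nrm_square c_def)
  then show ?thesis
    using power2_le_imp_le[OF _ opnorm_nonneg[OF f]] by blast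
qed

lemma vec_rmul_add: "\<eta> \<in> fock X \<Longrightarrow> \<zeta> \<in> fock X \<Longrightarrow> vec_rmul (vec_add \<eta> \<zeta>) a = vec_add (vec_rmul \<eta> a) (vec_rmul \<zeta> a)"
  by (simp add: vec_rmul_def vec_add_def rmul_add fock_mem[of \<eta>] fock_mem[of \<zeta>])

lemma vec_rmul_scale: "\<eta> \<in> fock X \<Longrightarrow> vec_rmul (vec_scale c \<eta>) a = vec_scale c (vec_rmul \<eta> a)"
  by (simp add: vec_rmul_def vec_scale_def rmul_scaleC fock_mem[of \<eta>])

lemma has_vac_add: "has_vac f \<xi> \<Longrightarrow> has_vac g \<zeta> \<Longrightarrow> has_vac (op_add f g) (vec_add \<xi> \<zeta>)"
  by (simp add: has_vac_def op_add_apply fk.mem vec_rmul_add)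

lemma has_vac_scale: "has_vac f \<xi> \<Longrightarrow> has_vac (op_scale c f) (vec_scale c \<xi>)"
  by (simp add: has_vac_def op_scale_apply fk.mem vec_rmul_scale)

lemma has_vac_comp: "g \<in> Op \<Longrightarrow> has_vac f \<xi> \<Longrightarrow> has_vac (g \<circ> f) (g \<xi>)"
  by (simp add: has_vac_def Op_mem Op_rmul_vec)

lemma has_vac_creation: "\<xi> \<in> M n \<Longrightarrow> has_vac (creation X n \<xi>) (single n \<xi>)"
  by (simp add: has_vac_def creation_single)

lemma has_vac_diff: "has_vac f \<xi> \<Longrightarrow> has_vac g \<zeta> \<Longrightarrow> has_vac (op_add f (op_scale (-1) g)) (\<lambda>m. \<xi> m - \<zeta> m)"
proof -
  assume "has_vac f \<xi>" "has_vac g \<zeta>"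
  then have "has_vac (op_add f (op_scale (-1) g)) (vec_add \<xi> (vec_scale (-1) \<zeta>))"
    by (intro has_vac_add has_vac_scale)
  then show ?thesis
    by (simp add: vec_add_def vec_scale_def)
qed

lemma dist_of_ops: "dist_of (adjointable_ops X) f g = opnorm (op_add f (op_scale (-1) g))"
  by (simp add: dist_of_def)

lemma dist_ops_triangle:
  assumes "f \<in> Op" "g \<in> Op" "h \<in> Op"
  shows "opnorm (op_add f (op_scale (-1) g)) \<le>
    opnorm (op_add f (op_scale (-1) h)) + opnorm (op_add g (op_scale (-1) h))"
proof -
  have "op_add f (op_scale (-1) g) =
      op_add (op_add f (op_scale (-1) h)) (op_scale (-1) (op_add g (op_scale (-1) h)))"
    by (simp add: op_add_def op_scale_def fun_eq_iff)
  then show ?thesis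
    using opnorm_add[of "op_add f (op_scale (-1) h)" "op_scale (-1) (op_add g (op_scale (-1) h))"] assms
    by (simp add: opnorm_scale)
qed

text \<open>\<open>has_vac_norm\<close> applied to differences makes the vectors Cauchy, so
  completeness of the Fock module supplies the vector of the limit.\<close>

lemma has_vac_limit:
  assumes s: "\<And>k::nat. s k \<in> Op" "\<And>k. \<exists>\<xi>. has_vac (s k) \<xi>" and f: "f \<in> Op"
    and lim: "(\<lambda>k. opnorm (op_add (s k) (op_scale (-1) f))) \<longlonglongrightarrow> 0"
  shows "\<exists>\<xi>. has_vac f \<xi>"
proof -
  let ?d = "\<lambda>k. opnorm (op_add (s k) (op_scale (-1) f))"
  obtain \<xi> where \<xi>: "\<And>k. has_vac (s k) (\<xi> k)"
    using s(2) by metis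
  have \<xi>m: "\<xi> k \<in> fock X" for k
    using \<xi> has_vac_def by blast
  have est: "fock_norm X (\<lambda>m. \<xi> k m - \<xi> l m) \<le> ?d k + ?d l" for k l
    using has_vac_norm[OF _ has_vac_diff[OF \<xi>[of k] \<xi>[of l]]] dist_ops_triangle[OF s(1) s(1) f, of k l] s(1) by simp
  have "\<exists>\<zeta>\<in>fock X. (\<lambda>k. fock_norm X (\<lambda>m. \<xi> k m - \<zeta> m)) \<longlonglongrightarrow> 0"
  proof (rule fock_complete[OF \<xi>m])
    fix e :: real assume "e > 0"
    then have "e / 2 > 0"
      by simp
    then obtain K where "\<And>k. k \<ge> K \<Longrightarrow> norm (?d k - 0) < e / 2"
      using LIMSEQ_D[OF lim] by blast
    then have K: "?d k < e / 2" if "k \<ge> K" for k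
      using that by fastforce
    have "fock_norm X (\<lambda>m. \<xi> k m - \<xi> l m) < e" if "k \<ge> K" "l \<ge> K" for k l
      using est[of k l] K[OF that(1)] K[OF that(2)] by linarith
    then show "\<exists>K. \<forall>k\<ge>K. \<forall>l\<ge>K. fock_norm X (\<lambda>m. \<xi> k m - \<xi> l m) < e"
      by blast
  qed
  then obtain \<zeta> where \<zeta>: "\<zeta> \<in> fock X" "(\<lambda>k. fock_norm X (\<lambda>m. \<xi> k m - \<zeta> m)) \<longlonglongrightarrow> 0"
    by blast
  have "f (single 0 (emb X a)) = vec_rmul \<zeta> a" for a
  proof -
    let ?\<delta> = "single 0 (emb X a)"
    define v where "v = (\<lambda>m. f ?\<delta> m - vec_rmul \<zeta> a m)"
    have vm: "v \<in> fock X"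
      using f \<zeta> by (simp add: v_def fk.mem Op_mem)
    have "fock_norm X v \<le> ?d k * norm a + fock_norm X (\<lambda>m. \<xi> k m - \<zeta> m) * norm a" for k
    proof -
      let ?u = "vec_rmul (\<lambda>m. \<xi> k m - \<zeta> m) a"
      let ?w = "op_add (s k) (op_scale (-1) f) ?\<delta>"
      have "v = (\<lambda>m. ?u m - ?w m)"
      proof
        fix m
        have "rmf m (\<xi> k m - \<zeta> m) a = rmf m (\<xi> k m) a - rmf m (\<zeta> m) a"
          using rmul_add[of "\<xi> k m - \<zeta> m" m "\<zeta> m" a] fock_mem[OF \<xi>m] fock_mem[OF \<zeta>(1)] by simp
        moreover have "s k ?\<delta> = vec_rmul (\<xi> k) a"
          using \<xi> by (simp add: has_vac_def)
        ultimately show "v m = ?u m - ?w m"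
          by (simp add: v_def op_scale_minus_one vec_rmul_def)
      qed
      moreover have "?u \<in> fock X"
        by (rule fk.rm_mem[OF fk.sub_mem[OF \<xi>m \<zeta>(1)]])
      moreover have "?w \<in> fock X"
        by (rule Op_mem) (simp_all add: s f)
      ultimately have "fock_norm X v \<le> fock_norm X ?u + fock_norm X ?w"
        using fk.nrm_sub_le[of ?u ?w] by simp
      also have "fock_norm X ?u \<le> fock_norm X (\<lambda>m. \<xi> k m - \<zeta> m) * norm a"
        by (rule fk.nrm_rm_le[OF fk.sub_mem[OF \<xi>m \<zeta>(1)]])
      also have "fock_norm X ?w \<le> ?d k * norm a"
        using opnorm_bound[of "op_add (s k) (op_scale (-1) f)" ?\<delta>] s f
        by (simp add: fock_norm_single mnorm_emb)
      finally show ?thesis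
        by simp
    qed
    moreover have "(\<lambda>k. ?d k * norm a + fock_norm X (\<lambda>m. \<xi> k m - \<zeta> m) * norm a) \<longlonglongrightarrow> 0 * norm a + 0 * norm a"
      by (intro tendsto_add tendsto_mult_right lim \<zeta>)
    ultimately have "fock_norm X v \<le> 0"
      using LIMSEQ_le_const by fastforce
    then have "fock_ip X v v = 0"
      unfolding fock_norm_def by simp
    then have "v = (\<lambda>_. 0)"
      by (rule fock_ip_self_eq_0[OF vm])
    then show ?thesis
      by (metis (no_types, lifting) ext eq_iff_diff_eq_0 v_def)
  qed
  then show ?thesis
    using \<zeta>(1) has_vac_def by blast
qed

text \<open>For a general adjointable operator the column could come from a multiplier of
  \<open>'a\<close>, so the generators have to be used. The induction carries \<open>adj f\<close>
  along because the class must be closed under adjoints.\<close>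

lemma vac_exists: "f \<in> NTc \<Longrightarrow> \<exists>\<xi>. has_vac f \<xi>"
proof -
  let ?S = "{f \<in> Op. (\<exists>\<xi>. has_vac f \<xi>) \<and> (\<exists>\<xi>. has_vac (adj f) \<xi>)}"
  have "NTc \<subseteq> ?S"
  proof (rule NT_induct)
    have cr: "creation X n \<xi> \<in> ?S" if \<xi>: "\<xi> \<in> M n" for n \<xi>
    proof -
      \<comment> \<open>In degree 0 the adjoint is creation by \<open>star a\<close>; in any other
        degree it annihilates the fibre at 0.\<close>
      have "\<exists>\<zeta>. has_vac (adj (creation X n \<xi>)) \<zeta>"
      proof (cases "n = 0")
        case True
        then obtain a where a: "\<xi> = emb X a"
          using emb_cases \<xi> by blast
        have "adj (creation X 0 (emb X a)) = creation X 0 (emb X (star a))"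
        proof (rule Op_eqI)
          fix \<eta> assume \<eta>: "\<eta> \<in> fock X"
          show "adj (creation X 0 (emb X a)) \<eta> = creation X 0 (emb X (star a)) \<eta>"
          proof (rule fock_eqI)
            fix \<theta> assume \<theta>: "\<theta> \<in> fock X"
            have "fock_ip X (creation X 0 (emb X a) \<theta>) \<eta> = fock_ip X \<theta> (creation X 0 (emb X (star a)) \<eta>)"
              unfolding fock_ip_def fpi_eq_creation[symmetric]
              by (rule infsum_cong) (simp add: fpi_apply \<eta> \<theta> lmul_adj fock_mem[OF \<eta>] fock_mem[OF \<theta>])
            then show "fock_ip X \<theta> (adj (creation X 0 (emb X a)) \<eta>) = fock_ip X \<theta> (creation X 0 (emb X (star a)) \<eta>)"
              by (simp add: adj_ip[symmetric] \<eta> \<theta>)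
          qed (simp_all add: Op_mem \<eta>)
        qed simp_all
        then show ?thesis
          using True a has_vac_creation[of "emb X (star a)" 0] by auto
      next
        case False
        have "has_vac (adj (creation X n \<xi>)) (\<lambda>_. 0)"
          unfolding has_vac_def
        proof (intro conjI allI)
          fix a
          have z: "vec_rmul (\<lambda>_. 0) a = (\<lambda>_. 0)"
            using fk.rm_mem[OF fock_zero] rmul_scaleC[OF zero_mem, of _ 0] by (simp add: vec_rmul_def)
          have "adj (creation X n \<xi>) (single 0 (emb X a)) = (\<lambda>_. 0)"
          proof (rule fock_eqI)
            fix \<theta> assume \<theta>: "\<theta> \<in> fock X"
            have "\<nexists>k. 0 = n + k"
              using False by (metis add_eq_0_iff_both_eq_0 vec_eq_iff vector_add_component zero_index)
            then have "creation X n \<xi> \<theta> 0 = 0"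
              by (rule creation_other)
            then have "fock_ip X (creation X n \<xi> \<theta>) (single 0 (emb X a)) = 0"
              using \<xi> \<theta> by (simp add: fock_ip_single_right Op_mem)
            moreover have "fock_ip X \<theta> (\<lambda>_. 0) = 0"
              by (simp add: fock_ip_def fock_mem[OF \<theta>])
            ultimately show "fock_ip X \<theta> (adj (creation X n \<xi>) (single 0 (emb X a))) = fock_ip X \<theta> (\<lambda>_. 0)"
              using \<xi> \<theta> by (simp add: adj_ip[symmetric])
          qed (use \<xi> in \<open>simp_all add: Op_mem\<close>)
          then show "adj (creation X n \<xi>) (single 0 (emb X a)) = vec_rmul (\<lambda>_. 0) a"
            by (simp add: z)
        qed simp
        then show ?thesis
          by blast
      qed
      then show ?thesis
        using has_vac_creation[OF \<xi>] \<xi> by auto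
    qed
    then show "\<And>n \<xi>. \<xi> \<in> M n \<Longrightarrow> creation X n \<xi> \<in> ?S"
      by blast
    have "?S \<noteq> {}"
      using cr[OF emb_mem[of 0]] by blast
    moreover have "op_add f g \<in> ?S" "f \<circ> g \<in> ?S" if "f \<in> ?S" "g \<in> ?S" for f g
      using that by (auto simp: adj_op_add adj_op_comp intro: has_vac_add has_vac_comp adj_Op)
    moreover have "adj f \<in> ?S" "op_scale c f \<in> ?S" if "f \<in> ?S" for f c
      using that by (auto simp: adj_op_scale intro: has_vac_scale)
    ultimately show "star_subalgebra (adjointable_ops X) ?S"
      unfolding star_subalgebra_def by simp
    show "closed_in (adjointable_ops X) ?S"
      unfolding closed_in_def
    proof (intro allI impI)
      fix s f assume A: "(\<forall>k::nat. s k \<in> ?S) \<and> f \<in> Op \<and> (\<lambda>k. dist_of (adjointable_ops X) (s k) f) \<longlonglongrightarrow> 0"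
      then have sf: "\<And>k. s k \<in> Op" "f \<in> Op" "(\<lambda>k. opnorm (op_add (s k) (op_scale (-1) f))) \<longlonglongrightarrow> 0"
        by (simp_all add: dist_of_ops)
      have "opnorm (op_add (adj (s k)) (op_scale (-1) (adj f))) = opnorm (op_add (s k) (op_scale (-1) f))" for k
        using opnorm_adj[of "op_add (s k) (op_scale (-1) f)"] sf by (simp add: adj_op_add adj_op_scale)
      then have lim: "(\<lambda>k. opnorm (op_add (adj (s k)) (op_scale (-1) (adj f)))) \<longlonglongrightarrow> 0"
        using sf(3) by simp
      have ex: "\<exists>\<xi>. has_vac (adj (s k)) \<xi>" "\<exists>\<xi>. has_vac (s k) \<xi>" for k
        using A by blast+
      have "\<exists>\<xi>. has_vac (adj f) \<xi>" "\<exists>\<xi>. has_vac f \<xi>"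
        by (rule has_vac_limit[of "\<lambda>k. adj (s k)" "adj f"]; simp add: ex sf lim)
          (rule has_vac_limit[of s f]; simp add: ex sf)
      then show "f \<in> ?S"
        using sf by blast
    qed
  qed
  then show "f \<in> NTc \<Longrightarrow> \<exists>\<xi>. has_vac f \<xi>"
    by blast
qed

lemma has_vac_unique:
  assumes "has_vac f \<xi>" "has_vac f \<zeta>"
  shows "\<xi> = \<zeta>"
proof -
  have m: "\<xi> \<in> fock X" "\<zeta> \<in> fock X"
    using assms by (auto simp: has_vac_def)
  let ?d = "\<lambda>m. \<xi> m - \<zeta> m"
  have "fock_ip X ?d (vec_rmul \<xi> a) - fock_ip X ?d (vec_rmul \<zeta> a) = 0" for a
    using assms by (simp add: has_vac_def)
  then have d0: "fock_ip X ?d ?d * a = 0" for a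
    using m by (simp add: fk.inner_rm fk.inner_sub fk.sub_mem left_diff_distrib)
  have "fock_ip X ?d ?d = 0"
    by (rule conj_eq_0) (simp_all add: d0 pos_self_adjoint fk.inner_pos fk.sub_mem m)
  then have "?d = (\<lambda>_. 0)"
    by (rule fock_ip_self_eq_0[rotated]) (simp add: fk.sub_mem m)
  then show ?thesis
    by (metis (no_types, lifting) ext eq_iff_diff_eq_0)
qed

section \<open>The compression \<open>e0\<close> to the fibre at 0\<close>

definition vac :: "('n, 'x) fop \<Rightarrow> ('n, 'x) fvec" where
  "vac f = (SOME \<xi>. has_vac f \<xi>)"

definition e0 :: "('n, 'x) fop \<Rightarrow> 'a" where
  "e0 f = inv (emb X) (vac f 0)"

lemma has_vac_vac: "f \<in> NTc \<Longrightarrow> has_vac f (vac f)"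
  unfolding vac_def by (rule someI_ex[OF vac_exists])

lemma vacI: "f \<in> NTc \<Longrightarrow> has_vac f \<xi> \<Longrightarrow> vac f = \<xi>"
  using has_vac_unique has_vac_vac by blast

lemma vac_mem [simp]: "f \<in> NTc \<Longrightarrow> vac f \<in> fock X"
  and vac_apply: "f \<in> NTc \<Longrightarrow> f (single 0 (emb X a)) = vec_rmul (vac f) a"
  using has_vac_vac by (auto simp: has_vac_def)

lemma vac_add: "f \<in> NTc \<Longrightarrow> g \<in> NTc \<Longrightarrow> vac (op_add f g) = vec_add (vac f) (vac g)"
  by (intro vacI has_vac_add has_vac_vac) simp_all

lemma vac_scale: "f \<in> NTc \<Longrightarrow> vac (op_scale c f) = vec_scale c (vac f)"
  by (intro vacI has_vac_scale has_vac_vac) simp_all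

lemma vac_comp: "g \<in> Op \<Longrightarrow> f \<in> NTc \<Longrightarrow> g \<circ> f \<in> NTc \<Longrightarrow> vac (g \<circ> f) = g (vac f)"
  by (intro vacI has_vac_comp has_vac_vac)

lemma vac_creation: "\<xi> \<in> M n \<Longrightarrow> vac (creation X n \<xi>) = single n \<xi>"
  by (intro vacI has_vac_creation) simp_all

lemma emb_e0: "f \<in> NTc \<Longrightarrow> emb X (e0 f) = vac f 0"
  unfolding e0_def using emb_cases[OF fock_mem[OF vac_mem]] emb_inject by (metis inv_f_f injI)

lemma e0_eqI: "f \<in> NTc \<Longrightarrow> vac f 0 = emb X a \<Longrightarrow> e0 f = a"
  using emb_e0 emb_inject by metis

lemma e0_add: "f \<in> NTc \<Longrightarrow> g \<in> NTc \<Longrightarrow> e0 (op_add f g) = e0 f + e0 g"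
  by (rule e0_eqI) (simp_all add: vac_add vec_add_def emb_add emb_e0)

lemma e0_scale: "f \<in> NTc \<Longrightarrow> e0 (op_scale c f) = c *\<^sub>C e0 f"
  by (rule e0_eqI) (simp_all add: vac_scale vec_scale_def emb_scaleC emb_e0)

lemma e0_fpi [simp]: "e0 (fpi X a) = a"
  by (rule e0_eqI) (simp_all add: fpi_eq_creation vac_creation)

lemma norm_e0: "f \<in> NTc \<Longrightarrow> norm (e0 f) \<le> opnorm f"
  using has_vac_norm[OF NT_Op has_vac_vac] mnorm_le_fock[OF vac_mem, of f 0]
  by (fastforce simp: emb_e0[symmetric] mnorm_emb)

lemma e0_matrix: "f \<in> NTc \<Longrightarrow> fock_ip X (single 0 (emb X a)) (f (single 0 (emb X b))) = star a * (e0 f * b)"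
proof -
  assume f: "f \<in> NTc"
  have "f (single 0 (emb X b)) 0 = emb X (e0 f * b)"
    using f by (simp add: vac_apply vec_rmul_def emb_e0[symmetric] emb_rmul)
  then show ?thesis
    using f by (simp add: fock_ip_single Op_mem emb_ip)
qed

lemma e0_unique:
  assumes "f \<in> NTc" "\<And>a b. fock_ip X (single 0 (emb X a)) (f (single 0 (emb X b))) = star a * (c * b)"
  shows "e0 f = c"
proof -
  have "star a * ((e0 f - c) * b) = 0" for a b
    using assms(2)[of a b] e0_matrix[OF assms(1), of a b] by (simp add: algebra_simps)
  then have "e0 f - c = 0"
    by (rule two_sided_zero)
  then show ?thesis
    by simp
qed

text \<open>This is the source of positivity of \<open>\<tau> \<circ> E\<close>: for
  \<open>g = f\<close> the right side is an inner square.\<close>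

lemma e0_adj_comp:
  assumes "f \<in> NTc" "g \<in> NTc"
  shows "e0 (adj g \<circ> f) = fock_ip X (vac g) (vac f)"
proof (rule e0_unique)
  fix a b
  have "fock_ip X (single 0 (emb X a)) ((adj g \<circ> f) (single 0 (emb X b))) =
      fock_ip X (g (single 0 (emb X a))) (f (single 0 (emb X b)))"
    using assms by (simp add: adj_ip Op_mem)
  then show "fock_ip X (single 0 (emb X a)) ((adj g \<circ> f) (single 0 (emb X b))) =
      star a * (fock_ip X (vac g) (vac f) * b)"
    using assms by (simp add: vac_apply fk.inner_simps fk.mem mult.assoc)
qed (use assms in simp)

lemma e0_comp: "f \<in> NTc \<Longrightarrow> g \<in> NTc \<Longrightarrow> e0 (f \<circ> g) = fock_ip X (vac (adj f)) (vac g)"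
  using e0_adj_comp[of g "adj f"] by simp

lemma e0_adj:
  assumes "f \<in> NTc"
  shows "e0 (adj f) = star (e0 f)"
proof (rule e0_unique)
  fix a b
  have "fock_ip X (single 0 (emb X a)) (adj f (single 0 (emb X b))) =
      star (fock_ip X (single 0 (emb X b)) (f (single 0 (emb X a))))"
    using assms fk.inner_star[of "single 0 (emb X b)" "f (single 0 (emb X a))"]
    by (simp add: adj_ip Op_mem flip: adj_ip)
  then show "fock_ip X (single 0 (emb X a)) (adj f (single 0 (emb X b))) = star a * (star (e0 f) * b)"
    using assms by (simp add: e0_matrix star_simps mult.assoc)
qed (use assms in simp)

lemma vac_rotation: "f \<in> NTc \<Longrightarrow> vac (rotation r f) = vec_rot r (vac f)"
proof (rule vacI)
  assume f: "f \<in> NTc"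
  have "vec_rot (- r) (single 0 \<xi>) = (single 0 \<xi> :: ('n, 'x) fvec)" for \<xi>
    by (auto simp: vec_rot_def single_def scaleC_one)
  moreover have "vec_rot r (vec_rmul (vac f) a) = vec_rmul (vec_rot r (vac f)) a" for a
    by (simp add: vec_rot_def vec_rmul_def rmul_scaleC fock_mem[OF vac_mem[OF f]])
  ultimately show "has_vac (rotation r f) (vec_rot r (vac f))"
    unfolding has_vac_def using f by (simp add: rotation_eq vac_apply)
qed simp

text \<open>The rotation multiplies the component at \<open>m\<close> by the character of
  \<open>deg m\<close> and the whole column by that of \<open>k\<close>. Comparing characters leaves
  only fibres of total degree \<open>k\<close>, and none at all if \<open>k\<close> is
  negative.\<close>

lemma vac_homogeneous:
  assumes "homogeneous k f" "int (deg m) \<noteq> k"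
  shows "vac f m = 0"
proof (rule ccontr)
  assume ne: "vac f m \<noteq> 0"
  have f: "f \<in> NTc"
    using assms(1) homogeneous_def by blast
  have "phase r (int (deg m)) *\<^sub>C vac f m = phase r k *\<^sub>C vac f m" for r
    using vac_rotation[OF f, of r] vac_scale[OF f, of "phase r k"] assms(1)
    by (metis homogeneous_def vec_rot_def vec_scale_def)
  then have "(phase r (int (deg m)) - phase r k) *\<^sub>C vac f m = 0" for r
    using scaleC_add_left[of "phase r (int (deg m)) - phase r k" "phase r k" "vac f m"] by simp
  then have eq: "phase r (int (deg m)) = phase r k" for r
    using ne scaleC_scaleC[of "inverse (phase r (int (deg m)) - phase r k)" "phase r (int (deg m)) - phase r k" "vac f m"]
    by (cases "phase r (int (deg m)) - phase r k = 0") (auto simp: scaleC_one)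
  have "phase r (int (deg m) - k) = 1" for r
    using eq[of r] phase_add_right[of r "int (deg m) - k" k] cmod_phase[of r k]
    by (metis diff_add_cancel mult_cancel_right2 norm_zero zero_neq_one)
  then show False
    using phase_eq_1_imp assms(2) by fastforce
qed

lemma e0_homogeneous: "homogeneous k f \<Longrightarrow> k \<noteq> 0 \<Longrightarrow> e0 f = 0"
  by (rule e0_eqI) (auto simp: homogeneous_def intro!: vac_homogeneous[of k])

lemma proj_compress: "f \<in> NTc \<Longrightarrow> proj UNIV \<circ> f \<circ> proj UNIV = fpi X (e0 f) \<circ> proj UNIV"
proof (rule Op_eqI)
  fix \<eta> assume f: "f \<in> NTc" and \<eta>: "\<eta> \<in> fock X"
  obtain a where a: "\<eta> 0 = emb X a"
    using emb_cases[OF fock_mem[OF \<eta>]] by blast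
  have "fpi X (e0 f) (single 0 (emb X a)) = single 0 (emb X (e0 f * a))"
  proof
    fix m
    show "fpi X (e0 f) (single 0 (emb X a)) m = single 0 (emb X (e0 f * a)) m"
      using lmul_scaleC[OF zero_mem, of m "e0 f" 0]
      by (cases "m = 0") (simp_all add: fpi_apply[OF emb_single_mem] emb_lmul)
  qed
  moreover have "proj UNIV (f (single 0 (emb X a))) = single 0 (emb X (e0 f * a))"
    using f by (simp add: proj_UNIV_apply Op_mem) (simp add: vac_apply vec_rmul_def emb_e0[symmetric] emb_rmul)
  ultimately show "(proj UNIV \<circ> f \<circ> proj UNIV) \<eta> = (fpi X (e0 f) \<circ> proj UNIV) \<eta>"
    using \<eta> by (simp add: proj_UNIV_apply a)
qed simp_all

end

section \<open>Fourier coefficients of orbits\<close>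

lemma holomorphic_shift:
  assumes "H holomorphic_on UNIV"
  shows "(\<lambda>z. H (z + c)) holomorphic_on UNIV"
proof -
  have "(\<lambda>z. z + c) holomorphic_on UNIV"
    by (intro holomorphic_on_add holomorphic_on_ident holomorphic_on_const)
  then show ?thesis
    using holomorphic_on_compose_gen[of "\<lambda>z. z + c" UNIV H UNIV] assms by (simp add: comp_def)
qed

text \<open>
  The mean over a period of a periodic entire function is the same on all horizontal lines; it is
  computed by a primitive, so that no integral is needed.
\<close>

lemma periodic_mean:
  fixes H :: "complex \<Rightarrow> complex"
  assumes H: "H holomorphic_on UNIV" and per: "\<And>x::real. H (of_real x + 2 * of_real pi) = H (of_real x)"
  shows "\<exists>c. \<forall>y b e. (\<forall>x::real. cmod (H (Complex x y) - b) \<le> e) \<longrightarrow> cmod (c - b) \<le> e"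
proof -
  let ?p = "2 * of_real pi :: complex"
  have shift: "(\<lambda>z. H (z + ?p)) holomorphic_on UNIV"
    by (rule holomorphic_shift[OF H])
  \<comment> \<open>Periodicity on the real line extends to the plane by the identity
    theorem.\<close>
  have perC: "H (z + ?p) = H z" for z
  proof -
    have "H (z + ?p) - H z = 0"
    proof (rule analytic_continuation[of "\<lambda>z. H (z + ?p) - H z" UNIV \<real> 0])
      show "(\<lambda>z. H (z + ?p) - H z) holomorphic_on UNIV"
        by (intro holomorphic_intros shift H)
      show "(0::complex) islimpt \<real>"
        unfolding islimpt_approachable
      proof (intro allI impI)
        fix e :: real assume "e > 0"
        then show "\<exists>x'\<in>\<real>. x' \<noteq> 0 \<and> dist x' (0::complex) < e"
          by (intro bexI[of _ "of_real (e/2)"]) auto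
      qed
      show "H (x + ?p) - H x = 0" if "x \<in> \<real>" for x
        using that per by (auto elim!: Reals_cases)
    qed auto
    then show ?thesis
      by simp
  qed
  obtain P where P: "\<And>z. (P has_field_derivative H z) (at z)"
    using holomorphic_convex_primitive'[OF convex_UNIV open_UNIV H] by auto
  have "((\<lambda>z. P (z + ?p) - P z) has_field_derivative 0) (at z)" for z
  proof -
    have "((\<lambda>z. P (z + ?p)) has_field_derivative H (z + ?p)) (at z)"
      using DERIV_shift[of P "H (z + ?p)" z ?p] P by simp
    then have "((\<lambda>z. P (z + ?p) - P z) has_field_derivative H (z + ?p) - H z) (at z)"
      by (intro DERIV_diff P)
    then show ?thesis
      by (simp add: perC)
  qed
  \<comment> \<open>\<open>C\<close> is the increment of the primitive over one period, so
    \<open>C / ?p\<close> is the mean on every horizontal line.\<close>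
  then obtain C where C: "\<And>z. P (z + ?p) - P z = C"
    using has_field_derivative_zero_constant[OF convex_UNIV, of "\<lambda>z. P (z + ?p) - P z"] by auto
  have "cmod (C / ?p - b) \<le> e" if bd: "\<And>x::real. cmod (H (Complex x y) - b) \<le> e" for y b e
  proof -
    let ?S = "{z. Im z = y}"
    \<comment> \<open>The mean value inequality for \<open>P z - b * z\<close> along the line turns
      a bound on the deviation of \<open>H\<close> from \<open>b\<close> into one for the
      mean.\<close>
    have "cmod ((P (Complex 0 y + ?p) - b * (Complex 0 y + ?p)) - (P (Complex 0 y) - b * Complex 0 y)) \<le>
        e * cmod (Complex 0 y + ?p - Complex 0 y)"
    proof (rule field_differentiable_bound[of ?S])
      show "convex ?S"
        by (auto simp: convex_alt algebra_simps)
      fix z assume "z \<in> ?S"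
      then have "z = Complex (Re z) y"
        by (simp add: complex_eq_iff)
      then show "cmod (H z - b) \<le> e"
        using bd[of "Re z"] by simp
      have "((\<lambda>z. P z - b * z) has_field_derivative H z - b) (at z)"
        by (auto intro!: derivative_eq_intros P)
      then show "((\<lambda>z. P z - b * z) has_field_derivative H z - b) (at z within ?S)"
        by (rule has_field_derivative_at_within)
    qed auto
    then have "cmod (C - b * ?p) \<le> e * (2 * pi)"
      using C[of "Complex 0 y"] by (simp add: algebra_simps norm_mult)
    moreover have "C - b * ?p = (C / ?p - b) * ?p"
      by (simp add: algebra_simps)
    ultimately have "cmod (C / ?p - b) * (2 * pi) \<le> e * (2 * pi)"
      by (simp add: norm_mult)
    then show ?thesis
      by (rule mult_right_le_imp_le) simp
  qed
  then show ?thesis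
    by blast
qed

text \<open>One setting for \<open>'a\<close>, the Toeplitz algebra and its quotients.
  \<open>norm_times\<close> asks for a constant that depends on \<open>f\<close>, enough for
  continuity of multiplication by a fixed element.\<close>

locale normed_alg =
  fixes B :: "'b star_alg"
  assumes plus_mem: "x \<in> carr B \<Longrightarrow> y \<in> carr B \<Longrightarrow> plus_of B x y \<in> carr B"
    and scale_mem: "x \<in> carr B \<Longrightarrow> scale_of B c x \<in> carr B"
    and times_mem: "x \<in> carr B \<Longrightarrow> y \<in> carr B \<Longrightarrow> times_of B x y \<in> carr B"
    and times_plus_right: "f \<in> carr B \<Longrightarrow> x \<in> carr B \<Longrightarrow> y \<in> carr B \<Longrightarrow>
      times_of B f (plus_of B x y) = plus_of B (times_of B f x) (times_of B f y)"
    and times_plus_left: "f \<in> carr B \<Longrightarrow> x \<in> carr B \<Longrightarrow> y \<in> carr B \<Longrightarrow>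
      times_of B (plus_of B x y) f = plus_of B (times_of B x f) (times_of B y f)"
    and times_scale_right: "f \<in> carr B \<Longrightarrow> x \<in> carr B \<Longrightarrow> times_of B f (scale_of B c x) = scale_of B c (times_of B f x)"
    and times_scale_left: "f \<in> carr B \<Longrightarrow> x \<in> carr B \<Longrightarrow> times_of B (scale_of B c x) f = scale_of B c (times_of B x f)"
    and norm_nonneg: "x \<in> carr B \<Longrightarrow> 0 \<le> norm_of B x"
    and norm_scale_le: "x \<in> carr B \<Longrightarrow> norm_of B (scale_of B c x) \<le> cmod c * norm_of B x"
    and norm_times: "f \<in> carr B \<Longrightarrow> \<exists>C\<ge>0. \<forall>x\<in>carr B.
      norm_of B (times_of B f x) \<le> C * norm_of B x \<and> norm_of B (times_of B x f) \<le> C * norm_of B x"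
begin

lemma stateD:
  assumes "\<phi> \<in> states B"
  shows "\<phi> \<in> extensional (carr B)"
    and "\<And>x y. x \<in> carr B \<Longrightarrow> y \<in> carr B \<Longrightarrow> \<phi> (plus_of B x y) = \<phi> x + \<phi> y"
    and "\<And>c x. x \<in> carr B \<Longrightarrow> \<phi> (scale_of B c x) = c * \<phi> x"
    and "\<And>x. x \<in> carr B \<Longrightarrow> \<phi> (times_of B (star_of B x) x) \<in> \<real>\<^sub>\<ge>\<^sub>0"
    and "(SUP x\<in>{x\<in>carr B. norm_of B x \<le> 1}. ereal (cmod (\<phi> x))) = 1"
  using assms by (simp_all add: states_def)

lemma state_bound:
  assumes \<phi>: "\<phi> \<in> states B" and x: "x \<in> carr B"
  shows "cmod (\<phi> x) \<le> norm_of B x"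
proof (rule field_le_epsilon)
  fix e :: real assume e: "e > 0"
  define t where "t = norm_of B x + e"
  have t: "t > 0"
    using norm_nonneg[OF x] e by (simp add: t_def)
  have "norm_of B (scale_of B (of_real (1/t)) x) \<le> \<bar>1/t\<bar> * norm_of B x"
    using norm_scale_le[OF x, of "of_real (1/t)"] unfolding norm_of_real .
  also have "\<dots> \<le> 1"
    using t e by (simp add: t_def)
  finally have "ereal (cmod (\<phi> (scale_of B (of_real (1/t)) x))) \<le> 1"
    unfolding stateD(5)[OF \<phi>, symmetric] using scale_mem[OF x] by (intro SUP_upper) simp
  then have "cmod (\<phi> x) / t \<le> 1"
    using t by (simp add: stateD(3)[OF \<phi> x] norm_mult norm_divide)
  then show "cmod (\<phi> x) \<le> norm_of B x + e"
    using t by (simp add: t_def)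
qed

lemma state_approx:
  assumes \<phi>: "\<phi> \<in> states B" and e: "e > 0"
  shows "\<exists>x\<in>carr B. norm_of B x \<le> 1 \<and> cmod (\<phi> x) > 1 - e"
proof -
  have "ereal (1 - e) < (SUP x\<in>{x\<in>carr B. norm_of B x \<le> 1}. ereal (cmod (\<phi> x)))"
    unfolding stateD(5)[OF \<phi>] using e by simp
  then show ?thesis
    by (auto simp: less_SUP_iff)
qed

text \<open>Without a unit the norm must be shown to equal 1. The slack \<open>1 + e\<close> suits
  quotients, where representatives attain the norm only approximately; rescaling removes it.\<close>

lemma stateI:
  assumes "\<phi> \<in> extensional (carr B)"
    "\<And>x y. x \<in> carr B \<Longrightarrow> y \<in> carr B \<Longrightarrow> \<phi> (plus_of B x y) = \<phi> x + \<phi> y"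
    and sc: "\<And>c x. x \<in> carr B \<Longrightarrow> \<phi> (scale_of B c x) = c * \<phi> x"
    and "\<And>x. x \<in> carr B \<Longrightarrow> \<phi> (times_of B (star_of B x) x) \<in> \<real>\<^sub>\<ge>\<^sub>0"
    and bd: "\<And>x. x \<in> carr B \<Longrightarrow> cmod (\<phi> x) \<le> norm_of B x"
    and approx: "\<And>e. e > 0 \<Longrightarrow> \<exists>x\<in>carr B. norm_of B x \<le> 1 + e \<and> cmod (\<phi> x) > 1 - e"
  shows "\<phi> \<in> states B"
proof -
  let ?S = "SUP x\<in>{x\<in>carr B. norm_of B x \<le> 1}. ereal (cmod (\<phi> x))"
  have "?S \<le> 1"
    using bd by (intro SUP_least) (auto intro: order_trans)
  have "ereal r \<le> ?S" if r: "r < 1" for r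
  proof -
    have "((\<lambda>e. (1 - e) / (1 + e)) \<longlongrightarrow> (1 - 0) / (1 + 0)) (at_right (0::real))"
      by (intro tendsto_intros) auto
    then have "\<forall>\<^sub>F e in at_right (0::real). r < (1 - e) / (1 + e)"
      using r by (intro order_tendstoD(1)) auto
    then have "\<exists>e::real. 0 < e \<and> r < (1 - e) / (1 + e)"
      using eventually_happens[OF eventually_conj[OF eventually_at_right_less]] by fastforce
    then obtain e :: real where e: "0 < e" "r < (1 - e) / (1 + e)"
      by blast
    obtain x where x: "x \<in> carr B" "norm_of B x \<le> 1 + e" "cmod (\<phi> x) > 1 - e"
      using approx[OF e(1)] by blast
    let ?y = "scale_of B (of_real (1 / (1 + e))) x"
    have "norm_of B ?y \<le> \<bar>1 / (1 + e)\<bar> * norm_of B x"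
      using norm_scale_le[OF x(1), of "of_real (1 / (1 + e))"] unfolding norm_of_real .
    also have "\<dots> \<le> 1"
      using e x by simp
    finally have "ereal (cmod (\<phi> ?y)) \<le> ?S"
      using scale_mem[OF x(1)] by (intro SUP_upper) simp
    moreover have "cmod (\<phi> ?y) = cmod (\<phi> x) / (1 + e)"
      using e unfolding sc[OF x(1)] norm_mult norm_of_real by simp
    moreover have "(1 - e) / (1 + e) \<le> cmod (\<phi> x) / (1 + e)"
      using e x by (intro divide_right_mono) auto
    ultimately have "ereal (cmod (\<phi> ?y)) \<le> ?S" "r \<le> cmod (\<phi> ?y)"
      using e(2) by simp_all
    then show ?thesis
      using order_trans[of "ereal r" "ereal (cmod (\<phi> ?y))" ?S] by simp
  qed
  note ge = this
  have "1 \<le> ?S"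
  proof (rule ccontr)
    assume "\<not> 1 \<le> ?S"
    then have "?S < 1"
      by simp
    then obtain r where r: "?S < ereal r" "ereal r < 1"
      using ereal_dense2 by blast
    then have "r < 1"
      by simp
    then show False
      using ge[of r] r(1) leD by blast
  qed
  then have "?S = 1"
    using \<open>?S \<le> 1\<close> by (rule antisym[rotated])
  then show ?thesis
    using assms by (simp add: states_def)
qed

lemma state_times_diff:
  assumes \<phi>: "\<phi> \<in> states B" and f: "f \<in> carr B"
  shows "\<exists>C\<ge>0. \<forall>x\<in>carr B. \<forall>y\<in>carr B.
    cmod (\<phi> (times_of B f x) - \<phi> (times_of B f y)) \<le> C * dist_of B x y \<and>
    cmod (\<phi> (times_of B x f) - \<phi> (times_of B y f)) \<le> C * dist_of B x y"
proof -
  obtain C where C: "C \<ge> 0" "\<And>x. x \<in> carr B \<Longrightarrow> norm_of B (times_of B f x) \<le> C * norm_of B x"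
    "\<And>x. x \<in> carr B \<Longrightarrow> norm_of B (times_of B x f) \<le> C * norm_of B x"
    using norm_times[OF f] by blast
  show ?thesis
  proof (intro exI[of _ C] conjI ballI C(1))
    fix x y assume x: "x \<in> carr B" and y: "y \<in> carr B"
    let ?d = "plus_of B x (scale_of B (-1) y)"
    have d: "?d \<in> carr B"
      by (intro plus_mem scale_mem x y)
    have "\<phi> (times_of B f ?d) = \<phi> (times_of B f x) - \<phi> (times_of B f y)"
      using x y f by (simp add: times_plus_right times_scale_right scale_mem times_mem stateD(2,3)[OF \<phi>])
    then show "cmod (\<phi> (times_of B f x) - \<phi> (times_of B f y)) \<le> C * dist_of B x y"
      using order_trans[OF state_bound[OF \<phi> times_mem[OF f d]] C(2)[OF d]] by (simp add: dist_of_def)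
    have "\<phi> (times_of B ?d f) = \<phi> (times_of B x f) - \<phi> (times_of B y f)"
      using x y f by (simp add: times_plus_left times_scale_left scale_mem times_mem stateD(2,3)[OF \<phi>])
    then show "cmod (\<phi> (times_of B x f) - \<phi> (times_of B y f)) \<le> C * dist_of B x y"
      using order_trans[OF state_bound[OF \<phi> times_mem[OF d f]] C(3)[OF d]] by (simp add: dist_of_def)
  qed
qed

lemma dense_state_eq:
  assumes \<phi>: "\<phi> \<in> states B" and D: "dense_in B D"
    and eq: "\<And>f. f \<in> D \<Longrightarrow> \<phi> (times_of B b f) = c * \<phi> (times_of B f b)"
    and b: "b \<in> carr B" and f: "f \<in> carr B"
  shows "\<phi> (times_of B b f) = c * \<phi> (times_of B f b)"
proof -
  obtain C where C: "C \<ge> 0"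
    "\<And>x y. x \<in> carr B \<Longrightarrow> y \<in> carr B \<Longrightarrow> cmod (\<phi> (times_of B b x) - \<phi> (times_of B b y)) \<le> C * dist_of B x y"
    "\<And>x y. x \<in> carr B \<Longrightarrow> y \<in> carr B \<Longrightarrow> cmod (\<phi> (times_of B x b) - \<phi> (times_of B y b)) \<le> C * dist_of B x y"
    using state_times_diff[OF \<phi> b] by blast
  let ?w = "\<phi> (times_of B b f) - c * \<phi> (times_of B f b)"
  have "cmod ?w \<le> 0 + e" if e: "e > 0" for e
  proof -
    define r where "r = e / (C * (1 + cmod c) + 1)"
    have pos: "C * (1 + cmod c) + 1 > 0"
      using C(1) by (intro add_nonneg_pos mult_nonneg_nonneg) auto
    then have "r > 0"
      using e by (simp add: r_def)
    then obtain g where g: "g \<in> D" "dist_of B g f < r"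
      using D f unfolding dense_in_def by blast
    then have gm: "g \<in> carr B"
      using D by (auto simp: dense_in_def)
    have d0: "0 \<le> dist_of B g f"
      unfolding dist_of_def by (intro norm_nonneg plus_mem scale_mem gm f)
    have "?w = c * (\<phi> (times_of B g b) - \<phi> (times_of B f b)) - (\<phi> (times_of B b g) - \<phi> (times_of B b f))"
      using eq[OF g(1)] by (simp add: algebra_simps)
    then have "cmod ?w \<le> cmod c * cmod (\<phi> (times_of B g b) - \<phi> (times_of B f b)) +
        cmod (\<phi> (times_of B b g) - \<phi> (times_of B b f))"
      by (metis norm_mult norm_triangle_ineq4)
    also have "\<dots> \<le> cmod c * (C * dist_of B g f) + C * dist_of B g f"
      using C gm f by (intro add_mono mult_left_mono) auto
    also have "\<dots> = (C * (1 + cmod c)) * dist_of B g f"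
      by (simp add: algebra_simps)
    also have "\<dots> \<le> (C * (1 + cmod c) + 1) * r"
      using g(2) d0 C(1) pos by (intro mult_mono) auto
    also have "\<dots> = e"
      using pos by (simp add: r_def)
    finally show ?thesis
      by simp
  qed
  then have "cmod ?w \<le> 0"
    by (rule field_le_epsilon)
  then show ?thesis
    by simp
qed

end

section \<open>Ground and KMS states under a periodic action\<close>

locale rot_alg = normed_alg B for B :: "'b star_alg" +
  fixes \<sigma> :: "real \<Rightarrow> 'b \<Rightarrow> 'b"
  assumes \<sigma>_mem: "x \<in> carr B \<Longrightarrow> \<sigma> r x \<in> carr B"
    and \<sigma>_plus: "x \<in> carr B \<Longrightarrow> y \<in> carr B \<Longrightarrow> \<sigma> r (plus_of B x y) = plus_of B (\<sigma> r x) (\<sigma> r y)"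
    and \<sigma>_scale: "x \<in> carr B \<Longrightarrow> \<sigma> r (scale_of B c x) = scale_of B c (\<sigma> r x)"
    and \<sigma>_norm: "x \<in> carr B \<Longrightarrow> norm_of B (\<sigma> r x) \<le> norm_of B x"
    and \<sigma>_2pi: "x \<in> carr B \<Longrightarrow> \<sigma> (r + 2 * pi) x = \<sigma> r x"
    and \<sigma>_\<sigma>: "x \<in> carr B \<Longrightarrow> \<sigma> r (\<sigma> s x) = \<sigma> (r + s) x"
begin

lemma dist_\<sigma>: "x \<in> carr B \<Longrightarrow> y \<in> carr B \<Longrightarrow> dist_of B (\<sigma> r x) (\<sigma> r y) \<le> dist_of B x y"
  using \<sigma>_norm[of "plus_of B x (scale_of B (-1) y)" r]
  by (simp add: dist_of_def \<sigma>_plus \<sigma>_scale plus_mem scale_mem)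

lemma orbit_holomorphic:
  assumes \<phi>: "\<phi> \<in> states B" and g: "g \<in> carr B" and F: "analytic_extension B \<sigma> f F"
  shows "(\<lambda>z. \<phi> (times_of B g (F z))) holomorphic_on UNIV"
proof -
  have Fm: "F z \<in> carr B" for z
    using F by (simp add: analytic_extension_def)
  obtain C where C: "C \<ge> 0"
    "\<And>x y. x \<in> carr B \<Longrightarrow> y \<in> carr B \<Longrightarrow> cmod (\<phi> (times_of B g x) - \<phi> (times_of B g y)) \<le> C * dist_of B x y"
    using state_times_diff[OF \<phi> g] by blast
  have "\<exists>D. ((\<lambda>z. \<phi> (times_of B g (F z))) has_field_derivative D) (at z)" for z
  proof -
    let ?Q = "\<lambda>h. scale_of B (1 / h) (plus_of B (F (z + h)) (scale_of B (-1) (F z)))"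
    obtain D where D: "D \<in> carr B" "((\<lambda>h. dist_of B (?Q h) D) \<longlongrightarrow> 0) (at 0)"
      using F unfolding analytic_extension_def by blast
    have Q: "\<phi> (times_of B g (?Q h)) = (\<phi> (times_of B g (F (z + h))) - \<phi> (times_of B g (F z))) / h" for h
      using Fm g by (simp add: times_plus_right times_scale_right plus_mem scale_mem times_mem stateD(2,3)[OF \<phi>])
    have "((\<lambda>h. \<phi> (times_of B g (?Q h))) \<longlongrightarrow> \<phi> (times_of B g D)) (at 0)"
    proof (rule LIM_zero_cancel, rule Lim_null_comparison)
      show "\<forall>\<^sub>F h in at 0. norm (\<phi> (times_of B g (?Q h)) - \<phi> (times_of B g D)) \<le> C * dist_of B (?Q h) D"
        by (rule always_eventually, rule allI, rule C(2)) (simp_all only: D(1) Fm plus_mem scale_mem)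
      show "((\<lambda>h. C * dist_of B (?Q h) D) \<longlongrightarrow> 0) (at 0)"
        using tendsto_mult_right_zero[OF D(2)] by simp
    qed
    then show ?thesis
      unfolding Q DERIV_def by blast
  qed
  then show ?thesis
    by (simp add: holomorphic_on_def field_differentiable_def)
qed

text \<open>\<open>c\<close> is the \<open>k\<close>-th Fourier coefficient of the orbit of
  \<open>f\<close>, seen through \<open>\<phi>\<close> and \<open>g\<close>. By
  \<open>periodic_mean\<close> it can be estimated on any horizontal line, which is how values at
  different heights are compared.\<close>

lemma orbit_mean:
  assumes \<phi>: "\<phi> \<in> states B" and g: "g \<in> carr B" and f: "f \<in> carr B" and F: "analytic_extension B \<sigma> f F"
  obtains c where "\<And>y b e. (\<And>x. cmod (exp (- \<i> * of_int k * Complex x y) * \<phi> (times_of B g (F (Complex x y))) - b) \<le> e) \<Longrightarrow>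
    cmod (c - b) \<le> e"
proof -
  let ?H = "\<lambda>z. exp (- \<i> * of_int k * z) * \<phi> (times_of B g (F z))"
  have "?H holomorphic_on UNIV"
    by (intro holomorphic_intros orbit_holomorphic[OF \<phi> g F])
  moreover have "?H (of_real x + 2 * of_real pi) = ?H (of_real x)" for x :: real
  proof -
    have FR: "F (of_real r) = \<sigma> r f" for r :: real
      using F by (simp add: analytic_extension_def)
    have "F (of_real x + 2 * of_real pi) = F (of_real x)"
      using FR[of "x + 2 * pi"] FR[of x] \<sigma>_2pi[OF f] by simp
    moreover have "exp (- \<i> * of_int k * (of_real x + 2 * of_real pi)) = exp (- \<i> * of_int k * of_real x)"
    proof -
      have "- \<i> * of_int k * (of_real x + 2 * of_real pi) =
          - \<i> * of_int k * of_real x + of_real (2 * of_int (- k) * pi) * \<i>"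
        by (simp add: algebra_simps)
      then show ?thesis
        by (simp only: exp_add exp_integer_2pi[OF Ints_of_int] mult_1_right)
    qed
    ultimately show ?thesis
      by simp
  qed
  ultimately have "\<exists>c. \<forall>y b e. (\<forall>x::real. cmod (?H (Complex x y) - b) \<le> e) \<longrightarrow> cmod (c - b) \<le> e"
    by (rule periodic_mean)
  then show thesis
    using that by blast
qed

lemma exp_Complex: "exp (- \<i> * of_int k * Complex x y) = of_real (exp (of_int k * y)) * phase (- x) k"
proof -
  have "- \<i> * of_int k * Complex x y = of_real (of_int k * y) + \<i> * of_real (- x * of_int k)"
    by (simp add: complex_eq_iff)
  then show ?thesis
    by (simp only: exp_add phase_def exp_of_real)
qed

text \<open>For \<open>f = b\<close> the phases cancel exactly; since the action is contractive,
  replacing \<open>b\<close> by \<open>f\<close> costs at most \<open>C\<close> times their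
  distance, uniformly in \<open>x\<close>.\<close>

lemma orbit_estimate:
  assumes \<phi>: "\<phi> \<in> states B" and b: "b \<in> carr B" "\<And>r. \<sigma> r b = scale_of B (phase r k) b"
    and f: "f \<in> carr B" and g: "g \<in> carr B"
    and C: "\<And>x y. x \<in> carr B \<Longrightarrow> y \<in> carr B \<Longrightarrow> cmod (\<phi> (times_of B g x) - \<phi> (times_of B g y)) \<le> C * dist_of B x y"
      "C \<ge> 0"
  shows "cmod (phase (- x) k * \<phi> (times_of B g (\<sigma> x f)) - \<phi> (times_of B g b)) \<le> C * dist_of B f b"
proof -
  have "\<phi> (times_of B g (\<sigma> x b)) = phase x k * \<phi> (times_of B g b)"
    using g b(1) by (simp add: b(2) times_scale_right times_mem stateD(3)[OF \<phi>])
  then have "\<phi> (times_of B g b) = phase (- x) k * \<phi> (times_of B g (\<sigma> x b))"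
    using phase_add_left[of "- x" x k] by (simp add: mult.assoc[symmetric])
  then have "cmod (phase (- x) k * \<phi> (times_of B g (\<sigma> x f)) - \<phi> (times_of B g b)) =
      cmod (\<phi> (times_of B g (\<sigma> x f)) - \<phi> (times_of B g (\<sigma> x b)))"
    by (simp add: right_diff_distrib[symmetric] norm_mult)
  also have "\<dots> \<le> C * dist_of B (\<sigma> x f) (\<sigma> x b)"
    by (intro C \<sigma>_mem f b)
  also have "\<dots> \<le> C * dist_of B f b"
    by (intro mult_left_mono dist_\<sigma> f b C)
  finally show ?thesis .
qed

lemma orbit_estimate_left:
  assumes \<phi>: "\<phi> \<in> states B" and b: "b \<in> carr B" "\<And>r. \<sigma> r b = scale_of B (phase r k) b"
    and f: "f \<in> carr B" and g: "g \<in> carr B"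
    and C: "\<And>x y. x \<in> carr B \<Longrightarrow> y \<in> carr B \<Longrightarrow> cmod (\<phi> (times_of B x g) - \<phi> (times_of B y g)) \<le> C * dist_of B x y"
      "C \<ge> 0"
  shows "cmod (phase (- x) k * \<phi> (times_of B (\<sigma> x f) g) - \<phi> (times_of B b g)) \<le> C * dist_of B f b"
proof -
  have "\<phi> (times_of B (\<sigma> x b) g) = phase x k * \<phi> (times_of B b g)"
    using g b(1) by (simp add: b(2) times_scale_left times_mem stateD(3)[OF \<phi>])
  then have "\<phi> (times_of B b g) = phase (- x) k * \<phi> (times_of B (\<sigma> x b) g)"
    using phase_add_left[of "- x" x k] by (simp add: mult.assoc[symmetric])
  then have "cmod (phase (- x) k * \<phi> (times_of B (\<sigma> x f) g) - \<phi> (times_of B b g)) =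
      cmod (\<phi> (times_of B (\<sigma> x f) g) - \<phi> (times_of B (\<sigma> x b) g))"
    by (simp add: right_diff_distrib[symmetric] norm_mult)
  also have "\<dots> \<le> C * dist_of B (\<sigma> x f) (\<sigma> x b)"
    by (intro C \<sigma>_mem f b)
  also have "\<dots> \<le> C * dist_of B f b"
    by (intro mult_left_mono dist_\<sigma> f b C)
  finally show ?thesis .
qed

lemma dense_approx:
  assumes "dense_in B D" "b \<in> carr B" "C \<ge> 0" "e > 0"
  obtains f where "f \<in> D" "f \<in> carr B" "C * dist_of B f b \<le> e"
proof -
  have "e / (C + 1) > 0"
    using assms by simp
  then obtain f where f: "f \<in> D" "dist_of B f b < e / (C + 1)"
    using assms(1,2) unfolding dense_in_def by blast
  then have fm: "f \<in> carr B"
    using assms(1) by (auto simp: dense_in_def)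
  have "0 \<le> dist_of B f b"
    unfolding dist_of_def by (intro norm_nonneg plus_mem scale_mem fm assms)
  then have "C * dist_of B f b \<le> (C + 1) * (e / (C + 1))"
    using f(2) assms(3) by (intro mult_mono) auto
  then show thesis
    using that[OF f(1) fm] assms(3) by simp
qed

lemma ground_vanish:
  assumes \<phi>: "\<phi> \<in> ground_states B \<sigma>" and b: "b \<in> carr B" "\<And>r. \<sigma> r b = scale_of B (phase r k) b"
    and k: "k < 0" and g: "g \<in> carr B"
  shows "\<phi> (times_of B g b) = 0"
proof -
  have \<phi>s: "\<phi> \<in> states B"
    using \<phi> by (simp add: ground_states_def)
  obtain D where D: "dense_in B D"
    and DG: "\<And>f. f \<in> D \<Longrightarrow> \<exists>F. analytic_extension B \<sigma> f F \<and>
      (\<forall>g\<in>D. bounded ((\<lambda>z. \<phi> (times_of B g (F z))) ` {z. Im z > 0}))"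
    using \<phi> unfolding ground_states_def by blast
  have gD: "\<phi> (times_of B g b) = 0" if gD: "g \<in> D" for g
  proof -
    have g: "g \<in> carr B"
      using gD D by (auto simp: dense_in_def)
    obtain C where C: "C \<ge> 0"
      "\<And>x y. x \<in> carr B \<Longrightarrow> y \<in> carr B \<Longrightarrow> cmod (\<phi> (times_of B g x) - \<phi> (times_of B g y)) \<le> C * dist_of B x y"
      using state_times_diff[OF \<phi>s g] by blast
    have "cmod (\<phi> (times_of B g b)) \<le> 0 + e" if e: "e > 0" for e
    proof -
      obtain f where f: "f \<in> D" "f \<in> carr B" "C * dist_of B f b \<le> e"
        using dense_approx[OF D b(1) C(1) e] by blast
      obtain F where F: "analytic_extension B \<sigma> f F"
        and bdF: "bounded ((\<lambda>z. \<phi> (times_of B g (F z))) ` {z. Im z > 0})"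
        using DG[OF f(1)] gD by blast
      obtain c where c: "\<And>y a e. (\<And>x. cmod (exp (- \<i> * of_int k * Complex x y) * \<phi> (times_of B g (F (Complex x y))) - a) \<le> e) \<Longrightarrow>
          cmod (c - a) \<le> e"
        using orbit_mean[OF \<phi>s g f(2) F, of k] by blast
      obtain A where A: "\<And>z. Im z > 0 \<Longrightarrow> cmod (\<phi> (times_of B g (F z))) \<le> A"
        using bdF unfolding bounded_iff by auto
      \<comment> \<open>At height \<open>y\<close> the bounded orbit is multiplied by a factor of
        modulus \<open>exp (k y)\<close>.\<close>
      have "cmod c \<le> exp (of_int k * y) * A" if "y > 0" for y
      proof -
        have "cmod (exp (- \<i> * of_int k * Complex x y) * \<phi> (times_of B g (F (Complex x y))) - 0) \<le> exp (of_int k * y) * A" for x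
          unfolding exp_Complex using A[of "Complex x y"] that by (simp add: norm_mult)
        then show ?thesis
          using c[where y = y and a = 0] by simp
      qed
      note le = this
      have "c = 0"
      proof (rule ccontr)
        assume "c \<noteq> 0"
        then have c: "cmod c > 0"
          by simp
        \<comment> \<open>Since \<open>y \<le> exp y\<close> and \<open>k + 1 \<le> 0\<close>, the
          product \<open>cmod c * y\<close> is at most \<open>\<bar>A\<bar>\<close>; this height
          would make it \<open>\<bar>A\<bar> + 1\<close>.\<close>
        define y where "y = (\<bar>A\<bar> + 1) / cmod c"
        have y: "y > 0"
          using c by (simp add: y_def add_nonneg_pos)
        have "y \<le> exp y"
          using exp_ge_add_one_self[of y] by linarith
        then have "cmod c * y \<le> cmod c * exp y"
          by (intro mult_left_mono) auto
        also have "\<dots> \<le> (exp (of_int k * y) * A) * exp y"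
          by (intro mult_right_mono le[OF y]) simp
        also have "\<dots> = exp (of_int k * y + y) * A"
          by (simp add: exp_add)
        also have "\<dots> \<le> exp (of_int k * y + y) * \<bar>A\<bar>"
          by (intro mult_left_mono) auto
        also have "\<dots> \<le> 1 * \<bar>A\<bar>"
        proof (intro mult_right_mono)
          have "of_int (k + 1) * y \<le> 0"
            using k y by (intro mult_nonpos_nonneg) linarith+
          then show "exp (of_int k * y + y) \<le> 1"
            by (simp add: distrib_right)
        qed simp
        finally show False
          using c by (simp add: y_def)
      qed
      note c0 = this
      \<comment> \<open>On the real line the same coefficient is close to the value at
        \<open>b\<close>, so that value is small.\<close>
      have "cmod (c - \<phi> (times_of B g b)) \<le> C * dist_of B f b"
      proof (rule c[where y = 0])
        fix x :: real
        have "F (Complex x 0) = \<sigma> x f"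
          using F by (simp add: analytic_extension_def complex_of_real_def)
        then show "cmod (exp (- \<i> * of_int k * Complex x 0) * \<phi> (times_of B g (F (Complex x 0))) - \<phi> (times_of B g b)) \<le> C * dist_of B f b"
          unfolding exp_Complex using orbit_estimate[OF \<phi>s b f(2) g C(2,1), of x] by simp
      qed
      then show ?thesis
        using f(3) c0 by simp
    qed
    then have "cmod (\<phi> (times_of B g b)) \<le> 0"
      by (rule field_le_epsilon)
    then show ?thesis
      by simp
  qed
  obtain C where C: "C \<ge> 0"
    "\<And>x y. x \<in> carr B \<Longrightarrow> y \<in> carr B \<Longrightarrow> cmod (\<phi> (times_of B x b) - \<phi> (times_of B y b)) \<le> C * dist_of B x y"
    using state_times_diff[OF \<phi>s b(1)] by blast
  have "cmod (\<phi> (times_of B g b)) \<le> 0 + e" if e: "e > 0" for e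
  proof -
    obtain f where f: "f \<in> D" "f \<in> carr B" "C * dist_of B f g \<le> e"
      using dense_approx[OF D g C(1) e] by blast
    then show ?thesis
      using C(2)[OF f(2) g] gD[OF f(1)] by simp
  qed
  then have "cmod (\<phi> (times_of B g b)) \<le> 0"
    by (rule field_le_epsilon)
  then show ?thesis
    by simp
qed

text \<open>The KMS condition concerns the single point \<open>\<i> * \<beta>\<close>. Applied to
  all translates \<open>\<sigma> r f\<close> it covers the whole line of height
  \<open>\<beta>\<close>, once the extension of a translate is known to be the translated extension.
  The identity theorem shows this after composition with \<open>\<phi>\<close>.\<close>

lemma analytic_extension_unique:
  assumes \<phi>: "\<phi> \<in> states B" and g: "g \<in> carr B" and f: "f \<in> carr B"
    and F: "analytic_extension B \<sigma> f F" and F': "analytic_extension B \<sigma> (\<sigma> r f) F'"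
  shows "\<phi> (times_of B g (F' z)) = \<phi> (times_of B g (F (z + of_real r)))"
proof -
  let ?h = "\<lambda>z. \<phi> (times_of B g (F' z)) - \<phi> (times_of B g (F (z + of_real r)))"
  have "?h z = 0"
  proof (rule analytic_continuation[of ?h UNIV \<real> 0])
    have "(\<lambda>z. \<phi> (times_of B g (F (z + of_real r)))) holomorphic_on UNIV"
      by (rule holomorphic_shift[OF orbit_holomorphic[OF \<phi> g F]])
    then show "?h holomorphic_on UNIV"
      by (intro holomorphic_intros orbit_holomorphic[OF \<phi> g F'])
    show "(0::complex) islimpt \<real>"
      unfolding islimpt_approachable
    proof (intro allI impI)
      fix e :: real assume "e > 0"
      then show "\<exists>x'\<in>\<real>. x' \<noteq> 0 \<and> dist x' (0::complex) < e"
        by (intro bexI[of _ "of_real (e/2)"]) auto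
    qed
    show "?h x = 0" if xr: "x \<in> \<real>" for x
    proof -
      obtain s :: real where s: "x = of_real s"
        using xr unfolding Reals_def by blast
      have "F' (of_real s) = \<sigma> (s + r) f"
        using F' \<sigma>_\<sigma>[OF f] by (simp add: analytic_extension_def)
      moreover have "F (of_real s + of_real r) = \<sigma> (s + r) f"
        using F unfolding analytic_extension_def by (metis of_real_add)
      ultimately show ?thesis
        by (simp add: s)
    qed
  qed auto
  then show ?thesis
    by simp
qed

text \<open>One Fourier coefficient is near \<open>\<phi>(g b)\<close> when estimated at height 0,
  and near \<open>exp (k \<beta>)\<close> times \<open>\<phi>(b g)\<close> when estimated at height
  \<open>\<beta>\<close>.\<close>

lemma kms_commute:
  assumes \<phi>: "\<phi> \<in> kms_states B \<sigma> \<beta>" and b: "b \<in> carr B" "\<And>r. \<sigma> r b = scale_of B (phase r k) b"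
    and g: "g \<in> carr B"
  shows "\<phi> (times_of B b g) = of_real (exp (- of_int k * \<beta>)) * \<phi> (times_of B g b)"
proof -
  have \<phi>s: "\<phi> \<in> states B"
    using \<phi> by (simp add: kms_states_def)
  obtain D where D: "dense_in B D" and Dinv: "\<And>r f. f \<in> D \<Longrightarrow> \<sigma> r f \<in> D"
    and DF: "\<And>f. f \<in> D \<Longrightarrow> \<exists>F. analytic_extension B \<sigma> f F \<and>
      (\<forall>g\<in>D. \<phi> (times_of B f g) = \<phi> (times_of B g (F (\<i> * complex_of_real \<beta>))))"
    using \<phi> unfolding kms_states_def by blast
  have "\<phi> (times_of B b g) = of_real (exp (- of_int k * \<beta>)) * \<phi> (times_of B g b)" if gD: "g \<in> D" for g
  proof -
    let ?E = "exp (of_int k * \<beta>)"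
    have g: "g \<in> carr B"
      using gD D by (auto simp: dense_in_def)
    obtain C where C: "C \<ge> 0"
      "\<And>x y. x \<in> carr B \<Longrightarrow> y \<in> carr B \<Longrightarrow> cmod (\<phi> (times_of B g x) - \<phi> (times_of B g y)) \<le> C * dist_of B x y"
      "\<And>x y. x \<in> carr B \<Longrightarrow> y \<in> carr B \<Longrightarrow> cmod (\<phi> (times_of B x g) - \<phi> (times_of B y g)) \<le> C * dist_of B x y"
      using state_times_diff[OF \<phi>s g] by blast
    let ?w = "of_real ?E * \<phi> (times_of B b g) - \<phi> (times_of B g b)"
    have "cmod ?w \<le> 0 + e" if e: "e > 0" for e
    proof -
      have CE: "C * (1 + ?E) \<ge> 0"
        using C(1) by (intro mult_nonneg_nonneg) (auto intro: add_nonneg_nonneg)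
      obtain f where f: "f \<in> D" "f \<in> carr B" "C * (1 + ?E) * dist_of B f b \<le> e"
        using dense_approx[OF D b(1) CE e] by blast
      obtain F where F: "analytic_extension B \<sigma> f F"
        using DF[OF f(1)] by blast
      have shift: "\<phi> (times_of B g (F (Complex x \<beta>))) = \<phi> (times_of B (\<sigma> x f) g)" for x
      proof -
        obtain F' where F': "analytic_extension B \<sigma> (\<sigma> x f) F'"
          "\<phi> (times_of B (\<sigma> x f) g) = \<phi> (times_of B g (F' (\<i> * complex_of_real \<beta>)))"
          using DF[OF Dinv[OF f(1)]] gD by blast
        have "\<i> * complex_of_real \<beta> + of_real x = Complex x \<beta>"
          by (simp add: complex_eq_iff)
        then show ?thesis
          using analytic_extension_unique[OF \<phi>s g f(2) F F'(1), of "\<i> * complex_of_real \<beta>"] F'(2) by simp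
      qed
      obtain c where c: "\<And>y a e. (\<And>x. cmod (exp (- \<i> * of_int k * Complex x y) * \<phi> (times_of B g (F (Complex x y))) - a) \<le> e) \<Longrightarrow>
          cmod (c - a) \<le> e"
        using orbit_mean[OF \<phi>s g f(2) F, of k] by blast
      have 1: "cmod (c - \<phi> (times_of B g b)) \<le> C * dist_of B f b"
      proof (rule c[where y = 0])
        fix x :: real
        have "F (Complex x 0) = \<sigma> x f"
          using F by (simp add: analytic_extension_def complex_of_real_def)
        then show "cmod (exp (- \<i> * of_int k * Complex x 0) * \<phi> (times_of B g (F (Complex x 0))) - \<phi> (times_of B g b)) \<le> C * dist_of B f b"
          unfolding exp_Complex using orbit_estimate[OF \<phi>s b f(2) g C(2,1), of x] by simp
      qed
      have 2: "cmod (c - of_real ?E * \<phi> (times_of B b g)) \<le> ?E * (C * dist_of B f b)"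
      proof (rule c[where y = \<beta>])
        fix x :: real
        have "cmod (of_real ?E * (phase (- x) k * \<phi> (times_of B (\<sigma> x f) g) - \<phi> (times_of B b g))) \<le> ?E * (C * dist_of B f b)"
          using orbit_estimate_left[OF \<phi>s b f(2) g C(3,1), of x] by (simp add: norm_mult)
        then show "cmod (exp (- \<i> * of_int k * Complex x \<beta>) * \<phi> (times_of B g (F (Complex x \<beta>))) - of_real ?E * \<phi> (times_of B b g)) \<le>
            ?E * (C * dist_of B f b)"
          unfolding exp_Complex shift by (simp add: algebra_simps)
      qed
      have "?w = (c - \<phi> (times_of B g b)) - (c - of_real ?E * \<phi> (times_of B b g))"
        by simp
      then have "cmod ?w \<le> cmod (c - \<phi> (times_of B g b)) + cmod (c - of_real ?E * \<phi> (times_of B b g))"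
        by (metis norm_triangle_ineq4)
      also have "\<dots> \<le> C * dist_of B f b + ?E * (C * dist_of B f b)"
        by (intro add_mono 1 2)
      also have "\<dots> = C * (1 + ?E) * dist_of B f b"
        by (simp add: algebra_simps)
      finally show ?thesis
        using f(3) by simp
    qed
    then have "cmod ?w \<le> 0"
      by (rule field_le_epsilon)
    then have "of_real ?E * \<phi> (times_of B b g) = \<phi> (times_of B g b)"
      by simp
    then have "of_real (exp (- of_int k * \<beta>)) * (of_real ?E * \<phi> (times_of B b g)) =
        of_real (exp (- of_int k * \<beta>)) * \<phi> (times_of B g b)"
      by simp
    moreover have "complex_of_real (exp (- of_int k * \<beta>)) * of_real ?E = 1"
      by (simp add: of_real_mult[symmetric] exp_add[symmetric] del: of_real_mult)
    ultimately show ?thesis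
      by (metis mult.assoc mult_1)
  qed
  then show ?thesis
    by (intro dense_state_eq[OF \<phi>s D _ b(1) g]) auto
qed

end

section \<open>Ground states of the Toeplitz algebra\<close>

lemma type_alg_simps [simp]:
  "carr type_alg = UNIV" "plus_of type_alg = (+)" "scale_of type_alg = (*\<^sub>C)"
  "times_of type_alg = (*)" "star_of type_alg = star" "norm_of type_alg = norm"
  by (simp_all add: type_alg_def)

interpretation ta: normed_alg "type_alg :: 'a::cstar_algebra star_alg"
proof
  show "\<exists>C\<ge>0. \<forall>x\<in>carr type_alg. norm_of type_alg (times_of type_alg f x) \<le> C * norm_of type_alg x \<and>
      norm_of type_alg (times_of type_alg x f) \<le> C * norm_of type_alg x" for f :: 'a
    using norm_mult_ineq[of f] norm_mult_ineq[of _ f]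
    by (intro exI[of _ "norm f"]) (simp add: mult.commute)
qed (simp_all add: distrib_left distrib_right scaleC_mult_left scaleC_mult_right norm_scaleC)

text \<open>Both \<open>\<Psi>\<close> and its inverse are evaluations at transported elements,
  \<open>h y\<close> and \<open>p a\<close>; such maps are continuous for pointwise
  convergence.\<close>

lemma weak_star_homeomorphismI:
  fixes A :: "'b star_alg" and B :: "'c star_alg"
  assumes S: "S \<subseteq> extensional (carr A)" and T: "T \<subseteq> extensional (carr B)" and img: "\<Psi> ` S = T"
    and h: "\<And>y. y \<in> carr B \<Longrightarrow> h y \<in> carr A \<and> (\<forall>\<tau>\<in>S. \<Psi> \<tau> y = \<tau> (h y))"
    and p: "\<And>a. a \<in> carr A \<Longrightarrow> p a \<in> carr B \<and> (\<forall>\<tau>\<in>S. \<Psi> \<tau> (p a) = \<tau> a)"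
  shows "weak_star_homeomorphism A S B T \<Psi>"
proof -
  define G where "G \<phi> = restrict (\<lambda>a. \<phi> (p a)) (carr A)" for \<phi> :: "'c \<Rightarrow> complex"
  have top: "topspace (subtopology (weak_star A) S) = S" "topspace (subtopology (weak_star B) T) = T"
    using S T by (auto simp: weak_star_def PiE_def)
  have GS: "G (\<Psi> \<tau>) = \<tau>" if "\<tau> \<in> S" for \<tau>
  proof (rule extensionalityI[of _ "carr A"])
    show "G (\<Psi> \<tau>) \<in> extensional (carr A)"
      by (simp add: G_def)
    show "\<tau> \<in> extensional (carr A)"
      using S that by blast
  qed (use p that in \<open>auto simp: G_def\<close>)
  have "continuous_map (subtopology (weak_star A) S) (subtopology (weak_star B) T) \<Psi>"
    unfolding continuous_map_in_subtopology weak_star_def continuous_map_componentwise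
  proof (intro conjI ballI)
    fix y assume y: "y \<in> carr B"
    have "continuous_map (subtopology (product_topology (\<lambda>_. euclidean) (carr A)) S) euclidean (\<lambda>\<tau>. \<tau> (h y))"
      using h[OF y] by (intro continuous_map_from_subtopology continuous_map_product_projection) simp
    then show "continuous_map (subtopology (product_topology (\<lambda>_. euclidean) (carr A)) S) euclidean (\<lambda>\<tau>. \<Psi> \<tau> y)"
      by (rule continuous_map_eq) (use h[OF y] top(1) in \<open>auto simp: weak_star_def\<close>)
  qed (use top(1) T img in \<open>auto simp: weak_star_def\<close>)
  moreover have "continuous_map (subtopology (weak_star B) T) (subtopology (weak_star A) S) G"
    unfolding continuous_map_in_subtopology weak_star_def continuous_map_componentwise
  proof (intro conjI ballI)
    fix a assume a: "a \<in> carr A"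
    have "continuous_map (subtopology (product_topology (\<lambda>_. euclidean) (carr B)) T) euclidean (\<lambda>\<phi>. \<phi> (p a))"
      using p[OF a] by (intro continuous_map_from_subtopology continuous_map_product_projection) simp
    then show "continuous_map (subtopology (product_topology (\<lambda>_. euclidean) (carr B)) T) euclidean (\<lambda>\<phi>. G \<phi> a)"
      using a by (simp add: G_def)
  qed (use top(2) GS img in \<open>auto simp: weak_star_def G_def\<close>)
  ultimately have "homeomorphic_maps (subtopology (weak_star A) S) (subtopology (weak_star B) T) \<Psi> G"
    unfolding homeomorphic_maps_def top using GS img by auto
  then show ?thesis
    unfolding weak_star_homeomorphism_def by (rule homeomorphic_maps_imp_map)
qed

section \<open>A dense algebra of analytic elements\<close>

context product_sys
begin

sublocale nt: rot_alg "NT X" rotation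
proof
  fix f assume f: "f \<in> NTc"
  show "\<exists>C\<ge>0. \<forall>x\<in>NTc. norm_of (NT X) (times_of (NT X) f x) \<le> C * norm_of (NT X) x \<and>
      norm_of (NT X) (times_of (NT X) x f) \<le> C * norm_of (NT X) x"
    using opnorm_comp[OF NT_Op[OF f] NT_Op] opnorm_comp[OF NT_Op NT_Op[OF f]] f
    by (intro exI[of _ "opnorm f"]) (simp add: opnorm_nonneg mult.commute)
qed (simp_all add: op_comp_add_left op_comp_add_right op_comp_scale_left op_comp_scale_right opnorm_nonneg
  opnorm_scale rotation_op_add rotation_op_scale opnorm_rotation rotation_2pi rotation_rotation)

lemma dist_of_NT: "dist_of (NT X) f g = opnorm (op_add f (op_scale (-1) g))"
  by (simp add: dist_of_def)

text \<open>The dense set for the states that are constructed on the Toeplitz algebra. Sums of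
  homogeneous elements are chosen instead of spans of monomials because closure under products then
  needs no computation.\<close>

inductive_set homspan :: "('n, 'x) fop set" where
  homogeneous: "homogeneous k f \<Longrightarrow> f \<in> homspan"
| add: "f \<in> homspan \<Longrightarrow> g \<in> homspan \<Longrightarrow> op_add f g \<in> homspan"

lemma homspan_NT [simp]: "f \<in> homspan \<Longrightarrow> f \<in> NTc"
  by (induction rule: homspan.induct) (auto simp: homogeneous_def)

lemma homspan_comp: "f \<in> homspan \<Longrightarrow> g \<in> homspan \<Longrightarrow> f \<circ> g \<in> homspan"
proof (induction rule: homspan.induct)
  case (homogeneous k f)
  have f: "f \<in> Op"
    using homspan_NT[OF homspan.homogeneous[OF homogeneous(1)]] by simp
  from homogeneous(2) show ?case
  proof (induction rule: homspan.induct)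
    case (homogeneous l h)
    then show ?case
      using homogeneous_comp[OF \<open>homogeneous k f\<close>] homspan.homogeneous by blast
  next
    case (add h h')
    then show ?case
      unfolding op_comp_add_right[OF f NT_Op[OF homspan_NT[OF add(1)]] NT_Op[OF homspan_NT[OF add(2)]]]
      by (intro homspan.add)
  qed
qed (auto simp: op_comp_add_left intro: homspan.intros)

lemma homspan_adj: "f \<in> homspan \<Longrightarrow> adj f \<in> homspan"
  by (induction rule: homspan.induct) (auto simp: adj_op_add intro: homspan.intros homogeneous_adj)

lemma homspan_scale: "f \<in> homspan \<Longrightarrow> op_scale c f \<in> homspan"
proof (induction rule: homspan.induct)
  case (add f g)
  have "op_scale c (op_add f g) = op_add (op_scale c f) (op_scale c g)"
    by (simp add: op_scale_def op_add_def scaleC_add_right)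
  then show ?case
    using add by (auto intro: homspan.intros)
qed (auto intro: homspan.intros homogeneous_scale)

lemma homspan_rotation: "f \<in> homspan \<Longrightarrow> rotation r f \<in> homspan"
proof (induction rule: homspan.induct)
  case (homogeneous k f)
  then have "rotation r f = op_scale (phase r k) f"
    by (simp add: homogeneous_def)
  then show ?case
    using homogeneous by (auto intro: homspan_scale homspan.intros)
qed (auto simp: rotation_op_add intro: homspan.intros)

lemma star_subalgebra_homspan: "star_subalgebra (NT X) homspan"
  using homspan.homogeneous[OF homogeneous_creation[OF emb_mem[of 0]]]
  by (auto simp: star_subalgebra_def intro: homspan.intros homspan_comp homspan_adj homspan_scale)

text \<open>The norm limits of \<open>homspan\<close> form a closed star subalgebra that contains
  all creation operators.\<close>

lemma dense_homspan: "dense_in (NT X) homspan"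
proof -
  let ?d = "\<lambda>s f. opnorm (op_add s (op_scale (-1) f))"
  define S where "S = {f \<in> NTc. \<forall>e>0. \<exists>s\<in>homspan. ?d s f < e}"
  have hs: "s \<in> S" if "s \<in> homspan" for s
  proof -
    have "op_add s (op_scale (-1) s) = op_scale 0 s"
      unfolding op_add_def op_scale_def by simp
    then have "?d s s = 0"
      using that by (simp add: opnorm_scale)
    then show ?thesis
      using that unfolding S_def by (intro CollectI conjI allI impI bexI[of _ s]) simp_all
  qed
  have "NTc \<subseteq> S"
  proof (rule NT_induct)
    show "creation X n \<xi> \<in> S" if "\<xi> \<in> M n" for n \<xi>
      using hs[OF homspan.homogeneous[OF homogeneous_creation[OF that]]] .
    have add: "op_add f g \<in> S" if f: "f \<in> S" and g: "g \<in> S" for f g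
      unfolding S_def
    proof (intro CollectI conjI allI impI)
      fix e :: real assume "e > 0"
      then have "e / 2 > 0"
        by simp
      then obtain s t where st: "s \<in> homspan" "?d s f < e / 2" "t \<in> homspan" "?d t g < e / 2"
        using f g unfolding S_def by blast
      have "op_add (op_add s t) (op_scale (-1) (op_add f g)) =
          op_add (op_add s (op_scale (-1) f)) (op_add t (op_scale (-1) g))"
        by (simp add: op_add_def op_scale_def fun_eq_iff)
      then have "?d (op_add s t) (op_add f g) \<le> ?d s f + ?d t g"
        using opnorm_add[of "op_add s (op_scale (-1) f)" "op_add t (op_scale (-1) g)"] st f g
        by (simp add: S_def)
      then show "\<exists>s\<in>homspan. ?d s (op_add f g) < e"
        using st by (intro bexI[of _ "op_add s t"] homspan.add) auto
    qed (use f g in \<open>simp add: S_def\<close>)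
    have comp: "f \<circ> g \<in> S" if f: "f \<in> S" and g: "g \<in> S" for f g
      unfolding S_def
    proof (intro CollectI conjI allI impI)
      have fg: "f \<in> Op" "g \<in> Op"
        using f g by (auto simp: S_def)
      fix e :: real assume e: "e > 0"
      \<comment> \<open>The cap at 1 keeps \<open>opnorm t\<close> at most
        \<open>opnorm g + 1\<close>; the other bound makes the two error terms add up to at most
        \<open>e / 2\<close>.\<close>
      define r where "r = min 1 (e / (2 * (opnorm f + opnorm g + 1)))"
      have A: "opnorm f + opnorm g + 1 > 0"
        using opnorm_nonneg[OF fg(1)] opnorm_nonneg[OF fg(2)] by linarith
      have r: "r > 0" "r \<le> 1" "r \<le> e / (2 * (opnorm f + opnorm g + 1))"
        using e A by (auto simp: r_def)
      obtain s t where st: "s \<in> homspan" "?d s f < r" "t \<in> homspan" "?d t g < r"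
        using f g r(1) unfolding S_def by blast
      have stO: "s \<in> Op" "t \<in> Op"
        using st by simp_all
      have "op_add (s \<circ> t) (op_scale (-1) (f \<circ> g)) =
          op_add ((op_add s (op_scale (-1) f)) \<circ> t) (f \<circ> (op_add t (op_scale (-1) g)))"
      proof -
        have "f \<circ> op_add t (op_scale (-1) g) = op_add (f \<circ> t) (op_scale (-1) (f \<circ> g))"
          using fg stO by (simp add: op_comp_add_right op_comp_scale_right)
        then show ?thesis
          by (simp only:) (simp add: op_add_def op_scale_def fun_eq_iff)
      qed
      then have "?d (s \<circ> t) (f \<circ> g) \<le> ?d s f * opnorm t + opnorm f * ?d t g"
        using opnorm_add[of "op_add s (op_scale (-1) f) \<circ> t" "f \<circ> op_add t (op_scale (-1) g)"]
          opnorm_comp[of "op_add s (op_scale (-1) f)" t] opnorm_comp[of f "op_add t (op_scale (-1) g)"] fg stO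
        by simp
      also have "opnorm t \<le> opnorm g + 1"
      proof -
        have "t = op_add (op_add t (op_scale (-1) g)) g"
          by (simp add: op_add_def op_scale_def)
        then have "opnorm t \<le> ?d t g + opnorm g"
          using opnorm_add[of "op_add t (op_scale (-1) g)" g] fg stO by simp
        then show ?thesis
          using st(4) r(2) by linarith
      qed
      also have "?d s f * (opnorm g + 1) + opnorm f * ?d t g \<le> r * (opnorm g + 1) + opnorm f * r"
        using st(2,4) opnorm_nonneg[OF fg(1)] opnorm_nonneg[OF fg(2)]
        by (intro add_mono mult_right_mono mult_left_mono) auto
      also have "\<dots> = r * (opnorm f + opnorm g + 1)"
        by (simp add: algebra_simps)
      also have "\<dots> \<le> (e / (2 * (opnorm f + opnorm g + 1))) * (opnorm f + opnorm g + 1)"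
        using r(3) A by (intro mult_right_mono) auto
      also have "\<dots> = e / 2"
        using A by (simp add: field_simps)
      finally have "?d (s \<circ> t) (f \<circ> g) \<le> e / 2"
        using opnorm_nonneg[of "op_add s (op_scale (-1) f)"] fg stO by (simp add: mult_left_mono)
      then have "?d (s \<circ> t) (f \<circ> g) < e"
        using e by simp
      then show "\<exists>s\<in>homspan. ?d s (f \<circ> g) < e"
        using st by (intro bexI[of _ "s \<circ> t"] homspan_comp) auto
    qed (use f g in \<open>simp add: S_def\<close>)
    have adjS: "adj f \<in> S" if f: "f \<in> S" for f
      unfolding S_def
    proof (intro CollectI conjI allI impI)
      fix e :: real assume "e > 0"
      then obtain s where s: "s \<in> homspan" "?d s f < e"
        using f unfolding S_def by blast
      then have "?d (adj s) (adj f) < e"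
        using opnorm_adj[of "op_add s (op_scale (-1) f)"] f by (simp add: S_def adj_op_add adj_op_scale)
      then show "\<exists>s\<in>homspan. ?d s (adj f) < e"
        using s homspan_adj by blast
    qed (use f in \<open>simp add: S_def\<close>)
    have scaleS: "op_scale c f \<in> S" if f: "f \<in> S" for c f
      unfolding S_def
    proof (intro CollectI conjI allI impI)
      fix e :: real assume e: "e > 0"
      then have "e / (cmod c + 1) > 0"
        by (simp add: add_nonneg_pos)
      then obtain s where s: "s \<in> homspan" "?d s f < e / (cmod c + 1)"
        using f unfolding S_def by blast
      have sf: "op_add s (op_scale (-1) f) \<in> Op"
        using s f by (simp add: S_def)
      have "op_add (op_scale c s) (op_scale (-1) (op_scale c f)) = op_scale c (op_add s (op_scale (-1) f))"
        unfolding op_scale_def op_add_def by (simp only: scaleC_add_right scaleC_scaleC mult.commute)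
      then have "?d (op_scale c s) (op_scale c f) = cmod c * ?d s f"
        using sf by (simp add: opnorm_scale)
      also have "\<dots> \<le> (cmod c + 1) * ?d s f"
        using opnorm_nonneg[OF sf] by (intro mult_right_mono) auto
      also have "\<dots> < (cmod c + 1) * (e / (cmod c + 1))"
        using s(2) by (intro mult_strict_left_mono) (auto simp: add_nonneg_pos)
      also have "\<dots> = e"
        using norm_ge_zero[of c] by (simp add: add_nonneg_eq_0_iff)
      finally show "\<exists>s\<in>homspan. ?d s (op_scale c f) < e"
        using s(1) homspan_scale by blast
    qed (use f in \<open>simp add: S_def\<close>)
    have "S \<noteq> {}"
      using hs[OF homspan.homogeneous[OF homogeneous_creation[OF emb_mem[of 0]]]] by blast
    moreover have "S \<subseteq> Op"
      by (auto simp: S_def)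
    ultimately show "star_subalgebra (adjointable_ops X) S"
      unfolding star_subalgebra_def by (simp add: add comp adjS scaleS)
    show "closed_in (adjointable_ops X) S"
      unfolding closed_in_def
    proof (intro allI impI)
      fix s f assume A: "(\<forall>k::nat. s k \<in> S) \<and> f \<in> Op \<and> (\<lambda>k. dist_of (adjointable_ops X) (s k) f) \<longlonglongrightarrow> 0"
      then have lim: "(\<lambda>k. ?d (s k) f) \<longlonglongrightarrow> 0" and fO: "f \<in> Op"
        by (simp_all add: dist_of_ops)
      have "\<forall>k. s k \<in> NTc"
        using A by (simp add: S_def)
      then have f: "f \<in> NTc"
        using closed_in_NT[unfolded closed_in_def, rule_format, of s f] A by blast
      show "f \<in> S"
        unfolding S_def
      proof (intro CollectI conjI allI impI f)
        fix e :: real assume "e > 0"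
        then have e: "e / 2 > 0"
          by simp
        obtain k where "norm (?d (s k) f - 0) < e / 2"
          using LIMSEQ_D[OF lim e] by blast
        then have k: "?d (s k) f < e / 2"
          by simp
        obtain t where t: "t \<in> homspan" "?d t (s k) < e / 2"
          using A e unfolding S_def by blast
        have sk: "s k \<in> Op"
          using A by (auto simp: S_def)
        have "op_add t (op_scale (-1) f) = op_add (op_add t (op_scale (-1) (s k))) (op_add (s k) (op_scale (-1) f))"
          by (simp add: op_add_def op_scale_def)
        then have "?d t f \<le> ?d t (s k) + ?d (s k) f"
          using opnorm_add[of "op_add t (op_scale (-1) (s k))" "op_add (s k) (op_scale (-1) f)"] t sk fO by simp
        then show "\<exists>s\<in>homspan. ?d s f < e"
          using t k by (intro bexI[of _ t]) auto
      qed
    qed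
  qed
  then show ?thesis
    by (auto simp: dense_in_def dist_of_NT S_def)
qed

lemma analytic_extension_homogeneous:
  assumes f: "homogeneous k f"
  shows "analytic_extension (NT X) rotation f (\<lambda>z. op_scale (exp (\<i> * z * of_int k)) f)"
  unfolding analytic_extension_def
proof (intro conjI allI)
  have fN: "f \<in> NTc"
    using f homogeneous_def by blast
  then show "op_scale (exp (\<i> * z * of_int k)) f \<in> carr (NT X)" for z
    by simp
  show "op_scale (exp (\<i> * of_real r * of_int k)) f = rotation r f" for r
    using f by (simp add: homogeneous_def phase_def mult.assoc)
  fix z
  let ?E = "\<lambda>z. exp (\<i> * z * of_int k)"
  let ?D = "\<i> * of_int k * ?E z"
  have "(?E has_field_derivative ?D) (at z)"
    by (auto intro!: derivative_eq_intros simp: mult_ac)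
  then have lim: "((\<lambda>h. cmod ((?E (z + h) - ?E z) / h - ?D) * opnorm f) \<longlongrightarrow> 0) (at 0)"
    unfolding DERIV_def by (intro tendsto_mult_left_zero tendsto_norm_zero LIM_zero)
  have "dist_of (NT X) (scale_of (NT X) (1 / h) (plus_of (NT X) (op_scale (?E (z + h)) f)
      (scale_of (NT X) (-1) (op_scale (?E z) f)))) (op_scale ?D f) =
      cmod ((?E (z + h) - ?E z) / h - ?D) * opnorm f" for h
  proof -
    have "op_add (op_scale (1 / h) (op_add (op_scale (?E (z + h)) f) (op_scale (-1) (op_scale (?E z) f)))) (op_scale (-1) (op_scale ?D f)) =
        op_scale ((?E (z + h) - ?E z) / h - ?D) f"
    proof -
      have "(?E (z + h) - ?E z) / h - ?D = 1 / h * ?E (z + h) + (1 / h * (- 1 * ?E z) + - 1 * ?D)"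
        by (simp add: diff_divide_distrib)
      then show ?thesis
        by (simp only: op_add_def op_scale_def scaleC_add_left scaleC_add_right scaleC_scaleC add.assoc)
    qed
    then show ?thesis
      using fN by (simp only: dist_of_NT NT_simps opnorm_scale[OF NT_Op])
  qed
  then show "\<exists>D\<in>carr (NT X). ((\<lambda>h. dist_of (NT X) (scale_of (NT X) (1 / h) (plus_of (NT X) (op_scale (?E (z + h)) f)
      (scale_of (NT X) (-1) (op_scale (?E z) f)))) D) \<longlongrightarrow> 0) (at 0)"
    using lim fN by (intro bexI[of _ "op_scale ?D f"]) simp_all
qed

lemma analytic_extension_add:
  assumes F: "analytic_extension (NT X) rotation f F" and G: "analytic_extension (NT X) rotation g G"
  shows "analytic_extension (NT X) rotation (op_add f g) (\<lambda>z. op_add (F z) (G z))"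
  unfolding analytic_extension_def
proof (intro conjI allI)
  have m: "F z \<in> NTc" "G z \<in> NTc" for z
    using F G by (simp_all add: analytic_extension_def)
  then show "op_add (F z) (G z) \<in> carr (NT X)" for z
    by simp
  show "op_add (F (complex_of_real r)) (G (complex_of_real r)) = rotation r (op_add f g)" for r
    using F G by (simp add: analytic_extension_def rotation_op_add)
  fix z
  let ?Q = "\<lambda>F h. op_scale (1 / h) (op_add (F (z + h)) (op_scale (-1) (F z)))"
  obtain D where D: "D \<in> NTc" "((\<lambda>h. dist_of (NT X) (?Q F h) D) \<longlongrightarrow> 0) (at 0)"
    using F[unfolded analytic_extension_def NT_simps, THEN conjunct2, THEN conjunct2, rule_format, of z] by blast
  obtain E where E: "E \<in> NTc" "((\<lambda>h. dist_of (NT X) (?Q G h) E) \<longlongrightarrow> 0) (at 0)"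
    using G[unfolded analytic_extension_def NT_simps, THEN conjunct2, THEN conjunct2, rule_format, of z] by blast
  have "((\<lambda>h. dist_of (NT X) (?Q (\<lambda>z. op_add (F z) (G z)) h) (op_add D E)) \<longlongrightarrow> 0) (at 0)"
  proof (rule Lim_null_comparison)
    show "((\<lambda>h. dist_of (NT X) (?Q F h) D + dist_of (NT X) (?Q G h) E) \<longlongrightarrow> 0) (at 0)"
      by (intro tendsto_add_zero D E)
    have "dist_of (NT X) (?Q (\<lambda>z. op_add (F z) (G z)) h) (op_add D E) \<le>
        dist_of (NT X) (?Q F h) D + dist_of (NT X) (?Q G h) E" for h
    proof -
      have "op_add (?Q (\<lambda>z. op_add (F z) (G z)) h) (op_scale (-1) (op_add D E)) =
          op_add (op_add (?Q F h) (op_scale (-1) D)) (op_add (?Q G h) (op_scale (-1) E))"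
        by (simp add: op_add_def op_scale_def fun_eq_iff scaleC_add_right scaleC_diff_right algebra_simps)
      then show ?thesis
        using opnorm_add[of "op_add (?Q F h) (op_scale (-1) D)" "op_add (?Q G h) (op_scale (-1) E)"] m D(1) E(1)
        by (simp add: dist_of_NT)
    qed
    moreover have "0 \<le> dist_of (NT X) (?Q (\<lambda>z. op_add (F z) (G z)) h) (op_add D E)" for h
      unfolding dist_of_NT using m D(1) E(1) by (intro opnorm_nonneg) simp
    ultimately show "\<forall>\<^sub>F h in at 0. norm (dist_of (NT X) (?Q (\<lambda>z. op_add (F z) (G z)) h) (op_add D E)) \<le>
        dist_of (NT X) (?Q F h) D + dist_of (NT X) (?Q G h) E"
      by (intro always_eventually allI) simp
  qed
  then show "\<exists>H\<in>carr (NT X). ((\<lambda>h. dist_of (NT X) (scale_of (NT X) (1 / h) (plus_of (NT X) (op_add (F (z + h)) (G (z + h)))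
      (scale_of (NT X) (-1) (op_add (F z) (G z))))) H) \<longlongrightarrow> 0) (at 0)"
    using D(1) E(1) by (intro bexI[of _ "op_add D E"]) simp_all
qed

lemma fpi_add: "fpi X (a + b) = op_add (fpi X a) (fpi X b)"
proof (rule Op_eqI)
  show "fpi X (a + b) \<eta> = op_add (fpi X a) (fpi X b) \<eta>" if \<eta>: "\<eta> \<in> fock X" for \<eta>
    unfolding op_add_def by (rule ext) (simp add: fpi_apply \<eta> lmul_add_left fock_mem[OF \<eta>])
qed simp_all

lemma fpi_scale: "fpi X (c *\<^sub>C a) = op_scale c (fpi X a)"
proof (rule Op_eqI)
  show "fpi X (c *\<^sub>C a) \<eta> = op_scale c (fpi X a) \<eta>" if \<eta>: "\<eta> \<in> fock X" for \<eta>
    unfolding op_scale_def by (rule ext) (simp add: fpi_apply \<eta> lmul_scaleC_left fock_mem[OF \<eta>])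
qed simp_all

lemma fpi_mult: "fpi X (a * b) = fpi X a \<circ> fpi X b"
  by (rule Op_eqI) (auto simp: fun_eq_iff fpi_apply Op_mem lmul_mult fock_mem)

lemma adj_fpi: "adj (fpi X a) = fpi X (star a)"
proof (rule OpI(2)[where K="norm a"])
  show "fock_operator X (fpi X a)" "fock_operator X (fpi X (star a))"
    using fpi_Op Op_iff by blast+
  show "fock_ip X (fpi X a \<eta>) \<zeta> = fock_ip X \<eta> (fpi X (star a) \<zeta>)" if "\<eta> \<in> fock X" "\<zeta> \<in> fock X" for \<eta> \<zeta>
    unfolding fock_ip_def
    by (rule infsum_cong) (simp add: fpi_apply that lmul_adj fock_mem[OF that(1)] fock_mem[OF that(2)])
  show "fock_norm X (fpi X a \<eta>) \<le> norm a * fock_norm X \<eta>" if "\<eta> \<in> fock X" for \<eta>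
    using order_trans[OF opnorm_bound[OF fpi_Op that] mult_right_mono[OF opnorm_fpi]] by simp
qed

section \<open>Functionals that factor through the fibre at 0\<close>

definition Psi :: "('a \<Rightarrow> complex) \<Rightarrow> ('n, 'x) fop \<Rightarrow> complex" where
  "Psi \<tau> = restrict (\<lambda>f. \<tau> (e0 f)) NTc"

lemma Psi_apply: "f \<in> NTc \<Longrightarrow> Psi \<tau> f = \<tau> (e0 f)"
  by (simp add: Psi_def)

lemma state_pos: "\<tau> \<in> states type_alg \<Longrightarrow> pos a \<Longrightarrow> \<tau> a \<in> \<real>\<^sub>\<ge>\<^sub>0"
  using ta.stateD(4)[of \<tau>] by (auto simp: pos_def)

lemma Psi_state:
  assumes \<tau>: "\<tau> \<in> states type_alg"
  shows "Psi \<tau> \<in> states (NT X)"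
proof (rule nt.stateI)
  show "Psi \<tau> \<in> extensional (carr (NT X))"
    by (simp add: Psi_def)
  fix f g :: "('n, 'x) fop" and c
  assume f: "f \<in> carr (NT X)"
  show "g \<in> carr (NT X) \<Longrightarrow> Psi \<tau> (plus_of (NT X) f g) = Psi \<tau> f + Psi \<tau> g"
    using f ta.stateD(2)[OF \<tau>] by (simp add: Psi_apply e0_add)
  show "Psi \<tau> (scale_of (NT X) c f) = c * Psi \<tau> f"
    using f ta.stateD(3)[OF \<tau>] by (simp add: Psi_apply e0_scale)
  show "Psi \<tau> (times_of (NT X) (star_of (NT X) f) f) \<in> \<real>\<^sub>\<ge>\<^sub>0"
    using f by (simp add: Psi_apply e0_adj_comp state_pos[OF \<tau>] fk.inner_pos)
  show "cmod (Psi \<tau> f) \<le> norm_of (NT X) f"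
    using f norm_e0[of f] ta.state_bound[OF \<tau>, of "e0 f"] by (simp add: Psi_apply)
next
  fix e :: real assume "e > 0"
  then obtain a where "norm a \<le> 1" "cmod (\<tau> a) > 1 - e"
    using ta.state_approx[OF \<tau>] by auto
  then show "\<exists>f\<in>carr (NT X). norm_of (NT X) f \<le> 1 + e \<and> cmod (Psi \<tau> f) > 1 - e"
    using opnorm_fpi[of a] \<open>e > 0\<close> by (intro bexI[of _ "fpi X a"]) (simp_all add: Psi_apply)
qed

lemma Psi_monomial:
  assumes \<xi>: "\<xi> \<in> M n" and \<eta>: "\<eta> \<in> M m" and nm: "n + m \<noteq> 0" and \<tau>: "\<tau> \<in> states type_alg"
  shows "Psi \<tau> (monomial X n \<xi> m \<eta>) = 0"
proof -
  have v: "vac (adj (creation X n \<xi>)) = (\<lambda>_. 0)" if "\<xi> \<in> M n" "n \<noteq> 0" for n \<xi>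
  proof
    fix m
    have "deg n \<noteq> 0"
      using that deg_eq_0 by blast
    then show "vac (adj (creation X n \<xi>)) m = 0"
      by (intro vac_homogeneous[OF homogeneous_adj[OF homogeneous_creation[OF that(1)]]]) linarith
  qed
  have "n \<noteq> 0 \<or> m \<noteq> 0"
    using nm by auto
  then have "fock_ip X (vac (adj (creation X n \<xi>))) (vac (adj (creation X m \<eta>))) = 0"
    using v[OF \<xi>] v[OF \<eta>] fock_mem[OF vac_mem] \<xi> \<eta> by (auto simp: fock_ip_def)
  then have "e0 (monomial X n \<xi> m \<eta>) = 0"
    using \<xi> \<eta> by (simp add: monomial_eq e0_comp)
  moreover have "\<tau> 0 = 0"
    using ta.stateD(3)[OF \<tau>, of 0 0] by simp
  ultimately show ?thesis
    using \<xi> \<eta> by (simp add: monomial_eq Psi_apply)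
qed

text \<open>A right factor of negative degree kills the column at 0. For degree
  \<open>k \<ge> 0\<close> the orbit carries \<open>exp (\<i> * z * k)\<close>, of modulus at most 1
  in the upper half plane.\<close>

lemma Psi_ground:
  assumes \<tau>: "\<tau> \<in> states type_alg"
  shows "Psi \<tau> \<in> ground_states (NT X) rotation"
proof -
  have \<tau>0: "\<tau> 0 = 0"
    using ta.stateD(3)[OF \<tau>, of 0 0] by simp
  have "\<exists>G. analytic_extension (NT X) rotation g G \<and> (\<forall>f\<in>homspan. bounded ((\<lambda>z. Psi \<tau> (f \<circ> G z)) ` {z. Im z > 0}))"
    if "g \<in> homspan" for g
    using that
  proof (induction rule: homspan.induct)
    case (homogeneous k g)
    then have g: "g \<in> NTc"
      by (simp add: homogeneous_def)
    have "bounded ((\<lambda>z. Psi \<tau> (f \<circ> op_scale (exp (\<i> * z * of_int k)) g)) ` {z. Im z > 0})" if f: "f \<in> homspan" for f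
    proof -
      have "cmod (Psi \<tau> (f \<circ> op_scale (exp (\<i> * z * of_int k)) g)) \<le> cmod (\<tau> (e0 (f \<circ> g)))" if "Im z > 0" for z
      proof -
        have eq: "Psi \<tau> (f \<circ> op_scale (exp (\<i> * z * of_int k)) g) = exp (\<i> * z * of_int k) * \<tau> (e0 (f \<circ> g))"
          using f g ta.stateD(3)[OF \<tau>] by (simp add: Psi_apply op_comp_scale_right e0_scale)
        show ?thesis
        proof (cases "k < 0")
          case True
          have "vac g = (\<lambda>_. 0)"
            using True by (intro ext vac_homogeneous[OF homogeneous]) simp
          then have "e0 (f \<circ> g) = 0"
            using f g fock_mem[OF vac_mem] by (simp add: e0_comp fock_ip_def)
          then show ?thesis
            by (simp add: eq \<tau>0)
        next
          case False
          then have "cmod (exp (\<i> * z * of_int k)) \<le> 1"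
            using that by (simp add: mult_nonneg_nonneg)
          then show ?thesis
            unfolding eq norm_mult by (simp add: mult_left_le_one_le)
        qed
      qed
      then show ?thesis
        unfolding bounded_iff by (intro exI[of _ "cmod (\<tau> (e0 (f \<circ> g)))"]) auto
    qed
    then show ?case
      using analytic_extension_homogeneous[OF homogeneous] by blast
  next
    case (add g h)
    then obtain G H where G: "analytic_extension (NT X) rotation g G"
        "\<And>f. f \<in> homspan \<Longrightarrow> bounded ((\<lambda>z. Psi \<tau> (f \<circ> G z)) ` {z. Im z > 0})"
      and H: "analytic_extension (NT X) rotation h H"
        "\<And>f. f \<in> homspan \<Longrightarrow> bounded ((\<lambda>z. Psi \<tau> (f \<circ> H z)) ` {z. Im z > 0})"
      by blast
    have m: "G z \<in> NTc" "H z \<in> NTc" for z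
      using G(1) H(1) by (simp_all add: analytic_extension_def)
    have "bounded ((\<lambda>z. Psi \<tau> (f \<circ> op_add (G z) (H z))) ` {z. Im z > 0})" if f: "f \<in> homspan" for f
    proof -
      have "Psi \<tau> (f \<circ> op_add (G z) (H z)) = Psi \<tau> (f \<circ> G z) + Psi \<tau> (f \<circ> H z)" for z
        using f m ta.stateD(2)[OF \<tau>] by (simp add: Psi_apply op_comp_add_right e0_add)
      then show ?thesis
        using bounded_plus_comp[OF G(2)[OF f] H(2)[OF f]] by simp
    qed
    then show ?case
      using analytic_extension_add[OF G(1) H(1)] by blast
  qed
  then show ?thesis
    using Psi_state[OF \<tau>] dense_homspan unfolding ground_states_def by (auto intro!: exI[of _ homspan])
qed

text \<open>The degenerate case of Cauchy-Schwarz. The quadratic term vanishes, so positivity at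
  \<open>t * adj x + y\<close> leaves a nonnegative expression of degree 1 in \<open>t\<close>,
  whose linear part must be zero; real and imaginary \<open>t\<close> together give
  \<open>A = 0\<close>.\<close>

lemma state_kernel:
  assumes \<phi>: "\<phi> \<in> states (NT X)" and x: "x \<in> NTc" and y: "y \<in> NTc" and z: "\<phi> (x \<circ> adj x) = 0"
  shows "\<phi> (x \<circ> y) = 0"
proof -
  define A B C where "A = \<phi> (x \<circ> y)" and "B = \<phi> (adj y \<circ> adj x)" and "C = \<phi> (adj y \<circ> y)"
  have lin: "\<phi> (op_add f g) = \<phi> f + \<phi> g" "\<phi> (op_scale c f) = c * \<phi> f" if "f \<in> NTc" "g \<in> NTc" for f g c
    using nt.stateD(2,3)[OF \<phi>] that by simp_all
  have P: "cnj t * A + t * B + C \<in> \<real>\<^sub>\<ge>\<^sub>0" for t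
  proof -
    let ?u = "op_add (op_scale t (adj x)) y"
    have u: "?u \<in> NTc"
      using x y by simp
    have "adj ?u \<circ> ?u = op_add (op_add (op_scale (cnj t * t) (x \<circ> adj x)) (op_scale (cnj t) (x \<circ> y)))
        (op_add (op_scale t (adj y \<circ> adj x)) (adj y \<circ> y))"
      using x y by (simp add: adj_op_add adj_op_scale op_comp_add_left op_comp_add_right op_comp_scale_left
        op_comp_scale_right op_scale_op_scale) (simp add: op_add_def op_scale_def scaleC_add_right scaleC_scaleC mult_ac)
    then have "\<phi> (adj ?u \<circ> ?u) = cnj t * A + t * B + C"
      using x y z by (simp add: lin A_def B_def C_def)
    then show ?thesis
      using nt.stateD(4)[OF \<phi> u] by simp
  qed
  have P': "Re (cnj t * A + t * B + C) \<ge> 0" "Im (cnj t * A + t * B + C) = 0" for t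
    using P[of t] by (simp_all add: complex_nonneg_Reals_iff)
  have lb: "w = 0" if "\<And>s::real. s * w + c \<ge> 0" for w c :: real
  proof (rule ccontr)
    assume "w \<noteq> 0"
    then have "(- (c + 1) / w) * w + c = -1"
      by simp
    then show False
      using that[of "- (c + 1) / w"] by simp
  qed
  have "Im C = 0"
    using P'(2)[of 0] by simp
  moreover have "Re (A + B) = 0"
    by (rule lb[of _ "Re C"]) (use P'(1)[of "of_real _"] in \<open>simp add: algebra_simps\<close>)
  moreover have "Im (A + B) = 0"
    using P'(2)[of 1] \<open>Im C = 0\<close> by simp
  moreover have "Re (\<i> * B - \<i> * A) = 0"
    by (rule lb[of _ "Re C"]) (use P'(1)[of "\<i> * of_real _"] in \<open>simp add: algebra_simps\<close>)
  moreover have "Im (\<i> * B - \<i> * A) = 0"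
    using P'(2)[of \<i>] \<open>Im C = 0\<close> by simp
  ultimately have "A = 0"
    by (simp add: complex_eq_iff)
  then show ?thesis
    by (simp add: A_def)
qed

definition vacuum :: "(('n, 'x) fop \<Rightarrow> complex) \<Rightarrow> bool" where
  "vacuum \<phi> \<longleftrightarrow> (\<forall>n \<xi> y. n \<noteq> 0 \<longrightarrow> \<xi> \<in> M n \<longrightarrow> y \<in> NTc \<longrightarrow>
    \<phi> (creation X n \<xi> \<circ> y) = 0 \<and> \<phi> (y \<circ> adj (creation X n \<xi>)) = 0)"

text \<open>With \<open>y\<close> the creation operator \<open>x\<close> itself, the second
  assumption gives \<open>\<phi> (x \<circ> adj x) = 0\<close>, and \<open>state_kernel\<close>
  provides the other half.\<close>

lemma vacuumI:
  assumes \<phi>: "\<phi> \<in> states (NT X)"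
    and z: "\<And>n \<xi> y. n \<noteq> 0 \<Longrightarrow> \<xi> \<in> M n \<Longrightarrow> y \<in> NTc \<Longrightarrow> \<phi> (y \<circ> adj (creation X n \<xi>)) = 0"
  shows "vacuum \<phi>"
  unfolding vacuum_def
proof (intro allI impI conjI)
  fix n \<xi> y assume n: "n \<noteq> 0" and \<xi>: "\<xi> \<in> M n" and y: "y \<in> NTc"
  show "\<phi> (creation X n \<xi> \<circ> y) = 0"
    by (rule state_kernel[OF \<phi> _ y z]) (use n \<xi> in simp_all)
qed (rule z)

lemma ground_vacuum: "\<phi> \<in> ground_states (NT X) rotation \<Longrightarrow> vacuum \<phi>"
proof (rule vacuumI)
  assume \<phi>: "\<phi> \<in> ground_states (NT X) rotation"
  then show "\<phi> \<in> states (NT X)"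
    by (simp add: ground_states_def)
  fix n \<xi> y assume n: "n \<noteq> 0" and \<xi>: "\<xi> \<in> M n" and y: "y \<in> NTc"
  have "deg n \<noteq> 0"
    using n deg_eq_0 by blast
  then have "\<phi> (times_of (NT X) y (adj (creation X n \<xi>))) = 0"
    using \<phi> \<xi> y homogeneous_adj[OF homogeneous_creation[OF \<xi>]]
    by (intro nt.ground_vanish[of \<phi> _ "- int (deg n)"]) (auto simp: homogeneous_def)
  then show "\<phi> (y \<circ> adj (creation X n \<xi>)) = 0"
    by simp
qed

text \<open>Norm 1 is inherited because an almost norming \<open>f\<close> can be replaced by
  \<open>e0 f\<close>, which has no larger norm and the same value.\<close>

lemma vacuum_restrict_state:
  assumes \<phi>: "\<phi> \<in> states (NT X)" and eq: "\<And>f. f \<in> NTc \<Longrightarrow> \<phi> f = \<phi> (fpi X (e0 f))"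
  shows "(\<lambda>a. \<phi> (fpi X a)) \<in> states type_alg" "\<phi> = Psi (\<lambda>a. \<phi> (fpi X a))"
proof -
  show "(\<lambda>a. \<phi> (fpi X a)) \<in> states type_alg"
  proof (rule ta.stateI)
    show "(\<lambda>a. \<phi> (fpi X a)) \<in> extensional (carr type_alg)"
      by (simp add: extensional_def)
    show "\<phi> (fpi X (plus_of type_alg a b)) = \<phi> (fpi X a) + \<phi> (fpi X b)" for a b
      using nt.stateD(2)[OF \<phi>] by (simp add: fpi_add)
    show "\<phi> (fpi X (scale_of type_alg c a)) = c * \<phi> (fpi X a)" for c a
      using nt.stateD(3)[OF \<phi>] by (simp add: fpi_scale)
    show "\<phi> (fpi X (times_of type_alg (star_of type_alg a) a)) \<in> \<real>\<^sub>\<ge>\<^sub>0" for a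
      using nt.stateD(4)[OF \<phi>, of "fpi X a"] by (simp add: fpi_mult adj_fpi)
    show "cmod (\<phi> (fpi X a)) \<le> norm_of type_alg a" for a
      using nt.state_bound[OF \<phi>, of "fpi X a"] opnorm_fpi[of a] by simp
  next
    fix e :: real assume e: "e > 0"
    then obtain f where f: "f \<in> NTc" "opnorm f \<le> 1" "cmod (\<phi> f) > 1 - e"
      using nt.state_approx[OF \<phi> e] by auto
    then show "\<exists>a\<in>carr type_alg. norm_of type_alg a \<le> 1 + e \<and> cmod (\<phi> (fpi X a)) > 1 - e"
      using norm_e0[of f] eq[of f] e by (intro bexI[of _ "e0 f"]) auto
  qed
  show "\<phi> = Psi (\<lambda>a. \<phi> (fpi X a))"
    by (rule extensionalityI[OF nt.stateD(1)[OF \<phi>]]) (simp add: Psi_def, simp add: Psi_apply eq[symmetric])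
qed

end

context framed_system
begin

lemma state_sum:
  assumes \<phi>: "\<phi> \<in> states (NT X)"
  shows "finite J \<Longrightarrow> (\<And>j. j \<in> J \<Longrightarrow> f j \<in> NTc) \<Longrightarrow> \<phi> (\<lambda>\<eta> m. \<Sum>j\<in>J. f j \<eta> m) = (\<Sum>j\<in>J. \<phi> (f j))"
proof (induction J rule: finite_induct)
  case empty
  have "op_scale 0 (fpi X 0) = (\<lambda>\<eta> m. 0)"
    by (simp add: op_scale_def)
  then show ?case
    using nt.stateD(3)[OF \<phi>, of "fpi X 0" 0] by simp
next
  case (insert j J)
  have "\<phi> (op_add (f j) (\<lambda>\<eta> m. \<Sum>j\<in>J. f j \<eta> m)) = \<phi> (f j) + \<phi> (\<lambda>\<eta> m. \<Sum>j\<in>J. f j \<eta> m)"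
    using nt.stateD(2)[OF \<phi>, of "f j" "\<lambda>\<eta> m. \<Sum>j\<in>J. f j \<eta> m"] insert NT_sum[of J f] by simp
  then show ?case
    using insert by (simp add: op_add_def)
qed

lemma vacuum_range_proj:
  assumes \<phi>: "\<phi> \<in> states (NT X)" and v: "vacuum \<phi>" and g: "g \<in> NTc"
  shows "\<phi> (range_proj X d x i \<circ> g) = 0" "\<phi> (g \<circ> range_proj X d x i) = 0"
proof -
  let ?c = "\<lambda>j. creation X (axis i 1) (x i j)"
  have "range_proj X d x i \<circ> g = (\<lambda>\<eta> m. \<Sum>j\<in>{..<d i}. (?c j \<circ> (adj (?c j) \<circ> g)) \<eta> m)"
    by (simp add: range_proj_def monomial_eq comp_def)
  then show "\<phi> (range_proj X d x i \<circ> g) = 0"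
    using v g axis_nonzero[of i] state_sum[OF \<phi>, of "{..<d i}" "\<lambda>j. ?c j \<circ> (adj (?c j) \<circ> g)"]
    unfolding vacuum_def by simp
  have comp: "finite J \<Longrightarrow> (\<And>j. j \<in> J \<Longrightarrow> f j \<in> NTc) \<Longrightarrow>
      g \<circ> (\<lambda>\<eta> m. \<Sum>j\<in>J. f j \<eta> m) = (\<lambda>\<eta> m. \<Sum>j\<in>J. (g \<circ> f j) \<eta> m)" for f :: "nat \<Rightarrow> ('n, 'x) fop" and J
  proof (induction J rule: finite_induct)
    case empty
    then show ?case
      using g by (simp add: comp_def)
  next
    case (insert j J)
    have "g \<circ> op_add (f j) (\<lambda>\<eta> m. \<Sum>j\<in>J. f j \<eta> m) = op_add (g \<circ> f j) (g \<circ> (\<lambda>\<eta> m. \<Sum>j\<in>J. f j \<eta> m))"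
      using g insert NT_sum[of J f] by (intro op_comp_add_right) auto
    then show ?case
      using insert by (simp add: op_add_def)
  qed
  have "range_proj X d x i = (\<lambda>\<eta> m. \<Sum>j\<in>{..<d i}. (?c j \<circ> adj (?c j)) \<eta> m)"
    by (simp add: range_proj_def monomial_eq)
  then have "g \<circ> range_proj X d x i = (\<lambda>\<eta> m. \<Sum>j\<in>{..<d i}. ((g \<circ> ?c j) \<circ> adj (?c j)) \<eta> m)"
    using comp[of "{..<d i}" "\<lambda>j. ?c j \<circ> adj (?c j)"] by (simp add: comp_assoc)
  then show "\<phi> (g \<circ> range_proj X d x i) = 0"
    using v g axis_nonzero[of i] state_sum[OF \<phi>, of "{..<d i}" "\<lambda>j. (g \<circ> ?c j) \<circ> adj (?c j)"]
    unfolding vacuum_def by simp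
qed

lemma vacuum_proj_left:
  assumes \<phi>: "\<phi> \<in> states (NT X)" and v: "vacuum \<phi>" and f: "f \<in> NTc"
  shows "\<phi> (proj F \<circ> f) = \<phi> f"
proof -
  have "\<phi> (proj {i} \<circ> g) = \<phi> g" if g: "g \<in> NTc" for i g
    using nt.stateD(2,3)[OF \<phi>] g vacuum_range_proj(1)[OF \<phi> v g, of i] range_proj_NT
    by (simp add: proj_diff)
  then show ?thesis
    using proj_NT_induct[of "\<lambda>g. \<phi> g = \<phi> f" f F] f by simp
qed

lemma vacuum_proj_right:
  assumes \<phi>: "\<phi> \<in> states (NT X)" and v: "vacuum \<phi>" and f: "f \<in> NTc"
  shows "\<phi> (f \<circ> proj F) = \<phi> f"
proof -
  have step: "\<phi> (g \<circ> proj {i}) = \<phi> g" if g: "g \<in> NTc" for i g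
    using nt.stateD(2,3)[OF \<phi>] g vacuum_range_proj(2)[OF \<phi> v g, of i] range_proj_NT
    by (simp add: proj_diff_right)
  have "finite F"
    by simp
  then show ?thesis
    using f
  proof (induction F arbitrary: f rule: finite_induct)
    case empty
    then show ?case
      by simp
  next
    case (insert i F)
    have "f \<circ> proj (insert i F) = (f \<circ> proj {i}) \<circ> proj F"
      using proj_comp[of "{i}" F] by (simp add: comp_assoc)
    then show ?case
      using insert.IH[OF proj_right_NT[OF insert.prems]] step[OF insert.prems] by metis
  qed
qed

lemma vacuum_eq:
  assumes \<phi>: "\<phi> \<in> states (NT X)" and v: "vacuum \<phi>" and f: "f \<in> NTc"
  shows "\<phi> f = \<phi> (fpi X (e0 f))"
proof -
  have "\<phi> f = \<phi> (proj UNIV \<circ> f \<circ> proj UNIV)"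
    using f by (simp add: vacuum_proj_left[OF \<phi> v] vacuum_proj_right[OF \<phi> v])
  then show ?thesis
    using f by (simp add: proj_compress vacuum_proj_right[OF \<phi> v])
qed

lemma vacuum_state_cases:
  assumes \<phi>: "\<phi> \<in> states (NT X)" and v: "vacuum \<phi>"
  obtains \<tau> where "\<tau> \<in> states type_alg" "\<phi> = Psi \<tau>" "\<And>a. \<tau> a = \<phi> (fpi X a)"
  using vacuum_restrict_state[OF \<phi> vacuum_eq[OF \<phi> v]] by blast

lemma ground_states_NT: "ground_states (NT X) rotation = Psi ` states type_alg"
proof
  show "ground_states (NT X) rotation \<subseteq> Psi ` states type_alg"
  proof
    fix \<phi> assume \<phi>: "\<phi> \<in> ground_states (NT X) rotation"
    then have "\<phi> \<in> states (NT X)"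
      by (simp add: ground_states_def)
    then show "\<phi> \<in> Psi ` states type_alg"
      using vacuum_state_cases[OF _ ground_vacuum[OF \<phi>]] by (metis imageI)
  qed
qed (use Psi_ground in blast)

end

section \<open>KMS states of the Toeplitz algebra\<close>

lemma has_sum_sum_finite:
  fixes f :: "'j \<Rightarrow> 'i \<Rightarrow> 'b::real_normed_vector"
  assumes "finite J" "\<And>j. j \<in> J \<Longrightarrow> (f j has_sum s j) A"
  shows "((\<lambda>x. \<Sum>j\<in>J. f j x) has_sum (\<Sum>j\<in>J. s j)) A"
  using assms
proof (induction J rule: finite_induct)
  case (insert j J)
  then show ?case
    by (simp add: has_sum_add)
qed simp

text \<open>A finite set of indices lies in a box, over which the sum factors into geometric sums,
  each at most 2.\<close>

lemma summable_half_deg: "(\<lambda>m :: nat ^ 'n::finite. (1 / 2 :: real) ^ deg m) summable_on UNIV"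
proof (rule nonneg_bdd_above_summable_on)
  show "bdd_above (sum (\<lambda>m :: nat ^ 'n. (1 / 2 :: real) ^ deg m) ` {F. F \<subseteq> UNIV \<and> finite F})"
  proof (rule bdd_aboveI2)
    fix F assume "F \<in> {F :: (nat ^ 'n) set. F \<subseteq> UNIV \<and> finite F}"
    then have F: "finite F"
      by simp
    define K where "K = Suc (Max (insert 0 (deg ` F)))"
    let ?P = "PiE UNIV (\<lambda>_ :: 'n. {..<K})"
    have sub: "vec_nth ` F \<subseteq> ?P"
    proof (intro image_subsetI PiE_I)
      fix m :: "nat ^ 'n" and i assume m: "m \<in> F"
      have "m $ i \<le> deg m"
        unfolding deg_def by (rule member_le_sum) auto
      also have "deg m \<le> Max (insert 0 (deg ` F))"
        using F m by (intro Max_ge) auto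
      finally show "m $ i \<in> {..<K}"
        by (simp add: K_def)
    qed auto
    have fin: "finite ?P"
      by (intro finite_PiE) auto
    have "(\<Sum>m\<in>F. (1 / 2 :: real) ^ deg m) = (\<Sum>m\<in>F. (\<lambda>g. \<Prod>i\<in>UNIV. (1 / 2) ^ g i) (vec_nth m))"
      by (simp add: deg_def power_sum)
    also have "\<dots> = (\<Sum>g\<in>vec_nth ` F. \<Prod>i\<in>UNIV. (1 / 2) ^ g i)"
      by (subst sum.reindex) (auto simp: inj_on_def vec_nth_inject)
    also have "\<dots> \<le> (\<Sum>g\<in>?P. \<Prod>i\<in>UNIV. (1 / 2) ^ g i)"
      using fin sub by (intro sum_mono2) (auto intro: prod_nonneg)
    also have "\<dots> = (\<Prod>i\<in>(UNIV :: 'n set). \<Sum>k<K. (1 / 2) ^ k)"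
      by (rule prod_sum_PiE[symmetric]) auto
    also have "\<dots> \<le> (\<Prod>i\<in>(UNIV :: 'n set). 2)"
    proof (rule prod_mono, intro conjI)
      have "(\<Sum>k<K. (1 / 2 :: real) ^ k) = 2 * (1 - (1 / 2) ^ K)"
        by (simp add: sum_gp_strict)
      also have "\<dots> \<le> 2"
        by simp
      finally show "(\<Sum>k<K. (1 / 2 :: real) ^ k) \<le> 2" .
    qed (auto intro: sum_nonneg)
    finally show "(\<Sum>m\<in>F. (1 / 2 :: real) ^ deg m) \<le> (\<Prod>i\<in>(UNIV :: 'n set). 2)" .
  qed
qed simp

lemma summable_half_deg_prod:
  "(\<lambda>(m, m'). c * ((1 / 2 :: real) ^ deg (m :: nat ^ 'n::finite) * (1 / 2) ^ deg (m' :: nat ^ 'n))) summable_on UNIV \<times> UNIV"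
proof -
  let ?h = "\<lambda>m :: nat ^ 'n. (1 / 2 :: real) ^ deg m"
  have "(\<lambda>(m, m'). ?h m * ?h m') summable_on UNIV \<times> UNIV"
  proof (rule summable_on_SigmaI)
    show "((\<lambda>m'. case (m, m') of (m, m') \<Rightarrow> ?h m * ?h m') has_sum (?h m * infsum ?h UNIV)) UNIV" for m
      using has_sum_cmult_right[OF has_sum_infsum[OF summable_half_deg]] by simp
    show "(\<lambda>m. ?h m * infsum ?h UNIV) summable_on UNIV"
      by (rule summable_on_cmult_left[OF summable_half_deg])
  qed simp
  from summable_on_cmult_right[OF this, of c] show ?thesis
    by (simp add: case_prod_unfold)
qed

lemma state_bounded_linear:
  fixes \<tau> :: "'a::cstar_algebra \<Rightarrow> complex"
  assumes \<tau>: "\<tau> \<in> states type_alg"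
  shows "bounded_linear \<tau>"
proof (rule bounded_linear_intro[where K = 1])
  show "\<tau> (a + b) = \<tau> a + \<tau> b" for a b
    using ta.stateD(2)[OF \<tau>] by simp
  show "\<tau> (r *\<^sub>R a) = r *\<^sub>R \<tau> a" for r a
    using ta.stateD(3)[OF \<tau>, of a "of_real r"] by (simp add: scaleR_scaleC scaleR_conv_of_real)
  show "norm (\<tau> a) \<le> norm a * 1" for a
    using ta.state_bound[OF \<tau>, of a] by simp
qed

context product_sys
begin

text \<open>For homogeneous \<open>f\<close> the extension at \<open>\<i> * \<beta>\<close>
  multiplies \<open>f\<close> by \<open>exp (- k * \<beta>)\<close>, and both sides of the KMS
  condition are additive in \<open>f\<close>; so \<open>homspan\<close> serves as the dense
  algebra.\<close>

lemma kms_stateI: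
  assumes \<phi>: "\<phi> \<in> states (NT X)" and \<beta>: "\<beta> > 0"
    and hom: "\<And>k f g. homogeneous k f \<Longrightarrow> g \<in> NTc \<Longrightarrow> \<phi> (f \<circ> g) = of_real (exp (- of_int k * \<beta>)) * \<phi> (g \<circ> f)"
  shows "\<phi> \<in> kms_states (NT X) rotation \<beta>"
proof -
  have "\<exists>F. analytic_extension (NT X) rotation f F \<and> (\<forall>g\<in>homspan. \<phi> (f \<circ> g) = \<phi> (g \<circ> F (\<i> * complex_of_real \<beta>)))"
    if "f \<in> homspan" for f
    using that
  proof (induction rule: homspan.induct)
    case (homogeneous k f)
    have fN: "f \<in> NTc"
      using homogeneous by (simp add: homogeneous_def)
    have "exp (\<i> * (\<i> * complex_of_real \<beta>) * of_int k) = of_real (exp (- of_int k * \<beta>))"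
      by (simp add: mult.assoc[symmetric] exp_of_real[symmetric] mult.commute)
    then have eq: "\<phi> (f \<circ> g) = \<phi> (g \<circ> op_scale (exp (\<i> * (\<i> * complex_of_real \<beta>) * of_int k)) f)" if "g \<in> homspan" for g
      using hom[OF homogeneous, of g] that fN nt.stateD(3)[OF \<phi>, of "g \<circ> f"] by (simp add: op_comp_scale_right)
    then show ?case
      using analytic_extension_homogeneous[OF homogeneous]
      by (intro exI[of _ "\<lambda>z. op_scale (exp (\<i> * z * of_int k)) f"] conjI ballI) (assumption, rule eq)
  next
    case (add f h)
    then obtain F H where F: "analytic_extension (NT X) rotation f F"
        "\<And>g. g \<in> homspan \<Longrightarrow> \<phi> (f \<circ> g) = \<phi> (g \<circ> F (\<i> * complex_of_real \<beta>))"
      and H: "analytic_extension (NT X) rotation h H"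
        "\<And>g. g \<in> homspan \<Longrightarrow> \<phi> (h \<circ> g) = \<phi> (g \<circ> H (\<i> * complex_of_real \<beta>))"
      by blast
    have m: "F z \<in> NTc" "H z \<in> NTc" for z
      using F(1) H(1) by (simp_all add: analytic_extension_def)
    have "\<phi> (op_add f h \<circ> g) = \<phi> (g \<circ> op_add (F (\<i> * complex_of_real \<beta>)) (H (\<i> * complex_of_real \<beta>)))" if g: "g \<in> homspan" for g
      using F(2)[OF g] H(2)[OF g] m g add(1,2) nt.stateD(2)[OF \<phi>]
      by (simp add: op_comp_add_left op_comp_add_right)
    then show ?case
      using analytic_extension_add[OF F(1) H(1)] by blast
  qed
  then show ?thesis
    unfolding kms_states_def using \<phi> \<beta> star_subalgebra_homspan dense_homspan homspan_rotation
    by (auto intro!: exI[of _ homspan])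
qed

lemma kms_homogeneous:
  assumes \<phi>: "\<phi> \<in> kms_states (NT X) rotation \<beta>" and f: "homogeneous k f" and g: "g \<in> NTc"
  shows "\<phi> (f \<circ> g) = of_real (exp (- of_int k * \<beta>)) * \<phi> (g \<circ> f)"
  using nt.kms_commute[OF \<phi>, of f k g] f g by (simp add: homogeneous_def)

lemma weak_star_limitD:
  assumes "limitin (weak_star B) F \<phi> \<F>" "f \<in> carr B"
  shows "((\<lambda>p. F p f) \<longlongrightarrow> \<phi> f) \<F>"
  using assms unfolding weak_star_def limitin_componentwise by simp

lemma kms_limit:
  assumes nb: "\<F> \<noteq> bot" and kms: "\<forall>\<^sub>F p in \<F>. snd p \<in> kms_states (NT X) rotation (fst p)"
    and top: "filterlim fst at_top \<F>" and lim: "limitin (weak_star (NT X)) snd \<phi> \<F>"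
    and f: "homogeneous k f" and g: "g \<in> NTc"
  shows "k < 0 \<Longrightarrow> \<phi> (g \<circ> f) = 0" and "k = 0 \<Longrightarrow> \<phi> (f \<circ> g) = \<phi> (g \<circ> f)"
proof -
  have fN: "f \<in> NTc"
    using f by (simp add: homogeneous_def)
  have l1: "((\<lambda>p. snd p (f \<circ> g)) \<longlongrightarrow> \<phi> (f \<circ> g)) \<F>" and l2: "((\<lambda>p. snd p (g \<circ> f)) \<longlongrightarrow> \<phi> (g \<circ> f)) \<F>"
    using weak_star_limitD[OF lim] fN g by simp_all
  have eq: "of_real (exp (of_int k * fst p)) * snd p (f \<circ> g) = snd p (g \<circ> f)"
    if "snd p \<in> kms_states (NT X) rotation (fst p)" for p
  proof -
    have "complex_of_real (exp (of_int k * fst p)) * of_real (exp (- of_int k * fst p)) = 1"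
      by (simp add: of_real_mult[symmetric] exp_add[symmetric] del: of_real_mult)
    then show ?thesis
      using kms_homogeneous[OF that f g] by (simp only: mult.assoc[symmetric] mult_1)
  qed
  \<comment> \<open>The weight stands on the side where it tends to 0 for negative \<open>k\<close>,
    next to state values that converge.\<close>
  have ev: "\<forall>\<^sub>F p in \<F>. of_real (exp (of_int k * fst p)) * snd p (f \<circ> g) = snd p (g \<circ> f)"
    using kms eq by (rule eventually_mono)
  show "\<phi> (g \<circ> f) = 0" if k: "k < 0"
  proof -
    have "filterlim (\<lambda>b. real_of_int k * b) at_bot (at_top :: real filter)"
      using k by (intro filterlim_tendsto_neg_mult_at_bot[OF tendsto_const]) (auto intro: filterlim_ident)
    then have "((\<lambda>b. exp (of_int k * b)) \<longlongrightarrow> (0::real)) at_top"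
      by (rule filterlim_compose[OF exp_at_bot])
    then have "((\<lambda>p. exp (of_int k * fst p)) \<longlongrightarrow> 0) \<F>"
      using top by (rule filterlim_compose)
    then have "((\<lambda>p. of_real (exp (of_int k * fst p)) * snd p (f \<circ> g)) \<longlongrightarrow> of_real 0 * \<phi> (f \<circ> g)) \<F>"
      by (intro tendsto_mult tendsto_of_real l1)
    then have "((\<lambda>p. snd p (g \<circ> f)) \<longlongrightarrow> 0) \<F>"
      using tendsto_cong[OF ev] by simp
    then show ?thesis
      using tendsto_unique[OF nb l2] by simp
  qed
  show "\<phi> (f \<circ> g) = \<phi> (g \<circ> f)" if k: "k = 0"
    using tendsto_cong[OF ev] tendsto_unique[OF nb l2] l1 k by simp
qed

lemma kms_infinity_vacuum:
  assumes "\<phi> \<in> kms_infinity_states (NT X) rotation"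
  shows "vacuum \<phi>" and "g \<in> NTc \<Longrightarrow> \<phi> (fpi X a \<circ> g) = \<phi> (g \<circ> fpi X a)"
proof -
  obtain \<F> :: "(real \<times> (('n, 'x) fop \<Rightarrow> complex)) filter" where \<phi>: "\<phi> \<in> states (NT X)"
    and F: "\<F> \<noteq> bot" "\<forall>\<^sub>F p in \<F>. snd p \<in> kms_states (NT X) rotation (fst p)"
      "filterlim fst at_top \<F>" "limitin (weak_star (NT X)) snd \<phi> \<F>"
    using assms unfolding kms_infinity_states_def by blast
  note lim = kms_limit[OF F]
  show "vacuum \<phi>"
  proof (rule vacuumI[OF \<phi>])
    fix n \<xi> y assume n: "n \<noteq> 0" and \<xi>: "\<xi> \<in> M n" and y: "y \<in> NTc"
    have "deg n \<noteq> 0"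
      using n deg_eq_0 by blast
    then show "\<phi> (y \<circ> adj (creation X n \<xi>)) = 0"
      using lim(1)[OF homogeneous_adj[OF homogeneous_creation[OF \<xi>]] y] by simp
  qed
  show "g \<in> NTc \<Longrightarrow> \<phi> (fpi X a \<circ> g) = \<phi> (g \<circ> fpi X a)"
    using lim(2)[of 0 "fpi X a" g] homogeneous_creation[OF emb_mem[of a]] by (simp add: fpi_eq_creation)
qed

end

section \<open>Gibbs functionals of a trace\<close>

context framed_system
begin

definition fib_frame :: "nat ^ 'n \<Rightarrow> nat set \<times> (nat \<Rightarrow> 'x)" where
  "fib_frame m = (SOME p. finite (fst p) \<and> card (fst p) \<le> rank_bound ^ deg m \<and>
    (\<forall>j\<in>fst p. snd p j \<in> M m \<and> mnorm (fib X m) (snd p j) \<le> 1) \<and>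
    (\<forall>\<xi>\<in>M m. (\<Sum>j\<in>fst p. rmf m (snd p j) (ipf m (snd p j) \<xi>)) = \<xi>))"

text \<open>The frames of the fibres as operators; the identity, which need not lie in the algebra,
  takes the place of a frame of the fibre at 0.\<close>

definition frame_idx :: "nat ^ 'n \<Rightarrow> nat set" where
  "frame_idx m = (if m = 0 then {0} else fst (fib_frame m))"

definition frame_op :: "nat ^ 'n \<Rightarrow> nat \<Rightarrow> ('n, 'x) fop" where
  "frame_op m j = (if m = 0 then proj {} else creation X m (snd (fib_frame m) j))"

lemma fib_frame:
  assumes "m \<noteq> 0"
  shows "finite (fst (fib_frame m))" "card (fst (fib_frame m)) \<le> rank_bound ^ deg m"
    "\<And>j. j \<in> fst (fib_frame m) \<Longrightarrow> snd (fib_frame m) j \<in> M m \<and> mnorm (fib X m) (snd (fib_frame m) j) \<le> 1"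
    "\<And>\<xi>. \<xi> \<in> M m \<Longrightarrow> (\<Sum>j\<in>fst (fib_frame m). rmf m (snd (fib_frame m) j) (ipf m (snd (fib_frame m) j) \<xi>)) = \<xi>"
proof -
  obtain S :: "nat set" and y where Sy: "finite S \<and> card S \<le> rank_bound ^ deg m \<and>
    (\<forall>j\<in>S. y j \<in> M m \<and> mnorm (fib X m) (y j) \<le> 1) \<and>
    (\<forall>\<xi>\<in>M m. (\<Sum>j\<in>S. rmf m (y j) (ipf m (y j) \<xi>)) = \<xi>)"
    using fib_frame_exists[OF assms] by (elim exE)
  have "finite (fst (fib_frame m)) \<and> card (fst (fib_frame m)) \<le> rank_bound ^ deg m \<and>
    (\<forall>j\<in>fst (fib_frame m). snd (fib_frame m) j \<in> M m \<and> mnorm (fib X m) (snd (fib_frame m) j) \<le> 1) \<and>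
    (\<forall>\<xi>\<in>M m. (\<Sum>j\<in>fst (fib_frame m). rmf m (snd (fib_frame m) j) (ipf m (snd (fib_frame m) j) \<xi>)) = \<xi>)"
    unfolding fib_frame_def by (rule someI[of _ "(S, y)"]) (use Sy in simp)
  then show "finite (fst (fib_frame m))" "card (fst (fib_frame m)) \<le> rank_bound ^ deg m"
    "\<And>j. j \<in> fst (fib_frame m) \<Longrightarrow> snd (fib_frame m) j \<in> M m \<and> mnorm (fib X m) (snd (fib_frame m) j) \<le> 1"
    "\<And>\<xi>. \<xi> \<in> M m \<Longrightarrow> (\<Sum>j\<in>fst (fib_frame m). rmf m (snd (fib_frame m) j) (ipf m (snd (fib_frame m) j) \<xi>)) = \<xi>"
    by simp_all
qed

lemma frame_idx: "finite (frame_idx m)" "card (frame_idx m) \<le> rank_bound ^ deg m"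
  using fib_frame(1,2) by (auto simp: frame_idx_def)

lemma frame_op_creation:
  "m \<noteq> 0 \<Longrightarrow> j \<in> frame_idx m \<Longrightarrow> \<exists>y. y \<in> M m \<and> mnorm (fib X m) y \<le> 1 \<and> frame_op m j = creation X m y"
  using fib_frame(3)[of m j] by (auto simp: frame_idx_def frame_op_def)

lemma frame_op_0 [simp]: "frame_op 0 j = proj {}"
  by (simp add: frame_op_def)

lemma frame_op_Op [simp]: "j \<in> frame_idx m \<Longrightarrow> frame_op m j \<in> Op"
  using frame_op_creation[of m j] by (cases "m = 0") auto

lemma opnorm_frame_op: "j \<in> frame_idx m \<Longrightarrow> opnorm (frame_op m j) \<le> 1"
proof (cases "m = 0")
  case True
  have "opnorm (proj {}) \<le> 1"
    by (rule opnorm_le) (use proj_fock(2) in auto)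
  then show ?thesis
    using True by simp
next
  case False
  assume "j \<in> frame_idx m"
  then show ?thesis
    using frame_op_creation[OF False] opnorm_creation order_trans by metis
qed

lemma comp_frame_op_NT [simp]: "j \<in> frame_idx m \<Longrightarrow> f \<in> NTc \<Longrightarrow> f \<circ> frame_op m j \<in> NTc"
  using frame_op_creation[of m j] by (cases "m = 0") auto

lemma adj_frame_op_comp_NT [simp]: "j \<in> frame_idx m \<Longrightarrow> f \<in> NTc \<Longrightarrow> adj (frame_op m j) \<circ> f \<in> NTc"
  using frame_op_creation[of m j] by (cases "m = 0") auto

lemma homogeneous_comp_frame_op:
  assumes "homogeneous k f" "j \<in> frame_idx m"
  shows "homogeneous (k + int (deg m)) (f \<circ> frame_op m j)"
proof (cases "m = 0")
  case True
  then show ?thesis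
    using assms(1) by (simp add: homogeneous_def)
next
  case False
  then show ?thesis
    using frame_op_creation[OF False assms(2)] homogeneous_comp[OF assms(1) homogeneous_creation] by metis
qed

lemma homogeneous_adj_frame_op_comp:
  assumes "homogeneous k f" "j \<in> frame_idx m"
  shows "homogeneous (k - int (deg m)) (adj (frame_op m j) \<circ> f)"
proof (cases "m = 0")
  case True
  then show ?thesis
    using assms(1) by (simp add: homogeneous_def)
next
  case False
  then obtain y where "y \<in> M m" "frame_op m j = creation X m y"
    using frame_op_creation[OF False assms(2)] by blast
  then show ?thesis
    using homogeneous_comp[OF homogeneous_adj[OF homogeneous_creation] assms(1), of y m] by simp
qed

text \<open>\<open>e0 (a \<circ> b)\<close> is the inner product of the columns of
  \<open>adj a\<close> and \<open>b\<close>, and each fibre contributes the expansion of the second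
  column in its frame.\<close>

lemma frame_expansion:
  assumes a: "a \<in> NTc" and b: "b \<in> NTc"
  shows "((\<lambda>m. \<Sum>j\<in>frame_idx m. e0 (a \<circ> frame_op m j) * e0 (adj (frame_op m j) \<circ> b)) has_sum e0 (a \<circ> b)) UNIV"
proof -
  let ?u = "vac (adj a)" and ?v = "vac b"
  have u: "?u \<in> fock X" and v: "?v \<in> fock X"
    using a b by simp_all
  have "ipf m (?u m) (?v m) = (\<Sum>j\<in>frame_idx m. e0 (a \<circ> frame_op m j) * e0 (adj (frame_op m j) \<circ> b))" for m
  proof (cases "m = 0")
    case True
    have "?u 0 = emb X (star (e0 a))" "?v 0 = emb X (e0 b)"
      using a b emb_e0[of "adj a"] emb_e0[of b] by (simp_all add: e0_adj)
    then show ?thesis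
      using True a b by (simp add: frame_idx_def emb_ip star_star)
  next
    case False
    define y where "y = snd (fib_frame m)"
    have S: "frame_idx m = fst (fib_frame m)"
      using False by (simp add: frame_idx_def)
    have W: "frame_op m j = creation X m (y j)" for j
      using False by (simp add: frame_op_def y_def)
    have y: "y j \<in> M m" if "j \<in> frame_idx m" for j
      using fib_frame(3)[OF False, of j] that by (simp add: S y_def)
    have um: "?u m \<in> M m" and vm: "?v m \<in> M m"
      using fock_mem[OF u] fock_mem[OF v] by simp_all
    have b': "e0 (adj (frame_op m j) \<circ> b) = ipf m (y j) (?v m)" if j: "j \<in> frame_idx m" for j
      using y[OF j] b v by (simp add: W e0_adj_comp vac_creation fock_ip_single)
    have a': "e0 (a \<circ> frame_op m j) = ipf m (?u m) (y j)" if j: "j \<in> frame_idx m" for j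
      using y[OF j] a u by (simp add: W e0_comp vac_creation fock_ip_single_right)
    have "ipf m (?u m) (?v m) = ipf m (?u m) (\<Sum>j\<in>frame_idx m. rmf m (y j) (ipf m (y j) (?v m)))"
      using fib_frame(4)[OF False vm] by (simp add: S y_def)
    also have "\<dots> = (\<Sum>j\<in>frame_idx m. ipf m (?u m) (rmf m (y j) (ipf m (y j) (?v m))))"
      using um y by (intro ip_sum_right) simp_all
    also have "\<dots> = (\<Sum>j\<in>frame_idx m. e0 (a \<circ> frame_op m j) * e0 (adj (frame_op m j) \<circ> b))"
      using um y by (intro sum.cong refl) (simp add: a' b' ip_rmul)
    finally show ?thesis .
  qed
  then show ?thesis
    using fock_ip_has_sum[OF u v] a b by (simp add: e0_comp)
qed

text \<open>Matrix coefficients with respect to the frames; \<open>compress_expansion\<close> is the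
  corresponding matrix product.\<close>

definition compress :: "nat ^ 'n \<Rightarrow> nat \<Rightarrow> ('n, 'x) fop \<Rightarrow> nat ^ 'n \<Rightarrow> nat \<Rightarrow> 'a" where
  "compress m j f m' j' = e0 (adj (frame_op m j) \<circ> f \<circ> frame_op m' j')"

lemma compress_NT [simp]:
  assumes "j \<in> frame_idx m" "j' \<in> frame_idx m'" "f \<in> NTc"
  shows "adj (frame_op m j) \<circ> f \<circ> frame_op m' j' \<in> NTc"
  using comp_frame_op_NT[OF assms(2) adj_frame_op_comp_NT[OF assms(1,3)]] .

lemma norm_compress:
  assumes j: "j \<in> frame_idx m" and j': "j' \<in> frame_idx m'" and f: "f \<in> NTc"
  shows "norm (compress m j f m' j') \<le> opnorm f"
proof -
  have "norm (compress m j f m' j') \<le> opnorm (adj (frame_op m j) \<circ> f \<circ> frame_op m' j')"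
    unfolding compress_def by (rule norm_e0[OF compress_NT[OF assms]])
  also have "\<dots> \<le> opnorm (adj (frame_op m j) \<circ> f) * opnorm (frame_op m' j')"
    using j j' f by (intro opnorm_comp) simp_all
  also have "\<dots> \<le> opnorm (adj (frame_op m j) \<circ> f) * 1"
    using j f by (intro mult_left_mono opnorm_frame_op[OF j'] opnorm_nonneg) simp
  also have "\<dots> \<le> opnorm (adj (frame_op m j)) * opnorm f"
    using opnorm_comp[of "adj (frame_op m j)" f] j f by simp
  also have "\<dots> \<le> 1 * opnorm f"
    using j f opnorm_frame_op[OF j] by (intro mult_right_mono opnorm_nonneg) (simp_all add: opnorm_adj)
  finally show ?thesis
    by simp
qed

lemma compress_add: "j \<in> frame_idx m \<Longrightarrow> j' \<in> frame_idx m' \<Longrightarrow> f \<in> NTc \<Longrightarrow> g \<in> NTc \<Longrightarrow>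
  compress m j (op_add f g) m' j' = compress m j f m' j' + compress m j g m' j'"
  unfolding compress_def by (subst op_comp_add_right) (simp_all add: op_comp_add_left e0_add)

lemma compress_scale: "j \<in> frame_idx m \<Longrightarrow> j' \<in> frame_idx m' \<Longrightarrow> f \<in> NTc \<Longrightarrow>
  compress m j (op_scale c f) m' j' = c *\<^sub>C compress m j f m' j'"
  unfolding compress_def by (subst op_comp_scale_right) (simp_all add: op_comp_scale_left e0_scale)

lemma compress_pos: "j \<in> frame_idx m \<Longrightarrow> f \<in> NTc \<Longrightarrow> pos (compress m j (adj f \<circ> f) m j)"
proof -
  assume j: "j \<in> frame_idx m" and f: "f \<in> NTc"
  have "adj (frame_op m j) \<circ> (adj f \<circ> f) \<circ> frame_op m j = adj (f \<circ> frame_op m j) \<circ> (f \<circ> frame_op m j)"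
    using j f by (simp add: adj_op_comp comp_assoc)
  then show ?thesis
    using j f by (simp add: compress_def e0_adj_comp fk.inner_pos)
qed

lemma compress_homogeneous:
  assumes f: "homogeneous k f" and j: "j \<in> frame_idx m" and j': "j' \<in> frame_idx m'"
    and ne: "int (deg m) \<noteq> int (deg m') + k"
  shows "compress m j f m' j' = 0"
  unfolding compress_def
  by (rule e0_homogeneous[OF homogeneous_comp_frame_op[OF homogeneous_adj_frame_op_comp[OF f j] j']]) (use ne in linarith)

lemma compress_expansion:
  assumes f: "f \<in> NTc" and g: "g \<in> NTc" and j: "j \<in> frame_idx m"
  shows "((\<lambda>m'. \<Sum>j'\<in>frame_idx m'. compress m j f m' j' * compress m' j' g m j) has_sum compress m j (f \<circ> g) m j) UNIV"
  using frame_expansion[OF adj_frame_op_comp_NT[OF j f] comp_frame_op_NT[OF j g]]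
  by (simp add: compress_def comp_assoc)

text \<open>The trace over the fibre at \<open>m\<close> that is induced by \<open>\<tau>\<close>,
  so that \<open>gibbs\<close> is the usual unnormalised Gibbs functional with energy
  \<open>deg\<close>.\<close>

definition wtrace :: "('a \<Rightarrow> complex) \<Rightarrow> nat ^ 'n \<Rightarrow> ('n, 'x) fop \<Rightarrow> complex" where
  "wtrace \<tau> m f = (\<Sum>j\<in>frame_idx m. \<tau> (compress m j f m j))"

definition gibbs :: "('a \<Rightarrow> complex) \<Rightarrow> real \<Rightarrow> ('n, 'x) fop \<Rightarrow> complex" where
  "gibbs \<tau> \<beta> f = infsum (\<lambda>m. of_real (exp (- real (deg m) * \<beta>)) * wtrace \<tau> m f) UNIV"

lemma wtrace_0: "f \<in> NTc \<Longrightarrow> wtrace \<tau> 0 f = \<tau> (e0 f)"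
  by (simp add: wtrace_def frame_idx_def compress_def)

lemma norm_wtrace:
  assumes \<tau>: "\<tau> \<in> states type_alg" and f: "f \<in> NTc"
  shows "cmod (wtrace \<tau> m f) \<le> real rank_bound ^ deg m * opnorm f"
proof -
  have "cmod (wtrace \<tau> m f) \<le> (\<Sum>j\<in>frame_idx m. opnorm f)"
    unfolding wtrace_def
  proof (rule sum_norm_le)
    fix j assume j: "j \<in> frame_idx m"
    have "cmod (\<tau> (compress m j f m j)) \<le> norm (compress m j f m j)"
      using ta.state_bound[OF \<tau>, of "compress m j f m j"] by simp
    then show "cmod (\<tau> (compress m j f m j)) \<le> opnorm f"
      using norm_compress[OF j j f] by linarith
  qed
  also have "\<dots> = real (card (frame_idx m)) * opnorm f"
    by simp
  also have "\<dots> \<le> real (rank_bound ^ deg m) * opnorm f"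
    using frame_idx(2)[of m] f by (intro mult_right_mono opnorm_nonneg of_nat_mono) simp_all
  finally show ?thesis
    by simp
qed

text \<open>Below this temperature the weights beat the growth of the ranks.\<close>

definition cold :: "real \<Rightarrow> bool" where
  "cold \<beta> \<longleftrightarrow> \<beta> > 0 \<and> real rank_bound * exp (- \<beta> / 2) \<le> 1 / 2"

lemma eventually_cold: "eventually cold at_top"
proof -
  have "((\<lambda>\<beta>. real rank_bound * exp (- \<beta> / 2)) \<longlongrightarrow> 0) at_top"
  proof (rule tendsto_mult_right_zero)
    have "filterlim (\<lambda>\<beta>. (- 1 / 2) * \<beta>) at_bot (at_top :: real filter)"
      by (intro filterlim_tendsto_neg_mult_at_bot[OF tendsto_const]) (auto intro: filterlim_ident)
    then show "((\<lambda>\<beta>. exp (- \<beta> / 2)) \<longlongrightarrow> (0::real)) at_top"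
      using filterlim_compose[OF exp_at_bot] by fastforce
  qed
  then have "\<forall>\<^sub>F \<beta> in at_top. real rank_bound * exp (- \<beta> / 2) < 1 / 2"
    by (rule order_tendstoD) simp
  then show ?thesis
    unfolding cold_def using eventually_gt_at_top[of 0] by eventually_elim auto
qed

lemma cold_power:
  assumes "cold \<beta>"
  shows "real rank_bound ^ l * exp (- real l * \<beta> / 2) \<le> (1 / 2) ^ l"
proof -
  have "real rank_bound ^ l * exp (- real l * \<beta> / 2) = (real rank_bound * exp (- \<beta> / 2)) ^ l"
    by (simp add: power_mult_distrib exp_of_nat_mult[symmetric])
  also have "\<dots> \<le> (1 / 2) ^ l"
    using assms by (intro power_mono) (auto simp: cold_def)
  finally show ?thesis .
qed

text \<open>Half of the exponent absorbs the ranks and leaves a summable power; the other half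
  survives as \<open>exp (- \<beta> / 2)\<close>, by which everything except the term at 0 vanishes
  in the limit.\<close>

lemma cold_weight:
  assumes \<beta>: "cold \<beta>" and m: "m \<noteq> 0"
  shows "real rank_bound ^ deg m * exp (- real (deg m) * \<beta>) \<le> exp (- \<beta> / 2) * (1 / 2) ^ deg m"
proof -
  have "deg m \<ge> 1"
    using m deg_eq_0[of m] by linarith
  then have "1 * \<beta> \<le> real (deg m) * \<beta>"
    using \<beta> by (intro mult_right_mono) (auto simp: cold_def)
  then have "exp (- real (deg m) * \<beta> / 2) \<le> exp (- \<beta> / 2)"
    by simp
  moreover have "exp (- real (deg m) * \<beta>) = exp (- real (deg m) * \<beta> / 2) * exp (- real (deg m) * \<beta> / 2)"
    by (simp add: exp_add[symmetric])
  ultimately have "real rank_bound ^ deg m * exp (- real (deg m) * \<beta>) \<le>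
      (real rank_bound ^ deg m * exp (- real (deg m) * \<beta> / 2)) * exp (- \<beta> / 2)"
    by (simp add: mult.assoc mult_left_mono)
  also have "\<dots> \<le> (1 / 2) ^ deg m * exp (- \<beta> / 2)"
    by (intro mult_right_mono cold_power[OF \<beta>]) simp
  finally show ?thesis
    by (simp add: mult.commute)
qed

lemma gibbs_term:
  assumes \<tau>: "\<tau> \<in> states type_alg" and f: "f \<in> NTc" and \<beta>: "cold \<beta>"
  shows "cmod (of_real (exp (- real (deg m) * \<beta>)) * wtrace \<tau> m f) \<le> opnorm f * (1 / 2) ^ deg m"
    and "m \<noteq> 0 \<Longrightarrow> cmod (of_real (exp (- real (deg m) * \<beta>)) * wtrace \<tau> m f) \<le>
      (exp (- \<beta> / 2) * opnorm f) * (1 / 2) ^ deg m"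
proof -
  have n: "opnorm f \<ge> 0"
    using f by (simp add: opnorm_nonneg)
  have "cmod (of_real (exp (- real (deg m) * \<beta>)) * wtrace \<tau> m f) = exp (- real (deg m) * \<beta>) * cmod (wtrace \<tau> m f)"
    by (simp add: norm_mult)
  also have "\<dots> \<le> exp (- real (deg m) * \<beta>) * (real rank_bound ^ deg m * opnorm f)"
    by (intro mult_left_mono norm_wtrace[OF \<tau> f]) simp
  also have "\<dots> = (real rank_bound ^ deg m * exp (- real (deg m) * \<beta>)) * opnorm f"
    by (simp add: mult_ac)
  finally have le: "cmod (of_real (exp (- real (deg m) * \<beta>)) * wtrace \<tau> m f) \<le>
      (real rank_bound ^ deg m * exp (- real (deg m) * \<beta>)) * opnorm f" .
  show nz: "cmod (of_real (exp (- real (deg m) * \<beta>)) * wtrace \<tau> m f) \<le> (exp (- \<beta> / 2) * opnorm f) * (1 / 2) ^ deg m"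
    if "m \<noteq> 0"
    using order_trans[OF le mult_right_mono[OF cold_weight[OF \<beta> that] n]] by (simp add: mult_ac)
  show "cmod (of_real (exp (- real (deg m) * \<beta>)) * wtrace \<tau> m f) \<le> opnorm f * (1 / 2) ^ deg m"
  proof (cases "m = 0")
    case True
    then show ?thesis
      using norm_wtrace[OF \<tau> f, of 0] by simp
  next
    case False
    have "exp (- \<beta> / 2) * opnorm f \<le> 1 * opnorm f"
      using \<beta> n by (intro mult_right_mono) (simp_all add: cold_def)
    then have "(exp (- \<beta> / 2) * opnorm f) * (1 / 2) ^ deg m \<le> (1 * opnorm f) * (1 / 2) ^ deg m"
      by (rule mult_right_mono) simp
    then show ?thesis
      using nz[OF False] by simp
  qed
qed

lemma gibbs_summable:
  assumes \<tau>: "\<tau> \<in> states type_alg" and f: "f \<in> NTc" and \<beta>: "cold \<beta>"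
  shows "(\<lambda>m. of_real (exp (- real (deg m) * \<beta>)) * wtrace \<tau> m f) summable_on UNIV"
proof (rule abs_summable_summable, rule summable_on_comparison_test)
  show "(\<lambda>m :: nat ^ 'n. opnorm f * (1 / 2) ^ deg m) summable_on UNIV"
    by (rule summable_on_cmult_right[OF summable_half_deg])
qed (use gibbs_term(1)[OF assms] in auto)

definition gibbs_error :: "real \<Rightarrow> real" where
  "gibbs_error \<beta> = exp (- \<beta> / 2) * infsum (\<lambda>m :: nat ^ 'n. (1 / 2) ^ deg m) UNIV"

text \<open>The term at \<open>m = 0\<close> is exactly \<open>\<tau> (e0 f)\<close>, and all others
  carry the factor \<open>exp (- \<beta> / 2)\<close>.\<close>

lemma gibbs_close:
  assumes \<tau>: "\<tau> \<in> states type_alg" and f: "f \<in> NTc" and \<beta>: "cold \<beta>"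
  shows "cmod (gibbs \<tau> \<beta> f - \<tau> (e0 f)) \<le> gibbs_error \<beta> * opnorm f"
proof (rule norm_infsum_le)
  let ?g = "\<lambda>m. of_real (exp (- real (deg m) * \<beta>)) * wtrace \<tau> m f"
  have "(?g has_sum gibbs \<tau> \<beta> f) UNIV"
    unfolding gibbs_def by (rule has_sum_infsum[OF gibbs_summable[OF assms]])
  moreover have "((\<lambda>m. - (if m \<in> {0} then \<tau> (e0 f) else 0)) has_sum - (\<tau> (e0 f))) UNIV"
    by (rule has_sum_finite_neutralI[of "{0}"]) auto
  ultimately show "((\<lambda>m. ?g m - (if m \<in> {0} then \<tau> (e0 f) else 0)) has_sum (gibbs \<tau> \<beta> f - \<tau> (e0 f))) UNIV"
    unfolding diff_conv_add_uminus by (rule has_sum_add)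
  show "((\<lambda>m. (exp (- \<beta> / 2) * opnorm f) * (1 / 2) ^ deg (m :: nat ^ 'n)) has_sum gibbs_error \<beta> * opnorm f) UNIV"
    using has_sum_cmult_right[OF has_sum_infsum[OF summable_half_deg], of "exp (- \<beta> / 2) * opnorm f"]
    by (simp add: gibbs_error_def mult_ac)
  show "cmod (?g m - (if m \<in> {0} then \<tau> (e0 f) else 0)) \<le> (exp (- \<beta> / 2) * opnorm f) * (1 / 2) ^ deg m" for m
    using gibbs_term(2)[OF assms, of m] f by (cases "m = 0") (simp_all add: wtrace_0 opnorm_nonneg)
qed

lemma gibbs_add:
  assumes \<tau>: "\<tau> \<in> states type_alg" and f: "f \<in> NTc" and g: "g \<in> NTc" and \<beta>: "cold \<beta>"
  shows "gibbs \<tau> \<beta> (op_add f g) = gibbs \<tau> \<beta> f + gibbs \<tau> \<beta> g"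
proof -
  have "wtrace \<tau> m (op_add f g) = wtrace \<tau> m f + wtrace \<tau> m g" for m
    using f g ta.stateD(2)[OF \<tau>] by (simp add: wtrace_def compress_add sum.distrib)
  then show ?thesis
    unfolding gibbs_def
    using infsum_add[OF gibbs_summable[OF \<tau> f \<beta>] gibbs_summable[OF \<tau> g \<beta>]] by (simp add: distrib_left)
qed

lemma gibbs_scale:
  assumes \<tau>: "\<tau> \<in> states type_alg" and f: "f \<in> NTc"
  shows "gibbs \<tau> \<beta> (op_scale c f) = c * gibbs \<tau> \<beta> f"
proof -
  have "wtrace \<tau> m (op_scale c f) = c * wtrace \<tau> m f" for m
    using f ta.stateD(3)[OF \<tau>] by (simp add: wtrace_def compress_scale sum_distrib_left)
  then show ?thesis
    unfolding gibbs_def infsum_cmult_right'[symmetric] by (simp add: mult_ac)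
qed

lemma gibbs_pos:
  assumes \<tau>: "\<tau> \<in> states type_alg" and f: "f \<in> NTc" and \<beta>: "cold \<beta>"
  shows "gibbs \<tau> \<beta> (adj f \<circ> f) \<in> \<real>\<^sub>\<ge>\<^sub>0"
proof -
  have "wtrace \<tau> m (adj f \<circ> f) \<ge> 0" for m
    unfolding wtrace_def
  proof (rule sum_nonneg)
    fix j assume "j \<in> frame_idx m"
    then show "0 \<le> \<tau> (compress m j (adj f \<circ> f) m j)"
      using state_pos[OF \<tau> compress_pos[OF _ f]] by (simp add: complex_nonneg_Reals_iff less_eq_complex_def)
  qed
  then have "gibbs \<tau> \<beta> (adj f \<circ> f) \<ge> 0"
    unfolding gibbs_def using f
    by (intro infsum_nonneg_complex gibbs_summable[OF \<tau> _ \<beta>]) (simp_all add: less_eq_complex_def)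
  then show ?thesis
    by (simp add: complex_nonneg_Reals_iff less_eq_complex_def)
qed

lemma gibbs_vanish:
  assumes "\<And>m j. j \<in> frame_idx m \<Longrightarrow> \<tau> (compress m j f m j) = 0"
  shows "gibbs \<tau> \<beta> f = 0"
  using assms by (simp add: gibbs_def wtrace_def)

text \<open>Both orders of the product expand into the same double series of matrix coefficients,
  whose terms live on one diagonal of degrees; the trace property exchanges the two factors.\<close>

lemma gibbs_commute:
  assumes \<tau>: "\<tau> \<in> tracial_states type_alg" and f: "homogeneous k f" and g: "g \<in> NTc" and \<beta>: "cold \<beta>"
  shows "gibbs \<tau> \<beta> (f \<circ> g) = of_real (exp (- of_int k * \<beta>)) * gibbs \<tau> \<beta> (g \<circ> f)"
proof -
  have \<tau>s: "\<tau> \<in> states type_alg" and tr: "\<tau> (a * b) = \<tau> (b * a)" for a b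
    using \<tau> by (simp_all add: tracial_states_def)
  have fN: "f \<in> NTc"
    using f by (simp add: homogeneous_def)
  have \<tau>0: "\<tau> 0 = 0"
    using ta.stateD(3)[OF \<tau>s, of 0 0] by simp
  define G where "G m m' = (\<Sum>j\<in>frame_idx m. \<Sum>j'\<in>frame_idx m'. \<tau> (compress m j f m' j' * compress m' j' g m j))" for m m'
  let ?e = "\<lambda>m :: nat ^ 'n. complex_of_real (exp (- real (deg m) * \<beta>))"
  let ?K = "complex_of_real (exp (- of_int k * \<beta>))"
  have bl: "bounded_linear \<tau>"
    by (rule state_bounded_linear[OF \<tau>s])
  have \<tau>sum: "\<tau> (\<Sum>j\<in>J. h j) = (\<Sum>j\<in>J. \<tau> (h j))" for h and J :: "nat set"
    by (rule linear_sum[OF bounded_linear.linear[OF bl]])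
  have G1: "(G m has_sum wtrace \<tau> m (f \<circ> g)) UNIV" for m
    unfolding wtrace_def G_def
  proof (rule has_sum_sum_finite[OF frame_idx(1)])
    fix j assume "j \<in> frame_idx m"
    from has_sum_bounded_linear[OF bl compress_expansion[OF fN g this]]
    show "((\<lambda>m'. \<Sum>j'\<in>frame_idx m'. \<tau> (compress m j f m' j' * compress m' j' g m j)) has_sum
        \<tau> (compress m j (f \<circ> g) m j)) UNIV"
      by (simp only: \<tau>sum)
  qed
  \<comment> \<open>Summing over \<open>m\<close> instead regroups the same entries into the trace
    of \<open>g \<circ> f\<close>, once \<open>tr\<close> has exchanged the factors.\<close>
  have G2: "((\<lambda>m. G m m') has_sum wtrace \<tau> m' (g \<circ> f)) UNIV" for m'
  proof -
    have "((\<lambda>m. \<Sum>j'\<in>frame_idx m'. \<Sum>j\<in>frame_idx m. \<tau> (compress m' j' g m j * compress m j f m' j')) has_sum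
        wtrace \<tau> m' (g \<circ> f)) UNIV"
      unfolding wtrace_def
    proof (rule has_sum_sum_finite[OF frame_idx(1)])
      fix j' assume "j' \<in> frame_idx m'"
      from has_sum_bounded_linear[OF bl compress_expansion[OF g fN this]]
      show "((\<lambda>m. \<Sum>j\<in>frame_idx m. \<tau> (compress m' j' g m j * compress m j f m' j')) has_sum
          \<tau> (compress m' j' (g \<circ> f) m' j')) UNIV"
        by (simp only: \<tau>sum)
    qed
    moreover have "(\<Sum>j'\<in>frame_idx m'. \<Sum>j\<in>frame_idx m. \<tau> (compress m' j' g m j * compress m j f m' j')) = G m m'" for m
      unfolding G_def by (subst sum.swap) (simp only: tr)
    ultimately show ?thesis
      by simp
  qed
  have G0: "G m m' = 0" if "int (deg m) \<noteq> int (deg m') + k" for m m'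
    unfolding G_def using that by (intro sum.neutral ballI) (simp add: compress_homogeneous[OF f] \<tau>0)
  have Gb: "cmod (G m m') \<le> real rank_bound ^ deg m * (real rank_bound ^ deg m' * (opnorm f * opnorm g))" for m m'
  proof -
    have "cmod (G m m') \<le> (\<Sum>j\<in>frame_idx m. \<Sum>j'\<in>frame_idx m'. opnorm f * opnorm g)"
      unfolding G_def
    proof (intro sum_norm_le)
      fix j j' assume j: "j \<in> frame_idx m" and j': "j' \<in> frame_idx m'"
      have "cmod (\<tau> (compress m j f m' j' * compress m' j' g m j)) \<le> norm (compress m j f m' j' * compress m' j' g m j)"
        using ta.state_bound[OF \<tau>s, of "compress m j f m' j' * compress m' j' g m j"] by simp
      also have "\<dots> \<le> norm (compress m j f m' j') * norm (compress m' j' g m j)"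
        by (rule norm_mult_ineq)
      also have "\<dots> \<le> opnorm f * opnorm g"
        using fN by (intro mult_mono norm_compress j j' g opnorm_nonneg) simp_all
      finally show "cmod (\<tau> (compress m j f m' j' * compress m' j' g m j)) \<le> opnorm f * opnorm g" .
    qed
    also have "\<dots> = real (card (frame_idx m)) * (real (card (frame_idx m')) * (opnorm f * opnorm g))"
      by simp
    also have "\<dots> \<le> real (rank_bound ^ deg m) * (real (rank_bound ^ deg m') * (opnorm f * opnorm g))"
      using fN g by (intro mult_mono of_nat_mono frame_idx(2) mult_nonneg_nonneg order_refl) (simp_all add: opnorm_nonneg)
    finally show ?thesis
      by simp
  qed
  define C where "C = opnorm f * opnorm g * exp (- of_int k * \<beta> / 2)"
  have hb: "cmod (?e m * G m m') \<le> C * ((1 / 2) ^ deg m * (1 / 2) ^ deg m')" for m m'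
  proof (cases "int (deg m) = int (deg m') + k")
    case True
    have "real (deg m) = real (deg m') + of_int k"
      using arg_cong[OF True, of real_of_int] by simp
    \<comment> \<open>On the diagonal \<open>deg m = deg m' + k\<close> the single weight is shared
      between both indices at the cost of the constant \<open>exp (- k * \<beta> / 2)\<close>; each
      half then beats the rank of its own fibre.\<close>
    then have ex: "exp (- real (deg m) * \<beta>) =
        exp (- real (deg m) * \<beta> / 2) * (exp (- real (deg m') * \<beta> / 2) * exp (- of_int k * \<beta> / 2))"
      by (simp add: exp_add[symmetric] field_simps)
    have "cmod (?e m * G m m') \<le> exp (- real (deg m) * \<beta>) *
        (real rank_bound ^ deg m * (real rank_bound ^ deg m' * (opnorm f * opnorm g)))"
      unfolding norm_mult norm_of_real by (intro mult_mono Gb) simp_all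
    also have "\<dots> = (real rank_bound ^ deg m * exp (- real (deg m) * \<beta> / 2)) *
        ((real rank_bound ^ deg m' * exp (- real (deg m') * \<beta> / 2)) * (opnorm f * opnorm g * exp (- of_int k * \<beta> / 2)))"
      unfolding ex by (simp only: mult_ac)
    also have "\<dots> \<le> (1 / 2) ^ deg m * ((1 / 2) ^ deg m' * (opnorm f * opnorm g * exp (- of_int k * \<beta> / 2)))"
      using fN g by (intro mult_mono cold_power[OF \<beta>] order_refl mult_nonneg_nonneg) (simp_all add: opnorm_nonneg)
    finally show ?thesis
      by (simp add: C_def mult_ac)
  next
    case False
    then show ?thesis
      using fN g by (simp add: G0 C_def opnorm_nonneg)
  qed
  have sm: "(\<lambda>(m, m'). ?e m * G m m') summable_on UNIV \<times> UNIV"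
  proof (rule abs_summable_summable, rule summable_on_comparison_test[OF summable_half_deg_prod[of C]])
    fix p :: "(nat ^ 'n) \<times> (nat ^ 'n)"
    show "norm (case p of (m, m') \<Rightarrow> ?e m * G m m') \<le> (case p of (m, m') \<Rightarrow> C * ((1 / 2) ^ deg m * (1 / 2) ^ deg m'))"
      using hb by (cases p) simp
  qed simp
  \<comment> \<open>Replacing the weight at \<open>m\<close> by that at \<open>m'\<close> produces
    the KMS factor; off the diagonal both sides are 0.\<close>
  have sw: "?e m * G m m' = ?K * (?e m' * G m m')" for m m'
  proof (cases "int (deg m) = int (deg m') + k")
    case True
    have "real (deg m) = real (deg m') + of_int k"
      using arg_cong[OF True, of real_of_int] by simp
    then have "exp (- real (deg m) * \<beta>) = exp (- of_int k * \<beta>) * exp (- real (deg m') * \<beta>)"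
      by (simp add: exp_add[symmetric] field_simps)
    then show ?thesis
      by (simp only: of_real_mult mult.assoc)
  qed (simp add: G0)
  have "gibbs \<tau> \<beta> (f \<circ> g) = infsum (\<lambda>m. infsum (\<lambda>m'. ?e m * G m m') UNIV) UNIV"
    unfolding gibbs_def infsum_cmult_right' using infsumI[OF G1] by simp
  also have "\<dots> = infsum (\<lambda>m'. infsum (\<lambda>m. ?e m * G m m') UNIV) UNIV"
    by (rule infsum_swap_banach[OF sm])
  also have "\<dots> = infsum (\<lambda>m'. ?K * (?e m' * wtrace \<tau> m' (g \<circ> f))) UNIV"
    unfolding sw infsum_cmult_right' using infsumI[OF G2] by simp
  also have "\<dots> = ?K * gibbs \<tau> \<beta> (g \<circ> f)"
    unfolding gibbs_def infsum_cmult_right' ..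
  finally show ?thesis .
qed

end

text \<open>With \<open>u = 1 - h\<close> the positive elements \<open>u\<^sup>n h u\<^sup>n\<close> decrease and their sums stay
  below 1, so they tend to 0.\<close>

lemma power_cutoff_bound:
  fixes a :: "'a::unital_cstar_algebra"
  assumes a: "norm a \<le> 1"
  defines "u \<equiv> 1 - star a * a"
  shows "real n * norm (star (a * u ^ n) * (a * u ^ n)) \<le> 1"
proof -
  define h where "h = star a * a"
  define p where "p n = star (a * u ^ n) * (a * u ^ n)" for n
  have hs: "star h = h"
    by (simp add: h_def star_mult star_star)
  have u: "u = 1 - h"
    by (simp add: u_def h_def)
  have us: "star u = u"
    by (simp add: u hs star_diff)
  have uns: "star (u ^ n) = u ^ n" for n
    by (induction n) (simp_all add: star_mult us power_commutes)
  have pc: "u * (u ^ n * y) = u ^ n * (u * y)" for n y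
    by (metis mult.assoc power_commutes)
  have posI: "pos b" if "Pos b" for b :: 'a
    using Pos_sqrt[OF that] Pos_self_adjoint unfolding pos_def by metis
  have nh: "norm (star b * b) \<le> 1" if "norm b \<le> 1" for b :: 'a
    using that by (simp add: cstar_identity power_le_one)
  have pos1: "pos (1 - star b * b)" if "norm b \<le> 1" for b :: 'a
    using Pos_of_real_minus[of "star b * b" 1] nh[OF that] by (intro posI) (simp add: star_mult star_star)
  have p: "p n = u ^ n * h * u ^ n" for n
    by (simp add: p_def star_mult uns h_def mult.assoc)
  have ppos: "pos (p n)" for n
    by (simp add: p_def)
  \<comment> \<open>With \<open>u = 1 - h\<close> one has
    \<open>h - u * h * u = h * h + h * (1 - h) * h\<close>, a sum of positive terms.\<close>
  have dec: "pos (p n - p (Suc n))" for n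
  proof -
    have "pos (star h * 1 * h + star h * (1 - h) * h)"
      using pos1[OF a] pos_star_mult[of "1::'a"] by (intro pos_add pos_conj) (simp_all add: h_def)
    then have "pos (star (u ^ n) * (star h * 1 * h + star h * (1 - h) * h) * u ^ n)"
      by (rule pos_conj)
    also have "star h * 1 * h + star h * (1 - h) * h = h - u * h * u"
      by (simp add: hs u algebra_simps)
    also have "star (u ^ n) * (h - u * h * u) * u ^ n = p n - p (Suc n)"
      by (simp add: p uns algebra_simps power_commutes pc)
    finally show ?thesis .
  qed
  \<comment> \<open>Here \<open>1 - u * u - h = h - h * h\<close> is the positive element
    \<open>1 - a * star a\<close> sandwiched by \<open>star a\<close> and \<open>a\<close>. So
    \<open>p n\<close> is at most a difference of consecutive even powers of \<open>u\<close>, and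
    the sum telescopes.\<close>
  have q: "pos ((1 - u ^ Suc n * u ^ Suc n) - (1 - u ^ n * u ^ n) - p n)" for n
  proof -
    have "pos (1 - a * star a)"
      using pos1[of "star a"] a by (simp add: star_star norm_star)
    then have "pos (star (a * u ^ n) * (1 - a * star a) * (a * u ^ n))"
      by (rule pos_conj)
    also have "star (a * u ^ n) * (1 - a * star a) * (a * u ^ n) = u ^ n * (h - h * h) * u ^ n"
      by (simp add: star_mult uns h_def algebra_simps)
    also have "h - h * h = 1 - u * u - h"
      by (simp add: u algebra_simps)
    also have "u ^ n * (1 - u * u - h) * u ^ n = (1 - u ^ Suc n * u ^ Suc n) - (1 - u ^ n * u ^ n) - p n"
      by (simp add: p algebra_simps power_commutes pc)
    finally show ?thesis .
  qed
  have sum: "pos ((1 - u ^ n * u ^ n) - (\<Sum>k<n. p k))" for n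
  proof (induction n)
    case (Suc n)
    from pos_add[OF this q[of n]] show ?case
      by (simp add: algebra_simps)
  qed simp
  have mono: "pos (p k - p (k + l))" for k l
  proof (induction l)
    case (Suc l)
    from pos_add[OF this dec[of "k + l"]] show ?case
      by simp
  qed simp
  \<comment> \<open>The family decreases, so its first \<open>n\<close> terms add up to at least
    \<open>n\<close> times \<open>p n\<close>.\<close>
  have "pos (\<Sum>k<n. p k - p n)"
    using mono by (intro pos_sum) (metis le_add_diff_inverse less_imp_le lessThan_iff)
  moreover have "(\<Sum>k<n. p k - p n) = (\<Sum>k<n. p k) - real n *\<^sub>R p n"
    by (simp add: sum_subtractf sum_constant_scaleR del: sum_constant)
  ultimately have "pos ((\<Sum>k<n. p k) - real n *\<^sub>R p n)"
    by simp
  moreover have "pos (u ^ n * u ^ n)"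
    using pos_star_mult[of "u ^ n"] by (simp add: uns)
  ultimately have "pos (((1 - u ^ n * u ^ n) - (\<Sum>k<n. p k)) + (((\<Sum>k<n. p k) - real n *\<^sub>R p n) + u ^ n * u ^ n))"
    by (intro pos_add sum)
  then have "pos (1 - real n *\<^sub>R p n)"
    by simp
  then have "norm (real n *\<^sub>R p n) \<le> norm (1::'a)"
    using pos_scaleR[OF ppos, of "real n"] by (intro pos_norm_mono) simp_all
  then show ?thesis
    by (simp add: p_def)
qed

text \<open>The definition of a closed ideal does not mention the involution. With
  \<open>h = star a * a\<close>, the elements \<open>star a - (1 - h) ^ k * star a\<close> lie in
  the ideal because \<open>h\<close> does, and by the cutoff bound they converge to
  \<open>star a\<close>.\<close>

lemma closed_ideal_star:
  fixes J :: "'a::cstar_algebra set"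
  assumes J: "closed_ideal type_alg J" and a: "a \<in> J"
  shows "star a \<in> J"
proof -
  have Jadd: "x + y \<in> J" if "x \<in> J" "y \<in> J" for x y
    using J that by (simp add: closed_ideal_def)
  have Jsc: "c *\<^sub>C x \<in> J" if "x \<in> J" for c x
    using J that by (simp add: closed_ideal_def)
  have Jm: "x * b \<in> J" "b * x \<in> J" if "x \<in> J" for x b
    using J that by (simp_all add: closed_ideal_def)
  have Jcl: "l \<in> J" if "\<And>k::nat. s k \<in> J" "(\<lambda>k. norm (s k + (-1) *\<^sub>C l)) \<longlonglongrightarrow> 0" for s l
    using J that unfolding closed_ideal_def closed_in_def dist_of_def by simp blast
  have star_small: "star a \<in> J" if a: "a \<in> J" and n: "norm a \<le> 1" for a
  proof -
    define h where "h = star a * a"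
    \<comment> \<open>\<open>z k\<close> is the \<open>k\<close>-th power of \<open>1 - h\<close>
      applied to \<open>star a\<close>, written recursively because \<open>'a\<close> may lack a
      unit.\<close>
    define z where "z = rec_nat (star a) (\<lambda>_ y. y - h * y)"
    have z0: "z 0 = star a" and zS: "z (Suc k) = z k - h * z k" for k
      by (simp_all add: z_def)
    have h: "h \<in> J"
      by (simp add: h_def Jm a)
    let ?a = "Unitization 0 a"
    let ?u = "1 - star ?a * ?a"
    have us: "star ?u = ?u"
      by (simp add: star_diff star_mult star_star)
    have uns: "star (?u ^ k) = ?u ^ k" for k
      by (induction k) (simp_all only: star_mult us power_Suc power_0 star_one power_commutes)
    have "Unitization 0 (z k) = ?u ^ k * star ?a" for k
    proof (induction k)
      case 0
      then show ?case
        by (simp add: z0 star_unitization_def)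
    next
      case (Suc k)
      have "Unitization 0 (z (Suc k)) = ?u * Unitization 0 (z k)"
        by (simp add: zS h_def star_unitization_def unitization_defs left_diff_distrib scaleC_one)
      then show ?case
        by (simp only: Suc power_Suc mult.assoc)
    qed
    then have eq: "star (Unitization 0 (z k)) = ?a * ?u ^ k" for k
      by (simp only: star_mult uns star_star)
    have zb: "norm (z k) \<le> sqrt (1 / real k)" if "k > 0" for k
    proof (rule real_le_rsqrt)
      have "(norm (z k))\<^sup>2 = (norm (?a * ?u ^ k))\<^sup>2"
        using eq[of k] norm_star[of "Unitization 0 (z k)"] by simp
      also have "\<dots> = norm (star (?a * ?u ^ k) * (?a * ?u ^ k))"
        by (rule cstar_identity[symmetric])
      also have "\<dots> \<le> 1 / real k"
        using power_cutoff_bound[of ?a k] n that by (simp add: field_simps)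
      finally show "(norm (z k))\<^sup>2 \<le> 1 / real k" .
    qed
    have "z \<longlonglongrightarrow> 0"
    proof (rule Lim_null_comparison)
      show "\<forall>\<^sub>F k in sequentially. norm (z k) \<le> sqrt (1 / real k)"
        using zb by (intro eventually_sequentiallyI[of 1]) simp
      have "(\<lambda>k. sqrt (1 / real k)) \<longlonglongrightarrow> sqrt 0"
        by (intro tendsto_real_sqrt lim_1_over_n)
      then show "(\<lambda>k. sqrt (1 / real k)) \<longlonglongrightarrow> 0"
        by simp
    qed
    then have "(\<lambda>k. norm (z k)) \<longlonglongrightarrow> 0"
      by (rule tendsto_norm_zero)
    moreover have "star a + - z k \<in> J" for k
    proof (induction k)
      case 0
      show ?case
        using Jsc[OF a, of 0] by (simp add: z0)
    next
      case (Suc k)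
      then show ?case
        using Jadd[OF Suc Jm(1)[OF h, of "z k"]] by (simp add: zS algebra_simps)
    qed
    ultimately show ?thesis
      using Jcl[of "\<lambda>k. star a + - z k" "star a"] by simp
  qed
  \<comment> \<open>Rescaling to norm at most 1; the added 1 covers \<open>a = 0\<close>.\<close>
  define c where "c = complex_of_real (1 / (norm a + 1))"
  have na: "norm a + 1 > 0"
    by (simp add: add_nonneg_pos)
  have "norm (c *\<^sub>C a) \<le> 1"
    using na by (simp add: norm_scaleC c_def norm_divide)
  then have "star (c *\<^sub>C a) \<in> J"
    using star_small Jsc[OF a] by blast
  then have "(1 / cnj c) *\<^sub>C (cnj c *\<^sub>C star a) \<in> J"
    unfolding star_scaleC by (rule Jsc)
  moreover have "cnj c \<noteq> 0"
    using na unfolding c_def complex_cnj_complex_of_real of_real_eq_0_iff by simp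
  ultimately show ?thesis
    by (simp add: scaleC_scaleC scaleC_one)
qed

text \<open>The limit is taken along the filter of pairs \<open>(\<beta>, G \<beta>)\<close> with
  \<open>\<beta>\<close> tending to infinity.\<close>

lemma kms_infinityI:
  fixes B :: "'b star_alg"
  assumes "\<phi> \<in> states B" and "\<forall>\<^sub>F \<beta> in at_top. G \<beta> \<in> kms_states B \<sigma> \<beta>"
    and "\<And>f. f \<in> carr B \<Longrightarrow> ((\<lambda>\<beta>. G \<beta> f) \<longlongrightarrow> \<phi> f) at_top"
  shows "\<phi> \<in> kms_infinity_states B \<sigma>"
proof -
  let ?F = "filtermap (\<lambda>\<beta>. (\<beta>, G \<beta>)) (at_top :: real filter)"
  have nb: "?F \<noteq> bot"
    by (simp add: filtermap_bot_iff)
  have ev: "\<forall>\<^sub>F p in ?F. snd p \<in> kms_states B \<sigma> (fst p)"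
    using assms(2) by (simp add: eventually_filtermap)
  have top: "filterlim fst at_top ?F"
    by (simp add: filterlim_def filtermap_filtermap)
  have "\<forall>\<^sub>F \<beta> in at_top. G \<beta> \<in> extensional (carr B)"
    using assms(2) by (rule eventually_mono) (simp add: kms_states_def states_def)
  moreover have "\<phi> \<in> extensional (carr B)"
    using assms(1) by (simp add: states_def)
  moreover have "((\<lambda>p. snd p f) \<longlongrightarrow> \<phi> f) ?F" if "f \<in> carr B" for f
    using assms(3)[OF that] by (simp add: filterlim_def filtermap_filtermap)
  ultimately have "limitin (weak_star B) snd \<phi> ?F"
    unfolding weak_star_def limitin_componentwise by (simp add: eventually_filtermap PiE_def)
  then show ?thesis
    unfolding kms_infinity_states_def using assms(1) nb ev top by blast
qed

section \<open>Normalised Gibbs states and their limits\<close>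

context framed_system
begin

text \<open>The norm of the Gibbs functional. It takes the place of the partition function, which
  would be the value at a unit.\<close>

definition gibbs_mass :: "('a \<Rightarrow> complex) \<Rightarrow> real \<Rightarrow> real" where
  "gibbs_mass \<tau> \<beta> = (SUP f\<in>{f \<in> NTc. opnorm f \<le> 1}. cmod (gibbs \<tau> \<beta> f))"

definition gibbs_state :: "('a \<Rightarrow> complex) \<Rightarrow> real \<Rightarrow> ('n, 'x) fop \<Rightarrow> complex" where
  "gibbs_state \<tau> \<beta> = restrict (\<lambda>f. gibbs \<tau> \<beta> f / of_real (gibbs_mass \<tau> \<beta>)) NTc"

lemma gibbs_error_lim: "(gibbs_error \<longlongrightarrow> 0) at_top"
  unfolding gibbs_error_def
proof (rule tendsto_mult_left_zero)
  have "filterlim (\<lambda>\<beta>. (- 1 / 2) * \<beta>) at_bot (at_top :: real filter)"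
    by (intro filterlim_tendsto_neg_mult_at_bot[OF tendsto_const]) (auto intro: filterlim_ident)
  then show "((\<lambda>\<beta>. exp (- \<beta> / 2)) \<longlongrightarrow> (0::real)) at_top"
    using filterlim_compose[OF exp_at_bot] by fastforce
qed

lemma gibbs_bound:
  assumes \<tau>: "\<tau> \<in> states type_alg" and \<beta>: "cold \<beta>" and f: "f \<in> NTc"
  shows "cmod (gibbs \<tau> \<beta> f) \<le> (1 + gibbs_error \<beta>) * opnorm f"
proof -
  have "cmod (\<tau> (e0 f)) \<le> opnorm f"
    using ta.state_bound[OF \<tau>, of "e0 f"] norm_e0[OF f] by simp
  moreover have "cmod (gibbs \<tau> \<beta> f) \<le> cmod (\<tau> (e0 f)) + cmod (gibbs \<tau> \<beta> f - \<tau> (e0 f))"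
    using norm_triangle_sub by blast
  ultimately show ?thesis
    using gibbs_close[OF \<tau> f \<beta>] by (simp add: algebra_simps)
qed

text \<open>In norm the functional is within \<open>gibbs_error \<beta>\<close> of
  \<open>Psi \<tau>\<close>, which has norm 1.\<close>

lemma gibbs_mass:
  assumes \<tau>: "\<tau> \<in> states type_alg" and \<beta>: "cold \<beta>" and e: "gibbs_error \<beta> < 1"
  shows "\<bar>gibbs_mass \<tau> \<beta> - 1\<bar> \<le> gibbs_error \<beta>"
    and "f \<in> NTc \<Longrightarrow> cmod (gibbs \<tau> \<beta> f) \<le> gibbs_mass \<tau> \<beta> * opnorm f"
    and "r < gibbs_mass \<tau> \<beta> \<Longrightarrow> \<exists>f\<in>NTc. opnorm f \<le> 1 \<and> r < cmod (gibbs \<tau> \<beta> f)"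
proof -
  let ?U = "{f \<in> NTc. opnorm f \<le> 1}" and ?g = "\<lambda>f. cmod (gibbs \<tau> \<beta> f)"
  have e0: "0 \<le> gibbs_error \<beta>"
    unfolding gibbs_error_def by (intro mult_nonneg_nonneg infsum_nonneg) simp_all
  have ub: "?g f \<le> 1 + gibbs_error \<beta>" if "f \<in> ?U" for f
  proof -
    have "?g f \<le> (1 + gibbs_error \<beta>) * opnorm f"
      using that by (intro gibbs_bound[OF \<tau> \<beta>]) simp
    also have "\<dots> \<le> (1 + gibbs_error \<beta>) * 1"
      using that e0 by (intro mult_left_mono) simp_all
    finally show ?thesis
      by simp
  qed
  then have bdd: "bdd_above (?g ` ?U)"
    by (rule bdd_aboveI2)
  have "fpi X 0 \<in> ?U"
    using opnorm_fpi[of 0] by simp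
  then have ne: "?U \<noteq> {}"
    by blast
  have up: "?g f \<le> gibbs_mass \<tau> \<beta>" if "f \<in> ?U" for f
    unfolding gibbs_mass_def by (rule cSUP_upper[OF that bdd])
  have "gibbs_mass \<tau> \<beta> \<le> 1 + gibbs_error \<beta>"
    unfolding gibbs_mass_def by (rule cSUP_least[OF ne ub])
  moreover have "1 - gibbs_error \<beta> \<le> gibbs_mass \<tau> \<beta>"
  proof (rule field_le_epsilon)
    fix e :: real assume "e > 0"
    then obtain f where f: "f \<in> NTc" "opnorm f \<le> 1" "cmod (Psi \<tau> f) > 1 - e"
      using nt.state_approx[OF Psi_state[OF \<tau>]] by auto
    have "cmod (\<tau> (e0 f)) \<le> ?g f + cmod (gibbs \<tau> \<beta> f - \<tau> (e0 f))"
      using norm_triangle_ineq4[of "gibbs \<tau> \<beta> f" "gibbs \<tau> \<beta> f - \<tau> (e0 f)"] by simp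
    also have "cmod (gibbs \<tau> \<beta> f - \<tau> (e0 f)) \<le> gibbs_error \<beta> * opnorm f"
      by (rule gibbs_close[OF \<tau> f(1) \<beta>])
    also have "\<dots> \<le> gibbs_error \<beta> * 1"
      using e0 f(2) by (intro mult_left_mono) simp_all
    finally show "1 - gibbs_error \<beta> \<le> gibbs_mass \<tau> \<beta> + e"
      using f up[of f] by (simp add: Psi_apply)
  qed
  ultimately show "\<bar>gibbs_mass \<tau> \<beta> - 1\<bar> \<le> gibbs_error \<beta>"
    by linarith
  show "?g f \<le> gibbs_mass \<tau> \<beta> * opnorm f" if f: "f \<in> NTc"
  proof (cases "opnorm f = 0")
    case True
    then show ?thesis
      using gibbs_bound[OF \<tau> \<beta> f] by simp
  next
    case False
    then have n: "opnorm f > 0"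
      using opnorm_nonneg[of f] f by simp
    have "op_scale (of_real (1 / opnorm f)) f \<in> ?U"
      using f n by (simp add: opnorm_scale norm_divide)
    from up[OF this] show ?thesis
      using n f by (simp add: gibbs_scale[OF \<tau>] norm_mult norm_divide field_simps)
  qed
  show "\<exists>f\<in>NTc. opnorm f \<le> 1 \<and> r < ?g f" if "r < gibbs_mass \<tau> \<beta>"
    using that unfolding gibbs_mass_def less_cSUP_iff[OF ne bdd] by auto
qed

lemma gibbs_state_kms:
  assumes \<tau>: "\<tau> \<in> tracial_states type_alg" and \<beta>: "cold \<beta>" and e: "gibbs_error \<beta> < 1"
  shows "gibbs_state \<tau> \<beta> \<in> kms_states (NT X) rotation \<beta>"
proof -
  have \<tau>s: "\<tau> \<in> states type_alg"
    using \<tau> by (simp add: tracial_states_def)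
  let ?c = "gibbs_mass \<tau> \<beta>"
  note gm = gibbs_mass[OF \<tau>s \<beta> e]
  have c: "?c > 0"
    using gm(1) e by linarith
  have ap: "gibbs_state \<tau> \<beta> f = gibbs \<tau> \<beta> f / of_real ?c" if "f \<in> NTc" for f
    using that by (simp add: gibbs_state_def)
  have "gibbs_state \<tau> \<beta> \<in> states (NT X)"
  proof (rule nt.stateI)
    show "gibbs_state \<tau> \<beta> \<in> extensional NTc"
      by (simp add: gibbs_state_def)
    fix f g :: "('n, 'x) fop" and z
    assume f: "f \<in> NTc"
    show "g \<in> NTc \<Longrightarrow> gibbs_state \<tau> \<beta> (plus_of (NT X) f g) = gibbs_state \<tau> \<beta> f + gibbs_state \<tau> \<beta> g"
      using f by (simp add: ap gibbs_add[OF \<tau>s _ _ \<beta>] add_divide_distrib)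
    show "gibbs_state \<tau> \<beta> (scale_of (NT X) z f) = z * gibbs_state \<tau> \<beta> f"
      using f by (simp add: ap gibbs_scale[OF \<tau>s])
    show "gibbs_state \<tau> \<beta> (times_of (NT X) (star_of (NT X) f) f) \<in> \<real>\<^sub>\<ge>\<^sub>0"
      using f c gibbs_pos[OF \<tau>s f \<beta>] by (simp add: ap nonneg_Reals_divide_I)
    show "cmod (gibbs_state \<tau> \<beta> f) \<le> norm_of (NT X) f"
      using gm(2)[OF f] c f by (simp add: ap norm_divide field_simps)
  next
    fix e :: real assume e: "e > 0"
    then have "?c * (1 - e) < ?c"
      using c by (simp add: algebra_simps)
    from gm(3)[OF this] obtain f where f: "f \<in> NTc" "opnorm f \<le> 1" "?c * (1 - e) < cmod (gibbs \<tau> \<beta> f)"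
      by blast
    then show "\<exists>f\<in>NTc. norm_of (NT X) f \<le> 1 + e \<and> cmod (gibbs_state \<tau> \<beta> f) > 1 - e"
      using c e by (intro bexI[of _ f]) (simp_all add: ap norm_divide pos_less_divide_eq mult.commute)
  qed
  then show ?thesis
  proof (rule kms_stateI)
    show "\<beta> > 0"
      using \<beta> by (simp add: cold_def)
    show "gibbs_state \<tau> \<beta> (f \<circ> g) = of_real (exp (- of_int k * \<beta>)) * gibbs_state \<tau> \<beta> (g \<circ> f)"
      if f: "homogeneous k f" and g: "g \<in> NTc" for k f g
    proof -
      have "f \<in> NTc"
        using f by (simp add: homogeneous_def)
      then show ?thesis
        using g gibbs_commute[OF \<tau> f g \<beta>] ap[of "f \<circ> g"] ap[of "g \<circ> f"] by simp
    qed
  qed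
qed

lemma eventually_gibbs: "\<forall>\<^sub>F \<beta> in at_top. cold \<beta> \<and> gibbs_error \<beta> < 1"
  using eventually_cold order_tendstoD(2)[OF gibbs_error_lim, of 1] by (auto intro: eventually_conj)

lemma gibbs_state_lim:
  assumes \<tau>: "\<tau> \<in> states type_alg" and f: "f \<in> NTc"
  shows "((\<lambda>\<beta>. gibbs_state \<tau> \<beta> f) \<longlongrightarrow> Psi \<tau> f) at_top"
proof -
  have "((\<lambda>\<beta>. gibbs_mass \<tau> \<beta> - 1) \<longlongrightarrow> 0) at_top"
  proof (rule Lim_null_comparison[OF _ gibbs_error_lim])
    show "\<forall>\<^sub>F \<beta> in at_top. norm (gibbs_mass \<tau> \<beta> - 1) \<le> gibbs_error \<beta>"
      using eventually_gibbs by (rule eventually_mono) (use gibbs_mass(1)[OF \<tau>] in simp)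
  qed
  then have m: "(gibbs_mass \<tau> \<longlongrightarrow> 1) at_top"
    by (rule LIM_zero_cancel)
  have "((\<lambda>\<beta>. gibbs \<tau> \<beta> f - \<tau> (e0 f)) \<longlongrightarrow> 0) at_top"
  proof (rule Lim_null_comparison)
    show "\<forall>\<^sub>F \<beta> in at_top. norm (gibbs \<tau> \<beta> f - \<tau> (e0 f)) \<le> gibbs_error \<beta> * opnorm f"
      using eventually_cold by (rule eventually_mono) (rule gibbs_close[OF \<tau> f])
    show "((\<lambda>\<beta>. gibbs_error \<beta> * opnorm f) \<longlongrightarrow> 0) at_top"
      by (rule tendsto_mult_left_zero[OF gibbs_error_lim])
  qed
  then have "((\<lambda>\<beta>. gibbs \<tau> \<beta> f) \<longlongrightarrow> \<tau> (e0 f)) at_top"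
    by (rule LIM_zero_cancel)
  then have "((\<lambda>\<beta>. gibbs \<tau> \<beta> f / of_real (gibbs_mass \<tau> \<beta>)) \<longlongrightarrow> \<tau> (e0 f) / of_real 1) at_top"
    by (intro tendsto_divide tendsto_of_real m) simp_all
  then show ?thesis
    using f by (simp add: gibbs_state_def Psi_apply)
qed

lemma Psi_kms_infinity:
  assumes \<tau>: "\<tau> \<in> tracial_states type_alg"
  shows "Psi \<tau> \<in> kms_infinity_states (NT X) rotation"
proof (rule kms_infinityI)
  have \<tau>s: "\<tau> \<in> states type_alg"
    using \<tau> by (simp add: tracial_states_def)
  show "Psi \<tau> \<in> states (NT X)"
    by (rule Psi_state[OF \<tau>s])
  show "\<forall>\<^sub>F \<beta> in at_top. gibbs_state \<tau> \<beta> \<in> kms_states (NT X) rotation \<beta>"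
    using eventually_gibbs by (rule eventually_mono) (use gibbs_state_kms[OF \<tau>] in blast)
qed (rule gibbs_state_lim, use \<tau> in \<open>simp_all add: tracial_states_def\<close>)

text \<open>Traciality is the degree 0 part of the limiting KMS relation, read off on the elements
  \<open>fpi X a\<close>.\<close>

lemma kms_infinity_cases:
  assumes \<phi>: "\<phi> \<in> kms_infinity_states (NT X) rotation"
  obtains \<tau> where "\<tau> \<in> tracial_states type_alg" "\<phi> = Psi \<tau>"
proof -
  have \<phi>s: "\<phi> \<in> states (NT X)"
    using \<phi> by (simp add: kms_infinity_states_def)
  obtain \<tau> where \<tau>: "\<tau> \<in> states type_alg" "\<phi> = Psi \<tau>" "\<And>a. \<tau> a = \<phi> (fpi X a)"
    using vacuum_state_cases[OF \<phi>s kms_infinity_vacuum(1)[OF \<phi>]] by blast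
  have "\<tau> (a * b) = \<tau> (b * a)" for a b
    using kms_infinity_vacuum(2)[OF \<phi>, of "fpi X b" a] by (simp add: \<tau>(3) fpi_mult)
  then have "\<tau> \<in> tracial_states type_alg"
    using \<tau>(1) by (simp add: tracial_states_def)
  then show thesis
    using that \<tau>(2) by blast
qed

lemma kms_infinity_states_NT: "kms_infinity_states (NT X) rotation = Psi ` tracial_states type_alg"
  using kms_infinity_cases Psi_kms_infinity by blast

end

section \<open>Quotients by ideals\<close>

context product_sys
begin

lemma closed_ideal_zero: "closed_ideal (NT X) J \<Longrightarrow> (\<lambda>_ _. 0) \<in> J"
proof -
  assume J: "closed_ideal (NT X) J"
  then obtain f where "f \<in> J"
    by (auto simp: closed_ideal_def)
  then have "op_scale 0 f \<in> J"
    using J by (auto simp: closed_ideal_def)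
  then show ?thesis
    by (simp add: op_scale_def)
qed

end

text \<open>Invariance under \<open>adj\<close> and \<open>rotation\<close> is what lets the
  involution and the action descend to cosets. For the kernel ideal it follows from the same
  invariance of the set of generators.\<close>

locale nt_ideal = product_sys X for X :: "('n::finite, 'a::cstar_algebra, 'x::complex_vector) product_system" +
  fixes K :: "('n, 'x) fop set"
  assumes ideal: "closed_ideal (NT X) K"
    and K_adj: "f \<in> K \<Longrightarrow> adj f \<in> K"
    and K_rotation: "f \<in> K \<Longrightarrow> rotation r f \<in> K"
begin

abbreviation "Q \<equiv> quotient_alg (NT X) K"
abbreviation "q \<equiv> coset (NT X) K"
abbreviation "rot \<equiv> quotient_action (NT X) K rotation"

lemma K_NT [simp]: "f \<in> K \<Longrightarrow> f \<in> NTc"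
  using ideal by (auto simp: closed_ideal_def)

lemma K_add: "f \<in> K \<Longrightarrow> g \<in> K \<Longrightarrow> op_add f g \<in> K"
  using ideal by (auto simp: closed_ideal_def)

lemma K_scale: "f \<in> K \<Longrightarrow> op_scale c f \<in> K"
  using ideal by (auto simp: closed_ideal_def)

lemma K_comp: "f \<in> K \<Longrightarrow> g \<in> NTc \<Longrightarrow> f \<circ> g \<in> K" "f \<in> K \<Longrightarrow> g \<in> NTc \<Longrightarrow> g \<circ> f \<in> K"
  using ideal by (auto simp: closed_ideal_def)

lemma K_zero: "(\<lambda>_ _. 0) \<in> K"
  by (rule closed_ideal_zero[OF ideal])

lemma q_mem: "b \<in> q f \<longleftrightarrow> (\<exists>k\<in>K. b = op_add f k)"
  by (auto simp: coset_def)

lemma q_self: "f \<in> q f"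
  unfolding q_mem by (intro bexI[OF _ K_zero]) (simp add: op_add_def)

lemma q_absorb: "k \<in> K \<Longrightarrow> q (op_add f k) = q f"
proof (intro set_eqI iffI)
  fix b assume k: "k \<in> K"
  show "b \<in> q f" if b: "b \<in> q (op_add f k)"
  proof -
    obtain l where "l \<in> K" "b = op_add (op_add f k) l"
      using b unfolding q_mem by blast
    then show ?thesis
      unfolding q_mem using K_add[OF k] by (intro bexI[of _ "op_add k l"]) (auto simp: op_add_def add.assoc)
  qed
  show "b \<in> q (op_add f k)" if b: "b \<in> q f"
  proof -
    obtain l where l: "l \<in> K" "b = op_add f l"
      using b unfolding q_mem by blast
    then show ?thesis
      unfolding q_mem using K_add[OF l(1) K_scale[OF k, of "-1"]]
      by (intro bexI[of _ "op_add l (op_scale (-1) k)"]) (auto simp: op_add_def op_scale_def)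
  qed
qed

lemma q_eq_iff: "q b = q f \<longleftrightarrow> b \<in> q f"
  using q_self[of b] q_absorb by (auto simp: q_mem)

lemma q_eqD: "q b = q f \<Longrightarrow> \<exists>k\<in>K. b = op_add f k"
  using q_eq_iff q_mem by blast

lemma q_NT: "f \<in> NTc \<Longrightarrow> b \<in> q f \<Longrightarrow> b \<in> NTc"
  by (auto simp: q_mem)

lemma carr_Q: "carr Q = q ` NTc"
  by (simp add: quotient_alg_def)

lemma q_carr [simp]: "f \<in> NTc \<Longrightarrow> q f \<in> carr Q"
  by (simp add: carr_Q)

lemma Q_cases:
  assumes "C \<in> carr Q"
  obtains f where "f \<in> NTc" "C = q f"
  using assms by (auto simp: carr_Q)

lemma Union_const: "C \<noteq> {} \<Longrightarrow> (\<And>b. b \<in> C \<Longrightarrow> F b = S) \<Longrightarrow> (\<Union>b\<in>C. F b) = S"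
  by auto

lemma q_ne: "q f \<noteq> {}"
  using q_self by blast

lemma q_plus [simp]: "plus_of Q (q f) (q g) = q (op_add f g)"
proof -
  have "q (op_add b c) = q (op_add f g)" if "b \<in> q f" "c \<in> q g" for b c
  proof -
    obtain k l where kl: "k \<in> K" "l \<in> K" "b = op_add f k" "c = op_add g l"
      using \<open>b \<in> q f\<close> \<open>c \<in> q g\<close> unfolding q_mem by blast
    then have "op_add b c = op_add (op_add f g) (op_add k l)"
      by (simp add: op_add_def fun_eq_iff)
    then show ?thesis
      using q_absorb[OF K_add[OF kl(1,2)]] by simp
  qed
  note eq = this
  have "(\<Union>b\<in>q f. \<Union>c\<in>q g. q (op_add b c)) = q (op_add f g)"
    by (intro Union_const q_ne eq)
  then show ?thesis
    by (simp add: quotient_alg_def)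
qed

lemma q_scale [simp]: "scale_of Q c (q f) = q (op_scale c f)"
proof -
  have "q (op_scale c b) = q (op_scale c f)" if "b \<in> q f" for b
  proof -
    obtain k where k: "k \<in> K" "b = op_add f k"
      using \<open>b \<in> q f\<close> unfolding q_mem by blast
    then have "op_scale c b = op_add (op_scale c f) (op_scale c k)"
      by (simp add: op_add_def op_scale_def fun_eq_iff scaleC_add_right)
    then show ?thesis
      using q_absorb[OF K_scale[OF k(1)]] by simp
  qed
  note eq = this
  have "(\<Union>b\<in>q f. q (op_scale c b)) = q (op_scale c f)"
    by (intro Union_const q_ne eq)
  then show ?thesis
    by (simp add: quotient_alg_def)
qed

lemma q_times [simp]:
  assumes f: "f \<in> NTc" and g: "g \<in> NTc"
  shows "times_of Q (q f) (q g) = q (f \<circ> g)"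
proof -
  have "q (b \<circ> c) = q (f \<circ> g)" if "b \<in> q f" "c \<in> q g" for b c
  proof -
    obtain k l where kl: "k \<in> K" "l \<in> K" "b = op_add f k" "c = op_add g l"
      using \<open>b \<in> q f\<close> \<open>c \<in> q g\<close> unfolding q_mem by blast
    have "b \<circ> c = op_add (f \<circ> g) (op_add (f \<circ> l) (k \<circ> c))"
      unfolding kl(3) op_comp_add_left unfolding kl(4)
      using op_comp_add_right[of f g l] f g kl by (simp add: op_add_def add.assoc)
    moreover have "op_add (f \<circ> l) (k \<circ> c) \<in> K"
      using f g kl by (intro K_add K_comp) simp_all
    ultimately show ?thesis
      using q_absorb by simp
  qed
  note eq = this
  have "(\<Union>b\<in>q f. \<Union>c\<in>q g. q (b \<circ> c)) = q (f \<circ> g)"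
    by (intro Union_const q_ne eq)
  then show ?thesis
    by (simp add: quotient_alg_def)
qed

lemma q_star [simp]:
  assumes f: "f \<in> NTc"
  shows "star_of Q (q f) = q (adj f)"
proof -
  have "q (adj b) = q (adj f)" if "b \<in> q f" for b
  proof -
    obtain k where k: "k \<in> K" "b = op_add f k"
      using \<open>b \<in> q f\<close> unfolding q_mem by blast
    then have "adj b = op_add (adj f) (adj k)"
      using f by (simp add: adj_op_add)
    then show ?thesis
      using q_absorb[OF K_adj[OF k(1)]] by simp
  qed
  note eq = this
  have "(\<Union>b\<in>q f. q (adj b)) = q (adj f)"
    by (intro Union_const q_ne eq)
  then show ?thesis
    by (simp add: quotient_alg_def)
qed

lemma q_rot [simp]: "rot r (q f) = q (rotation r f)"
proof -
  have "q (rotation r b) = q (rotation r f)" if "b \<in> q f" for b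
  proof -
    obtain k where k: "k \<in> K" "b = op_add f k"
      using \<open>b \<in> q f\<close> unfolding q_mem by blast
    then have "rotation r b = op_add (rotation r f) (rotation r k)"
      by (simp add: rotation_op_add)
    then show ?thesis
      using q_absorb[OF K_rotation[OF k(1)]] by simp
  qed
  note eq = this
  show ?thesis
    unfolding quotient_action_def by (intro Union_const q_ne eq)
qed

lemma q_norm: "norm_of Q C = (INF b\<in>C. opnorm b)"
  by (simp add: quotient_alg_def)

lemma q_norm_bdd: "f \<in> NTc \<Longrightarrow> bdd_below (opnorm ` q f)"
  using q_NT by (intro bdd_belowI2[of _ 0]) (auto intro: opnorm_nonneg)

lemma norm_q_le: "f \<in> NTc \<Longrightarrow> b \<in> q f \<Longrightarrow> norm_of Q (q f) \<le> opnorm b"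
  unfolding q_norm by (intro cINF_lower q_norm_bdd)

lemma norm_q_approx:
  assumes "f \<in> NTc" "e > 0"
  obtains b where "b \<in> NTc" "q b = q f" "opnorm b < norm_of Q (q f) + e"
proof -
  have "(INF b\<in>q f. opnorm b) < norm_of Q (q f) + e"
    using assms(2) by (simp add: q_norm)
  then obtain b where "b \<in> q f" "opnorm b < norm_of Q (q f) + e"
    unfolding cINF_less_iff[OF q_ne q_norm_bdd[OF assms(1)]] by blast
  then show thesis
    using that q_NT[OF assms(1)] q_eq_iff by blast
qed

text \<open>Norm estimates in the quotient are checked on every representative and then passed to
  the infimum.\<close>

lemma le_norm_q:
  assumes f: "f \<in> NTc" and C: "C \<ge> 0" and le: "\<And>b. b \<in> NTc \<Longrightarrow> q b = q f \<Longrightarrow> r \<le> C * opnorm b"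
  shows "r \<le> C * norm_of Q (q f)"
proof (rule field_le_epsilon)
  fix e :: real assume e: "e > 0"
  then have "e / (C + 1) > 0"
    using C by simp
  then obtain b where b: "b \<in> NTc" "q b = q f" "opnorm b < norm_of Q (q f) + e / (C + 1)"
    using norm_q_approx[OF f] by blast
  have "r \<le> C * (norm_of Q (q f) + e / (C + 1))"
    using le[OF b(1,2)] b(3) C mult_left_mono[of "opnorm b" "norm_of Q (q f) + e / (C + 1)" C] by linarith
  also have "\<dots> = C * norm_of Q (q f) + (C / (C + 1)) * e"
    by (simp add: algebra_simps)
  also have "(C / (C + 1)) * e \<le> 1 * e"
    using C e by (intro mult_right_mono) simp_all
  finally show "r \<le> C * norm_of Q (q f) + e"
    by simp
qed

sublocale qt: rot_alg Q rot
proof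
  fix C D E :: "('n, 'x) fop set" and c :: complex and r s :: real
  assume "C \<in> carr Q"
  then obtain f where f: "f \<in> NTc" "C = q f"
    by (rule Q_cases)
  show "scale_of Q c C \<in> carr Q"
    using f by simp
  show "0 \<le> norm_of Q C"
    unfolding f(2) q_norm using q_NT[OF f(1)] by (intro cINF_greatest q_ne opnorm_nonneg) simp
  show "norm_of Q (scale_of Q c C) \<le> cmod c * norm_of Q C"
    unfolding f(2)
  proof (rule le_norm_q[OF f(1)])
    show "norm_of Q (scale_of Q c (q f)) \<le> cmod c * opnorm b" if b: "b \<in> NTc" "q b = q f" for b
      using norm_q_le[OF NT_scale[OF b(1), of c] q_self] b(1) by (simp add: opnorm_scale b(2)[symmetric])
  qed simp
  show "rot r C \<in> carr Q" "rot r (scale_of Q c C) = scale_of Q c (rot r C)" "rot (r + 2 * pi) C = rot r C"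
    "rot r (rot s C) = rot (r + s) C"
    using f by (simp_all add: rotation_op_scale rotation_2pi rotation_rotation)
  show "norm_of Q (rot r C) \<le> norm_of Q C"
  proof -
    have "norm_of Q (rot r (q f)) \<le> 1 * norm_of Q (q f)"
    proof (rule le_norm_q[OF f(1)])
      show "norm_of Q (rot r (q f)) \<le> 1 * opnorm b" if b: "b \<in> NTc" "q b = q f" for b
        using norm_q_le[OF rotation_NT[OF b(1), of r] q_self] b(1) by (simp add: opnorm_rotation b(2)[symmetric])
    qed simp
    then show ?thesis
      by (simp add: f(2))
  qed
  show "\<exists>B\<ge>0. \<forall>x\<in>carr Q. norm_of Q (times_of Q C x) \<le> B * norm_of Q x \<and> norm_of Q (times_of Q x C) \<le> B * norm_of Q x"
  proof (intro exI[of _ "opnorm f"] conjI ballI)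
    show n: "0 \<le> opnorm f"
      using f(1) by (simp add: opnorm_nonneg)
    fix x assume "x \<in> carr Q"
    then obtain g where g: "g \<in> NTc" "x = q g"
      by (rule Q_cases)
    show "norm_of Q (times_of Q C x) \<le> opnorm f * norm_of Q x"
      unfolding f(2) g(2)
    proof (rule le_norm_q[OF g(1) n])
      fix b assume b: "b \<in> NTc" "q b = q g"
      have "norm_of Q (times_of Q (q f) (q g)) \<le> opnorm (f \<circ> b)"
        using norm_q_le[OF NT_comp[OF f(1) b(1)] q_self] f(1) b(1) by (simp add: b(2)[symmetric])
      then show "norm_of Q (times_of Q (q f) (q g)) \<le> opnorm f * opnorm b"
        using opnorm_comp[of f b] f(1) b(1) by simp
    qed
    show "norm_of Q (times_of Q x C) \<le> opnorm f * norm_of Q x"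
      unfolding f(2) g(2)
    proof (rule le_norm_q[OF g(1) n])
      fix b assume b: "b \<in> NTc" "q b = q g"
      have "norm_of Q (times_of Q (q g) (q f)) \<le> opnorm (b \<circ> f)"
        using norm_q_le[OF NT_comp[OF b(1) f(1)] q_self] f(1) b(1) by (simp add: b(2)[symmetric])
      then show "norm_of Q (times_of Q (q g) (q f)) \<le> opnorm f * opnorm b"
        using opnorm_comp[of b f] f(1) b(1) by (simp add: mult.commute)
    qed
  qed
  assume "D \<in> carr Q"
  then obtain g where g: "g \<in> NTc" "D = q g"
    by (rule Q_cases)
  show "plus_of Q C D \<in> carr Q" "times_of Q C D \<in> carr Q" "rot r (plus_of Q C D) = plus_of Q (rot r C) (rot r D)"
    "times_of Q C (scale_of Q c D) = scale_of Q c (times_of Q C D)"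
    "times_of Q (scale_of Q c D) C = scale_of Q c (times_of Q D C)"
    using f g by (simp_all add: rotation_op_add op_comp_scale_left op_comp_scale_right)
  assume "E \<in> carr Q"
  then obtain h where h: "h \<in> NTc" "E = q h"
    by (rule Q_cases)
  show "times_of Q C (plus_of Q D E) = plus_of Q (times_of Q C D) (times_of Q C E)"
    "times_of Q (plus_of Q D E) C = plus_of Q (times_of Q D C) (times_of Q E C)"
    using f g h by (simp_all add: op_comp_add_left op_comp_add_right)
qed

section \<open>States of the quotient as states that vanish on the ideal\<close>

definition pull :: "(('n, 'x) fop set \<Rightarrow> complex) \<Rightarrow> ('n, 'x) fop \<Rightarrow> complex" where
  "pull \<psi> = restrict (\<lambda>f. \<psi> (q f)) NTc"

definition push :: "(('n, 'x) fop \<Rightarrow> complex) \<Rightarrow> ('n, 'x) fop set \<Rightarrow> complex" where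
  "push \<phi> = restrict (\<lambda>C. \<phi> (SOME f. f \<in> NTc \<and> q f = C)) (carr Q)"

definition kills :: "(('n, 'x) fop \<Rightarrow> complex) \<Rightarrow> bool" where
  "kills \<phi> \<longleftrightarrow> (\<forall>f\<in>K. \<phi> f = 0)"

lemma pull_apply: "f \<in> NTc \<Longrightarrow> pull \<psi> f = \<psi> (q f)"
  by (simp add: pull_def)

lemma push_apply:
  assumes \<phi>: "\<phi> \<in> states (NT X)" and K: "kills \<phi>" and f: "f \<in> NTc"
  shows "push \<phi> (q f) = \<phi> f"
proof -
  have "(SOME g. g \<in> NTc \<and> q g = q f) \<in> NTc \<and> q (SOME g. g \<in> NTc \<and> q g = q f) = q f"
    by (rule someI[of _ f]) (simp add: f)
  moreover have "\<phi> g = \<phi> f" if g: "g \<in> NTc" "q g = q f" for g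
  proof -
    obtain k where k: "k \<in> K" "g = op_add f k"
      using q_eqD[OF g(2)] by blast
    then show ?thesis
      using nt.stateD(2)[OF \<phi> f, of k] K by (simp add: kills_def)
  qed
  ultimately have "\<phi> (SOME g. g \<in> NTc \<and> q g = q f) = \<phi> f"
    by blast
  then show ?thesis
    using f by (simp add: push_def)
qed

lemma pull_state:
  assumes \<psi>: "\<psi> \<in> states Q"
  shows "pull \<psi> \<in> states (NT X)" and "kills (pull \<psi>)" and "push (pull \<psi>) = \<psi>"
proof -
  show st: "pull \<psi> \<in> states (NT X)"
  proof (rule nt.stateI)
    show "pull \<psi> \<in> extensional NTc"
      by (simp add: pull_def)
    fix f g :: "('n, 'x) fop" and c
    assume f: "f \<in> NTc"
    show "g \<in> NTc \<Longrightarrow> pull \<psi> (plus_of (NT X) f g) = pull \<psi> f + pull \<psi> g"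
      using f qt.stateD(2)[OF \<psi>, of "q f" "q g"] by (simp add: pull_apply)
    show "pull \<psi> (scale_of (NT X) c f) = c * pull \<psi> f"
      using f qt.stateD(3)[OF \<psi>, of "q f" c] by (simp add: pull_apply)
    show "pull \<psi> (times_of (NT X) (star_of (NT X) f) f) \<in> \<real>\<^sub>\<ge>\<^sub>0"
      using f qt.stateD(4)[OF \<psi>, of "q f"] by (simp add: pull_apply)
    show "cmod (pull \<psi> f) \<le> norm_of (NT X) f"
      using qt.state_bound[OF \<psi> q_carr[OF f]] norm_q_le[OF f q_self] f by (simp add: pull_apply)
  next
    fix e :: real assume e: "e > 0"
    then obtain C where C: "C \<in> carr Q" "norm_of Q C \<le> 1" "cmod (\<psi> C) > 1 - e"
      using qt.state_approx[OF \<psi>] by blast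
    obtain f where f: "f \<in> NTc" "C = q f"
      using C(1) by (rule Q_cases)
    obtain b where b: "b \<in> NTc" "q b = q f" "opnorm b < norm_of Q (q f) + e"
      using norm_q_approx[OF f(1) e] by blast
    then show "\<exists>x\<in>NTc. norm_of (NT X) x \<le> 1 + e \<and> cmod (pull \<psi> x) > 1 - e"
      using C f by (intro bexI[of _ b]) (simp_all add: pull_apply)
  qed
  show k: "kills (pull \<psi>)"
    unfolding kills_def
  proof
    fix k assume k: "k \<in> K"
    have "op_add (op_scale 0 k) k = k"
      by (simp add: op_add_def op_scale_def)
    then have "q k = q (op_scale 0 k)"
      using q_absorb[OF k, of "op_scale 0 k"] by simp
    then have "\<psi> (q k) = \<psi> (q (op_scale 0 k))"
      by (rule arg_cong)
    also have "\<dots> = \<psi> (scale_of Q 0 (q k))"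
      by (simp only: q_scale)
    also have "\<dots> = 0"
      using qt.stateD(3)[OF \<psi> q_carr[OF K_NT[OF k]], of 0] by simp
    finally show "pull \<psi> k = 0"
      using k by (simp add: pull_apply)
  qed
  show "push (pull \<psi>) = \<psi>"
  proof (rule extensionalityI[of _ "carr Q"])
    show "push (pull \<psi>) \<in> extensional (carr Q)"
      by (simp add: push_def)
    show "\<psi> \<in> extensional (carr Q)"
      by (rule qt.stateD(1)[OF \<psi>])
    fix C assume "C \<in> carr Q"
    then obtain f where "f \<in> NTc" "C = q f"
      by (rule Q_cases)
    then show "push (pull \<psi>) C = \<psi> C"
      by (simp add: push_apply[OF st k] pull_apply)
  qed
qed

lemma push_state:
  assumes \<phi>: "\<phi> \<in> states (NT X)" and K: "kills \<phi>"
  shows "push \<phi> \<in> states Q"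
proof (rule qt.stateI)
  note ap = push_apply[OF \<phi> K]
  show "push \<phi> \<in> extensional (carr Q)"
    by (simp add: push_def)
  fix C D :: "('n, 'x) fop set" and c
  assume "C \<in> carr Q"
  then obtain f where f: "f \<in> NTc" "C = q f"
    by (rule Q_cases)
  show "push \<phi> (plus_of Q C D) = push \<phi> C + push \<phi> D" if "D \<in> carr Q"
  proof -
    obtain g where "g \<in> NTc" "D = q g"
      using \<open>D \<in> carr Q\<close> by (rule Q_cases)
    then show ?thesis
      using f nt.stateD(2)[OF \<phi>] by (simp add: ap)
  qed
  show "push \<phi> (scale_of Q c C) = c * push \<phi> C"
    using f nt.stateD(3)[OF \<phi>] by (simp add: ap)
  show "push \<phi> (times_of Q (star_of Q C) C) \<in> \<real>\<^sub>\<ge>\<^sub>0"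
    using f nt.stateD(4)[OF \<phi> f(1)] by (simp add: ap)
  have "cmod (push \<phi> (q f)) \<le> 1 * norm_of Q (q f)"
  proof (rule le_norm_q[OF f(1)])
    show "cmod (push \<phi> (q f)) \<le> 1 * opnorm b" if b: "b \<in> NTc" "q b = q f" for b
      using nt.state_bound[OF \<phi> b(1)] by (simp add: b(2)[symmetric] ap b(1))
  qed simp
  then show "cmod (push \<phi> C) \<le> norm_of Q C"
    by (simp add: f(2))
next
  fix e :: real assume e: "e > 0"
  then obtain f where f: "f \<in> NTc" "opnorm f \<le> 1" "cmod (\<phi> f) > 1 - e"
    using nt.state_approx[OF \<phi>] by auto
  then show "\<exists>C\<in>carr Q. norm_of Q C \<le> 1 + e \<and> cmod (push \<phi> C) > 1 - e"
    using norm_q_le[OF f(1) q_self] e by (intro bexI[of _ "q f"]) (simp_all add: push_apply[OF \<phi> K])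
qed

lemma dist_q_le: "f \<in> NTc \<Longrightarrow> g \<in> NTc \<Longrightarrow> dist_of Q (q f) (q g) \<le> dist_of (NT X) f g"
  unfolding dist_of_def by (simp add: norm_q_le q_self)

lemma analytic_extension_q:
  assumes f: "f \<in> NTc" and F: "analytic_extension (NT X) rotation f F"
  shows "analytic_extension Q rot (q f) (\<lambda>z. q (F z))"
  unfolding analytic_extension_def
proof (intro conjI allI)
  have m: "F z \<in> NTc" for z
    using F by (simp add: analytic_extension_def)
  then show "q (F z) \<in> carr Q" for z
    by simp
  show "q (F (complex_of_real r)) = rot r (q f)" for r
    using F by (simp add: analytic_extension_def)
  fix z
  let ?D = "\<lambda>h. op_scale (1 / h) (op_add (F (z + h)) (op_scale (-1) (F z)))"
  obtain D where D: "D \<in> NTc" "((\<lambda>h. dist_of (NT X) (?D h) D) \<longlongrightarrow> 0) (at 0)"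
    using F[unfolded analytic_extension_def NT_simps, THEN conjunct2, THEN conjunct2, rule_format, of z] by blast
  have "((\<lambda>h. dist_of Q (q (?D h)) (q D)) \<longlongrightarrow> 0) (at 0)"
  proof (rule Lim_null_comparison[OF _ D(2)], rule always_eventually, rule allI)
    fix h
    have "0 \<le> dist_of Q (q (?D h)) (q D)"
      unfolding dist_of_def q_scale q_plus by (rule qt.norm_nonneg[OF q_carr]) (simp add: m D(1))
    then show "norm (dist_of Q (q (?D h)) (q D)) \<le> dist_of (NT X) (?D h) D"
      using dist_q_le[of "?D h" D] m D(1) by simp
  qed
  then show "\<exists>E\<in>carr Q. ((\<lambda>h. dist_of Q (scale_of Q (1 / h) (plus_of Q (q (F (z + h))) (scale_of Q (-1) (q (F z))))) E) \<longlongrightarrow> 0) (at 0)"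
    unfolding q_scale q_plus using D(1) by (intro bexI[of _ "q D"]) simp_all
qed

lemma dense_q: "dense_in (NT X) D \<Longrightarrow> dense_in Q (q ` D)"
  unfolding dense_in_def
proof (elim conjE, intro conjI ballI allI impI)
  fix C and e :: real
  assume sub: "D \<subseteq> NTc" and dense: "\<forall>x\<in>NTc. \<forall>e>0. \<exists>s\<in>D. dist_of (NT X) s x < e" and C: "C \<in> carr Q" and e: "e > 0"
  obtain f where f: "f \<in> NTc" "C = q f"
    using C by (rule Q_cases)
  obtain s where s: "s \<in> D" "dist_of (NT X) s f < e"
    using dense f(1) e by blast
  then have "dist_of Q (q s) C < e"
    using dist_q_le[of s f] sub f by force
  then show "\<exists>s\<in>q ` D. dist_of Q s C < e"
    using s(1) by blast
qed auto

lemma push_ground: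
  assumes \<phi>: "\<phi> \<in> ground_states (NT X) rotation" and K: "kills \<phi>"
  shows "push \<phi> \<in> ground_states Q rot"
proof -
  have \<phi>s: "\<phi> \<in> states (NT X)"
    using \<phi> by (simp add: ground_states_def)
  obtain D where D: "dense_in (NT X) D"
    and DG: "\<And>g. g \<in> D \<Longrightarrow> \<exists>G. analytic_extension (NT X) rotation g G \<and>
      (\<forall>f\<in>D. bounded ((\<lambda>z. \<phi> (f \<circ> G z)) ` {z. Im z > 0}))"
    using \<phi> unfolding ground_states_def by auto
  have DN: "D \<subseteq> NTc"
    using D by (simp add: dense_in_def)
  have "\<exists>G. analytic_extension Q rot C G \<and> (\<forall>f\<in>q ` D. bounded ((\<lambda>z. push \<phi> (times_of Q f (G z))) ` {z. Im z > 0}))"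
    if C: "C \<in> q ` D" for C
  proof -
    obtain g where g: "g \<in> D" "C = q g"
      using C by blast
    obtain G where G: "analytic_extension (NT X) rotation g G"
      "\<forall>f\<in>D. bounded ((\<lambda>z. \<phi> (f \<circ> G z)) ` {z. Im z > 0})"
      using DG[OF g(1)] by blast
    have m: "G z \<in> NTc" for z
      using G(1) by (simp add: analytic_extension_def)
    have "push \<phi> (times_of Q (q f) (q (G z))) = \<phi> (f \<circ> G z)" if "f \<in> D" for f z
      using DN that m by (subst q_times) (auto simp: push_apply[OF \<phi>s K])
    then show ?thesis
      using G(2) analytic_extension_q[OF _ G(1)] DN g by (intro exI[of _ "\<lambda>z. q (G z)"]) auto
  qed
  then show ?thesis
    unfolding ground_states_def using push_state[OF \<phi>s K] dense_q[OF D] by blast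
qed

lemma push_kms:
  assumes \<phi>: "\<phi> \<in> kms_states (NT X) rotation \<beta>" and K: "kills \<phi>"
  shows "push \<phi> \<in> kms_states Q rot \<beta>"
proof -
  have \<phi>s: "\<phi> \<in> states (NT X)" and \<beta>: "\<beta> > 0"
    using \<phi> by (simp_all add: kms_states_def)
  obtain D where D: "dense_in (NT X) D" and sub: "star_subalgebra (NT X) D"
    and inv: "\<And>r f. f \<in> D \<Longrightarrow> rotation r f \<in> D"
    and DF: "\<And>f. f \<in> D \<Longrightarrow> \<exists>F. analytic_extension (NT X) rotation f F \<and>
      (\<forall>g\<in>D. \<phi> (f \<circ> g) = \<phi> (g \<circ> F (\<i> * complex_of_real \<beta>)))"
    using \<phi> unfolding kms_states_def by auto
  have DN: "D \<subseteq> NTc"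
    using D by (simp add: dense_in_def)
  have "star_subalgebra Q (q ` D)"
    unfolding star_subalgebra_def
  proof (intro conjI ballI allI)
    show "q ` D \<subseteq> carr Q" "q ` D \<noteq> {}"
      using DN sub by (auto simp: star_subalgebra_def)
    fix C assume "C \<in> q ` D"
    then obtain f where f: "f \<in> D" "C = q f"
      by blast
    show "star_of Q C \<in> q ` D" "scale_of Q c C \<in> q ` D" for c
      using f sub DN by (auto simp: star_subalgebra_def)
    fix E assume "E \<in> q ` D"
    then obtain g where g: "g \<in> D" "E = q g"
      by blast
    have fg: "f \<in> NTc" "g \<in> NTc" "op_add f g \<in> D" "f \<circ> g \<in> D"
      using f g DN sub by (auto simp: star_subalgebra_def)
    show "plus_of Q C E \<in> q ` D" "times_of Q C E \<in> q ` D"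
      unfolding f(2) g(2) q_plus q_times[OF fg(1,2)] using fg by blast+
  qed
  moreover have "\<exists>F. analytic_extension Q rot C F \<and>
      (\<forall>E\<in>q ` D. push \<phi> (times_of Q C E) = push \<phi> (times_of Q E (F (\<i> * complex_of_real \<beta>))))" if C: "C \<in> q ` D" for C
  proof -
    obtain f where f: "f \<in> D" "C = q f"
      using C by blast
    obtain F where F: "analytic_extension (NT X) rotation f F"
      "\<And>g. g \<in> D \<Longrightarrow> \<phi> (f \<circ> g) = \<phi> (g \<circ> F (\<i> * complex_of_real \<beta>))"
      using DF[OF f(1)] by blast
    have m: "F z \<in> NTc" for z
      using F(1) by (simp add: analytic_extension_def)
    have fN: "f \<in> NTc"
      using f DN by blast
    have "push \<phi> (times_of Q C E) = push \<phi> (times_of Q E (q (F (\<i> * complex_of_real \<beta>))))" if "E \<in> q ` D" for E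
    proof -
      obtain g where g: "g \<in> D" "E = q g"
        using \<open>E \<in> q ` D\<close> by blast
      then have gN: "g \<in> NTc"
        using DN by blast
      show ?thesis
        unfolding f(2) g(2) q_times[OF fN gN] q_times[OF gN m]
          push_apply[OF \<phi>s K NT_comp[OF fN gN]] push_apply[OF \<phi>s K NT_comp[OF gN m]] by (rule F(2)[OF g(1)])
    qed
    then show ?thesis
      unfolding f(2) using analytic_extension_q[OF fN F(1)] by blast
  qed
  moreover have "rot r C \<in> q ` D" if "C \<in> q ` D" for r C
    using that inv by auto
  ultimately show ?thesis
    unfolding kms_states_def using push_state[OF \<phi>s K] \<beta> dense_q[OF D] by blast
qed

text \<open>The dense algebra given in the quotient has no evident lift. The KMS condition is first
  turned into the relation for cosets of homogeneous elements, which lifts, and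
  \<open>kms_stateI\<close> rebuilds the condition from it.\<close>

lemma pull_kms:
  assumes \<psi>: "\<psi> \<in> kms_states Q rot \<beta>"
  shows "pull \<psi> \<in> kms_states (NT X) rotation \<beta>"
proof (rule kms_stateI)
  show "pull \<psi> \<in> states (NT X)" "\<beta> > 0"
    using \<psi> pull_state by (simp_all add: kms_states_def)
  fix k f g assume f: "homogeneous k f" and g: "g \<in> NTc"
  have fN: "f \<in> NTc" and "rot r (q f) = scale_of Q (phase r k) (q f)" for r
    using f by (simp_all add: homogeneous_def)
  then have "\<psi> (times_of Q (q f) (q g)) = of_real (exp (- of_int k * \<beta>)) * \<psi> (times_of Q (q g) (q f))"
    using g by (intro qt.kms_commute[OF \<psi>]) simp_all
  then show "pull \<psi> (f \<circ> g) = of_real (exp (- of_int k * \<beta>)) * pull \<psi> (g \<circ> f)"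
    using fN g pull_apply[OF NT_comp[OF fN g]] pull_apply[OF NT_comp[OF g fN]] by simp
qed

lemma pull_kms_infinity:
  assumes \<psi>: "\<psi> \<in> kms_infinity_states Q rot"
  shows "pull \<psi> \<in> kms_infinity_states (NT X) rotation"
proof -
  obtain \<F> :: "(real \<times> (('n, 'x) fop set \<Rightarrow> complex)) filter" where \<psi>s: "\<psi> \<in> states Q"
    and F: "\<F> \<noteq> bot" "\<forall>\<^sub>F p in \<F>. snd p \<in> kms_states Q rot (fst p)"
      "filterlim fst at_top \<F>" "limitin (weak_star Q) snd \<psi> \<F>"
    using \<psi> unfolding kms_infinity_states_def by blast
  let ?F = "filtermap (\<lambda>p. (fst p, pull (snd p))) \<F>"
  have nb: "?F \<noteq> bot"
    using F(1) by (simp add: filtermap_bot_iff)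
  have ev: "\<forall>\<^sub>F p in ?F. snd p \<in> kms_states (NT X) rotation (fst p)"
    unfolding eventually_filtermap using F(2) by (rule eventually_mono) (simp add: pull_kms)
  have top: "filterlim fst at_top ?F"
    using F(3) by (simp add: filterlim_def filtermap_filtermap)
  have "((\<lambda>p. snd p f) \<longlongrightarrow> pull \<psi> f) ?F" if "f \<in> NTc" for f
    using weak_star_limitD[OF F(4) q_carr[OF that]] that by (simp add: filterlim_def filtermap_filtermap pull_apply)
  then have "limitin (weak_star (NT X)) snd (pull \<psi>) ?F"
    unfolding weak_star_def limitin_componentwise by (simp add: eventually_filtermap PiE_def pull_def)
  then show ?thesis
    unfolding kms_infinity_states_def using pull_state(1)[OF \<psi>s] nb ev top by blast
qed

text \<open>The dense set belongs to the quotient, so boundedness is exploited there, on the coset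
  of an annihilation operator, and only its consequence is lifted.\<close>

lemma pull_ground_vacuum:
  assumes \<psi>: "\<psi> \<in> ground_states Q rot"
  shows "vacuum (pull \<psi>)"
proof (rule vacuumI)
  show "pull \<psi> \<in> states (NT X)"
    using \<psi> pull_state by (simp add: ground_states_def)
  fix n \<xi> y assume n: "n \<noteq> 0" and \<xi>: "\<xi> \<in> M n" and y: "y \<in> NTc"
  let ?c = "adj (creation X n \<xi>)"
  have "deg n \<noteq> 0"
    using n deg_eq_0 by blast
  then have neg: "- int (deg n) < 0"
    by simp
  have c: "?c \<in> NTc" and r: "rot r (q ?c) = scale_of Q (phase r (- int (deg n))) (q ?c)" for r
    using \<xi> homogeneous_adj[OF homogeneous_creation[OF \<xi>]] by (simp_all add: homogeneous_def)
  have "\<psi> (times_of Q (q y) (q ?c)) = 0"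
    by (rule qt.ground_vanish[OF \<psi> q_carr[OF c] r neg q_carr[OF y]])
  then show "pull \<psi> (y \<circ> ?c) = 0"
    using y c pull_apply[OF NT_comp[OF y c]] by simp
qed

end

section \<open>The kernel ideal of a lattice\<close>

lemma closed_ideal_closed:
  fixes J :: "'a::cstar_algebra set"
  assumes "closed_ideal type_alg J"
  shows "closed J"
  unfolding closed_sequential_limits
proof (intro allI impI, elim conjE)
  fix s l assume s: "\<forall>k::nat. s k \<in> J" and l: "s \<longlonglongrightarrow> l"
  have "(\<lambda>k. dist_of type_alg (s k) l) \<longlonglongrightarrow> 0"
    using l by (simp add: dist_of_def tendsto_norm_zero LIM_zero)
  then show "l \<in> J"
    using assms s unfolding closed_ideal_def closed_in_def by simp
qed

lemma closed_ideal_has_sum: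
  fixes J :: "'a::cstar_algebra set"
  assumes J: "closed_ideal type_alg J" and f: "\<And>i. i \<in> A \<Longrightarrow> f i \<in> J" and s: "(f has_sum s) A"
  shows "s \<in> J"
proof (rule Lim_in_closed_set[OF closed_ideal_closed[OF J]])
  obtain a where "a \<in> J"
    using J by (auto simp: closed_ideal_def)
  moreover have "\<forall>x\<in>J. \<forall>c. c *\<^sub>C x \<in> J"
    using J by (simp add: closed_ideal_def)
  ultimately have "0 *\<^sub>C a \<in> J"
    by blast
  then have z: "0 \<in> J"
    by (simp add: scaleC_zero_left)
  have "sum f F \<in> J" if "finite F" "F \<subseteq> A" for F
    using that f J by (induction F rule: finite_induct) (auto simp: z closed_ideal_def)
  then show "\<forall>\<^sub>F F in finite_subsets_at_top A. sum f F \<in> J"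
    by (rule eventually_finite_subsets_at_top_weakI)
  show "(sum f \<longlongrightarrow> s) (finite_subsets_at_top A)"
    using s by (simp add: has_sum_def)
qed simp

lemma generated_ideal_least: "closed_ideal B J \<Longrightarrow> G \<subseteq> J \<Longrightarrow> generated_ideal B G \<subseteq> J"
  by (auto simp: generated_ideal_def)

context product_sys
begin

lemma closed_ideal_NT: "closed_ideal (NT X) NTc"
proof -
  have "NTc \<noteq> {}"
    using fpi_NT by blast
  then show ?thesis
    by (simp add: closed_ideal_def closed_in_def)
qed

lemma closed_ideal_generated:
  assumes "G \<subseteq> NTc"
  shows "closed_ideal (NT X) (generated_ideal (NT X) G)"
proof -
  have "generated_ideal (NT X) G \<subseteq> NTc"
    by (rule generated_ideal_least[OF closed_ideal_NT assms])
  moreover have "(\<lambda>_ _. 0) \<in> generated_ideal (NT X) G"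
    unfolding generated_ideal_def using closed_ideal_zero by blast
  moreover have "closed_in (NT X) (generated_ideal (NT X) G)"
    unfolding closed_in_def
  proof (intro allI impI, elim conjE)
    fix s f assume s: "\<forall>k::nat. s k \<in> generated_ideal (NT X) G" and f: "f \<in> NTc" "(\<lambda>k. dist_of (NT X) (s k) f) \<longlonglongrightarrow> 0"
    have "f \<in> J" if J: "closed_ideal (NT X) J" "G \<subseteq> J" for J
    proof -
      have "\<forall>k. s k \<in> J"
        using s generated_ideal_least[OF J] by blast
      then show ?thesis
        using J(1) f unfolding closed_ideal_def closed_in_def by blast
    qed
    then show "f \<in> generated_ideal (NT X) G"
      by (simp add: generated_ideal_def)
  qed
  moreover have "op_add f g \<in> generated_ideal (NT X) G" if "f \<in> generated_ideal (NT X) G" "g \<in> generated_ideal (NT X) G" for f g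
    using that by (simp add: generated_ideal_def closed_ideal_def)
  moreover have "op_scale c f \<in> generated_ideal (NT X) G" if "f \<in> generated_ideal (NT X) G" for c f
    using that by (simp add: generated_ideal_def closed_ideal_def)
  moreover have "b \<circ> f \<in> generated_ideal (NT X) G \<and> f \<circ> b \<in> generated_ideal (NT X) G"
    if "f \<in> generated_ideal (NT X) G" "b \<in> NTc" for f b
    using that by (simp add: generated_ideal_def closed_ideal_def)
  ultimately show ?thesis
    unfolding closed_ideal_def NT_simps by blast
qed

text \<open>Stated so as to cover both \<open>adj\<close>, which is conjugate linear and reverses
  products, and \<open>rotation\<close>.\<close>

lemma closed_ideal_vimage:
  assumes K: "closed_ideal (NT X) K"
    and T: "\<And>f. f \<in> NTc \<Longrightarrow> T f \<in> NTc" "\<And>f g. f \<in> NTc \<Longrightarrow> g \<in> NTc \<Longrightarrow> T (op_add f g) = op_add (T f) (T g)"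
      "\<And>c f. f \<in> NTc \<Longrightarrow> T (op_scale c f) = op_scale (S c) (T f)" "S (-1) = -1"
      "\<And>f g. f \<in> NTc \<Longrightarrow> g \<in> NTc \<Longrightarrow> T (f \<circ> g) = T f \<circ> T g \<or> T (f \<circ> g) = T g \<circ> T f"
      "\<And>f. f \<in> NTc \<Longrightarrow> opnorm (T f) = opnorm f"
  shows "closed_ideal (NT X) {f \<in> NTc. T f \<in> K}"
proof -
  let ?J = "{f \<in> NTc. T f \<in> K}"
  have "T (\<lambda>_ _. 0) = (\<lambda>_ _. 0)"
  proof -
    have "(\<lambda>_ _. 0) = op_add (fpi X 0) (op_scale (-1) (fpi X 0))"
      by (simp add: op_add_def op_scale_def)
    then have "T (\<lambda>_ _. 0) = op_add (T (fpi X 0)) (op_scale (-1) (T (fpi X 0)))"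
      by (simp add: T)
    then show ?thesis
      by (simp add: op_add_def op_scale_def)
  qed
  then have "(\<lambda>_ _. 0) \<in> ?J"
    using closed_ideal_zero[OF K] closed_ideal_zero[OF closed_ideal_NT] by simp
  then have ne: "?J \<noteq> {}"
    by blast
  have cl: "closed_in (NT X) ?J"
    unfolding closed_in_def
  proof (intro allI impI, elim conjE)
    fix s f assume s: "\<forall>k::nat. s k \<in> ?J" and f: "f \<in> NTc" and lim: "(\<lambda>k. dist_of (NT X) (s k) f) \<longlonglongrightarrow> 0"
    have "dist_of (NT X) (T (s k)) (T f) = dist_of (NT X) (s k) f" for k
      using s f T(6)[of "op_add (s k) (op_scale (-1) f)"] by (simp add: dist_of_NT T(2,3,4))
    then have "(\<lambda>k. dist_of (NT X) (T (s k)) (T f)) \<longlonglongrightarrow> 0"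
      using lim by simp
    moreover have "\<forall>k. T (s k) \<in> K"
      using s by simp
    ultimately have "T f \<in> K"
      using K T(1)[OF f] by (auto simp: closed_ideal_def closed_in_def)
    then show "f \<in> ?J"
      using f by simp
  qed
  have comp: "b \<circ> f \<in> ?J \<and> f \<circ> b \<in> ?J" if "f \<in> ?J" "b \<in> NTc" for f b
  proof -
    have "T b \<in> NTc"
      using that T(1) by blast
    then have "T b \<circ> T f \<in> K" "T f \<circ> T b \<in> K"
      using K that(1) by (auto simp: closed_ideal_def)
    then show ?thesis
      using T(5)[of b f] T(5)[of f b] that by auto
  qed
  have add: "op_add f g \<in> ?J" if "f \<in> ?J" "g \<in> ?J" for f g
    using K that by (simp add: T(2) closed_ideal_def)
  have scale: "op_scale c f \<in> ?J" if "f \<in> ?J" for c f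
    using K that by (simp add: T(3) closed_ideal_def)
  show ?thesis
    unfolding closed_ideal_def NT_simps
    by (intro conjI ballI allI ne cl)
      (blast, (rule add scale comp[THEN conjunct1] comp[THEN conjunct2]; assumption)+)
qed

lemma fpi_proj_commute: "proj F \<circ> fpi X a = fpi X a \<circ> proj F"
proof (rule Op_eqI)
  fix \<eta> assume \<eta>: "\<eta> \<in> fock X"
  have z: "lmf m a 0 = 0" for m
    using lmul_scaleC[of 0 m a 0] by (simp add: scaleC_zero_left)
  show "(proj F \<circ> fpi X a) \<eta> = (fpi X a \<circ> proj F) \<eta>"
    by (rule ext) (simp add: proj_apply[OF Op_mem[OF fpi_Op \<eta>]] fpi_apply[OF Op_mem[OF proj_Op \<eta>]] fpi_apply[OF \<eta>] proj_apply[OF \<eta>] z)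
qed simp_all

lemma rotation_fpi: "rotation r (fpi X a) = fpi X a"
  using rotation_creation[OF emb_mem[of a], of r] by (simp add: fpi_eq_creation)

lemma rotation_proj: "rotation r (proj F) = proj F"
proof (rule Op_eqI)
  fix \<eta> assume \<eta>: "\<eta> \<in> fock X"
  show "rotation r (proj F) \<eta> = proj F \<eta>"
  proof
    fix m :: "nat ^ 'n"
    have "phase r (int (deg m)) * phase (- r) (int (deg m)) = 1"
      using phase_add_left[of r "- r"] by simp
    then show "rotation r (proj F) \<eta> m = proj F \<eta> m"
      by (simp add: rotation_eq vec_rot_def[of r] proj_apply[OF vec_rot_mem[OF \<eta>]] proj_apply[OF \<eta>])
        (simp add: vec_rot_def scaleC_simps)
  qed
qed simp_all

text \<open>The support of 0 is empty, so \<open>proj F\<close> fixes the fibre at 0.\<close>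

lemma e0_fpi_proj:
  assumes "fpi X a \<circ> proj F \<in> NTc"
  shows "e0 (fpi X a \<circ> proj F) = a"
proof (rule e0_unique[OF assms])
  fix b c
  have "proj F (single 0 (emb X c)) = single 0 (emb X c)"
    unfolding fun_eq_iff proj_apply[OF emb_single_mem] by (auto simp: single_def supp_def)
  then show "fock_ip X (single 0 (emb X b)) ((fpi X a \<circ> proj F) (single 0 (emb X c))) = star b * (a * c)"
    by (simp add: fock_ip_single Op_mem[OF fpi_Op] fpi_apply emb_lmul emb_ip)
qed

end

section \<open>Compressions of the kernel ideal\<close>

locale quotient_system = framed_system X d x
  for X :: "('n::finite, 'a::cstar_algebra, 'x::complex_vector) product_system"
    and d :: "'n \<Rightarrow> nat" and x :: "'n \<Rightarrow> nat \<Rightarrow> 'x" +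
  fixes I :: "'n set \<Rightarrow> 'a set"
  assumes lattice: "perp_invariant_lattice X I"
begin

abbreviation "K \<equiv> kernel_ideal X d x I"

lemma I_ideal: "F \<noteq> {} \<Longrightarrow> closed_ideal type_alg (I F)"
  using lattice by (simp add: perp_invariant_lattice_def)

lemma I_UNIV: "F \<noteq> {} \<Longrightarrow> a \<in> I F \<Longrightarrow> a \<in> I UNIV"
  using lattice[unfolded perp_invariant_lattice_def, THEN conjunct2, THEN conjunct1, rule_format, of F UNIV] by blast

lemma I_perp: "F \<noteq> {} \<Longrightarrow> supp n \<inter> F = {} \<Longrightarrow> \<xi> \<in> M n \<Longrightarrow> \<eta> \<in> M n \<Longrightarrow> a \<in> I F \<Longrightarrow> ipf n \<xi> (lmf n a \<eta>) \<in> I F"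
  by (rule lattice[unfolded perp_invariant_lattice_def, THEN conjunct2, THEN conjunct2, rule_format]) simp_all

lemma K_eq: "K = generated_ideal (NT X) {fpi X a \<circ> proj F | a F. F \<noteq> {} \<and> a \<in> I F}"
  by (simp add: kernel_ideal_def defect_proj_eq)

lemma K_least:
  assumes "closed_ideal (NT X) J" "\<And>F a. F \<noteq> {} \<Longrightarrow> a \<in> I F \<Longrightarrow> fpi X a \<circ> proj F \<in> J"
  shows "K \<subseteq> J"
  unfolding K_eq using assms by (intro generated_ideal_least) auto

lemma K_closed_ideal: "closed_ideal (NT X) K"
  unfolding K_eq by (rule closed_ideal_generated) auto

lemma K_gen: "F \<noteq> {} \<Longrightarrow> a \<in> I F \<Longrightarrow> fpi X a \<circ> proj F \<in> K"
  unfolding K_eq generated_ideal_def by blast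

sublocale nt_ideal X K
proof
  have "K \<subseteq> {f \<in> NTc. adj f \<in> K}"
  proof (rule K_least[OF closed_ideal_vimage[OF K_closed_ideal, of _ cnj]])
    fix F :: "'n set" and a assume Fa: "F \<noteq> {}" "a \<in> I F"
    have "adj (fpi X a \<circ> proj F) = fpi X (star a) \<circ> proj F"
      by (simp add: adj_op_comp adj_fpi fpi_proj_commute)
    then show "fpi X a \<circ> proj F \<in> {f \<in> NTc. adj f \<in> K}"
      using K_gen[OF Fa(1) closed_ideal_star[OF I_ideal[OF Fa(1)] Fa(2)]] by simp
  qed (simp_all add: adj_op_add adj_op_scale adj_op_comp opnorm_adj)
  then show "adj f \<in> K" if "f \<in> K" for f
    using that by blast
  have "K \<subseteq> {f \<in> NTc. rotation r f \<in> K}" for r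
  proof (rule K_least[OF closed_ideal_vimage[OF K_closed_ideal, of _ "\<lambda>c. c"]])
    fix F :: "'n set" and a assume Fa: "F \<noteq> {}" "a \<in> I F"
    then show "fpi X a \<circ> proj F \<in> {f \<in> NTc. rotation r f \<in> K}"
      using K_gen by (simp add: rotation_comp rotation_fpi rotation_proj)
  qed (simp_all add: rotation_op_add rotation_op_scale rotation_comp opnorm_rotation)
  then show "rotation r f \<in> K" if "f \<in> K" for r f
    using that by blast
qed (rule K_closed_ideal)

text \<open>The identity has to be adjoined because the algebra may not be unital.\<close>

definition multipliers :: "('n, 'x) fop set" where
  "multipliers = insert (proj {}) NTc"

lemma multipliers_NT:
  assumes "u \<in> multipliers" "f \<in> NTc"
  shows "u \<in> Op" "u \<circ> f \<in> NTc" "f \<circ> u \<in> NTc"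
  using assms by (auto simp: multipliers_def)

lemma multipliers_comp: "u \<in> multipliers \<Longrightarrow> f \<in> NTc \<Longrightarrow> u \<circ> f \<in> multipliers \<and> f \<circ> u \<in> multipliers"
  by (auto simp: multipliers_def)

lemma multipliers_frame_op: "j \<in> frame_idx m \<Longrightarrow> frame_op m j \<in> multipliers \<and> adj (frame_op m j) \<in> multipliers"
  using frame_op_creation[of m j] by (cases "m = 0") (auto simp: multipliers_def)

text \<open>For \<open>u\<close> and \<open>v\<close> in the algebra, the compression is an inner
  product of two columns with \<open>a\<close> inserted on the fibres whose index has support
  disjoint from \<open>F\<close>. Invariance puts every term into \<open>I F\<close>, which is
  closed. An identity factor may have no column, so these cases are separate.\<close>

lemma e0_generator:
  assumes F: "F \<noteq> {}" and a: "a \<in> I F" and u: "u \<in> multipliers" and v: "v \<in> multipliers"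
  shows "e0 (u \<circ> (fpi X a \<circ> proj F) \<circ> v) \<in> I UNIV"
proof -
  note ideal_simps = I_ideal[OF F, unfolded closed_ideal_def type_alg_simps]
  have left: "e0 ((fpi X b \<circ> proj F) \<circ> w) \<in> I F" if b: "b \<in> I F" and w: "w \<in> NTc" for b w
  proof -
    let ?T = "(fpi X b \<circ> proj F) \<circ> w"
    have T: "?T \<in> NTc"
      using w by simp
    have "vac ?T = (fpi X b \<circ> proj F) (vac w)"
      by (rule vac_comp[OF _ w T]) simp
    then have "vac ?T 0 = lmf 0 b (vac w 0)"
      using w by (simp add: fpi_apply[OF Op_mem[OF proj_Op]] proj_apply supp_def)
    also have "\<dots> = emb X (b * e0 w)"
      using w by (simp add: emb_e0[symmetric] emb_lmul)
    finally have "e0 ?T = b * e0 w"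
      by (rule e0_eqI[OF T])
    then show ?thesis
      using ideal_simps b by simp
  qed
  have both: "e0 (u \<circ> (fpi X a \<circ> proj F) \<circ> w) \<in> I F" if u: "u \<in> NTc" and w: "w \<in> NTc" for u w
  proof -
    have v1: "vac (adj u) \<in> fock X" and v2: "vac w \<in> fock X"
      using u w by simp_all
    have c: "(fpi X a \<circ> proj F) \<circ> w \<in> NTc"
      using w by simp
    have "vac ((fpi X a \<circ> proj F) \<circ> w) = (fpi X a \<circ> proj F) (vac w)"
      by (rule vac_comp[OF _ w c]) simp
    then have vm: "vac ((fpi X a \<circ> proj F) \<circ> w) m = lmf m a (if supp m \<inter> F = {} then vac w m else 0)" for m
      using v2 by (simp add: fpi_apply[OF Op_mem[OF proj_Op]] proj_apply)
    have "e0 (u \<circ> ((fpi X a \<circ> proj F) \<circ> w)) = fock_ip X (vac (adj u)) (vac ((fpi X a \<circ> proj F) \<circ> w))"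
      by (rule e0_comp[OF u c])
    moreover have "fock_ip X (vac (adj u)) (vac ((fpi X a \<circ> proj F) \<circ> w)) \<in> I F"
    proof (rule closed_ideal_has_sum[OF I_ideal[OF F] _ fock_ip_has_sum[OF v1 vac_mem[OF c]]])
      fix m
      have z: "lmf m a 0 = 0"
        using lmul_scaleC[of 0 m a 0] by (simp add: scaleC_zero_left)
      have "(0::'a) \<in> I F"
        using closed_ideal_has_sum[OF I_ideal[OF F], of "{}" "\<lambda>_. 0" 0] by simp
      then show "ipf m (vac (adj u) m) (vac ((fpi X a \<circ> proj F) \<circ> w) m) \<in> I F"
        unfolding vm using I_perp[OF F _ fock_mem[OF v1] fock_mem[OF v2] a, of m] fock_mem[OF v1, of m] by (simp add: z)
    qed
    ultimately show ?thesis
      by (simp add: comp_assoc)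
  qed
  consider "u \<in> NTc" "v \<in> NTc" | "u = proj {}" "v \<in> NTc" | "u \<in> NTc" "v = proj {}" | "u = proj {}" "v = proj {}"
    using u v by (auto simp: multipliers_def)
  then have "e0 (u \<circ> (fpi X a \<circ> proj F) \<circ> v) \<in> I F"
  proof cases
    case 1
    then show ?thesis
      by (rule both)
  next
    case 2
    then show ?thesis
      using left[OF a] by simp
  next
    case 3
    \<comment> \<open>An identity on the right is reduced by adjoints to an identity on the left,
      which requires that \<open>I F\<close> is closed under \<open>star\<close>.\<close>
    have "adj (u \<circ> (fpi X a \<circ> proj F)) = (fpi X (star a) \<circ> proj F) \<circ> adj u"
      using 3 by (simp add: adj_op_comp adj_fpi fpi_proj_commute)
    then have "e0 (adj (u \<circ> (fpi X a \<circ> proj F))) \<in> I F"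
      using left[OF closed_ideal_star[OF I_ideal[OF F] a], of "adj u"] 3 by simp
    then have "star (e0 (adj (u \<circ> (fpi X a \<circ> proj F)))) \<in> I F"
      by (rule closed_ideal_star[OF I_ideal[OF F]])
    then show ?thesis
      using 3 by (simp add: e0_adj star_star)
  next
    case 4
    then show ?thesis
      using a by (simp add: e0_fpi_proj)
  qed
  then show ?thesis
    by (rule I_UNIV[OF F])
qed

text \<open>Quantifying over all multipliers on both sides makes the condition stable under
  multiplication, so the elements that satisfy it form a closed ideal containing the
  generators.\<close>

lemma e0_kernel:
  assumes f: "f \<in> K" and u: "u \<in> multipliers" and v: "v \<in> multipliers"
  shows "e0 (u \<circ> f \<circ> v) \<in> I UNIV"
proof -
  let ?J = "{f \<in> NTc. \<forall>u\<in>multipliers. \<forall>v\<in>multipliers. e0 (u \<circ> f \<circ> v) \<in> I UNIV}"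
  have IU: "closed_ideal type_alg (I UNIV)"
    by (rule I_ideal) simp
  have uv: "u \<circ> f \<circ> v \<in> NTc" "u \<in> Op" "v \<in> Op" if "u \<in> multipliers" "v \<in> multipliers" "f \<in> NTc" for u v f
    using multipliers_NT(1)[OF that(1,3)] multipliers_NT(1)[OF that(2,3)]
      multipliers_NT(3)[OF that(2) multipliers_NT(2)[OF that(1,3)]] by simp_all
  have add: "op_add f g \<in> ?J" if fg: "f \<in> ?J" "g \<in> ?J" for f g
  proof -
    have N: "f \<in> NTc" "g \<in> NTc"
      using fg by simp_all
    have "e0 (u \<circ> op_add f g \<circ> v) \<in> I UNIV" if m: "u \<in> multipliers" "v \<in> multipliers" for u v
    proof -
      have "u \<circ> op_add f g \<circ> v = op_add (u \<circ> f \<circ> v) (u \<circ> g \<circ> v)"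
        using uv[OF m N(1)] N by (simp add: op_comp_add_right op_comp_add_left)
      then have "e0 (u \<circ> op_add f g \<circ> v) = e0 (u \<circ> f \<circ> v) + e0 (u \<circ> g \<circ> v)"
        using uv(1)[OF m N(1)] uv(1)[OF m N(2)] by (simp add: e0_add)
      then show ?thesis
        using IU fg m by (simp add: closed_ideal_def)
    qed
    then show ?thesis
      using N by simp
  qed
  have scale: "op_scale c f \<in> ?J" if f: "f \<in> ?J" for c f
  proof -
    have N: "f \<in> NTc"
      using f by simp
    have "e0 (u \<circ> op_scale c f \<circ> v) \<in> I UNIV" if m: "u \<in> multipliers" "v \<in> multipliers" for u v
    proof -
      have "u \<circ> op_scale c f \<circ> v = op_scale c (u \<circ> f \<circ> v)"
        using uv[OF m N] N by (simp add: op_comp_scale_right op_comp_scale_left)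
      then have "e0 (u \<circ> op_scale c f \<circ> v) = c *\<^sub>C e0 (u \<circ> f \<circ> v)"
        using uv(1)[OF m N] by (simp add: e0_scale)
      then show ?thesis
        using IU f m by (simp add: closed_ideal_def)
    qed
    then show ?thesis
      using N by simp
  qed
  have comp: "b \<circ> f \<in> ?J \<and> f \<circ> b \<in> ?J" if f: "f \<in> ?J" and b: "b \<in> NTc" for f b
  proof -
    have "e0 (u \<circ> (b \<circ> f) \<circ> v) \<in> I UNIV" "e0 (u \<circ> (f \<circ> b) \<circ> v) \<in> I UNIV"
      if m: "u \<in> multipliers" "v \<in> multipliers" for u v
    proof -
      have "e0 ((u \<circ> b) \<circ> f \<circ> v) \<in> I UNIV" "e0 (u \<circ> f \<circ> (b \<circ> v)) \<in> I UNIV"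
        using f m multipliers_comp[OF m(1) b] multipliers_comp[OF m(2) b] by blast+
      then show "e0 (u \<circ> (b \<circ> f) \<circ> v) \<in> I UNIV" "e0 (u \<circ> (f \<circ> b) \<circ> v) \<in> I UNIV"
        by (simp_all only: comp_assoc)
    qed
    then show ?thesis
      using f b by simp
  qed
  have cl: "closed_in (NT X) ?J"
    unfolding closed_in_def
  proof (intro allI impI, elim conjE)
    fix s f assume s: "\<forall>k::nat. s k \<in> ?J" and f: "f \<in> NTc" and lim: "(\<lambda>k. dist_of (NT X) (s k) f) \<longlonglongrightarrow> 0"
    have "e0 (u \<circ> f \<circ> v) \<in> I UNIV" if m: "u \<in> multipliers" "v \<in> multipliers" for u v
    proof (rule Lim_in_closed_set[OF closed_ideal_closed[OF IU]])
      have sN: "s k \<in> NTc" for k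
        using s by simp
      show "\<forall>\<^sub>F k in sequentially. e0 (u \<circ> s k \<circ> v) \<in> I UNIV"
        using s m by simp
      have u: "u \<in> Op" and v: "v \<in> Op"
        using uv[OF m f] by simp_all
      have "norm (e0 (u \<circ> s k \<circ> v) - e0 (u \<circ> f \<circ> v)) \<le> opnorm u * dist_of (NT X) (s k) f * opnorm v" for k
      proof -
        let ?d = "op_add (s k) (op_scale (-1) f)"
        have dN: "?d \<in> NTc"
          using sN f by simp
        have "u \<circ> ?d \<circ> v = op_add (u \<circ> s k \<circ> v) (op_scale (-1) (u \<circ> f \<circ> v))"
          using sN f u v by (simp add: op_comp_add_right op_comp_add_left op_comp_scale_right op_comp_scale_left)
        then have "e0 (u \<circ> ?d \<circ> v) = e0 (u \<circ> s k \<circ> v) - e0 (u \<circ> f \<circ> v)"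
          using uv(1)[OF m sN] uv(1)[OF m f] by (simp add: e0_add e0_scale)
        moreover have "norm (e0 (u \<circ> ?d \<circ> v)) \<le> opnorm (u \<circ> ?d \<circ> v)"
          by (rule norm_e0[OF uv(1)[OF m dN]])
        moreover have "opnorm (u \<circ> ?d \<circ> v) \<le> opnorm (u \<circ> ?d) * opnorm v"
          using u v dN by (intro opnorm_comp op_comp_Op) simp_all
        moreover have "opnorm (u \<circ> ?d) * opnorm v \<le> opnorm u * opnorm ?d * opnorm v"
          using u v dN by (intro mult_right_mono opnorm_comp opnorm_nonneg) simp_all
        ultimately show ?thesis
          by (simp add: dist_of_NT)
      qed
      then have "(\<lambda>k. e0 (u \<circ> s k \<circ> v) - e0 (u \<circ> f \<circ> v)) \<longlonglongrightarrow> 0"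
        by (intro Lim_null_comparison[OF always_eventually tendsto_mult_left_zero[OF tendsto_mult_right_zero[OF lim]]]) blast
      then show "(\<lambda>k. e0 (u \<circ> s k \<circ> v)) \<longlonglongrightarrow> e0 (u \<circ> f \<circ> v)"
        by (rule LIM_zero_cancel)
    qed simp
    then show "f \<in> ?J"
      using f by simp
  qed
  have gen: "fpi X a \<circ> proj F \<in> ?J" if "F \<noteq> {}" "a \<in> I F" for a F
    using e0_generator[OF that] by simp
  have "(0::'a) \<in> I UNIV"
    using closed_ideal_has_sum[OF IU, of "{}" "\<lambda>_. 0" 0] by simp
  then have ne: "?J \<noteq> {}"
    using gen[of UNIV 0] by blast
  have "closed_ideal (NT X) ?J"
    unfolding closed_ideal_def NT_simps
    by (intro conjI ballI allI ne cl)
      (blast, (rule add scale comp[THEN conjunct1] comp[THEN conjunct2]; assumption)+)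
  then have "K \<subseteq> ?J"
    using gen by (rule K_least)
  then show ?thesis
    using f u v by blast
qed

text \<open>Every diagonal matrix coefficient of \<open>f\<close> is the compression of a sandwich
  \<open>u \<circ> f \<circ> v\<close> with multipliers, hence lies in
  \<open>I UNIV\<close>.\<close>

lemma kills_gibbs:
  assumes "\<tau> \<in> annihilating (I UNIV)"
  shows "kills (gibbs_state \<tau> \<beta>)"
  unfolding kills_def
proof
  fix f assume f: "f \<in> K"
  have "gibbs \<tau> \<beta> f = 0"
  proof (rule gibbs_vanish)
    fix m j assume "j \<in> frame_idx m"
    then show "\<tau> (compress m j f m j) = 0"
      using assms e0_kernel[OF f] multipliers_frame_op unfolding compress_def annihilating_def by blast
  qed
  then show "gibbs_state \<tau> \<beta> f = 0"
    using f by (simp add: gibbs_state_def)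
qed

lemma kills_Psi_iff: "kills (Psi \<tau>) \<longleftrightarrow> \<tau> \<in> annihilating (I UNIV)"
proof
  assume k: "kills (Psi \<tau>)"
  have "\<tau> a = 0" if "a \<in> I UNIV" for a
    using k K_gen[OF _ that] by (auto simp: kills_def Psi_apply e0_fpi_proj)
  then show "\<tau> \<in> annihilating (I UNIV)"
    by (simp add: annihilating_def)
next
  assume \<tau>: "\<tau> \<in> annihilating (I UNIV)"
  show "kills (Psi \<tau>)"
    unfolding kills_def
  proof
    fix f assume f: "f \<in> K"
    have "e0 (proj {} \<circ> f \<circ> proj {}) \<in> I UNIV"
      by (rule e0_kernel[OF f]) (simp_all add: multipliers_def)
    then show "Psi \<tau> f = 0"
      using f \<tau> by (simp add: Psi_apply annihilating_def)
  qed
qed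

lemma ground_states_Q: "ground_states Q rot = (\<lambda>\<tau>. push (Psi \<tau>)) ` (states type_alg \<inter> annihilating (I UNIV))"
proof (intro set_eqI iffI)
  fix \<psi> assume \<psi>: "\<psi> \<in> ground_states Q rot"
  then have \<psi>s: "\<psi> \<in> states Q"
    by (simp add: ground_states_def)
  note p = pull_state[OF \<psi>s]
  obtain \<tau> where \<tau>: "\<tau> \<in> states type_alg" "pull \<psi> = Psi \<tau>"
    using vacuum_state_cases[OF p(1) pull_ground_vacuum[OF \<psi>]] by blast
  then show "\<psi> \<in> (\<lambda>\<tau>. push (Psi \<tau>)) ` (states type_alg \<inter> annihilating (I UNIV))"
    using p(2,3) kills_Psi_iff by (intro image_eqI[of _ _ \<tau>]) auto
qed (use push_ground[OF Psi_ground] kills_Psi_iff in blast)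

text \<open>The approximation has to take place inside the quotient, so the Gibbs states themselves
  must vanish on the kernel, not only their limit.\<close>

lemma kms_infinity_states_Q:
  "kms_infinity_states Q rot = (\<lambda>\<tau>. push (Psi \<tau>)) ` (tracial_states type_alg \<inter> annihilating (I UNIV))"
proof (intro set_eqI iffI)
  fix \<psi> assume \<psi>: "\<psi> \<in> kms_infinity_states Q rot"
  then have \<psi>s: "\<psi> \<in> states Q"
    by (simp add: kms_infinity_states_def)
  note p = pull_state[OF \<psi>s]
  obtain \<tau> where \<tau>: "\<tau> \<in> tracial_states type_alg" "pull \<psi> = Psi \<tau>"
    using kms_infinity_cases[OF pull_kms_infinity[OF \<psi>]] by blast
  then show "\<psi> \<in> (\<lambda>\<tau>. push (Psi \<tau>)) ` (tracial_states type_alg \<inter> annihilating (I UNIV))"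
    using p(2,3) kills_Psi_iff by (intro image_eqI[of _ _ \<tau>]) auto
next
  fix \<psi> assume "\<psi> \<in> (\<lambda>\<tau>. push (Psi \<tau>)) ` (tracial_states type_alg \<inter> annihilating (I UNIV))"
  then obtain \<tau> where \<tau>: "\<tau> \<in> tracial_states type_alg" "\<tau> \<in> annihilating (I UNIV)" and \<psi>: "\<psi> = push (Psi \<tau>)"
    by blast
  have \<tau>s: "\<tau> \<in> states type_alg"
    using \<tau>(1) by (simp add: tracial_states_def)
  have k: "kills (Psi \<tau>)"
    using kills_Psi_iff \<tau>(2) by blast
  show "\<psi> \<in> kms_infinity_states Q rot"
    unfolding \<psi>
  proof (rule kms_infinityI)
    show "push (Psi \<tau>) \<in> states Q"
      by (rule push_state[OF Psi_state[OF \<tau>s] k])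
    show "\<forall>\<^sub>F \<beta> in at_top. push (gibbs_state \<tau> \<beta>) \<in> kms_states Q rot \<beta>"
      using eventually_gibbs by (rule eventually_mono) (use push_kms[OF gibbs_state_kms[OF \<tau>(1)] kills_gibbs[OF \<tau>(2)]] in blast)
    fix C assume "C \<in> carr Q"
    then obtain f where f: "f \<in> NTc" "C = q f"
      by (rule Q_cases)
    have "gibbs_state \<tau> \<beta> f = push (gibbs_state \<tau> \<beta>) C" if "cold \<beta> \<and> gibbs_error \<beta> < 1" for \<beta>
      using gibbs_state_kms[OF \<tau>(1), of \<beta>] that push_apply[OF _ kills_gibbs[OF \<tau>(2)] f(1)]
      by (simp add: f(2) kms_states_def)
    then have "\<forall>\<^sub>F \<beta> in at_top. gibbs_state \<tau> \<beta> f = push (gibbs_state \<tau> \<beta>) C"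
      using eventually_gibbs by (rule eventually_mono[rotated])
    from Lim_transform_eventually[OF gibbs_state_lim[OF \<tau>s f(1)] this]
    show "((\<lambda>\<beta>. push (gibbs_state \<tau> \<beta>) C) \<longlongrightarrow> push (Psi \<tau>) C) at_top"
      by (simp add: f(2) push_apply[OF Psi_state[OF \<tau>s] k f(1)])
  qed
qed

text \<open>The value is \<open>\<tau>\<close> at an element of \<open>'a\<close> that depends on
  \<open>C\<close> alone; continuity and affinity follow from this form.\<close>

lemma push_Psi:
  assumes "C \<in> carr Q"
  shows "push (Psi \<tau>) C = \<tau> (e0 (SOME f. f \<in> NTc \<and> q f = C))"
proof -
  obtain f where "f \<in> NTc" "C = q f"
    using assms by (rule Q_cases)
  then have "(SOME f. f \<in> NTc \<and> q f = C) \<in> NTc \<and> q (SOME f. f \<in> NTc \<and> q f = C) = C"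
    by (intro someI_ex[of "\<lambda>f. f \<in> NTc \<and> q f = C"]) blast
  then show ?thesis
    using assms by (simp add: push_def Psi_apply)
qed

lemma homeomorphism_Q:
  assumes S: "S \<subseteq> states type_alg \<inter> annihilating (I UNIV)" and T: "T = (\<lambda>\<tau>. push (Psi \<tau>)) ` S"
  shows "weak_star_homeomorphism type_alg S Q T (\<lambda>\<tau>. push (Psi \<tau>))"
proof (rule weak_star_homeomorphismI)
  show "S \<subseteq> extensional (carr type_alg)"
    by (simp add: extensional_def)
  show "T \<subseteq> extensional (carr Q)"
    unfolding T by (auto simp: push_def)
  show "e0 (SOME f. f \<in> NTc \<and> q f = C) \<in> carr type_alg \<and>
      (\<forall>\<tau>\<in>S. push (Psi \<tau>) C = \<tau> (e0 (SOME f. f \<in> NTc \<and> q f = C)))" if "C \<in> carr Q" for C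
    using push_Psi[OF that] by simp
  show "q (fpi X a) \<in> carr Q \<and> (\<forall>\<tau>\<in>S. push (Psi \<tau>) (q (fpi X a)) = \<tau> a)" for a
  proof (intro conjI ballI)
    fix \<tau> assume "\<tau> \<in> S"
    then have "\<tau> \<in> states type_alg" "kills (Psi \<tau>)"
      using S kills_Psi_iff by auto
    then show "push (Psi \<tau>) (q (fpi X a)) = \<tau> a"
      by (simp add: push_apply Psi_state Psi_apply)
  qed simp
qed (simp add: T)

lemma affine_Q: "affine_map_on type_alg S Q (\<lambda>\<tau>. push (Psi \<tau>))"
  unfolding affine_map_on_def
proof (intro ballI ext)
  fix \<phi> \<psi> :: "'a \<Rightarrow> complex" and s :: real and C
  show "push (Psi (convex_comb type_alg s \<phi> \<psi>)) C = convex_comb Q s (push (Psi \<phi>)) (push (Psi \<psi>)) C"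
  proof (cases "C \<in> carr Q")
    case True
    then show ?thesis
      by (simp add: push_Psi convex_comb_def)
  next
    case False
    then show ?thesis
      by (simp add: push_def convex_comb_def)
  qed
qed

end

section \<open>The correspondence for the Toeplitz algebra\<close>

context product_sys
begin

lemma affine_NT: "affine_map_on type_alg S (NT X) Psi"
  unfolding affine_map_on_def convex_comb_def Psi_def by (intro ballI ext) simp

lemma homeomorphism_NT:
  assumes T: "T = Psi ` S"
  shows "weak_star_homeomorphism type_alg S (NT X) T Psi"
proof (rule weak_star_homeomorphismI)
  show "S \<subseteq> extensional (carr type_alg)"
    by (simp add: extensional_def)
  show "T \<subseteq> extensional NTc"
    unfolding T by (auto simp: Psi_def)
  show "e0 f \<in> carr type_alg \<and> (\<forall>\<tau>\<in>S. Psi \<tau> f = \<tau> (e0 f))" if "f \<in> NTc" for f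
    using that by (simp add: Psi_apply)
  show "fpi X a \<in> NTc \<and> (\<forall>\<tau>\<in>S. Psi \<tau> (fpi X a) = \<tau> a)" for a
    by (simp add: Psi_apply)
qed (simp add: T)

end

theorem theoremE:
  fixes X :: "('n::finite, 'a::cstar_algebra, 'x::complex_vector) product_system"
  assumes "is_product_system X" and "finite_rank X"
  shows "\<exists>\<Psi>.
    affine_map_on type_alg (states type_alg) (NT X) \<Psi> \<and>
    weak_star_homeomorphism type_alg (states type_alg) (NT X) (ground_states (NT X) rotation) \<Psi> \<and>
    (\<forall>\<tau>\<in>states type_alg.
       (\<forall>a. \<Psi> \<tau> (fpi X a) = \<tau> a) \<and>
       (\<forall>n m. \<forall>\<xi>\<in>mcarr (fib X n). \<forall>\<eta>\<in>mcarr (fib X m).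
          n + m \<noteq> 0 \<longrightarrow> \<Psi> \<tau> (monomial X n \<xi> m \<eta>) = 0)) \<and>
    weak_star_homeomorphism type_alg (tracial_states type_alg)
      (NT X) (kms_infinity_states (NT X) rotation) \<Psi> \<and>
    (\<forall>d x I. is_frame X d x \<and> perp_invariant_lattice X I \<longrightarrow>
       (\<exists>\<Phi>.
          (\<forall>\<tau>\<in>states type_alg \<inter> annihilating (I UNIV).
             \<forall>f\<in>carr (NT X). \<Phi> \<tau> (NO_quot X d x I f) = \<Psi> \<tau> f) \<and>
          affine_map_on type_alg (states type_alg \<inter> annihilating (I UNIV)) (NO X d x I) \<Phi> \<and>
          weak_star_homeomorphism type_alg (states type_alg \<inter> annihilating (I UNIV))
            (NO X d x I) (ground_states (NO X d x I) (NO_sigma X d x I)) \<Phi> \<and>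
          weak_star_homeomorphism type_alg (tracial_states type_alg \<inter> annihilating (I UNIV))
            (NO X d x I) (kms_infinity_states (NO X d x I) (NO_sigma X d x I)) \<Phi>))"
proof -
  obtain d x where frame: "is_frame X d x"
    using assms(2) unfolding finite_rank_def by blast
  interpret framed_system X d x
    using assms(1) frame by unfold_locales
  \<comment> \<open>The frame bound here is arbitrary and unrelated to the one fixed above. One
    \<open>Psi\<close> serves all of them because it depends on \<open>X\<close> alone.\<close>
  have quot: "\<exists>\<Phi>.
      (\<forall>\<tau>\<in>states type_alg \<inter> annihilating (I UNIV).
         \<forall>f\<in>carr (NT X). \<Phi> \<tau> (NO_quot X d x I f) = Psi \<tau> f) \<and>
      affine_map_on type_alg (states type_alg \<inter> annihilating (I UNIV)) (NO X d x I) \<Phi> \<and>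
      weak_star_homeomorphism type_alg (states type_alg \<inter> annihilating (I UNIV))
        (NO X d x I) (ground_states (NO X d x I) (NO_sigma X d x I)) \<Phi> \<and>
      weak_star_homeomorphism type_alg (tracial_states type_alg \<inter> annihilating (I UNIV))
        (NO X d x I) (kms_infinity_states (NO X d x I) (NO_sigma X d x I)) \<Phi>"
    if fr: "is_frame X d x" and lat: "perp_invariant_lattice X I" for d x I
  proof -
    interpret qs: quotient_system X d x I
      using assms(1) fr lat by unfold_locales
    show ?thesis
      unfolding NO_def NO_quot_def NO_sigma_def
    proof (intro exI[of _ "\<lambda>\<tau>. qs.push (Psi \<tau>)"] conjI ballI)
      show "qs.push (Psi \<tau>) (qs.q f) = Psi \<tau> f" if "\<tau> \<in> states type_alg \<inter> annihilating (I UNIV)" "f \<in> NTc" for \<tau> f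
        using that by (intro qs.push_apply Psi_state) (auto simp: qs.kills_Psi_iff)
      have "tracial_states type_alg \<inter> annihilating (I UNIV) \<subseteq> states type_alg \<inter> annihilating (I UNIV)"
        by (auto simp: tracial_states_def)
      then show "weak_star_homeomorphism type_alg (tracial_states type_alg \<inter> annihilating (I UNIV)) qs.Q
          (kms_infinity_states qs.Q qs.rot) (\<lambda>\<tau>. qs.push (Psi \<tau>))"
        by (rule qs.homeomorphism_Q[OF _ qs.kms_infinity_states_Q])
    qed (rule qs.affine_Q qs.homeomorphism_Q[OF order_refl qs.ground_states_Q])+
  qed
  show ?thesis
  proof (intro exI[of _ Psi] conjI allI impI ballI)
    show "Psi \<tau> (fpi X a) = \<tau> a" for \<tau> a
      by (simp add: Psi_apply)
    show "Psi \<tau> (monomial X n \<xi> m \<eta>) = 0"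
      if "\<tau> \<in> states type_alg" "\<xi> \<in> M n" "\<eta> \<in> M m" "n + m \<noteq> 0" for \<tau> n m \<xi> \<eta>
      by (rule Psi_monomial[OF that(2,3,4,1)])
    show "weak_star_homeomorphism type_alg (states type_alg) (NT X) (ground_states (NT X) rotation) Psi"
      by (rule homeomorphism_NT[OF ground_states_NT])
    show "weak_star_homeomorphism type_alg (tracial_states type_alg) (NT X) (kms_infinity_states (NT X) rotation) Psi"
      by (rule homeomorphism_NT[OF kms_infinity_states_NT])
  qed (rule affine_NT, rule quot, simp_all)
qed
end
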